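(* Let $(G,\mathbf{D})$ be an $m$-generically solvable plabic tangle. Then $(G,\mathbf{D})$ is dominant if and only if it admits a brushing.
   Context: Plabic graphs: a plabic graph is a planar graph embedded in a closed disk, internal vertices colored black or white, boundary vertices $1,\dots,n$ on the circle (clockwise) each incident to exactly one edge, every internal vertex joined by a path to a boundary vertex, leafless (no internal leaves except ones adjacent to a boundary vertex). Here $G=((B,W),E)$ is bipartite (every edge joins a black and a white vertex) with boundary vertices regarded as black. A reverse perfect orientation of $G$ is an orientation in which each internal white vertex has exactly one outgoing edge and each internal black vertex exactly one incoming edge. $m$-VRCs: an $m$-vector-relation configuration on $G$ assigns $v_b\in\mathbb{C}^m$ to each black vertex and $r_e\in\mathbb{C}^*$ to each edge so that $v_1,\dots,v_n$ span $\mathbb{C}^m$ and $\sum_{e=\{w,b\}}r_ev_b=0$ at every white vertex $w$. A gauge transformation by $t\in\mathbb{C}^*$ at an internal vertex $x$ multiplies $r_e$ by $t$ for all edges $e$ at $x$, and if $x$ is black also replaces $v_x$ by $v_x/t$; $GL_m$ acts by left multiplication on all vectors. Classes modulo gauge and $GL_m$ are denoted $[\mathbf{v},\mathbf{R}]$; the boundary $(v_1,\dots,v_n)$ then gives a point of the configuration space $\mathrm{Conf}_{m,n}$ of $n$ points of $\mathbb{P}^{m-1}$ modulo $GL_m$ (allowing also gauge at boundary vertices). $\mathrm{Conf}^\circ_{m,n}$ is the open subset where any $m$ of the points span $\mathbb{P}^{m-1}$. $G$ is $m$-generically solvable if for all $\mathbf{z}$ in a Zariski open dense subset of $\mathrm{Conf}^\circ_{m,n}$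 there is a unique class $[\mathbf{v},\mathbf{R}]$ with boundary $\mathbf{z}$. Plabic tangle: $(G,\mathbf{D})$ consists of $G$ drawn in an outer disk together with $\ell$ inner disks (blobs), each lying in a face of $G$; blob $i$ has boundary vertices $D^{(i)}$, and each $u\in D^{(i)}$ is joined by a segment to one black vertex $b_u$ of $G$ so that the whole picture is planar; each disk has a marked interval and its boundary vertices are ordered clockwise starting after it. $\mathbf{D}=(D^{(1)},\dots,D^{(\ell)})$. The tangle is $m$-generically solvable if $G$ is and $|D|\ge m$ for each blob $D$. For such a tangle, $\psi:\mathrm{Conf}^\circ_{m,n}\dashrightarrow\prod_{D}\mathrm{Conf}_{m,D}$ sends generic $\mathbf{z}$ to, for each blob $D$, the tuple of lines $(\mathbb{C}v_{b_u})_{u\in D}$ in the unique class with boundary $\mathbf{z}$. The tangle is rank-$m$ regular if for generic $\mathbf{z}$, for every blob $D$ the vectors $v_{b_u}$, $u\in D$, span $\mathbb{C}^m$. It is dominant if it is rank-$m$ regular and for each blob $D$ the image of $\pi^D\circ\psi$ (with $\pi^D$ the projection to $\mathrm{Conf}_{m,D}$) contains a Zariski-dense subset of $\mathrm{Conf}^\circ_{m,D}$. A brushing of $(G,\mathbf{D})$ is a choice, for each blob $D$, of an acyclic reverse perfect orientation $\mathcal{O}^D$ of $G$ and a collection of pairwise vertex-disjoint directed paths $\{P_u\}_{u\in D}$ in $\mathcal{O}^D$, where $P_u$ goes from some boundary vertex of $G$ to $b_u$.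
   Formalization: Assumes m ≥ 2 and that G has an acyclic reverse perfect orientation, since the equivalence fails for m = 1 and for some solvable G without one; brushing paths must start at boundary sources, so the one-vertex path at a boundary sink is excluded. *)

theory Defs
  imports "HOL-Analysis.Analysis"
begin

section \<open>Plabic graphs\<close>

text \<open>The outer disk is the closed unit disk of the complex plane, and vertices are points of it.
  Edges have labels (so parallel edges are possible); the edge \<open>e\<close> is drawn as the arc
  \<open>curve G e\<close>, parametrised from its black end to its white end.\<close>

record 'e plabic =
  nbd :: nat
  bvert :: "nat \<Rightarrow> complex"
  blacks :: "complex set"
  whites :: "complex set"
  edges :: "'e set"
  curve :: "'e \<Rightarrow> real \<Rightarrow> complex"

definition blk :: "('e, 'x) plabic_scheme \<Rightarrow> 'e \<Rightarrow> complex"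
  where "blk G e = pathstart (curve G e)"

definition wht :: "('e, 'x) plabic_scheme \<Rightarrow> 'e \<Rightarrow> complex"
  where "wht G e = pathfinish (curve G e)"

definition boundary_verts :: "('e, 'x) plabic_scheme \<Rightarrow> complex set"
  where "boundary_verts G = bvert G ` {1..nbd G}"

definition all_blacks :: "('e, 'x) plabic_scheme \<Rightarrow> complex set"
  where "all_blacks G = blacks G \<union> boundary_verts G"

definition verts :: "('e, 'x) plabic_scheme \<Rightarrow> complex set"
  where "verts G = all_blacks G \<union> whites G"

definition open_arc :: "(real \<Rightarrow> complex) \<Rightarrow> complex set"
  where "open_arc g = path_image g - {pathstart g, pathfinish g}"

text \<open>Points \<open>p 1, \<dots>, p d\<close> in clockwise order on a circle. The marked interval of the
  circle is the one from \<open>p d\<close> clockwise to \<open>p 1\<close>.\<close>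

definition clockwise :: "complex \<Rightarrow> real \<Rightarrow> nat \<Rightarrow> (nat \<Rightarrow> complex) \<Rightarrow> bool"
  where "clockwise c \<rho> d p \<longleftrightarrow> (\<exists>\<theta>::nat \<Rightarrow> real.
    (\<forall>j\<in>{1..d}. p j = c + complex_of_real \<rho> * cis (\<theta> j)) \<and>
    (\<forall>j\<in>{1..d}. \<forall>k\<in>{1..d}. j < k \<longrightarrow> \<theta> k < \<theta> j \<and> \<theta> j < \<theta> k + 2 * pi))"

definition adj :: "('e, 'x) plabic_scheme \<Rightarrow> complex rel"
  where "adj G = {(x, y). \<exists>e\<in>edges G. {x, y} = {blk G e, wht G e}}"

definition incident :: "('e, 'x) plabic_scheme \<Rightarrow> complex \<Rightarrow> 'e set"
  where "incident G x = {e \<in> edges G. blk G e = x \<or> wht G e = x}"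

definition plabic_graph :: "('e, 'x) plabic_scheme \<Rightarrow> bool"
  where "plabic_graph G \<longleftrightarrow>
    finite (blacks G) \<and> finite (whites G) \<and> finite (edges G) \<and>
    blacks G \<union> whites G \<subseteq> ball 0 1 \<and> blacks G \<inter> whites G = {} \<and>
    clockwise 0 1 (nbd G) (bvert G) \<and>
    (\<forall>e\<in>edges G. arc (curve G e) \<and> blk G e \<in> all_blacks G \<and> wht G e \<in> whites G \<and>
       open_arc (curve G e) \<subseteq> ball 0 1 - verts G) \<and>
    (\<forall>e\<in>edges G. \<forall>f\<in>edges G. e \<noteq> f \<longrightarrow> open_arc (curve G e) \<inter> open_arc (curve G f) = {}) \<and>
    (\<forall>x\<in>boundary_verts G. card (incident G x) = 1) \<and>
    (\<forall>x\<in>blacks G \<union> whites G. \<exists>y\<in>boundary_verts G. (x, y) \<in> (adj G)\<^sup>*) \<and>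
    (\<forall>x\<in>blacks G \<union> whites G. card (incident G x) = 1 \<longrightarrow>
       (\<exists>y\<in>boundary_verts G. (x, y) \<in> adj G))"

definition drawing :: "('e, 'x) plabic_scheme \<Rightarrow> complex set"
  where "drawing G = verts G \<union> (\<Union>e\<in>edges G. path_image (curve G e))"

definition faces :: "('e, 'x) plabic_scheme \<Rightarrow> complex set set"
  where "faces G = components (ball 0 1 - drawing G)"

text \<open>An orientation is given by the set \<open>F\<close> of edges directed from white to black; all
  other edges are directed from black to white.\<close>

definition arcs_of :: "('e, 'x) plabic_scheme \<Rightarrow> 'e set \<Rightarrow> complex rel"
  where "arcs_of G F = {(wht G e, blk G e) | e. e \<in> edges G \<inter> F} \<union>
    {(blk G e, wht G e) | e. e \<in> edges G - F}"

definition reverse_perfect_orientation :: "('e, 'x) plabic_scheme \<Rightarrow> 'e set \<Rightarrow> bool"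
  where "reverse_perfect_orientation G F \<longleftrightarrow> F \<subseteq> edges G \<and>
    (\<forall>w\<in>whites G. card {e \<in> F. wht G e = w} = 1) \<and>
    (\<forall>b\<in>blacks G. card {e \<in> F. blk G e = b} = 1)"

definition acyclic_rpo :: "('e, 'x) plabic_scheme \<Rightarrow> 'e set \<Rightarrow> bool"
  where "acyclic_rpo G F \<longleftrightarrow> reverse_perfect_orientation G F \<and> acyclic (arcs_of G F)"

text \<open>A directed path starting at a boundary vertex starts at a boundary source, i.e. a boundary
  vertex whose edge is outgoing. This is also required of paths of length zero, so the one-vertex
  path at a boundary sink is not admitted.\<close>

definition boundary_sources :: "('e, 'x) plabic_scheme \<Rightarrow> 'e set \<Rightarrow> complex set"
  where "boundary_sources G F = boundary_verts G - Range (arcs_of G F)"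

definition boundary_path_to ::
    "('e, 'x) plabic_scheme \<Rightarrow> 'e set \<Rightarrow> complex \<Rightarrow> complex list \<Rightarrow> bool"
  where "boundary_path_to G F b p \<longleftrightarrow> p \<noteq> [] \<and> distinct p \<and>
    successively (\<lambda>x y. (x, y) \<in> arcs_of G F) p \<and>
    hd p \<in> boundary_sources G F \<and> last p = b"


section \<open>Configuration spaces\<close>

text \<open>A point of projective space is represented by a nonzero vector in \<open>complex ^ 'm\<close>;
  configurations are indexed by a set \<open>I\<close>.\<close>

definition points :: "'i set \<Rightarrow> ('i \<Rightarrow> complex ^ 'm) set"
  where "points I = {x \<in> I \<rightarrow>\<^sub>E UNIV. \<forall>i\<in>I. x i \<noteq> 0}"

definition conf_rel :: "'i set \<Rightarrow> ('i \<Rightarrow> complex ^ 'm) rel"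
  where "conf_rel I = {(x, y). x \<in> points I \<and> y \<in> points I \<and>
    (\<exists>A :: complex ^ 'm ^ 'm. \<exists>t :: 'i \<Rightarrow> complex. invertible A \<and>
       (\<forall>i\<in>I. t i \<noteq> 0 \<and> y i = t i *s (A *v x i)))}"

definition general_position :: "'i set \<Rightarrow> ('i \<Rightarrow> complex ^ 'm) set"
  where "general_position I = {x \<in> points I.
    \<forall>J. J \<subseteq> I \<and> card J = CARD('m) \<longrightarrow> vec.span (x ` J) = UNIV}"

text \<open>\<open>conf I\<close> is \<open>Conf\<^bsub>m,I\<^esub>\<close> and \<open>conf_gen I\<close> is its open subset of points in general
  position.\<close>

definition conf :: "'i set \<Rightarrow> ('i \<Rightarrow> complex ^ 'm) set set"
  where "conf I = points I // conf_rel I"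

definition conf_gen :: "'i set \<Rightarrow> ('i \<Rightarrow> complex ^ 'm) set set"
  where "conf_gen I = general_position I // conf_rel I"

text \<open>The class of a tuple; it is empty (hence not in \<open>conf I\<close>) if some vector is zero.\<close>

definition conf_of :: "'i set \<Rightarrow> ('i \<Rightarrow> complex ^ 'm) \<Rightarrow> ('i \<Rightarrow> complex ^ 'm) set"
  where "conf_of I x = conf_rel I `` {x}"

inductive_set polyfun :: "'i set \<Rightarrow> (('i \<Rightarrow> complex ^ 'm) \<Rightarrow> complex) set" for I :: "'i set"
where
  const: "(\<lambda>_. c) \<in> polyfun I"
| coord: "i \<in> I \<Longrightarrow> (\<lambda>x. x i $ k) \<in> polyfun I"
| add: "f \<in> polyfun I \<Longrightarrow> g \<in> polyfun I \<Longrightarrow> (\<lambda>x. f x + g x) \<in> polyfun I"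
| mult: "f \<in> polyfun I \<Longrightarrow> g \<in> polyfun I \<Longrightarrow> (\<lambda>x. f x * g x) \<in> polyfun I"

definition zariski :: "'i set \<Rightarrow> ('i \<Rightarrow> complex ^ 'm) topology"
  where "zariski I = topology_generated_by
    {{x \<in> I \<rightarrow>\<^sub>E UNIV. f x \<noteq> 0} | f. f \<in> polyfun I}"

text \<open>The Zariski topology on \<open>conf_gen I\<close> is the quotient topology.\<close>

definition conf_open :: "'i set \<Rightarrow> ('i \<Rightarrow> complex ^ 'm) set set \<Rightarrow> bool"
  where "conf_open I U \<longleftrightarrow> U \<subseteq> conf_gen I \<and>
    openin (subtopology (zariski I) (general_position I)) (\<Union>U)"

definition conf_top :: "'i set \<Rightarrow> ('i \<Rightarrow> complex ^ 'm) set topology"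
  where "conf_top I = topology (conf_open I)"

lemma equiv_conf_rel: "equiv (points I) (conf_rel I :: ('i \<Rightarrow> complex ^ 'm) rel)"
proof (rule equivI)
  show "conf_rel I \<subseteq> points I \<times> (points I :: ('i \<Rightarrow> complex ^ 'm) set)"
    by (auto simp: conf_rel_def)
  show "refl_on (points I) (conf_rel I :: ('i \<Rightarrow> complex ^ 'm) rel)"
  proof (rule refl_onI)
    fix x :: "'i \<Rightarrow> complex ^ 'm" assume "x \<in> points I"
    moreover have "invertible (mat 1 :: complex ^ 'm ^ 'm)"
      unfolding invertible_def by (rule exI[of _ "mat 1"]) simp
    ultimately show "(x, x) \<in> conf_rel I"
      unfolding conf_rel_def by (auto intro!: exI[of _ "mat 1"] exI[of _ "\<lambda>_. 1"])
  qed
  show "sym (conf_rel I :: ('i \<Rightarrow> complex ^ 'm) rel)"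
  proof (rule symI)
    fix x y :: "'i \<Rightarrow> complex ^ 'm" assume "(x, y) \<in> conf_rel I"
    then obtain A :: "complex ^ 'm ^ 'm" and t where
      *: "x \<in> points I" "y \<in> points I" "invertible A"
        "\<And>i. i \<in> I \<Longrightarrow> t i \<noteq> 0 \<and> y i = t i *s (A *v x i)"
      unfolding conf_rel_def by blast
    obtain B where B: "A ** B = mat 1" "B ** A = mat 1"
      using *(3) unfolding invertible_def by blast
    have "invertible B" using B unfolding invertible_def by blast
    moreover have "\<forall>i\<in>I. inverse (t i) \<noteq> 0 \<and> x i = inverse (t i) *s (B *v y i)"
      using * B(2)
      by (auto simp: vector_scalar_commute matrix_vector_mul_assoc vec.scale_scale)
    ultimately show "(y, x) \<in> conf_rel I"
      unfolding conf_rel_def using *(1,2)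
      by (auto intro!: exI[of _ B] exI[of _ "\<lambda>i. inverse (t i)"])
  qed
  show "trans (conf_rel I :: ('i \<Rightarrow> complex ^ 'm) rel)"
  proof (rule transI)
    fix x y z :: "'i \<Rightarrow> complex ^ 'm"
    assume "(x, y) \<in> conf_rel I" "(y, z) \<in> conf_rel I"
    then obtain A B :: "complex ^ 'm ^ 'm" and s t where
      *: "x \<in> points I" "z \<in> points I" "invertible A" "invertible B"
        "\<And>i. i \<in> I \<Longrightarrow> s i \<noteq> 0 \<and> y i = s i *s (A *v x i)"
        "\<And>i. i \<in> I \<Longrightarrow> t i \<noteq> 0 \<and> z i = t i *s (B *v y i)"
      unfolding conf_rel_def by blast
    have "invertible (B ** A)" using * by (simp add: invertible_mult)
    moreover have "\<forall>i\<in>I. t i * s i \<noteq> 0 \<and> z i = (t i * s i) *s ((B ** A) *v x i)"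
      using *(5,6)
      by (auto simp: vector_scalar_commute matrix_vector_mul_assoc[symmetric] vec.scale_scale)
    ultimately show "(x, z) \<in> conf_rel I"
      unfolding conf_rel_def using *(1,2)
      by (auto intro!: exI[of _ "B ** A"] exI[of _ "\<lambda>i. t i * s i"])
  qed
qed

lemma istopology_conf_open: "istopology (conf_open I :: ('i \<Rightarrow> complex ^ 'm) set set \<Rightarrow> bool)"
proof -
  have sub: "(conf_gen I :: ('i \<Rightarrow> complex ^ 'm) set set) \<subseteq> points I // conf_rel I" for I :: "'i set"
    by (auto simp: conf_gen_def general_position_def quotient_def)
  have Int: "\<Union>(U \<inter> V) = \<Union>U \<inter> \<Union>V" if "U \<subseteq> conf_gen I" "V \<subseteq> conf_gen I"
    for U V :: "('i \<Rightarrow> complex ^ 'm) set set"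
  proof
    show "\<Union>U \<inter> \<Union>V \<subseteq> \<Union>(U \<inter> V)"
    proof
      fix x assume "x \<in> \<Union>U \<inter> \<Union>V"
      then obtain X Y where XY: "X \<in> U" "Y \<in> V" "x \<in> X" "x \<in> Y" by blast
      then have "X = Y"
        using that sub[of I] quotient_disj[OF equiv_conf_rel, of X I Y] by blast
      with XY show "x \<in> \<Union>(U \<inter> V)" by blast
    qed
  qed blast
  have Un: "\<Union>(\<Union>K) = \<Union>(Union ` K)" for K :: "('i \<Rightarrow> complex ^ 'm) set set set"
    by blast
  show ?thesis
    unfolding istopology_def
  proof (intro conjI allI impI)
    fix U V :: "('i \<Rightarrow> complex ^ 'm) set set"
    assume "conf_open I U" "conf_open I V"
    then have UV: "U \<subseteq> conf_gen I" "V \<subseteq> conf_gen I"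
      and op: "openin (subtopology (zariski I) (general_position I)) (\<Union>U \<inter> \<Union>V)"
      unfolding conf_open_def by (blast intro: openin_Int)+
    have "openin (subtopology (zariski I) (general_position I)) (\<Union>(U \<inter> V))"
      by (subst Int[OF UV]) (rule op)
    then show "conf_open I (U \<inter> V)"
      using UV unfolding conf_open_def by blast
  next
    fix K :: "('i \<Rightarrow> complex ^ 'm) set set set"
    assume K: "\<forall>U\<in>K. conf_open I U"
    have "openin (subtopology (zariski I) (general_position I)) (\<Union>(Union ` K))"
      using K unfolding conf_open_def by (intro openin_Union) blast
    then have "openin (subtopology (zariski I) (general_position I)) (\<Union>(\<Union>K))"
      by (simp only: Un)
    then show "conf_open I (\<Union>K)"
      using K unfolding conf_open_def by blast
  qed
qed

lemma openin_conf_top: "openin (conf_top I) = conf_open I"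
  by (simp add: conf_top_def istopology_conf_open topology_inverse')

definition conf_dense :: "'i set \<Rightarrow> ('i \<Rightarrow> complex ^ 'm) set set \<Rightarrow> bool"
  where "conf_dense I S \<longleftrightarrow> S \<subseteq> conf_gen I \<and> conf_top I closure_of S = conf_gen I"

definition open_dense :: "'i set \<Rightarrow> ('i \<Rightarrow> complex ^ 'm) set set \<Rightarrow> bool"
  where "open_dense I U \<longleftrightarrow> openin (conf_top I) U \<and> conf_dense I U"


section \<open>Vector-relation configurations\<close>

definition vrcs ::
    "('e, 'x) plabic_scheme \<Rightarrow> ((complex \<Rightarrow> complex ^ 'm) \<times> ('e \<Rightarrow> complex)) set"
  where "vrcs G = {(v, r). (\<forall>e\<in>edges G. r e \<noteq> 0) \<and> vec.span (v ` boundary_verts G) = UNIV \<and>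
    (\<forall>w\<in>whites G. (\<Sum>e\<in>{e \<in> edges G. wht G e = w}. r e *s v (blk G e)) = 0)}"

text \<open>Simultaneous action of \<open>GL\<^sub>m\<close> and of the gauge transformations by \<open>t x\<close> at all vertices
  \<open>x\<close>, boundary vertices included, since boundaries are taken in \<open>Conf\<^bsub>m,n\<^esub>\<close>. Values of
  \<open>v\<close> and \<open>r\<close> off the black vertices and the edges are irrelevant.\<close>

definition gauge_rel ::
    "('e, 'x) plabic_scheme \<Rightarrow> ((complex \<Rightarrow> complex ^ 'm) \<times> ('e \<Rightarrow> complex)) rel"
  where "gauge_rel G = {((v, r), (v', r')). (v, r) \<in> vrcs G \<and> (v', r') \<in> vrcs G \<and>
    (\<exists>A :: complex ^ 'm ^ 'm. \<exists>t :: complex \<Rightarrow> complex. invertible A \<and>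
       (\<forall>x\<in>verts G. t x \<noteq> 0) \<and>
       (\<forall>b\<in>all_blacks G. v' b = inverse (t b) *s (A *v v b)) \<and>
       (\<forall>e\<in>edges G. r' e = t (blk G e) * t (wht G e) * r e))}"

definition vrc_classes ::
    "('e, 'x) plabic_scheme \<Rightarrow> ((complex \<Rightarrow> complex ^ 'm) \<times> ('e \<Rightarrow> complex)) set set"
  where "vrc_classes G = vrcs G // gauge_rel G"

definition bdry ::
    "('e, 'x) plabic_scheme \<Rightarrow> (complex \<Rightarrow> complex ^ 'm) \<Rightarrow> nat \<Rightarrow> complex ^ 'm"
  where "bdry G v = (\<lambda>i\<in>{1..nbd G}. v (bvert G i))"

definition has_boundary ::
    "('e, 'x) plabic_scheme \<Rightarrow> ((complex \<Rightarrow> complex ^ 'm) \<times> ('e \<Rightarrow> complex)) set \<Rightarrow>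
     (nat \<Rightarrow> complex ^ 'm) set \<Rightarrow> bool"
  where "has_boundary G X z \<longleftrightarrow> (\<exists>(v, r)\<in>X. bdry G v \<in> z)"

definition solvable_locus :: "('e, 'x) plabic_scheme \<Rightarrow> (nat \<Rightarrow> complex ^ 'm) set set"
  where "solvable_locus G =
    {z \<in> conf_gen {1..nbd G}. \<exists>!X. X \<in> vrc_classes G \<and> has_boundary G X z}"

definition generically_solvable :: "'m::finite itself \<Rightarrow> ('e, 'x) plabic_scheme \<Rightarrow> bool"
  where "generically_solvable _ G \<longleftrightarrow>
    (\<exists>U :: (nat \<Rightarrow> complex ^ 'm) set set. open_dense {1..nbd G} U \<and> U \<subseteq> solvable_locus G)"


section \<open>Plabic tangles\<close>

text \<open>Blobs are numbered \<open>1, \<dots>, nblobs T\<close>, and the boundary vertices of blob \<open>i\<close> are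
  \<open>bpos T i 1, \<dots>, bpos T i (bsize T i)\<close>. The curve \<open>seg T i j\<close> joins \<open>bpos T i j\<close> to
  a black vertex.\<close>

record 'e tangle =
  pgraph :: "'e plabic"
  nblobs :: nat
  center :: "nat \<Rightarrow> complex"
  radius :: "nat \<Rightarrow> real"
  bsize :: "nat \<Rightarrow> nat"
  bpos :: "nat \<Rightarrow> nat \<Rightarrow> complex"
  seg :: "nat \<Rightarrow> nat \<Rightarrow> real \<Rightarrow> complex"

definition blob :: "'e tangle \<Rightarrow> nat \<Rightarrow> complex set"
  where "blob T i = cball (center T i) (radius T i)"

definition target :: "'e tangle \<Rightarrow> nat \<Rightarrow> nat \<Rightarrow> complex"
  where "target T i j = pathfinish (seg T i j)"

definition plabic_tangle :: "'e tangle \<Rightarrow> bool"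
  where "plabic_tangle T \<longleftrightarrow> plabic_graph (pgraph T) \<and>
    (\<forall>i\<in>{1..nblobs T}. 0 < radius T i \<and> (\<exists>f\<in>faces (pgraph T). blob T i \<subseteq> f) \<and>
       clockwise (center T i) (radius T i) (bsize T i) (bpos T i)) \<and>
    (\<forall>i\<in>{1..nblobs T}. \<forall>i'\<in>{1..nblobs T}. i \<noteq> i' \<longrightarrow> blob T i \<inter> blob T i' = {}) \<and>
    (\<forall>i\<in>{1..nblobs T}. \<forall>j\<in>{1..bsize T i}.
       arc (seg T i j) \<and> pathstart (seg T i j) = bpos T i j \<and>
       target T i j \<in> all_blacks (pgraph T) \<and>
       open_arc (seg T i j) \<subseteq>
         ball 0 1 - drawing (pgraph T) - (\<Union>k\<in>{1..nblobs T}. blob T k)) \<and>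
    (\<forall>i\<in>{1..nblobs T}. \<forall>j\<in>{1..bsize T i}. \<forall>i'\<in>{1..nblobs T}. \<forall>j'\<in>{1..bsize T i'}.
       (i, j) \<noteq> (i', j') \<longrightarrow> open_arc (seg T i j) \<inter> open_arc (seg T i' j') = {})"

definition tangle_solvable :: "'m::finite itself \<Rightarrow> 'e tangle \<Rightarrow> bool"
  where "tangle_solvable M T \<longleftrightarrow> generically_solvable M (pgraph T) \<and>
    (\<forall>i\<in>{1..nblobs T}. CARD('m) \<le> bsize T i)"

text \<open>The vectors \<open>v\<^bsub>b\<^sub>u\<^esub>\<close> at the boundary of blob \<open>i\<close>.\<close>

definition blob_tuple ::
    "'e tangle \<Rightarrow> nat \<Rightarrow> (complex \<Rightarrow> complex ^ 'm) \<Rightarrow> nat \<Rightarrow> complex ^ 'm"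
  where "blob_tuple T i v = (\<lambda>j\<in>{1..bsize T i}. v (target T i j))"

text \<open>A representative of the class with boundary \<open>z\<close>, for \<open>z\<close> in the solvable locus.\<close>

definition the_vrc ::
    "('e, 'x) plabic_scheme \<Rightarrow> (nat \<Rightarrow> complex ^ 'm) set \<Rightarrow>
     (complex \<Rightarrow> complex ^ 'm) \<times> ('e \<Rightarrow> complex)"
  where "the_vrc G z = (SOME vr. vr \<in> vrcs G \<and> bdry G (fst vr) \<in> z)"

definition psi ::
    "'e tangle \<Rightarrow> (nat \<Rightarrow> complex ^ 'm) set \<Rightarrow> nat \<Rightarrow> (nat \<Rightarrow> complex ^ 'm) set"
  where "psi T z = (\<lambda>i\<in>{1..nblobs T}.
    conf_of {1..bsize T i} (blob_tuple T i (fst (the_vrc (pgraph T) z))))"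

definition rank_regular :: "'m::finite itself \<Rightarrow> 'e tangle \<Rightarrow> bool"
  where "rank_regular _ T \<longleftrightarrow>
    (\<exists>U :: (nat \<Rightarrow> complex ^ 'm) set set.
       open_dense {1..nbd (pgraph T)} U \<and> U \<subseteq> solvable_locus (pgraph T) \<and>
       (\<forall>z\<in>U. \<forall>i\<in>{1..nblobs T}.
          vec.span (blob_tuple T i (fst (the_vrc (pgraph T) z)) ` {1..bsize T i}) = UNIV))"

text \<open>As \<open>psi\<close> is only a rational map, the condition on its image is imposed on every dense
  open set of boundary configurations over which it is defined.\<close>

definition dominant :: "'m::finite itself \<Rightarrow> 'e tangle \<Rightarrow> bool"
  where "dominant M T \<longleftrightarrow> rank_regular M T \<and>
    (\<forall>i\<in>{1..nblobs T}. \<forall>U :: (nat \<Rightarrow> complex ^ 'm) set set.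
       open_dense {1..nbd (pgraph T)} U \<and> U \<subseteq> solvable_locus (pgraph T) \<longrightarrow>
       (\<exists>S. S \<subseteq> (\<lambda>z. psi T z i) ` U \<and> conf_dense {1..bsize T i} S))"

definition brushing ::
    "'e tangle \<Rightarrow> (nat \<Rightarrow> 'e set) \<Rightarrow> (nat \<Rightarrow> nat \<Rightarrow> complex list) \<Rightarrow> bool"
  where "brushing T F P \<longleftrightarrow> (\<forall>i\<in>{1..nblobs T}.
    acyclic_rpo (pgraph T) (F i) \<and>
    (\<forall>j\<in>{1..bsize T i}. boundary_path_to (pgraph T) (F i) (target T i j) (P i j)) \<and>
    (\<forall>j\<in>{1..bsize T i}. \<forall>k\<in>{1..bsize T i}. j \<noteq> k \<longrightarrow> set (P i j) \<inter> set (P i k) = {}))"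

end

theory Submission
  imports Defs "HOL-Complex_Analysis.Riemann_Mapping" "HOL-Homology.Homology"
begin

text \<open>An acyclic reverse perfect orientation \<open>F\<close>, with coefficients on its edges normalised to \<open>-1\<close>, turns the
  relations into a recursion that expresses all vectors through those at the sources, polynomially in the
  remaining coefficients. Coefficients \<open>1\<close> along disjoint paths and \<open>0\<close> elsewhere copy source vectors to the
  blob, so a brushing makes the blob vectors of a generic solution arbitrary. Normalising the gauge freedom makes
  the boundary map injective, so that by invariance of domain it does not enlarge dimensions, and the
  hypersurface of solutions with degenerate blob vectors maps into a hypersurface.

  Conversely, without disjoint paths to a blob a matching argument gives \<open>\<nu> \<noteq> 0\<close> on the white vertices with
  \<open>\<Sum> \<nu>\<^sub>w r\<^sub>e = 0\<close> at all black vertices off the blob. The vectors \<open>\<nu>\<^sub>w r\<^sub>e v\<^sub>b\<close> then form a circulation on the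
  planar graph obtained by placing a white vertex in the blob, and so they are the jumps across the edges of a
  function that is constant on faces, built from winding numbers. This potential yields a deformation of the
  configuration that fixes the boundary. Uniqueness forces the values of the potential in the faces around a
  black vertex into the line of its vector; as the lines at the blob are distinct, the circulation vanishes
  there, and then \<open>\<nu> = 0\<close> by acyclicity.\<close>

section \<open>Potentials of planar circulations\<close>

text \<open>Faces are given as connected components, with no cyclic order of the edges at a vertex.
  The potential is therefore a sum of winding numbers of open arcs, weighted by the circulation. A
  single summand is neither integral nor locally constant, but its variation is a difference of end
  point values, and these cancel because inflow equals outflow. Jumps are computed near the
  vertices, where the arcs are first made straight; the Jordan curve theorem serves only to match
  the two ends of an edge.

  Why a projective flow: the values of the potential around a black vertex lie on one affine line in
  the direction of its vector. A projective map sends this line to a line, so the jumps at the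
  vertex remain multiples of one vector, the deformed one. At the boundary the line passes through
  the outer value 0, and the map preserves lines through 0.

  Density of the image asks for one good parameter per open set, which the irreducibility of affine
  space provides. Rank regularity speaks of all boundaries in an open set; this is why dimensions
  must be compared.\<close>

lemma exp_lift_unique:
  fixes F P :: "real \<Rightarrow> complex"
  assumes F: "continuous_on {0..1} F" and P: "continuous_on {0..1} P"
    and FP: "\<And>t. t \<in> {0..1} \<Longrightarrow> exp (F t) = c * exp (P t)"
  shows "F 1 - F 0 = P 1 - P 0"
proof -
  define \<phi> where "\<phi> t = F t - P t" for t
  have expc: "exp (\<phi> t) = c" if "t \<in> {0..1}" for t
    using FP[OF that] by (simp add: \<phi>_def exp_diff)
  have "\<phi> constant_on {0..1}"
  proof (rule continuous_discrete_range_constant)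
    show "connected {0..1::real}" by simp
    show "continuous_on {0..1} \<phi>"
      unfolding \<phi>_def by (intro continuous_on_diff F P)
    fix x :: real assume x: "x \<in> {0..1}"
    show "\<exists>e>0. \<forall>y. y \<in> {0..1} \<and> \<phi> y \<noteq> \<phi> x \<longrightarrow> e \<le> norm (\<phi> y - \<phi> x)"
    proof (intro exI[of _ "2*pi"] conjI allI impI)
      fix y assume y: "y \<in> {0..1} \<and> \<phi> y \<noteq> \<phi> x"
      then have "exp (\<phi> y) = exp (\<phi> x)" using expc x by simp
      then obtain n :: int where n: "\<phi> y = \<phi> x + complex_of_real (2 * of_int n * pi) * \<i>"
        by (auto simp: exp_eq)
      with y have "n \<noteq> 0" by auto
      then have "\<bar>of_int n :: real\<bar> \<ge> 1" by linarith
      moreover have "norm (\<phi> y - \<phi> x) = 2 * \<bar>of_int n\<bar> * pi"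
        unfolding n by (simp add: norm_mult abs_mult)
      ultimately show "2 * pi \<le> norm (\<phi> y - \<phi> x)" by simp
    qed simp
  qed
  then have "\<phi> 0 = \<phi> 1" by (force simp: constant_on_def)
  then show ?thesis by (simp add: \<phi>_def algebra_simps)
qed

text \<open>The winding number of an open path comes from a continuous logarithm along the path; a
  logarithm \<open>f\<close> given on the image can replace it. The constant \<open>c\<close> admits
  logarithms of rescaled functions such as \<open>1 - x / p\<close>, as \<open>pot_outside\<close>
  requires.\<close>

lemma winding_number_log:
  assumes g: "path g" and p: "p \<notin> path_image g" and c: "c \<noteq> 0"
    and f: "continuous_on (path_image g) f"
    and ef: "\<And>x. x \<in> path_image g \<Longrightarrow> exp (f x) = c * (x - p)"
  shows "2 * of_real pi * \<i> * winding_number g p = f (pathfinish g) - f (pathstart g)"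
proof -
  obtain P where P: "path P" "pathfinish P - pathstart P = 2 * of_real pi * \<i> * winding_number g p"
    "\<And>t. t \<in> {0..1} \<Longrightarrow> g t = p + exp (P t)"
    using winding_number_as_continuous_log[OF g p] by metis
  have "f (g 1) - f (g 0) = P 1 - P 0"
  proof (rule exp_lift_unique[of "\<lambda>t. f (g t)" P c])
    show "continuous_on {0..1} (\<lambda>t. f (g t))"
      using continuous_on_compose[of "{0..1}" g f] g f by (simp add: path_def path_image_def o_def)
    show "continuous_on {0..1} P" using P(1) by (simp add: path_def)
    fix t :: real assume t: "t \<in> {0..1}"
    then have "g t \<in> path_image g" by (auto simp: path_image_def)
    from ef[OF this] show "exp (f (g t)) = c * exp (P t)" using P(3)[OF t] by simp
  qed
  then show ?thesis using P(2) by (simp add: pathstart_def pathfinish_def)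
qed

text \<open>Separate logarithms of \<open>x - p\<close> and \<open>x - q\<close> need not exist on
  the image, while their quotient often has one: away from the chord from \<open>p\<close> to
  \<open>q\<close> it is the principal one.\<close>

lemma winding_number_diff_log:
  assumes g: "path g" and p: "p \<notin> path_image g" and q: "q \<notin> path_image g"
    and f: "continuous_on (path_image g) f"
    and ef: "\<And>x. x \<in> path_image g \<Longrightarrow> exp (f x) = (x - p) / (x - q)"
  shows "2 * of_real pi * \<i> * (winding_number g p - winding_number g q) = f (pathfinish g) - f (pathstart g)"
proof -
  obtain P where P: "path P" "pathfinish P - pathstart P = 2 * of_real pi * \<i> * winding_number g p"
    "\<And>t. t \<in> {0..1} \<Longrightarrow> g t = p + exp (P t)"
    using winding_number_as_continuous_log[OF g p] by metis
  obtain Q where Q: "path Q" "pathfinish Q - pathstart Q = 2 * of_real pi * \<i> * winding_number g q"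
    "\<And>t. t \<in> {0..1} \<Longrightarrow> g t = q + exp (Q t)"
    using winding_number_as_continuous_log[OF g q] by metis
  have "f (g 1) - f (g 0) = (P 1 - Q 1) - (P 0 - Q 0)"
  proof (rule exp_lift_unique[of "\<lambda>t. f (g t)" "\<lambda>t. P t - Q t" 1])
    show "continuous_on {0..1} (\<lambda>t. f (g t))"
      using continuous_on_compose[of "{0..1}" g f] g f by (simp add: path_def path_image_def o_def)
    show "continuous_on {0..1} (\<lambda>t. P t - Q t)"
      using P(1) Q(1) by (intro continuous_on_diff) (simp_all add: path_def)
    fix t :: real assume t: "t \<in> {0..1}"
    then have "g t \<in> path_image g" by (auto simp: path_image_def)
    from ef[OF this] have "exp (f (g t)) = exp (P t) / exp (Q t)"
      using P(3)[OF t] Q(3)[OF t] by (metis add_diff_cancel_left')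
    then show "exp (f (g t)) = 1 * exp (P t - Q t)" by (simp add: exp_diff)
  qed
  then show ?thesis using P(2) Q(2)
    by (simp add: pathstart_def pathfinish_def algebra_simps)
qed

text \<open>A ratio \<open>r \<le> 0\<close> means \<open>x = (p - r q) / (1 - r)\<close>, a convex
  combination. So the cut of the principal logarithm of the ratio is the chord.\<close>

lemma nonpos_ratio_segment:
  fixes x p q :: complex
  assumes "(x - p) / (x - q) \<in> \<real>\<^sub>\<le>\<^sub>0" "x \<noteq> q"
  shows "x \<in> closed_segment p q"
proof -
  obtain r where r: "r \<le> 0" "(x - p) / (x - q) = of_real r"
    using assms(1) by (auto simp: nonpos_Reals_def elim: Reals_cases)
  have d: "1 - r > 0" using r(1) by simp
  have "x - p = of_real r * (x - q)" using assms(2) r(2) nonzero_divide_eq_eq[of "x - q" "x - p" "of_real r"] by simp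
  then have "x - p - (r *\<^sub>R x - r *\<^sub>R q) = 0" by (simp add: scaleR_conv_of_real right_diff_distrib)
  moreover have "(1 - r) *\<^sub>R x - (p - r *\<^sub>R q) = x - p - (r *\<^sub>R x - r *\<^sub>R q)" by (simp add: scaleR_diff_left)
  ultimately have *: "(1 - r) *\<^sub>R x = p - r *\<^sub>R q" by (metis right_minus_eq)
  have "x = (1 / (1 - r)) *\<^sub>R ((1 - r) *\<^sub>R x)" using d by simp
  also have "\<dots> = (1 / (1 - r)) *\<^sub>R p + (- r / (1 - r)) *\<^sub>R q"
    unfolding * by (simp add: scaleR_diff_right)
  finally have "x = (1 / (1 - r)) *\<^sub>R p + (- r / (1 - r)) *\<^sub>R q" .
  moreover have "1 / (1 - r) = 1 - (- r / (1 - r))" using d by (simp add: field_simps)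
  ultimately have "x = (1 - (- r / (1 - r))) *\<^sub>R p + (- r / (1 - r)) *\<^sub>R q" by metis
  moreover have "0 \<le> - r / (1 - r)" "- r / (1 - r) \<le> 1" using r d by (auto simp: field_simps)
  ultimately show ?thesis unfolding closed_segment_def by blast
qed

text \<open>Difference of the logarithms of \<open>x - p\<close> and \<open>x - q\<close>, with the cut along the chord.\<close>

definition chord_log :: "complex \<Rightarrow> complex \<Rightarrow> complex \<Rightarrow> complex"
  where "chord_log p q x = Ln ((x - p) / (x - q)) / (2 * of_real pi * \<i>)"

text \<open>Only the end points of the path enter on the right, through one function that depends on
  \<open>p\<close> and \<open>q\<close> but not on the path. This is what makes the variation of
  open winding numbers cancel in a circulation.\<close>

lemma winding_number_diff_chord:
  assumes g: "path g" and pq: "closed_segment p q \<inter> path_image g = {}"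
  shows "winding_number g p - winding_number g q = chord_log p q (pathfinish g) - chord_log p q (pathstart g)"
proof -
  have p: "p \<notin> path_image g" and q: "q \<notin> path_image g" using pq by auto
  have nz: "(x - p) / (x - q) \<noteq> 0" "(x - p) / (x - q) \<notin> \<real>\<^sub>\<le>\<^sub>0" if "x \<in> path_image g" for x
    using that p q pq nonpos_ratio_segment[of x p q] by auto
  have "2 * of_real pi * \<i> * (winding_number g p - winding_number g q)
      = Ln ((pathfinish g - p) / (pathfinish g - q)) - Ln ((pathstart g - p) / (pathstart g - q))"
  proof (rule winding_number_diff_log[OF g p q])
    show "continuous_on (path_image g) (\<lambda>x. Ln ((x - p) / (x - q)))"
      using nz q by (intro continuous_intros) auto
  qed (use nz in auto)
  then show ?thesis by (simp add: chord_log_def field_simps)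
qed

text \<open>The segment crosses the chord at \<open>m\<close> and has \<open>p\<close> on its left.
  The crossing of the cut of the logarithm accounts for the summand \<open>1\<close>.\<close>

lemma winding_number_diff_linepath:
  assumes s: "0 < s" and \<tau>: "0 < \<tau>" "\<tau> < 1" and ab: "a \<noteq> b"
    and m: "m = a + of_real \<tau> * (b - a)"
    and p: "p = m + \<i> * of_real s * (b - a)" and q: "q = m - \<i> * of_real s * (b - a)"
  shows "winding_number (linepath a b) p - winding_number (linepath a b) q
    = 1 + (chord_log p q b - chord_log p q a)"
proof -
  let ?pt = "\<lambda>\<sigma>::real. m + of_real \<sigma> * (b - a)"
  let ?R = "\<lambda>x. (x - p) / (x - q)"
  have ratio: "?R (?pt \<sigma>) = (of_real \<sigma> - \<i> * of_real s) / (of_real \<sigma> + \<i> * of_real s)" for \<sigma>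
  proof -
    have "?pt \<sigma> - p = (b - a) * (of_real \<sigma> - \<i> * of_real s)" "?pt \<sigma> - q = (b - a) * (of_real \<sigma> + \<i> * of_real s)"
      by (auto simp: p q algebra_simps)
    then show ?thesis using ab by simp
  qed
  have nz: "?R (?pt \<sigma>) \<noteq> 0" for \<sigma>
  proof -
    have "Im (of_real \<sigma> - \<i> * of_real s) \<noteq> 0" "Im (of_real \<sigma> + \<i> * of_real s) \<noteq> 0" using s by auto
    then have "of_real \<sigma> - \<i> * of_real s \<noteq> 0" "of_real \<sigma> + \<i> * of_real s \<noteq> 0" by force+
    then show ?thesis unfolding ratio by simp
  qed
  have pne: "?pt \<sigma> \<noteq> p" "?pt \<sigma> \<noteq> q" for \<sigma>
    using nz[of \<sigma>] by auto
  have R: "Im (?R (?pt \<sigma>)) = - 2 * s * \<sigma> / (\<sigma>\<^sup>2 + s\<^sup>2)" for \<sigma>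
    unfolding ratio using s by (simp add: Im_divide power2_eq_square)
  have R': "Re (?R (?pt \<sigma>)) = (\<sigma>\<^sup>2 - s\<^sup>2) / (\<sigma>\<^sup>2 + s\<^sup>2)" for \<sigma>
    unfolding ratio using s by (simp add: Re_divide power2_eq_square)
  have a: "a = ?pt (- \<tau>)" and b: "b = ?pt (1 - \<tau>)" and mm: "m = ?pt 0"
    by (auto simp: m algebra_simps)
  have pos: "\<sigma>\<^sup>2 + s\<^sup>2 > 0" for \<sigma> using s by (simp add: sum_power2_gt_zero_iff)
  have seg: "\<exists>\<sigma>. x = ?pt \<sigma> \<and> u \<le> \<sigma> \<and> \<sigma> \<le> v" if xs: "x \<in> closed_segment (?pt u) (?pt v)" and uv: "u \<le> v" for x u v
  proof -
    obtain t where t: "0 \<le> t" "t \<le> 1" "x = (1 - t) *\<^sub>R ?pt u + t *\<^sub>R ?pt v"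
      using xs unfolding in_segment(1) by metis
    have "x = ?pt ((1 - t) * u + t * v)"
      by (simp add: t(3) scaleR_conv_of_real algebra_simps)
    moreover have "u \<le> (1 - t) * u + t * v" "(1 - t) * u + t * v \<le> v"
      using mult_left_mono[OF uv, of t] mult_left_mono[OF uv, of "1 - t"] t(1,2)
      by (auto simp: algebra_simps)
    ultimately show ?thesis by blast
  qed
  have tm: "1 - \<tau> > 0" "-\<tau> < 0" using \<tau> by auto
  have im: "m \<in> closed_segment a b"
    unfolding closed_segment_def m using \<tau>
    by (auto simp: scaleR_conv_of_real algebra_simps intro!: exI[of _ \<tau>])
  have outg: "p \<notin> closed_segment (?pt u) (?pt v)" "q \<notin> closed_segment (?pt u) (?pt v)" if "u \<le> v" for u v
    using seg[OF _ that] pne by blast+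
  have out: "p \<notin> closed_segment a b" "q \<notin> closed_segment a b"
    using outg[of "-\<tau>" "1 - \<tau>", folded a b] by auto
  have out1: "p \<notin> closed_segment a m" "q \<notin> closed_segment a m" "p \<notin> closed_segment m b" "q \<notin> closed_segment m b"
    using outg[of "-\<tau>" 0, folded a mm] outg[of 0 "1 - \<tau>", folded b mm] tm by auto
  \<comment> \<open>On the half before \<open>m\<close> the ratio stays in the upper half plane
    until it reaches \<open>-1\<close>; on the half after \<open>m\<close> it leaves
    \<open>-1\<close> into the lower one. A branch of the logarithm turned by a quarter is
    continuous on each half.\<close>
  have 1: "2 * of_real pi * \<i> * (winding_number (linepath a m) p - winding_number (linepath a m) q)
      = (Ln (- \<i> * ?R m) + \<i> * of_real pi / 2) - (Ln (- \<i> * ?R a) + \<i> * of_real pi / 2)"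
  proof -
    have Re: "- \<i> * ?R x \<noteq> 0 \<and> - \<i> * ?R x \<notin> \<real>\<^sub>\<le>\<^sub>0 \<and> x \<noteq> q" if xs: "x \<in> closed_segment a m" for x
    proof -
      obtain \<sigma> where \<sigma>: "x = ?pt \<sigma>" "\<sigma> \<le> 0"
        using seg[of x "-\<tau>" 0, folded a mm, OF xs] tm by auto
      have "Re (- \<i> * y) = Im y" "Im (- \<i> * y) = - Re y" for y by simp_all
      moreover have "Im (?R x) > 0 \<or> Re (?R x) < 0"
      proof (cases "\<sigma> = 0")
        case True then show ?thesis using s by (simp add: \<sigma>(1) R' del: of_real_0)
      next
        case False
        then have "Im (?R x) > 0" unfolding \<sigma>(1) R using \<sigma>(2) s pos
          by (intro divide_pos_pos) (auto simp: mult_less_0_iff)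
        then show ?thesis by simp
      qed
      moreover have "Im (?R x) \<ge> 0" unfolding \<sigma>(1) R using \<sigma>(2) s pos[of \<sigma>]
        by (intro divide_nonneg_pos) (auto simp: mult_le_0_iff)
      moreover have "?R x \<noteq> 0" "x \<noteq> q" using nz pne \<sigma>(1) by auto
      ultimately show ?thesis by (simp only: complex_nonpos_Reals_iff mult_eq_0_iff) auto
    qed
    have "2 * of_real pi * \<i> * (winding_number (linepath a m) p - winding_number (linepath a m) q)
      = (\<lambda>x. Ln (- \<i> * ?R x) + \<i> * of_real pi / 2) (pathfinish (linepath a m)) - (\<lambda>x. Ln (- \<i> * ?R x) + \<i> * of_real pi / 2) (pathstart (linepath a m))"
    proof (rule winding_number_diff_log)
      show "continuous_on (path_image (linepath a m)) (\<lambda>x. Ln (- \<i> * ?R x) + \<i> * of_real pi / 2)"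
        using Re by (intro continuous_intros) auto
      fix x assume "x \<in> path_image (linepath a m)"
      with Re have "- \<i> * ?R x \<noteq> 0" by auto
      moreover have "exp (\<i> * of_real pi / 2) = \<i>"
        using exp_Ln[of \<i>] by simp
      moreover have "(- \<i> * y) * \<i> = y" for y by (simp add: complex_eq_iff)
      ultimately show "exp (Ln (- \<i> * ?R x) + \<i> * of_real pi / 2) = ?R x"
        by (simp only: exp_add exp_Ln not_False_eq_True)
    qed (use out1 in auto)
    then show ?thesis by simp
  qed
  have 2: "2 * of_real pi * \<i> * (winding_number (linepath m b) p - winding_number (linepath m b) q)
      = (Ln (\<i> * ?R b) - \<i> * of_real pi / 2) - (Ln (\<i> * ?R m) - \<i> * of_real pi / 2)"
  proof -
    have Re: "\<i> * ?R x \<noteq> 0 \<and> \<i> * ?R x \<notin> \<real>\<^sub>\<le>\<^sub>0 \<and> x \<noteq> q" if xs: "x \<in> closed_segment m b" for x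
    proof -
      obtain \<sigma> where \<sigma>: "x = ?pt \<sigma>" "\<sigma> \<ge> 0"
        using seg[of x 0 "1-\<tau>", folded b mm, OF xs] tm by auto
      have "Re (\<i> * y) = - Im y" "Im (\<i> * y) = Re y" for y by simp_all
      moreover have "Im (?R x) < 0 \<or> Re (?R x) < 0"
      proof (cases "\<sigma> = 0")
        case True then show ?thesis using s by (simp add: \<sigma>(1) R' del: of_real_0)
      next
        case False
        then have "Im (?R x) < 0" unfolding \<sigma>(1) R using \<sigma>(2) s pos
          by (intro divide_neg_pos) (auto simp: mult_less_0_iff)
        then show ?thesis by simp
      qed
      moreover have "Im (?R x) \<le> 0" unfolding \<sigma>(1) R using \<sigma>(2) s pos[of \<sigma>]
        by (intro divide_nonpos_pos) (auto simp: mult_le_0_iff)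
      moreover have "?R x \<noteq> 0" "x \<noteq> q" using nz pne \<sigma>(1) by auto
      ultimately show ?thesis by (simp only: complex_nonpos_Reals_iff mult_eq_0_iff) auto
    qed
    have "2 * of_real pi * \<i> * (winding_number (linepath m b) p - winding_number (linepath m b) q)
      = (\<lambda>x. Ln (\<i> * ?R x) - \<i> * of_real pi / 2) (pathfinish (linepath m b)) - (\<lambda>x. Ln (\<i> * ?R x) - \<i> * of_real pi / 2) (pathstart (linepath m b))"
    proof (rule winding_number_diff_log)
      show "continuous_on (path_image (linepath m b)) (\<lambda>x. Ln (\<i> * ?R x) - \<i> * of_real pi / 2)"
        using Re by (intro continuous_intros) auto
      fix x assume "x \<in> path_image (linepath m b)"
      with Re have "\<i> * ?R x \<noteq> 0" by auto
      moreover have "exp (\<i> * of_real pi / 2) = \<i>"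
        using exp_Ln[of \<i>] by simp
      moreover have "(\<i> * y) / \<i> = y" for y by simp
      ultimately show "exp (Ln (\<i> * ?R x) - \<i> * of_real pi / 2) = ?R x"
        by (simp only: exp_diff exp_Ln not_False_eq_True)
    qed (use out1 in auto)
    then show ?thesis by simp
  qed
  \<comment> \<open>At \<open>m\<close> the two turned branches take the values
    \<open>\<i> * pi\<close> and \<open>- \<i> * pi\<close>; their difference is the full
    period.\<close>
  have Rm: "?R m = -1"
  proof -
    have "?R (?pt 0) = -1" using s by (simp only: ratio) (simp add: complex_eq_iff Re_divide Im_divide)
    then show ?thesis by simp
  qed
  have lb: "Ln (\<i> * ?R b) = Ln (?R b) + \<i> * of_real pi / 2"
  proof -
    have "Im (?R b) < 0" unfolding R[of "1 - \<tau>", folded b] using s tm pos by (intro divide_neg_pos) (auto simp: mult_less_0_iff)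
    then show ?thesis using Ln_times_ii[of "?R b"] nz[of "1 - \<tau>", folded b] by auto
  qed
  have la: "Ln (- \<i> * ?R a) = Ln (?R a) - \<i> * of_real pi / 2"
  proof -
    have im: "Im (?R a) > 0" unfolding R[of "- \<tau>", folded a] using s tm \<tau> pos[of "- \<tau>"] by (intro divide_pos_pos) auto
    have "Ln (- \<i> * y) = Ln y - \<i> * of_real pi / 2" if "Im y > 0" for y
    proof -
      have "Ln (\<i> * (- \<i> * y)) = Ln (- \<i> * y) + \<i> * of_real pi / 2"
        using that by (subst Ln_times_ii) auto
      moreover have "\<i> * (- \<i> * y) = y" by (simp add: complex_eq_iff)
      ultimately show ?thesis by simp
    qed
    from this[OF im] show ?thesis .
  qed
  let ?W = "\<lambda>x y. winding_number (linepath x y) p - winding_number (linepath x y) q"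
  have 1: "2 * of_real pi * \<i> * ?W a m = \<i> * of_real pi - Ln (?R a)"
    using 1 unfolding Rm la by (simp add: algebra_simps)
  have 2: "2 * of_real pi * \<i> * ?W m b = Ln (?R b) + \<i> * of_real pi"
    using 2 unfolding Rm lb by (simp add: algebra_simps)
  have "?W a b = ?W a m + ?W m b"
    by (simp add: winding_number_split_linepath[OF im out(1)] winding_number_split_linepath[OF im out(2)])
  then have "2 * of_real pi * \<i> * ?W a b = (Ln (?R b) - Ln (?R a)) + 2 * of_real pi * \<i>"
    using 1 2 by (simp add: distrib_left)
  then have "?W a b = ((Ln (?R b) - Ln (?R a)) + 2 * of_real pi * \<i>) / (2 * of_real pi * \<i>)"
    by (simp add: eq_divide_eq mult.commute)
  then show ?thesis by (simp add: chord_log_def add_divide_distrib diff_divide_distrib)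
qed

text \<open>The jump points are removed one at a time from the right. A window of radius
  \<open>\<epsilon>\<close> may stick out of \<open>{a..b}\<close>, which does no harm because it
  contains no jump point besides its centre.\<close>

lemma step_sum:
  fixes f :: "real \<Rightarrow> 'v::ab_group_add"
  assumes const: "\<And>c d. c \<le> d \<Longrightarrow> {c..d} \<inter> A = {} \<Longrightarrow> f c = f d"
    and iso: "\<And>\<alpha> s. \<alpha> \<in> A \<Longrightarrow> s \<noteq> 0 \<Longrightarrow> \<bar>s\<bar> \<le> \<epsilon> \<Longrightarrow> \<alpha> + s \<notin> A"
    and \<epsilon>: "0 < \<epsilon>" and a: "a \<notin> A"
  shows "a \<le> b \<Longrightarrow> b \<notin> A \<Longrightarrow> finite (A \<inter> {a..b}) \<Longrightarrow>
    f b - f a = (\<Sum>\<alpha>\<in>A \<inter> {a..b}. f (\<alpha> + \<epsilon>) - f (\<alpha> - \<epsilon>))"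
proof (induction "card (A \<inter> {a..b})" arbitrary: b)
  case 0
  then have "A \<inter> {a..b} = {}" by simp
  then show ?case using const[of a b] 0 by (simp add: Int_commute)
next
  case (Suc n)
  then have ne: "A \<inter> {a..b} \<noteq> {}" by auto
  define \<alpha> where "\<alpha> = Max (A \<inter> {a..b})"
  have \<alpha>: "\<alpha> \<in> A" "a \<le> \<alpha>" "\<alpha> \<le> b" and mx: "\<And>y. y \<in> A \<Longrightarrow> a \<le> y \<Longrightarrow> y \<le> b \<Longrightarrow> y \<le> \<alpha>"
    using Max_in[OF Suc(5) ne] Max_ge[OF Suc(5)] by (auto simp: \<alpha>_def)
  have lt: "a < \<alpha>" "\<alpha> < b" using \<alpha> a Suc(4) by (metis order_le_imp_less_or_eq)+
  have isoy: "y \<notin> A" if "y \<noteq> \<alpha>" "\<bar>y - \<alpha>\<bar> \<le> \<epsilon>" for y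
    using iso[OF \<alpha>(1), of "y - \<alpha>"] that by simp
  have fb: "f (\<alpha> + \<epsilon>) = f b"
  proof (cases "\<alpha> + \<epsilon> \<le> b")
    case True
    have "{\<alpha> + \<epsilon>..b} \<inter> A = {}" using mx lt \<epsilon> by force
    then show ?thesis using const True by blast
  next
    case False
    have "{b..\<alpha> + \<epsilon>} \<inter> A = {}" using isoy lt by fastforce
    then show ?thesis using const[of b "\<alpha> + \<epsilon>"] False by auto
  qed
  \<comment> \<open>The left end of the last window, unless that lies before
    \<open>a\<close>.\<close>
  define c where "c = max a (\<alpha> - \<epsilon>)"
  have c: "a \<le> c" "c < \<alpha>" using lt \<epsilon> by (auto simp: c_def)
  have fc: "f (\<alpha> - \<epsilon>) = f c"
  proof -
    have "{\<alpha> - \<epsilon>..c} \<inter> A = {}" using isoy c by fastforce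
    then show ?thesis using const[of "\<alpha> - \<epsilon>" c] by (auto simp: c_def)
  qed
  have "\<bar>c - \<alpha>\<bar> \<le> \<epsilon>" using c unfolding c_def by linarith
  then have cA: "c \<notin> A" using isoy[of c] c by auto
  have set: "A \<inter> {a..b} = insert \<alpha> (A \<inter> {a..c})"
  proof
    show "A \<inter> {a..b} \<subseteq> insert \<alpha> (A \<inter> {a..c})"
    proof
      fix y assume y: "y \<in> A \<inter> {a..b}"
      then have "y \<le> \<alpha>" using mx by auto
      moreover have "y \<le> c" if "y < \<alpha>"
        using isoy[of y] that y unfolding c_def by (cases "\<alpha> - \<epsilon> \<le> y") (auto simp: abs_if split: if_splits)
      ultimately show "y \<in> insert \<alpha> (A \<inter> {a..c})" using y by force
    qed
    show "insert \<alpha> (A \<inter> {a..c}) \<subseteq> A \<inter> {a..b}" using \<alpha> c by auto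
  qed
  have fin: "finite (A \<inter> {a..c})" and nin: "\<alpha> \<notin> A \<inter> {a..c}"
    using Suc(5) c unfolding set by auto
  have "n = card (A \<inter> {a..c})" using Suc(2) fin nin unfolding set by simp
  from Suc(1)[OF this c(1) cA fin]
  have "f c - f a = (\<Sum>\<alpha>\<in>A \<inter> {a..c}. f (\<alpha> + \<epsilon>) - f (\<alpha> - \<epsilon>))" .
  then show ?case unfolding set using fin nin fb fc by (simp add: algebra_simps)
qed

section \<open>Weighted winding numbers of a circulation\<close>

locale curve_system =
  fixes E :: "'a set" and \<gamma> :: "'a \<Rightarrow> real \<Rightarrow> complex" and \<omega> :: "'a \<Rightarrow> complex ^ 'm"
  assumes fin_E: "finite E"
    and path_\<gamma>: "\<And>e. e \<in> E \<Longrightarrow> path (\<gamma> e)"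
    and circulation: "\<And>x. (\<Sum>e\<in>{e\<in>E. pathstart (\<gamma> e) = x}. \<omega> e) = (\<Sum>e\<in>{e\<in>E. pathfinish (\<gamma> e) = x}. \<omega> e)"
begin

text \<open>For a circulation made of closed curves this is their weighted winding number. With open
  curves only the sum, not its summands, is locally constant off the curves.\<close>

definition pot :: "complex \<Rightarrow> complex ^ 'm"
  where "pot p = (\<Sum>e\<in>E. winding_number (\<gamma> e) p *s \<omega> e)"

text \<open>Summation by parts: collected by vertices, the coefficient of \<open>f x\<close> is
  inflow minus outflow at \<open>x\<close>.\<close>

lemma sum_coboundary: "(\<Sum>e\<in>E. (f (pathfinish (\<gamma> e)) - f (pathstart (\<gamma> e))) *s \<omega> e) = 0"
proof -
  let ?V = "(\<lambda>e. pathstart (\<gamma> e)) ` E \<union> (\<lambda>e. pathfinish (\<gamma> e)) ` E"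
  have fV: "finite ?V" using fin_E by simp
  have s: "(\<Sum>e\<in>E. f (pathstart (\<gamma> e)) *s \<omega> e) = (\<Sum>x\<in>?V. f x *s (\<Sum>e\<in>{e\<in>E. pathstart (\<gamma> e) = x}. \<omega> e))"
    by (subst sum.group[OF fin_E fV, of "\<lambda>e. pathstart (\<gamma> e)", symmetric]) (auto simp: vec.scale_sum_right intro!: sum.cong)
  have t: "(\<Sum>e\<in>E. f (pathfinish (\<gamma> e)) *s \<omega> e) = (\<Sum>x\<in>?V. f x *s (\<Sum>e\<in>{e\<in>E. pathfinish (\<gamma> e) = x}. \<omega> e))"
    by (subst sum.group[OF fin_E fV, of "\<lambda>e. pathfinish (\<gamma> e)", symmetric]) (auto simp: vec.scale_sum_right intro!: sum.cong)
  show ?thesis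
    by (simp add: vec.scale_left_diff_distrib sum_subtractf s t circulation)
qed

text \<open>The end point terms come from the same \<open>f\<close> for all edges and drop out by
  \<open>sum_coboundary\<close>.\<close>

lemma pot_diff:
  assumes "\<And>e. e \<in> E \<Longrightarrow> winding_number (\<gamma> e) p - winding_number (\<gamma> e) q
      = s e + (f (pathfinish (\<gamma> e)) - f (pathstart (\<gamma> e)))"
  shows "pot p - pot q = (\<Sum>e\<in>E. s e *s \<omega> e)"
proof -
  have "pot p - pot q = (\<Sum>e\<in>E. (winding_number (\<gamma> e) p - winding_number (\<gamma> e) q) *s \<omega> e)"
    by (simp add: pot_def sum_subtractf vec.scale_left_diff_distrib)
  also have "\<dots> = (\<Sum>e\<in>E. s e *s \<omega> e + (f (pathfinish (\<gamma> e)) - f (pathstart (\<gamma> e))) *s \<omega> e)"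
    by (rule sum.cong) (simp_all add: assms vec.scale_left_distrib)
  finally show ?thesis by (simp only: sum.distrib sum_coboundary add_0_right)
qed

lemma pot_chord:
  assumes "\<And>e. e \<in> E \<Longrightarrow> closed_segment p q \<inter> path_image (\<gamma> e) = {}"
  shows "pot p = pot q"
  using pot_diff[of p q "\<lambda>_. 0" "chord_log p q"] winding_number_diff_chord[OF path_\<gamma>] assms by simp

text \<open>Nearby points off the curves are joined by a chord that misses all of them, so
  \<open>pot\<close> is locally constant there.\<close>

lemma pot_connected:
  assumes S: "connected S" and d: "\<And>e. e \<in> E \<Longrightarrow> S \<inter> path_image (\<gamma> e) = {}" and pq: "p \<in> S" "q \<in> S"
  shows "pot p = pot q"
proof -
  let ?X = "\<Union>e\<in>E. path_image (\<gamma> e)"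
  have "compact ?X" using fin_E path_\<gamma> by (intro compact_UN) (auto intro: compact_path_image)
  then have op: "open (- ?X)" using compact_imp_closed by blast
  have "pot constant_on S"
  proof (rule locally_constant_imp_constant[OF S])
    fix a assume a: "a \<in> S"
    then have "a \<in> - ?X" using d by blast
    then obtain r where r: "r > 0" "ball a r \<subseteq> - ?X" using op open_contains_ball by blast
    show "\<exists>T. openin (top_of_set S) T \<and> a \<in> T \<and> (\<forall>x\<in>T. pot x = pot a)"
    proof (intro exI[of _ "S \<inter> ball a r"] conjI ballI)
      show "openin (top_of_set S) (S \<inter> ball a r)" by (simp add: openin_open_Int)
      show "a \<in> S \<inter> ball a r" using a r by simp
      fix x assume x: "x \<in> S \<inter> ball a r"
      have "closed_segment x a \<subseteq> ball a r"
        by (rule closed_segment_subset) (use x r in auto)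
      then show "pot x = pot a" using r(2) by (intro pot_chord) blast
    qed
  qed
  then show ?thesis using pq by (auto simp: constant_on_def)
qed

text \<open>For \<open>p\<close> outside the disc, \<open>1 - x / p\<close> has positive real part
  on the whole disc. So one logarithm serves all edges, and the winding numbers themselves are end
  point differences.\<close>

lemma pot_outside:
  assumes "\<And>e. e \<in> E \<Longrightarrow> path_image (\<gamma> e) \<subseteq> cball 0 1" and p: "norm p > 1"
  shows "pot p = 0"
proof -
  let ?f = "\<lambda>x. Ln (1 - x / p) / (2 * of_real pi * \<i>)"
  have "winding_number (\<gamma> e) p = ?f (pathfinish (\<gamma> e)) - ?f (pathstart (\<gamma> e))" if e: "e \<in> E" for e
  proof -
    have pi: "norm x \<le> 1" if "x \<in> path_image (\<gamma> e)" for x using assms(1)[OF e] that by auto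
    have nz: "1 - x / p \<notin> \<real>\<^sub>\<le>\<^sub>0" if "x \<in> path_image (\<gamma> e)" for x
    proof -
      have "norm (x / p) < 1" using pi[OF that] p by (simp add: norm_divide divide_simps)
      then have "Re (x / p) < 1" using complex_Re_le_cmod[of "x / p"] by linarith
      then show ?thesis by (auto simp: complex_nonpos_Reals_iff)
    qed
    have "2 * of_real pi * \<i> * winding_number (\<gamma> e) p = Ln (1 - pathfinish (\<gamma> e) / p) - Ln (1 - pathstart (\<gamma> e) / p)"
    proof (rule winding_number_log[OF path_\<gamma>[OF e], of p "- 1 / p" "\<lambda>x. Ln (1 - x / p)"])
      show "p \<notin> path_image (\<gamma> e)" using pi p by force
      show "- 1 / p \<noteq> 0" using p by auto
      show "continuous_on (path_image (\<gamma> e)) (\<lambda>x. Ln (1 - x / p))"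
        using nz p by (intro continuous_intros) auto
      fix x assume "x \<in> path_image (\<gamma> e)"
      with nz have "1 - x / p \<noteq> 0" by fastforce
      moreover have "p \<noteq> 0" using p by auto
      then have "- 1 / p * (x - p) = 1 - x / p" by (simp add: diff_divide_distrib)
      ultimately show "exp (Ln (1 - x / p)) = - 1 / p * (x - p)" by simp
    qed
    then show ?thesis by (simp add: field_simps)
  qed
  then have "pot p = (\<Sum>e\<in>E. (?f (pathfinish (\<gamma> e)) - ?f (pathstart (\<gamma> e))) *s \<omega> e)"
    by (simp add: pot_def)
  then show ?thesis using sum_coboundary by simp
qed

end

section \<open>Arcs that are straight near their end points\<close>

lemma circle_point_on_ray:
  fixes d d' x :: complex
  assumes "norm d = 1" "norm d' = 1" "0 < \<sigma>" "0 < \<rho>"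
    and "x + of_real \<sigma> * d \<in> closed_segment x (x + of_real \<rho> * d')"
  shows "d = d'"
proof -
  obtain t where t: "0 \<le> t" "t \<le> 1" "x + of_real \<sigma> * d = (1 - t) *\<^sub>R x + t *\<^sub>R (x + of_real \<rho> * d')"
    using assms(5) unfolding in_segment by blast
  then have eq: "of_real \<sigma> * d = of_real (t * \<rho>) * d'"
    by (simp add: scaleR_conv_of_real algebra_simps)
  then have "norm (of_real \<sigma> * d) = norm (of_real (t * \<rho>) * d')" by simp
  then have "\<sigma> = t * \<rho>" using assms t by (simp add: norm_mult)
  moreover have "of_real \<sigma> \<noteq> (0::complex)" using assms(3) by simp
  ultimately show ?thesis using eq by (metis mult_left_cancel)
qed

text \<open>Relative to the direction \<open>d\<close>, a point of the chord has real part exactly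
  \<open>\<sigma> * cos \<epsilon>\<close> and norm at most \<open>\<sigma>\<close>. Hence its
  direction \<open>d'\<close> makes an angle of at most \<open>\<epsilon>\<close> with
  \<open>d\<close>.\<close>

lemma chord_point_on_ray:
  fixes d d' x y :: complex
  assumes d: "norm d = 1" "norm d' = 1" and \<sigma>: "0 < \<sigma>" and \<epsilon>: "0 < \<epsilon>" "\<epsilon> < pi / 2"
    and y: "y \<in> closed_segment (x + of_real \<sigma> * d * cis \<epsilon>) (x + of_real \<sigma> * d * cis (- \<epsilon>))"
    and y': "y \<in> closed_segment x (x + of_real \<rho> * d')" and \<rho>: "0 < \<rho>"
  shows "cos \<epsilon> \<le> Re (d' * cnj d)"
proof -
  have cpos: "cos \<epsilon> > 0" using \<epsilon> by (intro cos_gt_zero_pi) auto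
  obtain t where t: "0 \<le> t" "t \<le> 1" "y = (1 - t) *\<^sub>R x + t *\<^sub>R (x + of_real \<rho> * d')"
    using y' unfolding in_segment by blast
  obtain r where r: "0 \<le> r" "r \<le> 1" "y = (1 - r) *\<^sub>R (x + of_real \<sigma> * d * cis \<epsilon>) + r *\<^sub>R (x + of_real \<sigma> * d * cis (- \<epsilon>))"
    using y unfolding in_segment by blast
  define z where "z = (1 - r) *\<^sub>R cis \<epsilon> + r *\<^sub>R cis (- \<epsilon>)"
  have yz: "y - x = of_real \<sigma> * (d * z)"
    unfolding r(3) z_def by (simp add: scaleR_conv_of_real algebra_simps)
  have yt: "y - x = of_real (t * \<rho>) * d'"
    unfolding t(3) by (simp add: scaleR_conv_of_real algebra_simps)
  have Rez: "Re z = cos \<epsilon>" by (simp add: z_def algebra_simps)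
  have "norm z \<le> norm ((1 - r) *\<^sub>R cis \<epsilon>) + norm (r *\<^sub>R cis (- \<epsilon>))" unfolding z_def by (rule norm_triangle_ineq)
  then have nz: "norm z \<le> 1" using r by simp
  have dd: "d * cnj d = 1" using complex_norm_square[of d] d(1) by simp
  have eq: "of_real \<sigma> * z = of_real (t * \<rho>) * (d' * cnj d)"
  proof -
    have "of_real \<sigma> * (d * z) * cnj d = of_real (t * \<rho>) * d' * cnj d" by (simp only: yz[symmetric] yt[symmetric])
    moreover have "of_real \<sigma> * (d * z) * cnj d = of_real \<sigma> * z * (d * cnj d)" by (simp add: ac_simps)
    ultimately show ?thesis by (metis dd mult.assoc mult.right_neutral)
  qed
  have 1: "\<sigma> * cos \<epsilon> = (t * \<rho>) * Re (d' * cnj d)"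
  proof -
    have Rem: "Re (of_real r * w) = r * Re w" for r and w :: complex by simp
    show ?thesis using arg_cong[OF eq, of Re] unfolding Rem Rez .
  qed
  have "norm (of_real \<sigma> * z) = norm (of_real (t * \<rho>) * (d' * cnj d))" using eq by simp
  then have 2: "\<sigma> * norm z = t * \<rho>" using d \<sigma> t \<rho> by (simp add: norm_mult)
  have tp: "t * \<rho> > 0" 
  proof -
    have "\<sigma> * cos \<epsilon> > 0" using cpos \<sigma> by simp
    then have "t * \<rho> \<noteq> 0" using 1 by auto
    moreover have "t * \<rho> \<ge> 0" using t \<rho> by simp
    ultimately show ?thesis by (simp only: less_le) simp
  qed
  have "t * \<rho> \<le> \<sigma>" using 2 nz \<sigma> by (metis mult_left_le less_imp_le)
  then have "cos \<epsilon> * (t * \<rho>) \<le> cos \<epsilon> * \<sigma>" using cpos by simp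
  also have "\<dots> = Re (d' * cnj d) * (t * \<rho>)" using 1 by (simp add: mult.commute)
  finally show ?thesis using tp by (metis mult_le_cancel_right_pos)
qed

definition end_pt :: "('a \<Rightarrow> real \<Rightarrow> complex) \<Rightarrow> 'a \<times> bool \<Rightarrow> complex"
  where "end_pt \<gamma> n = (if snd n then pathstart (\<gamma> (fst n)) else pathfinish (\<gamma> (fst n)))"

text \<open>Curves that are straight of length \<open>\<rho>\<close> near their end points; \<open>u (e, True)\<close> and
  \<open>u (e, False)\<close> are the directions at the start and the finish of \<open>e\<close>, pointing away from the
  vertex.\<close>

locale radial_system = curve_system E \<gamma> \<omega>
  for E :: "'a set" and \<gamma> :: "'a \<Rightarrow> real \<Rightarrow> complex" and \<omega> :: "'a \<Rightarrow> complex ^ 'm" +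
  fixes V :: "complex set" and \<rho> :: real and u :: "'a \<times> bool \<Rightarrow> complex"
  assumes \<rho>: "0 < \<rho>"
    and arc_\<gamma>: "\<And>e. e \<in> E \<Longrightarrow> arc (\<gamma> e)"
    and ends_V: "\<And>e s. e \<in> E \<Longrightarrow> end_pt \<gamma> (e, s) \<in> V"
    and image_V: "\<And>e. e \<in> E \<Longrightarrow> path_image (\<gamma> e) \<inter> V \<subseteq> {pathstart (\<gamma> e), pathfinish (\<gamma> e)}"
    and images_V: "\<And>e f. e \<in> E \<Longrightarrow> f \<in> E \<Longrightarrow> e \<noteq> f \<Longrightarrow> path_image (\<gamma> e) \<inter> path_image (\<gamma> f) \<subseteq> V"
    and norm_u: "\<And>e s. e \<in> E \<Longrightarrow> norm (u (e, s)) = 1"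
    and u_inj: "\<And>n n'. fst n \<in> E \<Longrightarrow> fst n' \<in> E \<Longrightarrow> n \<noteq> n' \<Longrightarrow> end_pt \<gamma> n = end_pt \<gamma> n' \<Longrightarrow> u n \<noteq> u n'"
    and away: "\<And>e x. e \<in> E \<Longrightarrow> x \<in> V \<Longrightarrow> x \<noteq> pathstart (\<gamma> e) \<Longrightarrow> x \<noteq> pathfinish (\<gamma> e) \<Longrightarrow> path_image (\<gamma> e) \<inter> ball x \<rho> = {}"
    and germ_start: "\<And>e. e \<in> E \<Longrightarrow> \<exists>g. path g \<and> pathstart g = pathstart (\<gamma> e) + of_real \<rho> * u (e, True)
      \<and> pathfinish g = pathfinish (\<gamma> e) \<and> path_image g \<inter> ball (pathstart (\<gamma> e)) \<rho> = {}
      \<and> path_image (\<gamma> e) = closed_segment (pathstart (\<gamma> e)) (pathstart g) \<union> path_image g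
      \<and> (\<forall>p. p \<notin> path_image (\<gamma> e) \<longrightarrow> winding_number (\<gamma> e) p = winding_number (linepath (pathstart (\<gamma> e)) (pathstart g)) p + winding_number g p)"
    and germ_finish: "\<And>e. e \<in> E \<Longrightarrow> \<exists>g. path g \<and> pathfinish g = pathfinish (\<gamma> e) + of_real \<rho> * u (e, False)
      \<and> pathstart g = pathstart (\<gamma> e) \<and> path_image g \<inter> ball (pathfinish (\<gamma> e)) \<rho> = {}
      \<and> path_image (\<gamma> e) = closed_segment (pathfinish (\<gamma> e)) (pathfinish g) \<union> path_image g
      \<and> (\<forall>p. p \<notin> path_image (\<gamma> e) \<longrightarrow> winding_number (\<gamma> e) p = winding_number g p - winding_number (linepath (pathfinish (\<gamma> e)) (pathfinish g)) p)"
begin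

lemma germ:
  assumes "e \<in> E"
  obtains g where "path g" "path_image g \<inter> ball (end_pt \<gamma> (e, s)) \<rho> = {}"
    "path_image (\<gamma> e) = closed_segment (end_pt \<gamma> (e, s)) (end_pt \<gamma> (e, s) + of_real \<rho> * u (e, s)) \<union> path_image g"
  using germ_start[OF assms] germ_finish[OF assms] by (cases s) (auto simp: end_pt_def)

lemma near_vertex:
  assumes "e \<in> E" "x \<in> V" "y \<in> path_image (\<gamma> e)" "dist x y < \<rho>"
  shows "\<exists>s. end_pt \<gamma> (e, s) = x \<and> y \<in> closed_segment x (x + of_real \<rho> * u (e, s))"
proof -
  obtain s where s: "end_pt \<gamma> (e, s) = x"
  proof (cases "x = pathstart (\<gamma> e)")
    case True then show ?thesis using that[of True] by (simp add: end_pt_def)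
  next
    case False
    then have "x = pathfinish (\<gamma> e)" using away[OF assms(1,2)] assms(3,4) by force
    then show ?thesis using that[of False] by (simp add: end_pt_def)
  qed
  obtain g where "path_image g \<inter> ball x \<rho> = {}"
    "path_image (\<gamma> e) = closed_segment x (x + of_real \<rho> * u (e, s)) \<union> path_image g"
    using germ[OF assms(1), of s] unfolding s by blast
  then show ?thesis using s assms(3,4) by auto
qed

text \<open>At each vertex the finitely many directions are distinct unit vectors, so their scalar
  products stay below some \<open>c < 1\<close>. An angle with cosine \<open>(1 + c) / 2\<close>
  separates them.\<close>

lemma ex_eps: "\<exists>\<epsilon>. 0 < \<epsilon> \<and> \<epsilon> < pi / 2 \<and> (\<forall>n n'. fst n \<in> E \<and> fst n' \<in> E \<and> n \<noteq> n' \<and> end_pt \<gamma> n = end_pt \<gamma> n'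
    \<longrightarrow> Re (u n' * cnj (u n)) < cos \<epsilon>)"
proof -
  let ?N = "{(n, n') | n n'. n \<in> E \<times> UNIV \<and> n' \<in> E \<times> UNIV \<and> n \<noteq> n' \<and> end_pt \<gamma> n = end_pt \<gamma> n'}"
  have fN: "finite ?N"
    by (rule finite_subset[of _ "(E \<times> UNIV) \<times> (E \<times> UNIV)"]) (auto simp: fin_E)
  \<comment> \<open>The inserted \<open>0\<close> makes the maximum meaningful when there is no
    pair, and keeps the cosine at least \<open>1 / 2\<close>, so that the angle is below
    \<open>pi / 2\<close>.\<close>
  define c where "c = Max (insert 0 ((\<lambda>(n, n'). Re (u n' * cnj (u n))) ` ?N))"
  have c1: "Re (u n' * cnj (u n)) < 1" if "(n, n') \<in> ?N" for n n'
  proof -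
    have nn: "fst n \<in> E" "fst n' \<in> E" "n \<noteq> n'" "end_pt \<gamma> n = end_pt \<gamma> n'" using that by auto
    have nu: "norm (u n) = 1" "norm (u n') = 1"
      using norm_u[OF nn(1), of "snd n"] norm_u[OF nn(2), of "snd n'"] by auto
    have "(norm (u n' - u n))\<^sup>2 > 0" using u_inj[OF nn] by simp
    moreover have "(norm (u n' - u n))\<^sup>2 = (norm (u n'))\<^sup>2 + (norm (u n))\<^sup>2 - 2 * Re (u n' * cnj (u n))"
      unfolding cmod_power2 by (simp add: power2_eq_square algebra_simps)
    ultimately show ?thesis using nu by simp
  qed
  have fin: "finite (insert 0 ((\<lambda>(n, n'). Re (u n' * cnj (u n))) ` ?N))" using fN by simp
  have c0: "0 \<le> c" unfolding c_def by (rule Max_ge[OF fin]) simp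
  have "c \<in> insert 0 ((\<lambda>(n, n'). Re (u n' * cnj (u n))) ` ?N)"
    unfolding c_def by (rule Max_in[OF fin]) simp
  then have c: "c < 1"
  proof
    assume "c \<in> (\<lambda>(n, n'). Re (u n' * cnj (u n))) ` ?N"
    then obtain m where m: "m \<in> ?N" "c = (\<lambda>(n, n'). Re (u n' * cnj (u n))) m" by blast
    obtain n n' where mn: "m = (n, n')" by (cases m)
    have "Re (u n' * cnj (u n)) < 1" by (rule c1) (use m(1) mn in simp)
    then show ?thesis using m(2) unfolding mn case_prod_conv by (simp only:)
  qed simp
  have le: "Re (u n' * cnj (u n)) \<le> c" if "(n, n') \<in> ?N" for n n'
  proof -
    have "(\<lambda>(n, n'). Re (u n' * cnj (u n))) (n, n') \<in> (\<lambda>(n, n'). Re (u n' * cnj (u n))) ` ?N"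
      using that by (rule imageI)
    then show ?thesis unfolding c_def case_prod_conv by (intro Max_ge[OF fin] insertI2)
  qed
  define \<epsilon> where "\<epsilon> = arccos ((1 + c) / 2)"
  have ce: "cos \<epsilon> = (1 + c) / 2" unfolding \<epsilon>_def using c0 c by (intro cos_arccos) auto
  have lt: "Re (u n' * cnj (u n)) < (1 + c) / 2" if "(n, n') \<in> ?N" for n n'
    by (rule le_less_trans[OF le[OF that]]) (use c in simp)
  show ?thesis
  proof (intro exI conjI allI impI)
    show "0 < \<epsilon>" unfolding \<epsilon>_def using c0 c arccos_lt_bounded[of "(1 + c)/2"] by auto
    show "\<epsilon> < pi / 2" unfolding \<epsilon>_def using arccos_less_arccos[of 0 "(1 + c) / 2"] c0 c by simp
    fix n n' assume A: "fst n \<in> E \<and> fst n' \<in> E \<and> n \<noteq> n' \<and> end_pt \<gamma> n = end_pt \<gamma> n'"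
    have "(n, n') \<in> ?N" using A by (cases n; cases n') simp
    from lt[OF this] show "Re (u n' * cnj (u n)) < cos \<epsilon>" unfolding ce .
  qed
qed

definition eps :: real where
  "eps = (SOME \<epsilon>. 0 < \<epsilon> \<and> \<epsilon> < pi / 2 \<and> (\<forall>n n'. fst n \<in> E \<and> fst n' \<in> E \<and> n \<noteq> n' \<and> end_pt \<gamma> n = end_pt \<gamma> n'
    \<longrightarrow> Re (u n' * cnj (u n)) < cos \<epsilon>))"

lemma eps: "0 < eps" "eps < pi / 2"
  and eps_sep: "fst n \<in> E \<Longrightarrow> fst n' \<in> E \<Longrightarrow> n \<noteq> n' \<Longrightarrow> end_pt \<gamma> n = end_pt \<gamma> n' \<Longrightarrow> Re (u n' * cnj (u n)) < cos eps"
  using someI_ex[OF ex_eps, folded eps_def] by blast+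

text \<open>\<open>True\<close> is the counterclockwise neighbour seen from the vertex: the left of
  the edge at its start, but the right of it at its finish. Radius \<open>\<rho> / 2\<close> keeps
  the chord between the two neighbours in the ball where all edges are straight.\<close>

definition side :: "'a \<times> bool \<Rightarrow> bool \<Rightarrow> complex"
  where "side n b = end_pt \<gamma> n + of_real (\<rho> / 2) * u n * cis (if b then eps else - eps)"

abbreviation chord :: "'a \<times> bool \<Rightarrow> complex set"
  where "chord n \<equiv> closed_segment (side n True) (side n False)"

lemma chord_ball: assumes "fst n \<in> E" shows "chord n \<subseteq> ball (end_pt \<gamma> n) \<rho>"
proof (rule closed_segment_subset)
  have "norm (u n) = 1" using norm_u[OF assms, of "snd n"] by simp
  then show "side n True \<in> ball (end_pt \<gamma> n) \<rho>" "side n False \<in> ball (end_pt \<gamma> n) \<rho>"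
    using \<rho> by (auto simp: side_def dist_norm norm_mult)
qed simp

lemma chord_path_image:
  assumes n: "fst n \<in> E" and f: "f \<in> E" "f \<noteq> fst n"
  shows "chord n \<inter> path_image (\<gamma> f) = {}"
proof (rule ccontr)
  assume "chord n \<inter> path_image (\<gamma> f) \<noteq> {}"
  then obtain y where y: "y \<in> chord n" "y \<in> path_image (\<gamma> f)" by blast
  have x: "end_pt \<gamma> n \<in> V" using ends_V[OF n, of "snd n"] by simp
  have "dist (end_pt \<gamma> n) y < \<rho>" using chord_ball[OF n] y(1) by auto
  from near_vertex[OF f(1) x y(2) this] obtain s where
    s: "end_pt \<gamma> (f, s) = end_pt \<gamma> n" "y \<in> closed_segment (end_pt \<gamma> n) (end_pt \<gamma> n + of_real \<rho> * u (f, s))" by blast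
  have "cos eps \<le> Re (u (f, s) * cnj (u n))"
    using chord_point_on_ray[OF _ norm_u[OF f(1)] _ eps, of "u n" "\<rho> / 2" y "end_pt \<gamma> n" \<rho> s]
      norm_u[OF n, of "snd n"] y(1) s(2) \<rho> by (simp add: side_def del: times_complex.sel)
  moreover have "Re (u (f, s) * cnj (u n)) < cos eps"
    using eps_sep[OF n, of "(f, s)"] f s(1) by fastforce
  ultimately show False by simp
qed

lemma side_notin: assumes e: "e \<in> E" shows "side (e, s) b \<notin> path_image (\<gamma> e)"
proof
  assume a: "side (e, s) b \<in> path_image (\<gamma> e)"
  let ?x = "end_pt \<gamma> (e, s)"
  have b: "side (e, s) b \<in> ball ?x \<rho>" using chord_ball[of "(e, s)"] e by (cases b) auto
  obtain g where "path_image g \<inter> ball ?x \<rho> = {}"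
    "path_image (\<gamma> e) = closed_segment ?x (?x + of_real \<rho> * u (e, s)) \<union> path_image g"
    using germ[OF e, of s] by blast
  then have "?x + of_real (\<rho>/2) * (u (e, s) * cis (if b then eps else - eps)) \<in> closed_segment ?x (?x + of_real \<rho> * u (e, s))"
    using a b by (auto simp: side_def mult.assoc)
  from circle_point_on_ray[OF _ _ _ _ this] have "u (e, s) * cis (if b then eps else - eps) = u (e, s)"
    using \<rho> norm_u[OF e] by (simp add: norm_mult)
  then have "cis (if b then eps else - eps) = 1" using norm_u[OF e, of s] by (metis mult_cancel_left1 norm_zero zero_neq_one mult_cancel_left2)
  then have "sin eps = 0" by (auto simp: complex_eq_iff split: if_splits)
  then show False using eps sin_gt_zero[of eps] by simp
qed

text \<open>Inside the ball the edge is a radial segment, and the chord between the two sides meets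
  nothing else of it. So the jump is that of a segment; at the finish the edge runs against the
  radial direction, hence the sign.\<close>

lemma winding_number_jump:
  assumes e: "e \<in> E"
  shows "winding_number (\<gamma> e) (side (e, s) True) - winding_number (\<gamma> e) (side (e, s) False)
    = (if s then 1 else -1) + (chord_log (side (e, s) True) (side (e, s) False) (pathfinish (\<gamma> e))
        - chord_log (side (e, s) True) (side (e, s) False) (pathstart (\<gamma> e)))"
proof -
  let ?p = "side (e, s) True" and ?q = "side (e, s) False" and ?x = "end_pt \<gamma> (e, s)"
  let ?y = "?x + of_real \<rho> * u (e, s)"
  have cpos: "cos eps > 0" using eps by (intro cos_gt_zero_pi) auto
  have spos: "sin eps > 0" using eps by (intro sin_gt_zero) auto
  have c1: "cos eps \<le> 1" by simp
  have L: "winding_number (linepath ?x ?y) ?p - winding_number (linepath ?x ?y) ?q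
      = 1 + (chord_log ?p ?q ?y - chord_log ?p ?q ?x)"
  proof (rule winding_number_diff_linepath)
    \<comment> \<open>The chord cuts the radial segment of length \<open>\<rho>\<close> at distance
      \<open>\<rho> * cos eps / 2\<close> from the vertex and has half-length
      \<open>\<rho> * sin eps / 2\<close>.\<close>
    show "0 < sin eps / 2" using spos by simp
    show "0 < cos eps / 2" "cos eps / 2 < 1" using cpos c1 by linarith+
    show "?x \<noteq> ?y" using norm_u[OF e, of s] \<rho> by auto
    show "?p = (?x + of_real (cos eps / 2) * (?y - ?x)) + \<i> * of_real (sin eps / 2) * (?y - ?x)"
      by (simp add: side_def cis_conv_exp exp_Euler cos_of_real sin_of_real algebra_simps)
    show "?q = (?x + of_real (cos eps / 2) * (?y - ?x)) - \<i> * of_real (sin eps / 2) * (?y - ?x)"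
      by (simp add: side_def cis_conv_exp exp_Euler exp_minus_Euler cos_of_real sin_of_real algebra_simps)
  qed simp
  have np: "?p \<notin> path_image (\<gamma> e)" "?q \<notin> path_image (\<gamma> e)" using side_notin[OF e] by auto
  have cb: "chord (e, s) \<subseteq> ball ?x \<rho>" using chord_ball[of "(e, s)"] e by simp
  show ?thesis
  proof (cases s)
    case True
    obtain g where g: "path g" "pathstart g = ?y" "pathfinish g = pathfinish (\<gamma> e)" "path_image g \<inter> ball ?x \<rho> = {}"
      "\<And>p. p \<notin> path_image (\<gamma> e) \<Longrightarrow> winding_number (\<gamma> e) p = winding_number (linepath ?x ?y) p + winding_number g p"
      using germ_start[OF e] True unfolding end_pt_def by auto
    have "winding_number g ?p - winding_number g ?q = chord_log ?p ?q (pathfinish (\<gamma> e)) - chord_log ?p ?q ?y"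
      using winding_number_diff_chord[OF g(1), of ?p ?q] g(2,3,4) cb by fastforce
    moreover have "winding_number (\<gamma> e) ?p - winding_number (\<gamma> e) ?q
      = (winding_number (linepath ?x ?y) ?p - winding_number (linepath ?x ?y) ?q) + (winding_number g ?p - winding_number g ?q)"
      unfolding g(5)[OF np(1)] g(5)[OF np(2)] by simp
    ultimately show ?thesis unfolding L using True by (simp add: end_pt_def)
  next
    case False
    obtain g where g: "path g" "pathfinish g = ?y" "pathstart g = pathstart (\<gamma> e)" "path_image g \<inter> ball ?x \<rho> = {}"
      "\<And>p. p \<notin> path_image (\<gamma> e) \<Longrightarrow> winding_number (\<gamma> e) p = winding_number g p - winding_number (linepath ?x ?y) p"
      using germ_finish[OF e] False unfolding end_pt_def by auto
    have "winding_number g ?p - winding_number g ?q = chord_log ?p ?q ?y - chord_log ?p ?q (pathstart (\<gamma> e))"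
      using winding_number_diff_chord[OF g(1), of ?p ?q] g(2,3,4) cb by fastforce
    moreover have "winding_number (\<gamma> e) ?p - winding_number (\<gamma> e) ?q
      = (winding_number g ?p - winding_number g ?q) - (winding_number (linepath ?x ?y) ?p - winding_number (linepath ?x ?y) ?q)"
      unfolding g(5)[OF np(1)] g(5)[OF np(2)] by simp
    ultimately show ?thesis unfolding L using False by (simp add: end_pt_def)
  qed
qed

lemma pot_jump:
  assumes e: "e \<in> E"
  shows "pot (side (e, s) True) - pot (side (e, s) False) = (if s then \<omega> e else - \<omega> e)"
proof -
  let ?p = "side (e, s) True" and ?q = "side (e, s) False"
  have "pot ?p - pot ?q = (\<Sum>f\<in>E. (if f = e then (if s then 1 else -1) else 0) *s \<omega> f)"
  proof (rule pot_diff[of ?p ?q _ "chord_log ?p ?q"])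
    fix f assume f: "f \<in> E"
    show "winding_number (\<gamma> f) ?p - winding_number (\<gamma> f) ?q = (if f = e then (if s then 1 else -1) else 0)
      + (chord_log ?p ?q (pathfinish (\<gamma> f)) - chord_log ?p ?q (pathstart (\<gamma> f)))"
      using winding_number_jump[OF e, of s] winding_number_diff_chord[OF path_\<gamma>[OF f], of ?p ?q] chord_path_image[of "(e, s)" f] e f
      by (cases "f = e") auto
  qed
  also have "\<dots> = (\<Sum>f\<in>E. if f = e then (if s then \<omega> e else - \<omega> e) else 0)"
    by (intro sum.cong) auto
  finally show ?thesis using e fin_E by simp
qed

end

section \<open>Turning once around a vertex\<close>

lemma cis_eq_int: "cis x = cis y \<Longrightarrow> \<exists>n::int. x = y + 2 * pi * of_int n"
  using sin_cos_eq_iff[of x y] by (simp add: complex_eq_iff)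

lemma finite_cis_eq: "finite {\<theta>. cis \<theta> = d \<and> \<theta> \<in> {a..b}}"
proof (cases "\<exists>t. cis t = d")
  case True
  then obtain t where t: "cis t = d" by blast
  have "{\<theta>. cis \<theta> = d \<and> \<theta> \<in> {a..b}} \<subseteq> (\<lambda>n::int. t + 2 * pi * of_int n) ` {\<lfloor>(a - t) / (2 * pi)\<rfloor>..\<lceil>(b - t) / (2 * pi)\<rceil>}"
  proof
    fix \<theta> assume \<theta>: "\<theta> \<in> {\<theta>. cis \<theta> = d \<and> \<theta> \<in> {a..b}}"
    then obtain n :: int where n: "\<theta> = t + 2 * pi * of_int n" using cis_eq_int[of \<theta> t] t by auto
    then have "of_int n = (\<theta> - t) / (2 * pi)" by simp
    then have "(a - t) / (2 * pi) \<le> of_int n" "of_int n \<le> (b - t) / (2 * pi)"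
      using \<theta> by (auto intro!: divide_right_mono)
    then have "n \<in> {\<lfloor>(a - t) / (2 * pi)\<rfloor>..\<lceil>(b - t) / (2 * pi)\<rceil>}" by (auto simp: floor_le_iff le_ceiling_iff)
    then show "\<theta> \<in> (\<lambda>n::int. t + 2 * pi * of_int n) ` {\<lfloor>(a - t) / (2 * pi)\<rfloor>..\<lceil>(b - t) / (2 * pi)\<rceil>}" using n by blast
  qed
  then show ?thesis by (rule finite_subset) simp
next
  case False
  then show ?thesis by (auto intro: finite_subset[of _ "{}"])
qed

lemma ex_angle_in_turn:
  assumes "norm d = 1" obtains \<theta> where "cis \<theta> = d" "a \<le> \<theta>" "\<theta> \<le> a + 2 * pi"
proof -
  have d: "cis (Arg d) = d" using assms by (metis cis_Arg norm_zero sgn_eq zero_neq_one div_by_1 of_real_1)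
  define k where "k = \<lceil>(a - Arg d) / (2 * pi)\<rceil>"
  have "(a - Arg d) / (2 * pi) \<le> of_int k" "of_int k < (a - Arg d) / (2 * pi) + 1"
    unfolding k_def by linarith+
  then have "a - Arg d \<le> of_int k * (2 * pi)" "of_int k * (2 * pi) < a - Arg d + 2 * pi"
    by (auto simp: field_simps)
  moreover have "cis (Arg d + of_int k * (2 * pi)) = d"
    using d by (simp add: cis_mult[symmetric] mult.commute[of _ "2 * pi"])
  ultimately show ?thesis using that[of "Arg d + of_int k * (2 * pi)"] by auto
qed

text \<open>A full turn that starts off \<open>D\<close> meets each direction in \<open>D\<close>
  once; a start in \<open>D\<close> would be counted twice.\<close>

lemma bij_betw_cis:
  assumes D: "\<And>d. d \<in> D \<Longrightarrow> norm d = 1" and a: "cis a \<notin> D"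
  shows "bij_betw cis ({\<theta>. cis \<theta> \<in> D} \<inter> {a..a + 2 * pi}) D"
proof (rule bij_betwI')
  fix x y assume x: "x \<in> {\<theta>. cis \<theta> \<in> D} \<inter> {a..a + 2 * pi}" and y: "y \<in> {\<theta>. cis \<theta> \<in> D} \<inter> {a..a + 2 * pi}"
  have a2: "cis (a + 2 * pi) \<notin> D" using a by (simp add: cis_mult[symmetric])
  have ne: "a < x" "x < a + 2 * pi" "a < y" "y < a + 2 * pi"
    using x y a a2 by (auto simp: less_le)
  show "cis x = cis y \<longleftrightarrow> x = y"
  proof
    assume "cis x = cis y"
    then obtain n :: int where n: "x = y + 2 * pi * of_int n" using cis_eq_int by blast
    then have "2 * pi * of_int n < 2 * pi * 1" "2 * pi * of_int n > 2 * pi * (-1)" using ne by linarith+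
    then have "(of_int n :: real) < 1" "(of_int n :: real) > -1" by (simp_all only: mult_less_cancel_left_pos pi_gt_zero mult_pos_pos zero_less_numeral)
    then have "n = 0" by linarith
    then show "x = y" using n by simp
  qed simp
next
  fix d assume d: "d \<in> D"
  obtain \<theta> where "cis \<theta> = d" "a \<le> \<theta>" "\<theta> \<le> a + 2 * pi" using ex_angle_in_turn[OF D[OF d]] by blast
  then show "\<exists>x\<in>{\<theta>. cis \<theta> \<in> D} \<inter> {a..a + 2 * pi}. d = cis x" using d by auto
qed auto

context radial_system begin

definition ends_at :: "complex \<Rightarrow> ('a \<times> bool) set"
  where "ends_at x = {n. fst n \<in> E \<and> end_pt \<gamma> n = x}"

lemma finite_ends_at [simp]: "finite (ends_at x)"
  by (rule finite_subset[of _ "E \<times> UNIV"]) (auto simp: ends_at_def fin_E)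

abbreviation dirs :: "complex \<Rightarrow> complex set" where "dirs x \<equiv> u ` ends_at x"

lemma norm_dirs: "d \<in> dirs x \<Longrightarrow> norm d = 1"
  by (auto simp: ends_at_def norm_u)

lemma inj_on_dirs: "inj_on u (ends_at x)"
  by (rule inj_onI) (metis (mono_tags, lifting) ends_at_def mem_Collect_eq u_inj)

lemma circle_avoid:
  assumes x: "x \<in> V" and \<theta>: "cis \<theta> \<notin> dirs x" and e: "e \<in> E"
  shows "x + of_real (\<rho> / 2) * cis \<theta> \<notin> path_image (\<gamma> e)"
proof
  assume y: "x + of_real (\<rho> / 2) * cis \<theta> \<in> path_image (\<gamma> e)"
  have "dist x (x + of_real (\<rho> / 2) * cis \<theta>) < \<rho>" using \<rho> by (simp add: dist_norm norm_mult)
  from near_vertex[OF e x y this] obtain s where s: "end_pt \<gamma> (e, s) = x"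
    "x + of_real (\<rho> / 2) * cis \<theta> \<in> closed_segment x (x + of_real \<rho> * u (e, s))" by blast
  have "cis \<theta> = u (e, s)"
    using circle_point_on_ray[OF _ norm_u[OF e] _ \<rho> s(2)] \<rho> by simp
  then show False using \<theta> s(1) e by (auto simp: ends_at_def)
qed

lemma pot_circle_const:
  assumes x: "x \<in> V" and cd: "c \<le> d" "{c..d} \<inter> {\<theta>. cis \<theta> \<in> dirs x} = {}"
  shows "pot (x + of_real (\<rho> / 2) * cis c) = pot (x + of_real (\<rho> / 2) * cis d)"
proof (rule pot_connected)
  show "connected ((\<lambda>\<theta>. x + of_real (\<rho> / 2) * cis \<theta>) ` {c..d})"
    by (intro connected_continuous_image continuous_intros) simp
  fix e assume "e \<in> E"
  then show "(\<lambda>\<theta>. x + of_real (\<rho> / 2) * cis \<theta>) ` {c..d} \<inter> path_image (\<gamma> e) = {}"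
    using circle_avoid[OF x] cd(2) by blast
qed (use cd in auto)

text \<open>\<open>eps\<close> is below the angle between any two directions at a vertex, and below
  a full turn, so that a direction does not recur within it.\<close>

lemma dirs_isolated:
  assumes "cis \<alpha> \<in> dirs x" "s \<noteq> 0" "\<bar>s\<bar> \<le> eps" shows "cis (\<alpha> + s) \<notin> dirs x"
proof
  assume "cis (\<alpha> + s) \<in> dirs x"
  then obtain n' where n': "n' \<in> ends_at x" "u n' = cis (\<alpha> + s)" by auto
  obtain n where n: "n \<in> ends_at x" "u n = cis \<alpha>" using assms(1) by auto
  have "n \<noteq> n'"
  proof
    assume "n = n'"
    then have "cis (\<alpha> + s) = cis \<alpha>" using n n' by simp
    then obtain k :: int where k: "\<alpha> + s = \<alpha> + 2 * pi * of_int k" using cis_eq_int by blast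
    then have "k \<noteq> 0" using assms(2) by auto
    then have "1 \<le> \<bar>of_int k :: real\<bar>" by linarith
    then have "2 * pi * 1 \<le> 2 * pi * \<bar>of_int k\<bar>" by (intro mult_left_mono) auto
    moreover have "\<bar>s\<bar> = 2 * pi * \<bar>of_int k\<bar>" using k by (simp add: abs_mult)
    ultimately show False using assms(3) eps pi_gt_zero by linarith
  qed
  then have "Re (u n' * cnj (u n)) < cos eps" using eps_sep[of n n'] n n' by (auto simp: ends_at_def)
  moreover have "u n' * cnj (u n) = cis s" unfolding n n' by (simp add: cis_cnj cis_mult)
  moreover have "cos eps \<le> cos \<bar>s\<bar>" using assms(3) eps by (intro cos_monotone_0_pi_le) auto
  ultimately show False by simp
qed

text \<open>An arbitrary \<open>G\<close> of the potential is still a step function on the circle.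
  The generality matters: \<open>G\<close> will be a projective map, the indicator of a predicate,
  and a cut-off to a line.\<close>

lemma circle_step_sum:
  fixes G :: "complex ^ 'm \<Rightarrow> 'v::ab_group_add"
  assumes x: "x \<in> V" and a: "cis a \<notin> dirs x" and b: "cis b \<notin> dirs x" "a \<le> b"
  shows "G (pot (x + of_real (\<rho> / 2) * cis b)) - G (pot (x + of_real (\<rho> / 2) * cis a))
    = (\<Sum>\<alpha>\<in>{\<theta>. cis \<theta> \<in> dirs x} \<inter> {a..b}. G (pot (x + of_real (\<rho> / 2) * cis (\<alpha> + eps))) - G (pot (x + of_real (\<rho> / 2) * cis (\<alpha> - eps))))"
proof (rule step_sum)
  have "{\<theta>. cis \<theta> \<in> dirs x} \<inter> {a..b} = (\<Union>d\<in>dirs x. {\<theta>. cis \<theta> = d \<and> \<theta> \<in> {a..b}})" by auto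
  then show "finite ({\<theta>. cis \<theta> \<in> dirs x} \<inter> {a..b})" using finite_cis_eq by auto
  show "\<And>c d. c \<le> d \<Longrightarrow> {c..d} \<inter> {\<theta>. cis \<theta> \<in> dirs x} = {} \<Longrightarrow>
      G (pot (x + of_real (\<rho> / 2) * cis c)) = G (pot (x + of_real (\<rho> / 2) * cis d))"
    using pot_circle_const[OF x] by metis
qed (use a b eps dirs_isolated in auto)

lemma side_angle:
  assumes "cis \<alpha> = u n" "end_pt \<gamma> n = x"
  shows "x + of_real (\<rho> / 2) * cis (\<alpha> + eps) = side n True" "x + of_real (\<rho> / 2) * cis (\<alpha> - eps) = side n False"
proof -
  have "cis (\<alpha> + eps) = u n * cis eps" by (simp only: cis_mult[symmetric] assms(1))
  moreover have "cis (\<alpha> + - eps) = u n * cis (- eps)" by (simp only: cis_mult[symmetric] assms(1))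
  then have "cis (\<alpha> - eps) = u n * cis (- eps)" by simp
  ultimately show "x + of_real (\<rho> / 2) * cis (\<alpha> + eps) = side n True" "x + of_real (\<rho> / 2) * cis (\<alpha> - eps) = side n False"
    using assms(2) by (simp_all add: side_def mult.assoc)
qed

lemma ex_free_angle: "\<exists>a. cis a \<notin> dirs x"
proof -
  have "inj_on cis {0..1::real}"
  proof (rule inj_onI)
    fix s t :: real assume st: "s \<in> {0..1}" "t \<in> {0..1}" "cis s = cis t"
    then obtain k :: int where k: "s = t + 2 * pi * of_int k" using cis_eq_int by blast
    have "k = 0"
    proof (rule ccontr)
      assume "k \<noteq> 0"
      then have "1 \<le> \<bar>of_int k :: real\<bar>" by linarith
      then have "2 * pi * 1 \<le> 2 * pi * \<bar>of_int k\<bar>" by (intro mult_left_mono) auto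
      moreover have "\<bar>s - t\<bar> = 2 * pi * \<bar>of_int k\<bar>" using k by (simp add: abs_mult)
      moreover have "\<bar>s - t\<bar> \<le> 1" using st by auto
      ultimately show False using pi_gt3 by linarith
    qed
    then show "s = t" using k by simp
  qed
  then have "infinite (cis ` {0..1::real})" using infinite_Icc[of "0::real" 1] by (simp add: finite_image_iff)
  moreover have "finite (dirs x)" by simp
  ultimately have "\<not> cis ` {0..1::real} \<subseteq> dirs x" by (metis finite_subset)
  then show ?thesis by (auto simp: subset_iff)
qed

text \<open>One full turn returns to the initial value, and each half-edge contributes its jump
  once.\<close>

lemma vertex_sum:
  fixes G :: "complex ^ 'm \<Rightarrow> 'v::ab_group_add"
  assumes x: "x \<in> V"
  shows "(\<Sum>n\<in>ends_at x. G (pot (side n True)) - G (pot (side n False))) = 0"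
proof -
  obtain a where a: "cis a \<notin> dirs x" using ex_free_angle by blast
  let ?A = "{\<theta>. cis \<theta> \<in> dirs x} \<inter> {a..a + 2 * pi}"
  let ?H = "\<lambda>d. G (pot (x + of_real (\<rho> / 2) * (d * cis eps))) - G (pot (x + of_real (\<rho> / 2) * (d * cis (- eps))))"
  have "cis (a + 2 * pi) = cis a" by (simp add: complex_eq_iff)
  then have "0 = (\<Sum>\<alpha>\<in>?A. ?H (cis \<alpha>))"
    using circle_step_sum[OF x a, of "a + 2 * pi" G] a by (simp add: cis_mult diff_conv_add_uminus del: add_uminus_conv_diff)
  also have "\<dots> = (\<Sum>d\<in>dirs x. ?H d)"
    by (rule sum.reindex_bij_betw[OF bij_betw_cis[OF norm_dirs a]])
  also have "\<dots> = (\<Sum>n\<in>ends_at x. ?H (u n))"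
    by (simp add: sum.reindex[OF inj_on_dirs])
  also have "\<dots> = (\<Sum>n\<in>ends_at x. G (pot (side n True)) - G (pot (side n False)))"
    by (rule sum.cong) (auto simp: side_def ends_at_def mult.assoc)
  finally show ?thesis by simp
qed

text \<open>The \<open>0\<close>-\<open>1\<close> indicator of a predicate that no half-edge at
  \<open>x\<close> separates is a step function without jumps.\<close>

lemma vertex_const:
  fixes Q :: "complex ^ 'm \<Rightarrow> bool"
  assumes x: "x \<in> V" and a: "cis a \<notin> dirs x" and n: "n \<in> ends_at x"
    and Q: "\<And>n. n \<in> ends_at x \<Longrightarrow> Q (pot (side n True)) = Q (pot (side n False))"
  shows "Q (pot (side n True)) = Q (pot (x + of_real (\<rho> / 2) * cis a))"
proof -
  let ?G = "\<lambda>y. if Q y then 1 else (0::int)"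
  have "norm (u n) = 1" using norm_dirs n by blast
  then obtain \<theta> where \<theta>: "cis \<theta> = u n" "a \<le> \<theta>" using ex_angle_in_turn[of "u n" a] by blast
  have "cis (\<theta> + eps) \<notin> dirs x" using dirs_isolated[of \<theta> x eps] \<theta> n eps by auto
  then have "?G (pot (x + of_real (\<rho> / 2) * cis (\<theta> + eps))) - ?G (pot (x + of_real (\<rho> / 2) * cis a))
    = (\<Sum>\<alpha>\<in>{\<theta>. cis \<theta> \<in> dirs x} \<inter> {a..\<theta> + eps}. ?G (pot (x + of_real (\<rho> / 2) * cis (\<alpha> + eps))) - ?G (pot (x + of_real (\<rho> / 2) * cis (\<alpha> - eps))))"
    by (rule circle_step_sum[OF x a, of _ ?G]) (use \<open>cis (\<theta> + eps) \<notin> dirs x\<close> \<theta>(2) eps in auto)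
  also have "\<dots> = 0"
  proof (rule sum.neutral, rule ballI)
    fix \<alpha> assume "\<alpha> \<in> {\<theta>. cis \<theta> \<in> dirs x} \<inter> {a..\<theta> + eps}"
    then obtain n' where n': "n' \<in> ends_at x" "cis \<alpha> = u n'" by auto
    then have "end_pt \<gamma> n' = x" by (simp add: ends_at_def)
    from side_angle[OF n'(2) this] show "?G (pot (x + of_real (\<rho> / 2) * cis (\<alpha> + eps))) - ?G (pot (x + of_real (\<rho> / 2) * cis (\<alpha> - eps))) = 0"
      using Q[OF n'(1)] by simp
  qed
  finally have "?G (pot (x + of_real (\<rho> / 2) * cis (\<theta> + eps))) = ?G (pot (x + of_real (\<rho> / 2) * cis a))" by simp
  moreover have "x + of_real (\<rho> / 2) * cis (\<theta> + eps) = side n True"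
    using side_angle(1)[OF \<theta>(1)] n by (simp add: ends_at_def)
  ultimately show ?thesis by (simp split: if_splits)
qed

text \<open>The midpoint of the chord lies on the edge. Hence the open arc and the chords at both of
  its ends form a connected set.\<close>

lemma chord_meets:
  assumes e: "e \<in> E"
  shows "chord (e, s) \<inter> (path_image (\<gamma> e) - {pathstart (\<gamma> e), pathfinish (\<gamma> e)}) \<noteq> {}"
proof -
  let ?x = "end_pt \<gamma> (e, s)" and ?m = "midpoint (side (e, s) True) (side (e, s) False)"
  have cpos: "cos eps > 0" using eps by (intro cos_gt_zero_pi) auto
  have m: "?m = ?x + of_real (\<rho> / 2 * cos eps) * u (e, s)"
  proof -
    have "cis eps + cis (- eps) = of_real (2 * cos eps)" by (simp add: complex_eq_iff)
    moreover have "?m = ?x + of_real (\<rho> / 4) * u (e, s) * (cis eps + cis (- eps))"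
      by (simp add: midpoint_def side_def scaleR_conv_of_real algebra_simps)
    ultimately show ?thesis by simp
  qed
  have "?m \<in> closed_segment ?x (?x + of_real \<rho> * u (e, s))"
    unfolding m in_segment
    by (intro exI[of _ "cos eps / 2"]) (use cpos cos_le_one[of eps] in \<open>auto simp: scaleR_conv_of_real algebra_simps simp del: cos_le_one\<close>)
  then have 1: "?m \<in> path_image (\<gamma> e)" using germ[OF e, of s] by blast
  have "dist ?x ?m > 0" unfolding m using \<rho> cpos norm_u[OF e, of s] by auto
  then have 2: "?m \<noteq> ?x" by auto
  have mb: "?m \<in> ball ?x \<rho>" using chord_ball[of "(e, s)"] e by (auto intro: midpoint_in_closed_segment)
  have 3: "?m \<noteq> end_pt \<gamma> (e, \<not> s)"
  proof (cases s)
    case True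
    obtain g where "pathfinish g = pathfinish (\<gamma> e)" "path_image g \<inter> ball (pathstart (\<gamma> e)) \<rho> = {}"
      using germ_start[OF e] by blast
    then have "pathfinish (\<gamma> e) \<notin> ball (pathstart (\<gamma> e)) \<rho>" using pathfinish_in_path_image[of g] by auto
    then show ?thesis using mb True by (auto simp: end_pt_def)
  next
    case False
    obtain g where "pathstart g = pathstart (\<gamma> e)" "path_image g \<inter> ball (pathfinish (\<gamma> e)) \<rho> = {}"
      using germ_finish[OF e] by blast
    then have "pathstart (\<gamma> e) \<notin> ball (pathfinish (\<gamma> e)) \<rho>" using pathstart_in_path_image[of g] by auto
    then show ?thesis using mb False by (auto simp: end_pt_def)
  qed
  have "?m \<noteq> pathstart (\<gamma> e)" "?m \<noteq> pathfinish (\<gamma> e)" using 2 3 by (cases s; simp add: end_pt_def)+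
  then show ?thesis using 1 by (auto intro: midpoint_in_closed_segment)
qed

end

section \<open>The two ends of an edge\<close>

context radial_system begin

lemma pathstart_ne_pathfinish: "e \<in> E \<Longrightarrow> pathstart (\<gamma> e) \<noteq> pathfinish (\<gamma> e)"
  using arc_distinct_ends[OF arc_\<gamma>, of e] by simp

text \<open>An edge carrying a nonzero coefficient of the circulation lies on a cycle, so that its end
  points are joined by the other edges.\<close>

lemma path_component_other_edges:
  assumes e: "e \<in> E" and \<omega>: "\<omega> e \<noteq> 0"
  shows "path_component (\<Union>f\<in>E - {e}. path_image (\<gamma> f)) (pathstart (\<gamma> e)) (pathfinish (\<gamma> e))"
proof (rule ccontr)
  let ?X = "\<Union>f\<in>E - {e}. path_image (\<gamma> f)"
  let ?s = "pathstart (\<gamma> e)"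
  assume n: "\<not> path_component ?X ?s (pathfinish (\<gamma> e))"
  \<comment> \<open>The indicator of what is reached from the start without \<open>e\<close>. If the
    finish is not reached, it changes along \<open>e\<close> only, and summation by parts leaves
    \<open>- \<omega> e = 0\<close>.\<close>
  define I where "I x = (if x = ?s \<or> path_component ?X ?s x then 1 else (0::complex))" for x
  have "I (pathfinish (\<gamma> f)) = I (pathstart (\<gamma> f))" if f: "f \<in> E" "f \<noteq> e" for f
  proof -
    have "path_image (\<gamma> f) \<subseteq> ?X" using f by blast
    then have pc: "path_component ?X (pathstart (\<gamma> f)) (pathfinish (\<gamma> f))"
      using path_\<gamma>[OF f(1)] unfolding path_component_def by blast
    have "y = ?s \<or> path_component ?X ?s y" if "path_component ?X x y" "x = ?s \<or> path_component ?X ?s x" for x y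
      using that path_component_trans[of ?X ?s x y] by blast
    from this[OF pc] this[OF path_component_sym[OF pc]]
    have "(pathstart (\<gamma> f) = ?s \<or> path_component ?X ?s (pathstart (\<gamma> f)))
        = (pathfinish (\<gamma> f) = ?s \<or> path_component ?X ?s (pathfinish (\<gamma> f)))"
      by blast
    then show ?thesis by (simp add: I_def)
  qed
  then have "(\<Sum>f\<in>E. (I (pathfinish (\<gamma> f)) - I (pathstart (\<gamma> f))) *s \<omega> f)
      = (\<Sum>f\<in>E. if f = e then - \<omega> e else 0)"
    using n pathstart_ne_pathfinish[OF e] by (intro sum.cong) (auto simp: I_def)
  then show False using sum_coboundary[of I] fin_E e \<omega> by simp
qed

lemma other_edges_disjoint:
  assumes e: "e \<in> E" shows "path_image (\<gamma> e) \<inter> (\<Union>f\<in>E - {e}. path_image (\<gamma> f)) \<subseteq> {pathstart (\<gamma> e), pathfinish (\<gamma> e)}"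
proof
  fix y assume "y \<in> path_image (\<gamma> e) \<inter> (\<Union>f\<in>E - {e}. path_image (\<gamma> f))"
  then obtain f where "f \<in> E" "e \<noteq> f" "y \<in> path_image (\<gamma> e) \<inter> path_image (\<gamma> f)" by blast
  then have "y \<in> path_image (\<gamma> e) \<inter> V" using images_V[OF e] by fast
  then show "y \<in> {pathstart (\<gamma> e), pathfinish (\<gamma> e)}" using image_V[OF e] by (rule rev_subsetD)
qed

text \<open>The left of \<open>e\<close> at its start and at its finish are compared by trading
  \<open>e\<close> for an arc \<open>\<eta>\<close> with the same ends inside the other edges. The
  traded potential has no curve on the connected set \<open>?S\<close>. The difference is the
  winding number of the Jordan curve \<open>J\<close>, which takes only the values \<open>0\<close>
  and a constant \<open>c\<close>, equal to \<open>1\<close> or \<open>-1\<close>; its jumps across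
  \<open>e\<close> have the same sense at both ends, so its value on the left is the same.\<close>

lemma pot_along:
  assumes e: "e \<in> E"
  shows "pot (side (e, True) True) = pot (side (e, False) False)"
proof -
  let ?X = "\<Union>f\<in>E - {e}. path_image (\<gamma> f)"
  let ?s = "pathstart (\<gamma> e)" and ?t = "pathfinish (\<gamma> e)"
  let ?S = "(path_image (\<gamma> e) - {?s, ?t}) \<union> chord (e, True) \<union> chord (e, False)"
  have S: "connected ?S"
  proof -
    have "connected (path_image (\<gamma> e) - {?s, ?t})"
      using arc_\<gamma>[OF e] by (intro connected_simple_path_endless arc_imp_simple_path)
    moreover have "connected (chord (e, True))" "connected (chord (e, False))" by auto
    ultimately show ?thesis using chord_meets[OF e, of True] chord_meets[OF e, of False]
      by (intro connected_Un) auto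
  qed
  have SX: "?S \<inter> ?X = {}"
  proof -
    have "chord (e, s) \<inter> ?X = {}" for s using chord_path_image[of "(e, s)"] e by auto
    then show ?thesis using other_edges_disjoint[OF e] by blast
  qed
  have sS: "side (e, s) b \<in> ?S" for s b by (cases s; cases b) auto
  show ?thesis
  proof (cases "\<omega> e = 0")
    case True
    have mono: "(\<Sum>f\<in>{f \<in> E - {e}. P f}. \<omega> f) = (\<Sum>f\<in>{f \<in> E. P f}. \<omega> f)" for P
      using fin_E True by (intro sum.mono_neutral_left) auto
    interpret c: curve_system "E - {e}" \<gamma> \<omega>
    proof
      show "finite (E - {e})" using fin_E by simp
      show "\<And>f. f \<in> E - {e} \<Longrightarrow> path (\<gamma> f)" using path_\<gamma> by simp
      show "(\<Sum>f\<in>{f \<in> E - {e}. pathstart (\<gamma> f) = x}. \<omega> f) = (\<Sum>f\<in>{f \<in> E - {e}. pathfinish (\<gamma> f) = x}. \<omega> f)" for x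
        unfolding mono by (rule circulation)
    qed
    have "pot p = c.pot p" for p
      unfolding pot_def c.pot_def using fin_E True by (intro sum.mono_neutral_right) auto
    moreover have "c.pot (side (e, True) True) = c.pot (side (e, False) False)"
      by (rule c.pot_connected[OF S]) (use SX sS in auto)
    ultimately show ?thesis by simp
  next
    case False
    obtain p where p: "path p" "path_image p \<subseteq> ?X" "pathstart p = ?s" "pathfinish p = ?t"
      using path_component_other_edges[OF e False] unfolding path_component_def by blast
    obtain \<eta> where \<eta>: "arc \<eta>" "path_image \<eta> \<subseteq> path_image p" "pathstart \<eta> = ?s" "pathfinish \<eta> = ?t"
      using path_contains_arc[OF p(1,3,4) pathstart_ne_pathfinish[OF e]] by blast
    have \<eta>X: "path_image \<eta> \<subseteq> ?X" using p(2) \<eta>(2) by blast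
    define J where "J = \<gamma> e +++ reversepath \<eta>"
    have J: "simple_path J" unfolding J_def
      by (rule simple_path_join_loop) (use arc_\<gamma>[OF e] \<eta> \<eta>X other_edges_disjoint[OF e] in \<open>auto simp: arc_reversepath\<close>)
    have Jc: "pathfinish J = pathstart J" unfolding J_def using \<eta> by simp
    have Ji: "path_image J = path_image (\<gamma> e) \<union> path_image \<eta>" unfolding J_def
      using \<eta> by (simp add: path_image_join)
    have sJ: "side (e, s) b \<notin> path_image J" for s b
    proof -
      have "side (e, s) b \<notin> ?X" using sS[of s b] SX disjoint_iff[of ?S ?X] by metis
      then have "side (e, s) b \<notin> path_image \<eta>" using \<eta>X by (meson subsetD)
      then show ?thesis using side_notin[OF e, of s b] unfolding Ji by simp
    qed
    have wJ: "winding_number J q = winding_number (\<gamma> e) q - winding_number \<eta> q" if "q \<notin> path_image J" for q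
      unfolding J_def using that \<eta> path_\<gamma>[OF e] unfolding Ji
      by (subst winding_number_join) (auto simp: winding_number_reversepath arc_imp_path)
    let ?W = "\<lambda>s b. winding_number J (side (e, s) b)"
    have jump: "?W s True - ?W s False = (if s then 1 else -1)" for s
    proof -
      have "chord (e, s) \<inter> path_image \<eta> = {}" using SX \<eta>X by (cases s) auto
      from winding_number_diff_chord[OF arc_imp_path[OF \<eta>(1)] this]
      have "winding_number \<eta> (side (e, s) True) - winding_number \<eta> (side (e, s) False)
        = chord_log (side (e, s) True) (side (e, s) False) ?t - chord_log (side (e, s) True) (side (e, s) False) ?s"
        unfolding \<eta>(3,4) .
      moreover have "?W s True - ?W s False = (winding_number (\<gamma> e) (side (e, s) True) - winding_number (\<gamma> e) (side (e, s) False))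
          - (winding_number \<eta> (side (e, s) True) - winding_number \<eta> (side (e, s) False))"
        unfolding wJ[OF sJ] by simp
      ultimately show ?thesis unfolding winding_number_jump[OF e, of s] by simp
    qed
    obtain c where c: "c = 1 \<or> c = -1" "\<And>z. z \<in> inside (path_image J) \<Longrightarrow> winding_number J z = c"
    proof (rule simple_closed_path_winding_number_inside[OF J])
      assume "\<And>z. z \<in> inside (path_image J) \<Longrightarrow> winding_number J z = 1"
      then show thesis using that[of 1] by blast
    next
      assume "\<And>z. z \<in> inside (path_image J) \<Longrightarrow> winding_number J z = - 1"
      then show thesis using that[of "- 1"] by blast
    qed
    have W: "?W s b = 0 \<or> ?W s b = c" for s b
    proof (cases "side (e, s) b \<in> inside (path_image J)")
      case True then show ?thesis using c by blast
    next
      case False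
      then have "side (e, s) b \<in> outside (path_image J)" using sJ inside_Un_outside[of "path_image J"] by blast
      then show ?thesis using winding_number_zero_in_outside[OF simple_path_imp_path[OF J] Jc] by blast
    qed
    \<comment> \<open>Two values out of \<open>0\<close> and \<open>c\<close> that differ by a
      prescribed sign are determined, so the jumps \<open>1\<close> and \<open>- 1\<close> fix all
      four winding numbers.\<close>
    have "p = t" if "p - q = 1" "r - t = - 1" "p = 0 \<or> p = c" "q = 0 \<or> q = c" "r = 0 \<or> r = c" "t = 0 \<or> t = c" for p q r t
      using c(1) that by (elim disjE) simp_all
    from this[OF jump[of True, unfolded if_True] jump[of False, unfolded if_False] W W W W]
    have WW: "?W True True = ?W False False"
      by simp
    let ?\<gamma> = "\<gamma>(e := \<eta>)"
    have ends: "pathstart (?\<gamma> f) = pathstart (\<gamma> f)" "pathfinish (?\<gamma> f) = pathfinish (\<gamma> f)" for f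
      using \<eta> by auto
    interpret c: curve_system E ?\<gamma> \<omega>
    proof
      show "finite E" by (rule fin_E)
      show "path (?\<gamma> f)" if "f \<in> E" for f
        using path_\<gamma>[OF that] arc_imp_path[OF \<eta>(1)] by simp
      show "(\<Sum>f\<in>{f \<in> E. pathstart (?\<gamma> f) = x}. \<omega> f) = (\<Sum>f\<in>{f \<in> E. pathfinish (?\<gamma> f) = x}. \<omega> f)" for x
        unfolding ends by (rule circulation)
    qed
    have "c.pot (side (e, True) True) = c.pot (side (e, False) False)"
    proof (rule c.pot_connected[OF S _ sS sS])
      fix f assume "f \<in> E"
      then have "path_image (?\<gamma> f) \<subseteq> ?X" using \<eta>X by auto
      then show "?S \<inter> path_image (?\<gamma> f) = {}" using SX by blast
    qed
    moreover have "pot q = winding_number J q *s \<omega> e + c.pot q" if "q \<notin> path_image J" for q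
    proof -
      have "pot q = winding_number (\<gamma> e) q *s \<omega> e + (\<Sum>f\<in>E - {e}. winding_number (\<gamma> f) q *s \<omega> f)"
        unfolding pot_def by (rule sum.remove[OF fin_E e])
      moreover have "c.pot q = winding_number \<eta> q *s \<omega> e + (\<Sum>f\<in>E - {e}. winding_number (\<gamma> f) q *s \<omega> f)"
        unfolding c.pot_def by (subst sum.remove[OF fin_E e]) (auto intro!: sum.cong)
      ultimately show ?thesis by (simp add: wJ[OF that] vec.scale_left_diff_distrib)
    qed
    ultimately show ?thesis using WW sJ by simp
  qed
qed

lemma pot_along':
  assumes e: "e \<in> E"
  shows "pot (side (e, True) False) = pot (side (e, False) True)"
proof -
  have "pot (side (e, True) True) - pot (side (e, True) False) = \<omega> e"
    using pot_jump[OF e, of True] by (simp only: if_True)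
  moreover have "pot (side (e, False) False) - pot (side (e, False) True) = \<omega> e"
    using pot_jump[OF e, of False] by (metis minus_diff_eq minus_minus)
  ultimately show ?thesis unfolding pot_along[OF e] by (metis diff_diff_eq2 add_diff_cancel_left')
qed

definition left_of :: "'a \<Rightarrow> complex ^ 'm" where "left_of e = pot (side (e, True) True)"
definition right_of :: "'a \<Rightarrow> complex ^ 'm" where "right_of e = pot (side (e, True) False)"

lemma left_right: "e \<in> E \<Longrightarrow> left_of e - right_of e = \<omega> e"
  unfolding left_of_def right_of_def by (simp only: pot_jump if_True)

lemma pot_side:
  "e \<in> E \<Longrightarrow> pot (side (e, s) b) = (if s = b then left_of e else right_of e)"
  unfolding left_of_def right_of_def
  by (cases s; cases b) (simp_all only: pot_along pot_along' simp_thms if_True if_False)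

text \<open>At the finish of an edge the counterclockwise side is its right; this sign turns the sum
  over half-edges into a balance of starts and finishes.\<close>

lemma left_right_sum:
  fixes G :: "complex ^ 'm \<Rightarrow> 'v::ab_group_add"
  assumes x: "x \<in> V"
  shows "(\<Sum>e\<in>{e\<in>E. pathstart (\<gamma> e) = x}. G (left_of e) - G (right_of e))
    = (\<Sum>e\<in>{e\<in>E. pathfinish (\<gamma> e) = x}. G (left_of e) - G (right_of e))"
proof -
  have ea: "ends_at x = (\<lambda>e. (e, True)) ` {e\<in>E. pathstart (\<gamma> e) = x} \<union> (\<lambda>e. (e, False)) ` {e\<in>E. pathfinish (\<gamma> e) = x}"
    by (auto simp: ends_at_def end_pt_def image_iff split: if_splits)
  have "0 = (\<Sum>n\<in>ends_at x. G (pot (side n True)) - G (pot (side n False)))"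
    using vertex_sum[OF x, of G] by simp
  also have "\<dots> = (\<Sum>e\<in>{e\<in>E. pathstart (\<gamma> e) = x}. G (left_of e) - G (right_of e))
     + (\<Sum>e\<in>{e\<in>E. pathfinish (\<gamma> e) = x}. G (right_of e) - G (left_of e))"
    unfolding ea using fin_E
    by (subst sum.union_disjoint) (auto simp: sum.reindex inj_on_def pot_side intro!: arg_cong2[where f="(+)"] sum.cong)
  also have "(\<Sum>e\<in>{e\<in>E. pathfinish (\<gamma> e) = x}. G (right_of e) - G (left_of e))
      = - (\<Sum>e\<in>{e\<in>E. pathfinish (\<gamma> e) = x}. G (left_of e) - G (right_of e))"
    by (simp add: sum_negf[symmetric])
  finally show ?thesis by simp
qed

lemma left_right_const:
  fixes Q :: "complex ^ 'm \<Rightarrow> bool"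
  assumes x: "x \<in> V" and Q: "\<And>e. e \<in> E \<Longrightarrow> pathstart (\<gamma> e) = x \<or> pathfinish (\<gamma> e) = x \<Longrightarrow> Q (left_of e) = Q (right_of e)"
    and a: "cis a \<notin> dirs x" and e: "e \<in> E" "pathstart (\<gamma> e) = x \<or> pathfinish (\<gamma> e) = x"
  shows "Q (left_of e) = Q (pot (x + of_real (\<rho> / 2) * cis a))"
proof -
  have Q': "Q (pot (side n True)) = Q (pot (side n False))" if "n \<in> ends_at x" for n
    using that Q[of "fst n"] pot_side[of "fst n" "snd n"] by (auto simp: ends_at_def end_pt_def split: if_splits)
  obtain s where s: "end_pt \<gamma> (e, s) = x" using e(2) by (metis end_pt_def fst_conv snd_conv)
  then have "(e, s) \<in> ends_at x" using e by (simp add: ends_at_def)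
  then have "Q (pot (side (e, s) True)) = Q (pot (x + of_real (\<rho> / 2) * cis a))"
    by (rule vertex_const[OF x a]) (rule Q')
  moreover have "Q (pot (side (e, s) True)) = Q (left_of e)"
    unfolding pot_side[OF e(1), of s True] using Q[OF e] by (cases s) simp_all
  ultimately show ?thesis by simp
qed

end

section \<open>Straightening arcs near their end points\<close>

lemma last_exit:
  fixes g :: "real \<Rightarrow> complex"
  assumes g: "path g" "pathstart g = x" "\<rho> < dist x (pathfinish g)" and \<rho>: "0 < \<rho>"
  obtains t where "0 \<le> t" "t \<le> 1" "dist x (g t) = \<rho>" "\<And>s. t < s \<Longrightarrow> s \<le> 1 \<Longrightarrow> \<rho> < dist x (g s)"
proof -
  have c: "continuous_on {0..1} (\<lambda>t. dist x (g t))"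
    using g(1) by (auto simp: path_def intro!: continuous_intros)
  let ?K = "{t \<in> {0..1}. dist x (g t) = \<rho>}"
  have "?K = {0..1} \<inter> (\<lambda>t. dist x (g t)) -` {\<rho>}" by auto
  then have "closed ?K" using continuous_closed_preimage[OF c _ closed_singleton, of \<rho>] by simp
  moreover have "bounded ?K" by (rule bounded_subset[of "{0..1}"]) auto
  ultimately have K: "compact ?K" by (simp only: compact_eq_bounded_closed)
  have "\<exists>t\<ge>0. t \<le> 1 \<and> dist x (g t) = \<rho>"
    by (rule IVT'[where f = "\<lambda>t. dist x (g t)"]) (use g \<rho> c in \<open>auto simp: pathstart_def pathfinish_def\<close>)
  then have "?K \<noteq> {}" by auto
  then obtain t where t: "t \<in> ?K" "\<And>s. s \<in> ?K \<Longrightarrow> s \<le> t"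
    using compact_attains_sup[OF K] by blast
  have "\<rho> < dist x (g s)" if s: "t < s" "s \<le> 1" for s
  proof (rule ccontr)
    assume "\<not> \<rho> < dist x (g s)"
    then have "\<exists>r\<ge>s. r \<le> 1 \<and> dist x (g r) = \<rho>"
      using s t(1) g(3) continuous_on_subset[OF c, of "{s..1}"]
      by (intro IVT'[where f = "\<lambda>t. dist x (g t)"]) (auto simp: pathfinish_def)
    then obtain r where "r \<ge> s" "r \<le> 1" "dist x (g r) = \<rho>" by blast
    then show False using t(2)[of r] t(1) s by simp
  qed
  then show ?thesis using that[of t] t(1) by auto
qed

text \<open>The arc is cut at its last point on the circle about its start, and then likewise at the
  other end.\<close>

lemma arc_middle:
  fixes g :: "real \<Rightarrow> complex"
  assumes g: "arc g" and \<rho>: "0 < \<rho>" "2 * \<rho> < dist (pathstart g) (pathfinish g)"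
  obtains mid where "arc mid" "path_image mid \<subseteq> path_image g"
    "dist (pathstart g) (pathstart mid) = \<rho>" "dist (pathfinish g) (pathfinish mid) = \<rho>"
    "path_image mid \<inter> cball (pathstart g) \<rho> = {pathstart mid}"
    "path_image mid \<inter> cball (pathfinish g) \<rho> = {pathfinish mid}"
proof -
  let ?x = "pathstart g" and ?y = "pathfinish g"
  obtain t where t: "0 \<le> t" "t \<le> 1" "dist ?x (g t) = \<rho>" "\<And>s. t < s \<Longrightarrow> s \<le> 1 \<Longrightarrow> \<rho> < dist ?x (g s)"
    using last_exit[OF arc_imp_path[OF g] refl _ \<rho>(1)] \<rho> by auto
  have t1: "t < 1" using t \<rho> by (auto simp: pathfinish_def less_le)
  \<comment> \<open>The remainder is run backwards, which makes the finish its start, so that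
    \<open>last_exit\<close> applies a second time; \<open>mid\<close> runs forward again.\<close>
  define h where "h = subpath 1 t g"
  have h: "arc h" unfolding h_def
    using g t t1 by (auto intro!: arc_subpath_arc)
  have hs: "pathstart h = ?y" "pathfinish h = g t"
    by (simp only: h_def pathstart_subpath pathfinish_def) (simp only: h_def pathfinish_subpath)
  have "dist ?x ?y \<le> dist ?x (g t) + dist (g t) ?y" by (rule dist_triangle)
  then have d: "\<rho> < dist ?y (pathfinish h)" using t(3) \<rho> hs(2) by (simp add: dist_commute)
  obtain s where s: "0 \<le> s" "s \<le> 1" "dist ?y (h s) = \<rho>" "\<And>r. s < r \<Longrightarrow> r \<le> 1 \<Longrightarrow> \<rho> < dist ?y (h r)"
    using last_exit[OF arc_imp_path[OF h] hs(1) d \<rho>(1)] by blast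
  have s1: "s < 1" using s d by (auto simp: pathfinish_def less_le)
  define mid where "mid = subpath 1 s h"
  have him: "path_image h = g ` {t..1}" unfolding h_def using t t1 by (simp add: path_image_subpath)
  have mim: "path_image mid = h ` {s..1}" unfolding mid_def using s s1 by (simp add: path_image_subpath)
  have mh: "path_image mid \<subseteq> path_image h" using s unfolding mim path_image_def[of h] by auto
  have "h 1 = g t" using hs(2) by (simp only: pathfinish_def)
  then have ms: "pathstart mid = g t" "pathfinish mid = h s"
    by (simp_all only: mid_def pathstart_subpath pathfinish_subpath)
  show ?thesis
  proof
    show "arc mid" unfolding mid_def using h s s1 by (auto intro!: arc_subpath_arc)
    show "path_image mid \<subseteq> path_image g" using mh t unfolding him path_image_def[of g] by auto
    show "dist ?x (pathstart mid) = \<rho>" "dist ?y (pathfinish mid) = \<rho>" using t s ms by auto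
    show "path_image mid \<inter> cball ?x \<rho> = {pathstart mid}"
    proof
      show "path_image mid \<inter> cball ?x \<rho> \<subseteq> {pathstart mid}"
      proof
        fix z assume z: "z \<in> path_image mid \<inter> cball ?x \<rho>"
        then have "z \<in> g ` {t..1}" using mh unfolding him by blast
        then obtain r where r: "t \<le> r" "r \<le> 1" "z = g r" by auto
        then have "r = t" using t(4)[of r] z by force
        then show "z \<in> {pathstart mid}" using r ms by simp
      qed
      show "{pathstart mid} \<subseteq> path_image mid \<inter> cball ?x \<rho>" using t ms pathstart_in_path_image[of mid] by auto
    qed
    show "path_image mid \<inter> cball ?y \<rho> = {pathfinish mid}"
    proof
      show "path_image mid \<inter> cball ?y \<rho> \<subseteq> {pathfinish mid}"
      proof
        fix z assume z: "z \<in> path_image mid \<inter> cball ?y \<rho>"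
        then have "z \<in> h ` {s..1}" unfolding mim by blast
        then obtain r where r: "s \<le> r" "r \<le> 1" "z = h r" by auto
        then have "r = s" using s(4)[of r] z by force
        then show "z \<in> {pathfinish mid}" using r ms by simp
      qed
      show "{pathfinish mid} \<subseteq> path_image mid \<inter> cball ?y \<rho>" using s ms pathfinish_in_path_image[of mid] by auto
    qed
  qed
qed

lemma segment_subset_cball: "dist x p \<le> \<rho> \<Longrightarrow> closed_segment x p \<subseteq> cball (x::complex) \<rho>"
  by (rule closed_segment_subset) (auto intro: order_trans[OF zero_le_dist])

lemma segment_far_end:
  fixes x y p :: complex
  assumes "y \<in> closed_segment x p" "dist x p \<le> dist x y" shows "y = p"
proof -
  obtain t where t: "0 \<le> t" "t \<le> 1" "y = (1 - t) *\<^sub>R x + t *\<^sub>R p"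
    using assms(1) unfolding in_segment by blast
  then have y: "y - x = t *\<^sub>R (p - x)" by (simp add: algebra_simps)
  then have "norm (p - x) \<le> t * norm (p - x)" using assms(2) t by (metis abs_of_nonneg dist_commute dist_norm norm_scaleR)
  show ?thesis
  proof (cases "p = x")
    case True then show ?thesis using y by simp
  next
    case False
    then have "t = 1" using \<open>norm (p - x) \<le> t * norm (p - x)\<close> t by simp
    then show ?thesis using t by simp
  qed
qed

locale plane_graph =
  fixes E :: "'a set" and V :: "complex set" and \<gamma> :: "'a \<Rightarrow> real \<Rightarrow> complex"
  assumes fin: "finite E" "finite V"
    and arcs: "\<And>e. e \<in> E \<Longrightarrow> arc (\<gamma> e)"
    and ends: "\<And>e s. e \<in> E \<Longrightarrow> end_pt \<gamma> (e, s) \<in> V"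
    and im_V: "\<And>e. e \<in> E \<Longrightarrow> path_image (\<gamma> e) \<inter> V \<subseteq> {pathstart (\<gamma> e), pathfinish (\<gamma> e)}"
    and ims_V: "\<And>e f. e \<in> E \<Longrightarrow> f \<in> E \<Longrightarrow> e \<noteq> f \<Longrightarrow> path_image (\<gamma> e) \<inter> path_image (\<gamma> f) \<subseteq> V"
    and disc: "\<And>e. e \<in> E \<Longrightarrow> path_image (\<gamma> e) \<subseteq> cball 0 1"
begin

text \<open>These are finitely many conditions, each valid for all small radii.\<close>

lemma ex_radius:
  "\<exists>\<rho>>0. (\<forall>x\<in>V. \<forall>y\<in>V. x \<noteq> y \<longrightarrow> 2 * \<rho> < dist x y) \<and>
     (\<forall>x\<in>V. \<forall>e\<in>E. x \<notin> path_image (\<gamma> e) \<longrightarrow> path_image (\<gamma> e) \<inter> cball x \<rho> = {})"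
proof -
  have "\<forall>\<^sub>F \<rho> in at_right 0. 2 * \<rho> < dist x y" if "x \<noteq> y" for x y :: complex
    unfolding eventually_at_right_field by (rule exI[of _ "dist x y / 2"]) (use that in auto)
  then have 1: "\<forall>\<^sub>F \<rho> in at_right 0. \<forall>x\<in>V. \<forall>y\<in>V. x \<noteq> y \<longrightarrow> 2 * \<rho> < dist x y"
    by (intro eventually_ball_finite[OF fin(2)] ballI) (auto intro: eventually_mono)
  have "\<forall>\<^sub>F \<rho> in at_right 0. path_image (\<gamma> e) \<inter> cball x \<rho> = {}" if eE: "e \<in> E" and xe: "x \<notin> path_image (\<gamma> e)" for x e
  proof -
    have "open (- path_image (\<gamma> e))" using arcs[OF eE] closed_arc_image by auto
    then obtain d where d: "d > 0" "cball x d \<subseteq> - path_image (\<gamma> e)"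
      using xe open_contains_cball by (metis ComplI)
    show ?thesis unfolding eventually_at_right_field
      by (rule exI[of _ d]) (use d in \<open>auto simp: subset_iff\<close>)
  qed
  then have 2: "\<forall>\<^sub>F \<rho> in at_right 0. \<forall>x\<in>V. \<forall>e\<in>E. x \<notin> path_image (\<gamma> e) \<longrightarrow> path_image (\<gamma> e) \<inter> cball x \<rho> = {}"
    by (intro eventually_ball_finite[OF fin(2)] eventually_ball_finite[OF fin(1)] ballI) (auto intro: eventually_mono)
  have 3: "\<forall>\<^sub>F \<rho>::real in at_right 0. 0 < \<rho>" by (simp add: eventually_at_right_less)
  from eventually_happens[OF eventually_conj[OF 1 eventually_conj[OF 2 3]]] show ?thesis
    by auto
qed

text \<open>Each arc keeps its middle part, and radial segments join this part to the vertices. A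
  middle part meets the closed disc about a vertex only in tips of its own segments, and different
  half-edges at a vertex have different tips because the old arcs meet only in vertices. So no new
  intersections arise, and convexity of the unit disc keeps the segments inside.\<close>

lemma ex_radial_system:
  fixes \<omega> :: "'a \<Rightarrow> complex ^ 'm"
  assumes circ: "\<And>x. (\<Sum>e\<in>{e\<in>E. pathstart (\<gamma> e) = x}. \<omega> e) = (\<Sum>e\<in>{e\<in>E. pathfinish (\<gamma> e) = x}. \<omega> e)"
  obtains \<gamma>' \<rho> u where "radial_system E \<gamma>' \<omega> V \<rho> u" "0 < \<rho>"
    "\<And>e. pathstart (\<gamma>' e) = pathstart (\<gamma> e)" "\<And>e. pathfinish (\<gamma>' e) = pathfinish (\<gamma> e)"
    "\<And>e. e \<in> E \<Longrightarrow> path_image (\<gamma>' e) \<subseteq> cball 0 1"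
    "\<And>e s. e \<in> E \<Longrightarrow> end_pt \<gamma>' (e, s) + of_real \<rho> * u (e, s) \<in> cball 0 1"
proof -
  obtain \<rho> where \<rho>: "\<rho> > 0" and sep: "\<And>x y. x \<in> V \<Longrightarrow> y \<in> V \<Longrightarrow> x \<noteq> y \<Longrightarrow> 2 * \<rho> < dist x y"
    and far: "\<And>x e. x \<in> V \<Longrightarrow> e \<in> E \<Longrightarrow> x \<notin> path_image (\<gamma> e) \<Longrightarrow> path_image (\<gamma> e) \<inter> cball x \<rho> = {}"
    using ex_radius by blast
  let ?st = "\<lambda>e. pathstart (\<gamma> e)" and ?fi = "\<lambda>e. pathfinish (\<gamma> e)"
  have endsV: "?st e \<in> V" "?fi e \<in> V" if "e \<in> E" for e
    using ends[OF that, of True] ends[OF that, of False] by (simp_all add: end_pt_def)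
  have ne: "?st e \<noteq> ?fi e" if "e \<in> E" for e
    using arc_distinct_ends[OF arcs[OF that]] by simp
  define isM where "isM e mid \<longleftrightarrow> arc mid \<and> path_image mid \<subseteq> path_image (\<gamma> e) \<and>
    dist (?st e) (pathstart mid) = \<rho> \<and> dist (?fi e) (pathfinish mid) = \<rho> \<and>
    path_image mid \<inter> cball (?st e) \<rho> = {pathstart mid} \<and>
    path_image mid \<inter> cball (?fi e) \<rho> = {pathfinish mid}" for e mid
  have "\<exists>mid. isM e mid" if "e \<in> E" for e
    using arc_middle[OF arcs[OF that] \<rho> sep[OF endsV[OF that] ne[OF that]]] unfolding isM_def by metis
  then obtain M where M: "\<And>e. e \<in> E \<Longrightarrow> isM e (M e)" by metis
  have Ma: "arc (M e)" "path_image (M e) \<subseteq> path_image (\<gamma> e)" "dist (?st e) (pathstart (M e)) = \<rho>"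
     "dist (?fi e) (pathfinish (M e)) = \<rho>" "path_image (M e) \<inter> cball (?st e) \<rho> = {pathstart (M e)}"
     "path_image (M e) \<inter> cball (?fi e) \<rho> = {pathfinish (M e)}" if "e \<in> E" for e
    using M[OF that] unfolding isM_def by blast+
  define \<gamma>' where "\<gamma>' e = linepath (?st e) (pathstart (M e)) +++ (M e +++ linepath (pathfinish (M e)) (?fi e))" for e
  define P where "P n = (if snd n then pathstart (M (fst n)) else pathfinish (M (fst n)))" for n
  define u where "u n = (P n - end_pt \<gamma> n) / of_real \<rho>" for n
  have st': "pathstart (\<gamma>' e) = ?st e" "pathfinish (\<gamma>' e) = ?fi e" for e by (simp_all add: \<gamma>'_def)
  have ep: "end_pt \<gamma>' n = end_pt \<gamma> n" for n by (simp add: end_pt_def st')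
  have Pu: "end_pt \<gamma> n + of_real \<rho> * u n = P n" for n using \<rho> by (simp add: u_def)
  have distP: "dist (end_pt \<gamma> (e, s)) (P (e, s)) = \<rho>" if "e \<in> E" for e s
    using Ma(3,4)[OF that] by (simp add: end_pt_def P_def)
  have P\<gamma>: "P (e, s) \<in> path_image (\<gamma> e)" if "e \<in> E" for e s
    using Ma(2)[OF that] pathstart_in_path_image[of "M e"] pathfinish_in_path_image[of "M e"] by (auto simp: P_def)
  have disj: "cball x \<rho> \<inter> cball y \<rho> = {}" if "x \<in> V" "y \<in> V" "x \<noteq> y" for x y
    using sep[OF that] by (intro disjoint_cballI) simp
  have PV: "P (e, s) \<notin> V" if "e \<in> E" for e s
    using sep[OF ends[OF that, of s], of "P (e, s)"] distP[OF that, of s] \<rho> by auto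
  define R where "R n = closed_segment (end_pt \<gamma> n) (P n)" for n
  have Rb: "R (e, s) \<subseteq> cball (end_pt \<gamma> (e, s)) \<rho>" if "e \<in> E" for e s
    unfolding R_def using distP[OF that] by (intro segment_subset_cball) simp
  have im: "path_image (\<gamma>' e) = R (e, True) \<union> path_image (M e) \<union> R (e, False)" for e
    by (simp add: \<gamma>'_def path_image_join R_def end_pt_def P_def closed_segment_commute Un_assoc)
  have Mnear: "\<exists>s. z = end_pt \<gamma> (e, s) \<and> y = P (e, s)" if e: "e \<in> E" and z: "z \<in> V" and y: "y \<in> path_image (M e)" "dist z y \<le> \<rho>" for e z y
  proof -
    have "z \<in> path_image (\<gamma> e)" using far[OF z e] y Ma(2)[OF e] by fastforce
    then have "z = ?st e \<or> z = ?fi e" using im_V[OF e] z by blast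
    then show ?thesis
    proof
      assume z': "z = ?st e"
      then have "y \<in> path_image (M e) \<inter> cball (?st e) \<rho>" using y by simp
      then show ?thesis using z' unfolding Ma(5)[OF e] by (intro exI[of _ True]) (simp add: end_pt_def P_def)
    next
      assume z': "z = ?fi e"
      then have "y \<in> path_image (M e) \<inter> cball (?fi e) \<rho>" using y by simp
      then show ?thesis using z' unfolding Ma(6)[OF e] by (intro exI[of _ False]) (simp add: end_pt_def P_def)
    qed
  qed
  have Pne: "P n \<noteq> P n'" if n: "fst n \<in> E" "fst n' \<in> E" "n \<noteq> n'" "end_pt \<gamma> n = end_pt \<gamma> n'" for n n'
  proof
    assume PP: "P n = P n'"
    show False
    proof (cases "fst n = fst n'")
      case True
      then have "snd n \<noteq> snd n'" using n(3) by (simp add: prod_eq_iff)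
      then show False using n(4) ne[OF n(1)] True by (auto simp: end_pt_def split: if_splits)
    next
      case False
      have "P n \<in> path_image (\<gamma> (fst n)) \<inter> path_image (\<gamma> (fst n'))"
        using P\<gamma>[OF n(1), of "snd n"] P\<gamma>[OF n(2), of "snd n'"] PP by simp
      then have "P n \<in> V" using ims_V[OF n(1,2) False] by blast
      then show False using PV[OF n(1), of "snd n"] by simp
    qed
  qed
  have RM: "y \<in> V" if e: "e \<in> E" and f: "f \<in> E" "e \<noteq> f" and y: "y \<in> R (e, s)" "y \<in> path_image (M f)" for e f s y
  proof -
    have zV: "end_pt \<gamma> (e, s) \<in> V" by (rule ends[OF e])
    have le: "dist (end_pt \<gamma> (e, s)) y \<le> \<rho>" using Rb[OF e, of s] y(1) by (auto simp: subset_iff)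
    obtain s' where s': "end_pt \<gamma> (e, s) = end_pt \<gamma> (f, s')" "y = P (f, s')" using Mnear[OF f(1) zV y(2) le] by blast
    have "y = P (e, s)"
      by (rule segment_far_end[OF y(1)[unfolded R_def]]) (simp add: s'(2) distP[OF e], simp add: s'(1) distP[OF f(1)])
    then show ?thesis using s' Pne[of "(e, s)" "(f, s')"] e f by simp
  qed
  have RR: "y \<in> V" if e: "e \<in> E" and f: "f \<in> E" "e \<noteq> f" and y: "y \<in> R (e, s)" "y \<in> R (f, s')" for e f s s' y
  proof (cases "end_pt \<gamma> (e, s) = end_pt \<gamma> (f, s')")
    case False
    then show ?thesis using disj[OF ends[OF e, of s] ends[OF f(1), of s'] False] Rb[OF e, of s] Rb[OF f(1), of s'] y by blast
  next
    case True
    define z where "z = end_pt \<gamma> (e, s)"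
    have un: "norm (P (e, s) - z) = \<rho>" "norm (P (f, s') - z) = \<rho>"
      using distP[OF e, of s] distP[OF f(1), of s'] True by (simp_all add: z_def dist_norm norm_minus_commute)
    obtain t where t: "0 \<le> t" "y = (1 - t) *\<^sub>R z + t *\<^sub>R P (e, s)" using y(1) unfolding R_def in_segment z_def by blast
    obtain t' where t': "0 \<le> t'" "y = (1 - t') *\<^sub>R z + t' *\<^sub>R P (f, s')"
      using y(2) True unfolding R_def in_segment z_def by auto
    have a: "y - z = t *\<^sub>R (P (e, s) - z)" unfolding t(2) by (simp add: algebra_simps)
    have b: "y - z = t' *\<^sub>R (P (f, s') - z)" unfolding t'(2) by (simp add: algebra_simps)
    have "norm (y - z) = t * \<rho>" "norm (y - z) = t' * \<rho>"
      using arg_cong[OF a, of norm] arg_cong[OF b, of norm] un t(1) t'(1) unfolding norm_scaleR by simp_all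
    then have "t * \<rho> = t' * \<rho>" by metis
    then have tt: "t = t'" using \<rho> by simp
    have "t *\<^sub>R (P (e, s) - z) = t *\<^sub>R (P (f, s') - z)" using a b tt by metis
    then have "t = 0 \<or> P (e, s) = P (f, s')" by auto
    then show ?thesis
    proof
      assume "t = 0"
      then show ?thesis using a ends[OF e, of s] by (simp add: z_def)
    next
      assume "P (e, s) = P (f, s')"
      then show ?thesis using Pne[of "(e, s)" "(f, s')"] e f True by simp
    qed
  qed
  have MM: "y \<in> V" if "e \<in> E" "f \<in> E" "e \<noteq> f" "y \<in> path_image (M e)" "y \<in> path_image (M f)" for e f y
    using ims_V[OF that(1-3)] Ma(2)[OF that(1)] Ma(2)[OF that(2)] that(4,5) by blast
  have g2: "arc (M e +++ linepath (pathfinish (M e)) (?fi e))" if e: "e \<in> E" for e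
  proof (rule arc_join)
    show "arc (linepath (pathfinish (M e)) (?fi e))" using Ma(4)[OF e] \<rho> by (intro arc_linepath) auto
    show "path_image (M e) \<inter> path_image (linepath (pathfinish (M e)) (?fi e)) \<subseteq> {pathstart (linepath (pathfinish (M e)) (?fi e))}"
      using Ma(6)[OF e] Rb[OF e, of False] by (auto simp: R_def end_pt_def P_def closed_segment_commute)
  qed (use Ma[OF e] in auto)
  have arc': "arc (\<gamma>' e)" if e: "e \<in> E" for e unfolding \<gamma>'_def
  proof (rule arc_join[OF _ g2[OF e]])
    show "arc (linepath (?st e) (pathstart (M e)))" using Ma(3)[OF e] \<rho> by (intro arc_linepath) auto
    have "cball (?st e) \<rho> \<inter> cball (?fi e) \<rho> = {}" by (rule disj[OF endsV[OF e] ne[OF e]])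
    then show "path_image (linepath (?st e) (pathstart (M e))) \<inter> path_image (M e +++ linepath (pathfinish (M e)) (?fi e))
        \<subseteq> {pathstart (M e +++ linepath (pathfinish (M e)) (?fi e))}"
      using Ma(5)[OF e] Rb[OF e, of False] Rb[OF e, of True]
      by (fastforce simp: path_image_join R_def end_pt_def P_def closed_segment_commute)
  qed simp
  have "radial_system E \<gamma>' \<omega> V \<rho> u"
  proof
    show "finite E" by (rule fin)
    show "path (\<gamma>' e)" if "e \<in> E" for e using arc'[OF that] by (rule arc_imp_path)
    show "(\<Sum>e\<in>{e\<in>E. pathstart (\<gamma>' e) = x}. \<omega> e) = (\<Sum>e\<in>{e\<in>E. pathfinish (\<gamma>' e) = x}. \<omega> e)" for x
      unfolding st' by (rule circ)
    show "0 < \<rho>" by (rule \<rho>)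
    show "arc (\<gamma>' e)" if "e \<in> E" for e by (rule arc'[OF that])
    show "end_pt \<gamma>' (e, s) \<in> V" if "e \<in> E" for e s unfolding ep by (rule ends[OF that])
    show "path_image (\<gamma>' e) \<inter> V \<subseteq> {pathstart (\<gamma>' e), pathfinish (\<gamma>' e)}" if e: "e \<in> E" for e
    proof
      fix y assume y: "y \<in> path_image (\<gamma>' e) \<inter> V"
      consider "y \<in> path_image (M e)" | s where "y \<in> R (e, s)" using y unfolding im by auto
      then show "y \<in> {pathstart (\<gamma>' e), pathfinish (\<gamma>' e)}" unfolding st'
      proof cases
        case 1 then show "y \<in> {?st e, ?fi e}" using Ma(2)[OF e] im_V[OF e] y by blast
      next
        case 2
        then have "y = end_pt \<gamma> (e, s)"
          using sep[OF ends[OF e, of s], of y] y Rb[OF e, of s] \<rho> by force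
        then show "y \<in> {?st e, ?fi e}" by (simp add: end_pt_def)
      qed
    qed
    show "path_image (\<gamma>' e) \<inter> path_image (\<gamma>' f) \<subseteq> V" if "e \<in> E" "f \<in> E" "e \<noteq> f" for e f
      unfolding im using that RM[OF that] RM[OF that(2,1)] RR[OF that] MM[OF that] by fast
    show "norm (u (e, s)) = 1" if "e \<in> E" for e s
      using distP[OF that, of s] \<rho> by (simp add: u_def norm_divide dist_norm norm_minus_commute)
    show "u n \<noteq> u n'" if "fst n \<in> E" "fst n' \<in> E" "n \<noteq> n'" "end_pt \<gamma>' n = end_pt \<gamma>' n'" for n n'
      using Pne[OF that(1-3)] that(4) Pu[of n] Pu[of n'] unfolding ep by auto
    show "path_image (\<gamma>' e) \<inter> ball x \<rho> = {}" if e: "e \<in> E" and x: "x \<in> V" "x \<noteq> pathstart (\<gamma>' e)" "x \<noteq> pathfinish (\<gamma>' e)" for e x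
    proof -
      have "x \<notin> path_image (\<gamma> e)" using im_V[OF e] x unfolding st' by blast
      then have "path_image (M e) \<inter> ball x \<rho> = {}" using far[OF x(1) e] Ma(2)[OF e] ball_subset_cball[of x \<rho>] by blast
      moreover have "R (e, s) \<inter> ball x \<rho> = {}" for s
      proof -
        have "x \<noteq> end_pt \<gamma> (e, s)" using x unfolding st' by (simp add: end_pt_def)
        from disj[OF x(1) ends[OF e] this] show ?thesis using Rb[OF e, of s] ball_subset_cball[of x \<rho>] by blast
      qed
      ultimately show ?thesis unfolding im by blast
    qed
    show "\<exists>g. path g \<and> pathstart g = pathstart (\<gamma>' e) + of_real \<rho> * u (e, True)
      \<and> pathfinish g = pathfinish (\<gamma>' e) \<and> path_image g \<inter> ball (pathstart (\<gamma>' e)) \<rho> = {}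
      \<and> path_image (\<gamma>' e) = closed_segment (pathstart (\<gamma>' e)) (pathstart g) \<union> path_image g
      \<and> (\<forall>p. p \<notin> path_image (\<gamma>' e) \<longrightarrow> winding_number (\<gamma>' e) p = winding_number (linepath (pathstart (\<gamma>' e)) (pathstart g)) p + winding_number g p)"
      if e: "e \<in> E" for e
    proof (intro exI conjI allI impI)
      let ?g = "M e +++ linepath (pathfinish (M e)) (?fi e)"
      show "path ?g" by (rule arc_imp_path[OF g2[OF e]])
      show "pathstart ?g = pathstart (\<gamma>' e) + of_real \<rho> * u (e, True)"
        using Pu[of "(e, True)"] by (simp add: st' end_pt_def P_def)
      show "pathfinish ?g = pathfinish (\<gamma>' e)" by (simp add: st')
      show "path_image ?g \<inter> ball (pathstart (\<gamma>' e)) \<rho> = {}"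
      proof -
        have "y \<notin> ball (?st e) \<rho>" if y: "y \<in> path_image (M e)" for y
        proof
          assume b: "y \<in> ball (?st e) \<rho>"
          then have "y \<in> path_image (M e) \<inter> cball (?st e) \<rho>" using y by simp
          then have "y = pathstart (M e)" unfolding Ma(5)[OF e] by simp
          then show False using b Ma(3)[OF e] by simp
        qed
        then have "path_image (M e) \<inter> ball (?st e) \<rho> = {}" by blast
        moreover have "R (e, False) \<inter> ball (?st e) \<rho> = {}"
        proof -
          have "R (e, False) \<subseteq> cball (?fi e) \<rho>" using Rb[OF e, of False] by (simp add: end_pt_def)
          then show ?thesis using disj[OF endsV[OF e] ne[OF e]] ball_subset_cball[of "?st e" \<rho>] by blast
        qed
        ultimately show ?thesis by (auto simp: st' path_image_join R_def end_pt_def P_def closed_segment_commute)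
      qed
      show i: "path_image (\<gamma>' e) = closed_segment (pathstart (\<gamma>' e)) (pathstart ?g) \<union> path_image ?g"
        unfolding st' by (simp add: \<gamma>'_def path_image_join)
      fix p assume "p \<notin> path_image (\<gamma>' e)"
      then show "winding_number (\<gamma>' e) p = winding_number (linepath (pathstart (\<gamma>' e)) (pathstart ?g)) p + winding_number ?g p"
        unfolding i st' unfolding \<gamma>'_def
        by (subst winding_number_join) (use arc_imp_path[OF g2[OF e]] in auto)
    qed
    show "\<exists>g. path g \<and> pathfinish g = pathfinish (\<gamma>' e) + of_real \<rho> * u (e, False)
      \<and> pathstart g = pathstart (\<gamma>' e) \<and> path_image g \<inter> ball (pathfinish (\<gamma>' e)) \<rho> = {}
      \<and> path_image (\<gamma>' e) = closed_segment (pathfinish (\<gamma>' e)) (pathfinish g) \<union> path_image g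
      \<and> (\<forall>p. p \<notin> path_image (\<gamma>' e) \<longrightarrow> winding_number (\<gamma>' e) p = winding_number g p - winding_number (linepath (pathfinish (\<gamma>' e)) (pathfinish g)) p)"
      if e: "e \<in> E" for e
    proof (intro exI conjI allI impI)
      let ?g = "linepath (?st e) (pathstart (M e)) +++ M e"
      have Mp: "path (M e)" using Ma(1)[OF e] by (rule arc_imp_path)
      show "path ?g" using Mp by simp
      show "pathfinish ?g = pathfinish (\<gamma>' e) + of_real \<rho> * u (e, False)"
        using Pu[of "(e, False)"] by (simp add: st' end_pt_def P_def)
      show "pathstart ?g = pathstart (\<gamma>' e)" by (simp add: st')
      show "path_image ?g \<inter> ball (pathfinish (\<gamma>' e)) \<rho> = {}"
      proof -
        have "y \<notin> ball (?fi e) \<rho>" if y: "y \<in> path_image (M e)" for y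
        proof
          assume b: "y \<in> ball (?fi e) \<rho>"
          then have "y \<in> path_image (M e) \<inter> cball (?fi e) \<rho>" using y by simp
          then have "y = pathfinish (M e)" unfolding Ma(6)[OF e] by simp
          then show False using b Ma(4)[OF e] by simp
        qed
        then have "path_image (M e) \<inter> ball (?fi e) \<rho> = {}" by blast
        moreover have "R (e, True) \<inter> ball (?fi e) \<rho> = {}"
        proof -
          have "R (e, True) \<subseteq> cball (?st e) \<rho>" using Rb[OF e, of True] by (simp add: end_pt_def)
          then show ?thesis using disj[OF endsV[OF e] ne[OF e]] ball_subset_cball[of "?fi e" \<rho>] by blast
        qed
        ultimately show ?thesis by (auto simp: st' path_image_join R_def end_pt_def P_def closed_segment_commute)
      qed
      show i: "path_image (\<gamma>' e) = closed_segment (pathfinish (\<gamma>' e)) (pathfinish ?g) \<union> path_image ?g"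
        unfolding st' by (auto simp add: \<gamma>'_def path_image_join closed_segment_commute)
      fix p assume p: "p \<notin> path_image (\<gamma>' e)"
      have pp: "p \<notin> closed_segment (?st e) (pathstart (M e))" "p \<notin> path_image (M e)" "p \<notin> closed_segment (?fi e) (pathfinish (M e))"
        using p unfolding i st' by (simp_all add: path_image_join)
      have "winding_number (\<gamma>' e) p = winding_number (linepath (?st e) (pathstart (M e))) p
          + (winding_number (M e) p + winding_number (linepath (pathfinish (M e)) (?fi e)) p)"
        unfolding \<gamma>'_def using pp Mp by (simp add: winding_number_join path_image_join closed_segment_commute)
      moreover have "winding_number (linepath (pathfinish (M e)) (?fi e)) p = - winding_number (linepath (?fi e) (pathfinish (M e))) p"
        using winding_number_reversepath[of "linepath (?fi e) (pathfinish (M e))" p] pp by simp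
      moreover have "winding_number ?g p = winding_number (linepath (?st e) (pathstart (M e))) p + winding_number (M e) p"
        using pp Mp by (simp add: winding_number_join)
      ultimately show "winding_number (\<gamma>' e) p = winding_number ?g p - winding_number (linepath (pathfinish (\<gamma>' e)) (pathfinish ?g)) p"
        by (simp add: st')
    qed
  qed
  moreover have Pd: "P (e, s) \<in> cball 0 1" if "e \<in> E" for e s using P\<gamma>[OF that] disc[OF that] by blast
  moreover have "path_image (\<gamma>' e) \<subseteq> cball 0 1" if e: "e \<in> E" for e
  proof -
    have "end_pt \<gamma> (e, s) \<in> cball 0 1" for s
      using disc[OF e] pathstart_in_path_image[of "\<gamma> e"] pathfinish_in_path_image[of "\<gamma> e"] by (auto simp: end_pt_def)
    then have "R (e, s) \<subseteq> cball 0 1" for s unfolding R_def using Pd[OF e] by (intro closed_segment_subset) auto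
    then show ?thesis unfolding im using Ma(2)[OF e] disc[OF e] by blast
  qed
  ultimately show ?thesis using that[of \<gamma>' \<rho> u] \<rho> st' Pd unfolding ep Pu by blast
qed

text \<open>The clauses replace any talk of faces. A predicate that no edge at \<open>x\<close>
  separates takes one value all around \<open>x\<close>; for \<open>x\<close> on the unit circle
  that value is the one at \<open>0\<close>, the potential outside the disc.\<close>

theorem ex_potential:
  fixes \<omega> :: "'a \<Rightarrow> complex ^ 'm"
  assumes circ: "\<And>x. (\<Sum>e\<in>{e\<in>E. pathstart (\<gamma> e) = x}. \<omega> e) = (\<Sum>e\<in>{e\<in>E. pathfinish (\<gamma> e) = x}. \<omega> e)"
  obtains l r :: "'a \<Rightarrow> complex ^ 'm" where
    "\<And>e. e \<in> E \<Longrightarrow> l e - r e = \<omega> e"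
    "\<And>x G. x \<in> V \<Longrightarrow> (\<Sum>e\<in>{e\<in>E. pathstart (\<gamma> e) = x}. G (l e) - G (r e) :: complex ^ 'm)
       = (\<Sum>e\<in>{e\<in>E. pathfinish (\<gamma> e) = x}. G (l e) - G (r e))"
    "\<And>x (Q :: complex ^ 'm \<Rightarrow> bool) e e'. x \<in> V \<Longrightarrow> (\<And>e. e \<in> E \<Longrightarrow> pathstart (\<gamma> e) = x \<or> pathfinish (\<gamma> e) = x \<Longrightarrow> Q (l e) = Q (r e))
       \<Longrightarrow> e \<in> E \<Longrightarrow> pathstart (\<gamma> e) = x \<or> pathfinish (\<gamma> e) = x
       \<Longrightarrow> e' \<in> E \<Longrightarrow> pathstart (\<gamma> e') = x \<or> pathfinish (\<gamma> e') = x \<Longrightarrow> Q (l e) = Q (l e')"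
    "\<And>x (Q :: complex ^ 'm \<Rightarrow> bool) e. x \<in> V \<Longrightarrow> norm x = 1 \<Longrightarrow> (\<And>e. e \<in> E \<Longrightarrow> pathstart (\<gamma> e) = x \<or> pathfinish (\<gamma> e) = x \<Longrightarrow> Q (l e) = Q (r e))
       \<Longrightarrow> e \<in> E \<Longrightarrow> pathstart (\<gamma> e) = x \<or> pathfinish (\<gamma> e) = x \<Longrightarrow> Q (l e) = Q 0"
proof -
  obtain \<gamma>' \<rho> u where rs: "radial_system E \<gamma>' \<omega> V \<rho> u" and \<rho>: "0 < \<rho>"
    and st: "\<And>e. pathstart (\<gamma>' e) = pathstart (\<gamma> e)" "\<And>e. pathfinish (\<gamma>' e) = pathfinish (\<gamma> e)"
    and d: "\<And>e. e \<in> E \<Longrightarrow> path_image (\<gamma>' e) \<subseteq> cball 0 1"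
    and P: "\<And>e s. e \<in> E \<Longrightarrow> end_pt \<gamma>' (e, s) + of_real \<rho> * u (e, s) \<in> cball 0 1"
    using ex_radial_system[OF circ] by blast
  interpret r: radial_system E \<gamma>' \<omega> V \<rho> u by (rule rs)
  show ?thesis
  proof (rule that[of r.left_of r.right_of])
    show "\<And>e. e \<in> E \<Longrightarrow> r.left_of e - r.right_of e = \<omega> e" by (rule r.left_right)
    show "(\<Sum>e\<in>{e\<in>E. pathstart (\<gamma> e) = x}. G (r.left_of e) - G (r.right_of e) :: complex ^ 'm)
       = (\<Sum>e\<in>{e\<in>E. pathfinish (\<gamma> e) = x}. G (r.left_of e) - G (r.right_of e))" if "x \<in> V" for x G
      using r.left_right_sum[OF that, of G] unfolding st .
    show "Q (r.left_of e) = Q (r.left_of e')"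
      if x: "x \<in> V" and Q: "\<And>e. e \<in> E \<Longrightarrow> pathstart (\<gamma> e) = x \<or> pathfinish (\<gamma> e) = x \<Longrightarrow> Q (r.left_of e) = Q (r.right_of e)"
        and e: "e \<in> E" "pathstart (\<gamma> e) = x \<or> pathfinish (\<gamma> e) = x" and e': "e' \<in> E" "pathstart (\<gamma> e') = x \<or> pathfinish (\<gamma> e') = x"
      for x e e' and Q :: "complex ^ 'm \<Rightarrow> bool"
    proof -
      obtain a where a: "cis a \<notin> r.dirs x" using r.ex_free_angle by blast
      show ?thesis
        using r.left_right_const[OF x _ a e(1), of Q] r.left_right_const[OF x _ a e'(1), of Q] Q e(2) e'(2) unfolding st by blast
    qed
    show "Q (r.left_of e) = Q 0"
      if x: "x \<in> V" "norm x = 1" and Q: "\<And>e. e \<in> E \<Longrightarrow> pathstart (\<gamma> e) = x \<or> pathfinish (\<gamma> e) = x \<Longrightarrow> Q (r.left_of e) = Q (r.right_of e)"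
        and e: "e \<in> E" "pathstart (\<gamma> e) = x \<or> pathfinish (\<gamma> e) = x" for x e and Q :: "complex ^ 'm \<Rightarrow> bool"
    proof -
      have xn: "norm (x + of_real t * x) = 1 + t" if "t > 0" for t
      proof -
        have "x + of_real t * x = of_real (1 + t) * x" by (simp add: algebra_simps)
        then show ?thesis using x(2) that by (simp only: norm_mult norm_of_real) simp
      qed
      obtain a where a: "cis a = x" using ex_angle_in_turn[OF x(2)] by blast
      \<comment> \<open>The outward direction \<open>x\<close> carries no edge, because the tip of
        its straight part would leave the closed disc.\<close>
      have "cis a \<notin> r.dirs x"
      proof
        assume "cis a \<in> r.dirs x"
        then obtain n where n: "fst n \<in> E" "end_pt \<gamma>' n = x" "u n = x" using a by (auto simp: r.ends_at_def)
        then have "x + of_real \<rho> * x \<in> cball 0 1" using P[OF n(1), of "snd n"] by simp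
        then show False using xn[OF \<rho>] \<rho> by simp
      qed
      moreover have "r.pot (x + of_real (\<rho> / 2) * cis a) = 0"
        by (rule r.pot_outside[OF d]) (use a xn[of "\<rho> / 2"] \<rho> in auto)
      ultimately show ?thesis
        using r.left_right_const[OF x(1) _ _ e(1), of Q a] Q e(2) unfolding st by simp
    qed
  qed
qed

end

section \<open>Polynomial functions\<close>

text \<open>This is a nonzero term of a maximal minor, found without determinants. For the new row
  \<open>w\<close> one looks for a column \<open>c\<close> with \<open>M w c \<noteq> 0\<close>
  whose removal keeps the other rows independent.\<close>

lemma independent_rows_matching:
  fixes M :: "'w \<Rightarrow> 'c \<Rightarrow> complex"
  assumes "finite W" "finite C"
    and "\<And>\<nu>. \<forall>c\<in>C. (\<Sum>w\<in>W. \<nu> w * M w c) = 0 \<Longrightarrow> \<forall>w\<in>W. \<nu> w = 0"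
  shows "\<exists>\<pi>. inj_on \<pi> W \<and> \<pi> ` W \<subseteq> C \<and> (\<forall>w\<in>W. M w (\<pi> w) \<noteq> 0)"
  using assms
proof (induction W arbitrary: C rule: finite_induct)
  case empty
  then show ?case by simp
next
  case (insert w W)
  note ins = insert.hyps
  have indW: "\<forall>v\<in>W. \<nu> v = 0" if "\<forall>c\<in>C. (\<Sum>v\<in>W. \<nu> v * M v c) = 0" for \<nu>
  proof -
    have "\<forall>v\<in>insert w W. (\<nu>(w := 0)) v = 0"
    proof (rule insert.prems(2), rule ballI)
      fix c assume "c \<in> C"
      have "(\<Sum>v\<in>insert w W. (\<nu>(w := 0)) v * M v c) = (\<Sum>v\<in>W. \<nu> v * M v c)"
        using ins by (auto intro!: sum.cong)
      then show "(\<Sum>v\<in>insert w W. (\<nu>(w := 0)) v * M v c) = 0" using that \<open>c \<in> C\<close> by simp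
    qed
    then have "(\<nu>(w := 0)) v = 0" if "v \<in> W" for v using that by blast
    moreover have "(\<nu>(w := 0)) v = \<nu> v" if "v \<in> W" for v using that ins by auto
    ultimately show ?thesis by simp
  qed
  have "\<exists>c\<in>C. M w c \<noteq> 0 \<and> (\<forall>\<mu>. (\<forall>d\<in>C - {c}. (\<Sum>v\<in>W. \<mu> v * M v d) = 0) \<longrightarrow> (\<forall>v\<in>W. \<mu> v = 0))"
  proof (rule ccontr)
    assume "\<not> ?thesis"
    then have "\<forall>c\<in>{c \<in> C. M w c \<noteq> 0}. \<exists>\<mu>. (\<forall>d\<in>C - {c}. (\<Sum>v\<in>W. \<mu> v * M v d) = 0) \<and> (\<exists>v\<in>W. \<mu> v \<noteq> 0)"
      by blast
    from bchoice[OF this] obtain \<mu> where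
      "\<forall>c\<in>{c \<in> C. M w c \<noteq> 0}. (\<forall>d\<in>C - {c}. (\<Sum>v\<in>W. \<mu> c v * M v d) = 0) \<and> (\<exists>v\<in>W. \<mu> c v \<noteq> 0)" by blast
    then have \<mu>: "\<And>c d. c \<in> C \<Longrightarrow> M w c \<noteq> 0 \<Longrightarrow> d \<in> C - {c} \<Longrightarrow> (\<Sum>v\<in>W. \<mu> c v * M v d) = 0"
      and \<mu>0: "\<And>c. c \<in> C \<Longrightarrow> M w c \<noteq> 0 \<Longrightarrow> \<exists>v\<in>W. \<mu> c v \<noteq> 0" by simp_all
    define \<alpha> where "\<alpha> c = (\<Sum>v\<in>W. \<mu> c v * M v c)" for c
    have \<alpha>: "\<alpha> c \<noteq> 0" if c: "c \<in> C" "M w c \<noteq> 0" for c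
    proof
      assume "\<alpha> c = 0"
      then have "\<forall>d\<in>C. (\<Sum>v\<in>W. \<mu> c v * M v d) = 0" using \<mu>[OF c] unfolding \<alpha>_def by (metis DiffI singletonD)
      then show False using indW[of "\<mu> c"] \<mu>0[OF c] by blast
    qed
    let ?D = "{c \<in> C. M w c \<noteq> 0}"
    \<comment> \<open>If every such column \<open>c\<close> fails, there is a relation
      \<open>\<mu> c\<close> among the old rows that holds off \<open>c\<close> only. Suitable
      multiples of these cancel row \<open>w\<close> column by column, against independence.\<close>
    define \<nu> where "\<nu> v = (if v = w then 1 else - (\<Sum>c\<in>?D. M w c / \<alpha> c * \<mu> c v))" for v
    have fD: "finite ?D" using insert.prems(1) by simp
    have "\<forall>v\<in>insert w W. \<nu> v = 0"
    proof (rule insert.prems(2), rule ballI)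
      fix d assume d: "d \<in> C"
      have "(\<Sum>v\<in>W. \<nu> v * M v d) = - (\<Sum>v\<in>W. \<Sum>c\<in>?D. M w c / \<alpha> c * \<mu> c v * M v d)"
        unfolding sum_negf[symmetric] using ins by (intro sum.cong) (auto simp: \<nu>_def sum_distrib_right sum_negf)
      also have "\<dots> = - (\<Sum>c\<in>?D. M w c / \<alpha> c * (\<Sum>v\<in>W. \<mu> c v * M v d))"
        by (subst sum.swap) (simp add: sum_distrib_left mult.assoc)
      also have "\<dots> = - (\<Sum>c\<in>?D. if c = d then M w d else 0)"
        using \<mu> \<alpha> d by (intro arg_cong[where f = uminus] sum.cong) (auto simp: \<alpha>_def)
      also have "\<dots> = - M w d" using fD d by (simp add: sum.delta)
      finally show "(\<Sum>v\<in>insert w W. \<nu> v * M v d) = 0"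
        using ins by (simp add: \<nu>_def)
    qed
    then show False by (simp add: \<nu>_def)
  qed
  then obtain c where c: "c \<in> C" "M w c \<noteq> 0"
    "\<And>\<mu>. \<forall>d\<in>C - {c}. (\<Sum>v\<in>W. \<mu> v * M v d) = 0 \<Longrightarrow> \<forall>v\<in>W. \<mu> v = 0" by blast
  obtain \<pi> where \<pi>: "inj_on \<pi> W" "\<pi> ` W \<subseteq> C - {c}" "\<forall>v\<in>W. M v (\<pi> v) \<noteq> 0"
    using insert.IH[of "C - {c}"] insert.prems(1) c(3) by blast
  have "inj_on (\<pi>(w := c)) (insert w W)" using \<pi> ins by (auto simp: inj_on_def)
  moreover have "(\<pi>(w := c)) ` insert w W \<subseteq> C" using \<pi> c by auto
  moreover have "\<forall>v\<in>insert w W. M v ((\<pi>(w := c)) v) \<noteq> 0" using \<pi> c by auto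
  ultimately show ?case by blast
qed

text \<open>Otherwise the matching would inject \<open>W\<close> into the smaller set
  \<open>C\<close>.\<close>

lemma more_rows_dependent:
  fixes M :: "'w \<Rightarrow> 'c \<Rightarrow> complex"
  assumes "finite W" "finite C" "card C < card W"
  obtains \<nu> w where "w \<in> W" "\<nu> w \<noteq> 0" "\<And>c. c \<in> C \<Longrightarrow> (\<Sum>w\<in>W. \<nu> w * M w c) = 0"
proof -
  have "\<not> (\<exists>\<pi>. inj_on \<pi> W \<and> \<pi> ` W \<subseteq> C \<and> (\<forall>w\<in>W. M w (\<pi> w) \<noteq> 0))"
    using assms card_inj_on_le by (metis not_less)
  then show ?thesis using independent_rows_matching[OF assms(1,2), of M] that by blast
qed

section \<open>Polynomial functions, degrees and monomials\<close>

inductive_set mpoly :: "'i set \<Rightarrow> (('i \<Rightarrow> complex) \<Rightarrow> complex) set" for I :: "'i set"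
where
  const: "(\<lambda>_. c) \<in> mpoly I"
| coord: "i \<in> I \<Longrightarrow> (\<lambda>x. x i) \<in> mpoly I"
| add: "f \<in> mpoly I \<Longrightarrow> g \<in> mpoly I \<Longrightarrow> (\<lambda>x. f x + g x) \<in> mpoly I"
| mult: "f \<in> mpoly I \<Longrightarrow> g \<in> mpoly I \<Longrightarrow> (\<lambda>x. f x * g x) \<in> mpoly I"

lemma mpoly_sum: "(\<And>a. a \<in> A \<Longrightarrow> f a \<in> mpoly I) \<Longrightarrow> (\<lambda>x. \<Sum>a\<in>A. f a x) \<in> mpoly I"
  by (induction A rule: infinite_finite_induct) (auto intro: mpoly.intros)

lemma mpoly_prod: "(\<And>a. a \<in> A \<Longrightarrow> f a \<in> mpoly I) \<Longrightarrow> (\<lambda>x. \<Prod>a\<in>A. f a x) \<in> mpoly I"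
  by (induction A rule: infinite_finite_induct) (auto intro: mpoly.intros)

lemma mpoly_power: "f \<in> mpoly I \<Longrightarrow> (\<lambda>x. f x ^ n) \<in> mpoly I"
  by (induction n) (auto intro: mpoly.intros)

lemma mpoly_cong: "f \<in> mpoly I \<Longrightarrow> (\<And>i. i \<in> I \<Longrightarrow> x i = y i) \<Longrightarrow> f x = f y"
  by (induction rule: mpoly.induct) auto

lemma mpoly_comp:
  assumes "f \<in> mpoly J" "\<And>j. j \<in> J \<Longrightarrow> (\<lambda>x. g x j) \<in> mpoly I"
  shows "(\<lambda>x. f (g x)) \<in> mpoly I"
  using assms by (induction rule: mpoly.induct) (auto intro: mpoly.intros)

lemma mpoly_line:
  assumes "f \<in> mpoly I"
  shows "\<exists>p. \<forall>t. f (\<lambda>i. x i + t * (y i - x i)) = poly p t"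
  using assms
proof (induction rule: mpoly.induct)
  case (const c)
  then show ?case by (intro exI[of _ "[:c:]"]) simp
next
  case (coord i)
  then show ?case by (intro exI[of _ "[:x i, y i - x i:]"]) simp
next
  case (add f g)
  then show ?case by (metis poly_add)
next
  case (mult f g)
  then show ?case by (metis poly_mult)
qed

text \<open>Irreducibility of affine space: on the line through \<open>x\<close> and
  \<open>y\<close> both restrictions are nonzero polynomials in one variable, and their product has
  finitely many roots.\<close>

lemma mpoly_nonzero2:
  assumes "f \<in> mpoly I" "g \<in> mpoly I" "f x \<noteq> 0" "g y \<noteq> 0"
  obtains z where "f z \<noteq> 0" "g z \<noteq> 0"
proof -
  obtain p where p: "\<And>t. f (\<lambda>i. x i + t * (y i - x i)) = poly p t" using mpoly_line[OF assms(1)] by blast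
  obtain q where q: "\<And>t. g (\<lambda>i. x i + t * (y i - x i)) = poly q t" using mpoly_line[OF assms(2)] by blast
  have "p \<noteq> 0" using p[of 0] assms(3) by auto
  moreover have "q \<noteq> 0" using q[of 1] assms(4) by auto
  ultimately have "finite {t. poly (p * q) t = 0}" by (intro poly_roots_finite) simp
  then obtain t where "poly (p * q) t \<noteq> 0" using infinite_UNIV_char_0[where 'a = complex]
    by (metis (mono_tags, lifting) UNIV_eq_I mem_Collect_eq)
  then show ?thesis using that p q by (metis mult_eq_0_iff poly_mult)
qed

lemma mpoly_nonzero_family:
  assumes "finite A" "\<And>a. a \<in> A \<Longrightarrow> F a \<in> mpoly I" "\<And>a. a \<in> A \<Longrightarrow> \<exists>x. F a x \<noteq> 0"
  shows "\<exists>z. \<forall>a\<in>A. F a z \<noteq> 0"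
  using assms
proof (induction A rule: finite_induct)
  case (insert a A)
  then obtain z where z: "\<forall>a\<in>A. F a z \<noteq> 0" by blast
  have "(\<lambda>x. \<Prod>a\<in>A. F a x) \<in> mpoly I" using insert.prems by (intro mpoly_prod) auto
  moreover have "(\<Prod>a\<in>A. F a z) \<noteq> 0" using z insert.hyps by simp
  moreover obtain x where "F a x \<noteq> 0" using insert.prems by blast
  ultimately obtain y where "(\<Prod>a\<in>A. F a y) \<noteq> 0" "F a y \<noteq> 0"
    using mpoly_nonzero2[of "\<lambda>x. \<Prod>a\<in>A. F a x" I "F a" z x] insert.prems(1)[of a] by blast
  then show ?case using insert.hyps by (intro exI[of _ y]) auto
qed simp

definition monom_fun :: "'i set \<Rightarrow> ('i \<Rightarrow> nat) \<Rightarrow> ('i \<Rightarrow> complex) \<Rightarrow> complex"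
  where "monom_fun I a x = (\<Prod>i\<in>I. x i ^ a i)"

lemma monom_fun_mpoly: "monom_fun I a \<in> mpoly I"
  unfolding monom_fun_def by (intro mpoly_prod mpoly_power mpoly.coord)

text \<open>Degrees are bounded in each variable separately, which makes the exponents a box with
  \<open>(k + 1) ^ card I\<close> elements; the later argument rests on this count.\<close>

definition deg_le :: "'i set \<Rightarrow> nat \<Rightarrow> (('i \<Rightarrow> complex) \<Rightarrow> complex) \<Rightarrow> bool"
  where "deg_le I k f \<longleftrightarrow> (\<exists>c. \<forall>x. f x = (\<Sum>a\<in>I \<rightarrow>\<^sub>E {..k}. c a * monom_fun I a x))"

lemma deg_le_monom:
  assumes "finite I" "\<And>i. i \<in> I \<Longrightarrow> a i \<le> k" shows "deg_le I k (monom_fun I a)"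
  unfolding deg_le_def
proof (intro exI allI)
  fix x
  have "restrict a I \<in> I \<rightarrow>\<^sub>E {..k}" using assms by auto
  moreover have "finite (I \<rightarrow>\<^sub>E {..k})" using assms by (intro finite_PiE) auto
  moreover have "monom_fun I a x = monom_fun I (restrict a I) x" by (simp add: monom_fun_def)
  ultimately show "monom_fun I a x = (\<Sum>b\<in>I \<rightarrow>\<^sub>E {..k}. (if b = restrict a I then 1 else 0) * monom_fun I b x)"
    by (simp add: if_distrib[of "\<lambda>c. c * _"] cong: if_cong)
qed

lemma deg_le_add: "deg_le I k f \<Longrightarrow> deg_le I k g \<Longrightarrow> deg_le I k (\<lambda>x. f x + g x)"
proof -
  assume "deg_le I k f" "deg_le I k g"
  then obtain c d where "\<And>x. f x = (\<Sum>a\<in>I \<rightarrow>\<^sub>E {..k}. c a * monom_fun I a x)"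
    "\<And>x. g x = (\<Sum>a\<in>I \<rightarrow>\<^sub>E {..k}. d a * monom_fun I a x)" unfolding deg_le_def by blast
  then show ?thesis unfolding deg_le_def
    by (intro exI[of _ "\<lambda>a. c a + d a"]) (simp add: sum.distrib distrib_right)
qed

lemma deg_le_scale: "deg_le I k f \<Longrightarrow> deg_le I k (\<lambda>x. c * f x)"
proof -
  assume "deg_le I k f"
  then obtain d where "\<And>x. f x = (\<Sum>a\<in>I \<rightarrow>\<^sub>E {..k}. d a * monom_fun I a x)" unfolding deg_le_def by blast
  then show ?thesis unfolding deg_le_def
    by (intro exI[of _ "\<lambda>a. c * d a"]) (simp add: sum_distrib_left mult.assoc)
qed

lemma deg_le_zero: "deg_le I k (\<lambda>_. 0)"
  unfolding deg_le_def by (intro exI[of _ "\<lambda>_. 0"]) simp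

lemma deg_le_sum: "(\<And>a. a \<in> A \<Longrightarrow> deg_le I k (f a)) \<Longrightarrow> deg_le I k (\<lambda>x. \<Sum>a\<in>A. f a x)"
  by (induction A rule: infinite_finite_induct) (auto intro: deg_le_add deg_le_zero)

lemma deg_le_mult:
  assumes I: "finite I" and f: "deg_le I k f" and g: "deg_le I l g"
  shows "deg_le I (k + l) (\<lambda>x. f x * g x)"
proof -
  obtain c d where c: "\<And>x. f x = (\<Sum>a\<in>I \<rightarrow>\<^sub>E {..k}. c a * monom_fun I a x)"
    and d: "\<And>x. g x = (\<Sum>a\<in>I \<rightarrow>\<^sub>E {..l}. d a * monom_fun I a x)" using f g unfolding deg_le_def by blast
  have "f x * g x = (\<Sum>a\<in>I \<rightarrow>\<^sub>E {..k}. \<Sum>b\<in>I \<rightarrow>\<^sub>E {..l}. c a * d b * monom_fun I (\<lambda>i. a i + b i) x)" for x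
    unfolding c d sum_product
    by (intro sum.cong) (simp_all add: monom_fun_def power_add prod.distrib)
  moreover have "deg_le I (k + l) (\<lambda>x. \<Sum>a\<in>I \<rightarrow>\<^sub>E {..k}. \<Sum>b\<in>I \<rightarrow>\<^sub>E {..l}. c a * d b * monom_fun I (\<lambda>i. a i + b i) x)"
    by (intro deg_le_sum deg_le_scale deg_le_monom I) (auto intro!: add_mono)
  ultimately show ?thesis by simp
qed

lemma deg_le_mono:
  assumes I: "finite I" and f: "deg_le I k f" and "k \<le> l" shows "deg_le I l f"
proof -
  obtain c where c: "\<And>x. f x = (\<Sum>a\<in>I \<rightarrow>\<^sub>E {..k}. c a * monom_fun I a x)" using f unfolding deg_le_def by blast
  have "deg_le I l (\<lambda>x. \<Sum>a\<in>I \<rightarrow>\<^sub>E {..k}. c a * monom_fun I a x)"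
    using assms(3) by (intro deg_le_sum deg_le_scale deg_le_monom I) (force simp: PiE_iff)
  then show ?thesis unfolding c[symmetric] .
qed

lemma deg_le_const: assumes "finite I" shows "deg_le I k (\<lambda>_. c)"
  using deg_le_scale[OF deg_le_monom[OF assms, of "\<lambda>_. 0" k], of c] by (simp add: monom_fun_def)

lemma mpoly_deg_le:
  assumes I: "finite I" and "f \<in> mpoly I" shows "\<exists>k. deg_le I k f"
  using assms(2)
proof (induction rule: mpoly.induct)
  case (const c)
  then show ?case using deg_le_const[OF I] by blast
next
  case (coord i)
  have "monom_fun I (\<lambda>j. if j = i then 1 else 0) = (\<lambda>x. x i)"
    using I coord by (auto simp: monom_fun_def fun_eq_iff if_distrib[of "\<lambda>n. _ ^ n"] cong: if_cong)
  moreover have "deg_le I 1 (monom_fun I (\<lambda>j. if j = i then 1 else 0))" by (rule deg_le_monom[OF I]) simp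
  ultimately show ?case by (intro exI[of _ 1]) simp
next
  case (add f g)
  then obtain k l where "deg_le I k f" "deg_le I l g" by blast
  then have "deg_le I (max k l) f" "deg_le I (max k l) g" using deg_le_mono[OF I] by auto
  then show ?case using deg_le_add by blast
next
  case (mult f g)
  then show ?case using deg_le_mult[OF I] by blast
qed

lemma deg_le_power: "finite I \<Longrightarrow> deg_le I k f \<Longrightarrow> deg_le I (n * k) (\<lambda>x. f x ^ n)"
proof (induction n)
  case 0 then show ?case by (simp add: deg_le_const)
next
  case (Suc n) then show ?case using deg_le_mult[of I k f "n * k" "\<lambda>x. f x ^ n"] by simp
qed

lemma deg_le_prod:
  assumes "finite I" "finite A" "\<And>a. a \<in> A \<Longrightarrow> deg_le I k (f a)"
  shows "deg_le I (card A * k) (\<lambda>x. \<Prod>a\<in>A. f a x)"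
  using assms(2,3)
proof (induction A rule: finite_induct)
  case empty then show ?case by (simp add: deg_le_const assms(1))
next
  case (insert a A)
  then show ?case using deg_le_mult[OF assms(1), of k "f a" "card A * k" "\<lambda>x. \<Prod>a\<in>A. f a x"] by simp
qed

text \<open>The coefficient vectors have fewer entries than there are functions.\<close>

lemma deg_le_dependent:
  assumes I: "finite I" and B: "finite B" and G: "\<And>b. b \<in> B \<Longrightarrow> deg_le I L (G b)" and card: "(L + 1) ^ card I < card B"
  obtains \<mu> b where "b \<in> B" "\<mu> b \<noteq> 0" "\<And>x. (\<Sum>b\<in>B. \<mu> b * G b x) = 0"
proof -
  have "\<forall>b\<in>B. \<exists>c. \<forall>x. G b x = (\<Sum>a\<in>I \<rightarrow>\<^sub>E {..L}. c a * monom_fun I a x)" using G unfolding deg_le_def by blast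
  then obtain c where c: "\<And>b x. b \<in> B \<Longrightarrow> G b x = (\<Sum>a\<in>I \<rightarrow>\<^sub>E {..L}. c b a * monom_fun I a x)" by metis
  have fin: "finite (I \<rightarrow>\<^sub>E {..L})" using I by (intro finite_PiE) auto
  have "card (I \<rightarrow>\<^sub>E {..L}) < card B" using card I by (simp add: card_PiE)
  then obtain \<mu> b where \<mu>: "b \<in> B" "\<mu> b \<noteq> 0" "\<And>a. a \<in> I \<rightarrow>\<^sub>E {..L} \<Longrightarrow> (\<Sum>b\<in>B. \<mu> b * c b a) = 0"
    using more_rows_dependent[OF B fin, where M = c] by metis
  have "(\<Sum>b\<in>B. \<mu> b * G b x) = 0" for x
  proof -
    have "(\<Sum>b\<in>B. \<mu> b * G b x) = (\<Sum>b\<in>B. \<Sum>a\<in>I \<rightarrow>\<^sub>E {..L}. \<mu> b * c b a * monom_fun I a x)"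
      by (intro sum.cong) (simp_all add: c sum_distrib_left mult.assoc)
    also have "\<dots> = (\<Sum>a\<in>I \<rightarrow>\<^sub>E {..L}. (\<Sum>b\<in>B. \<mu> b * c b a) * monom_fun I a x)"
      by (subst sum.swap) (simp add: sum_distrib_right)
    finally show ?thesis using \<mu>(3) by simp
  qed
  then show ?thesis using that \<mu> by blast
qed

text \<open>Independence of monomials, one variable at a time: some coefficient, a polynomial in the
  old variables, is nonzero at a point by induction, and the new variable is then chosen off the
  roots.\<close>

lemma monom_sum_nonzero:
  assumes "finite J" "a \<in> J \<rightarrow>\<^sub>E {..k}" "\<mu> a \<noteq> 0"
  shows "\<exists>y. (\<Sum>b\<in>J \<rightarrow>\<^sub>E {..k}. \<mu> b * monom_fun J b y) \<noteq> 0"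
  using assms
proof (induction J arbitrary: a \<mu> rule: finite_induct)
  case empty
  then show ?case by (simp add: monom_fun_def)
next
  case (insert j J)
  let ?c = "\<lambda>n y. \<Sum>b\<in>J \<rightarrow>\<^sub>E {..k}. \<mu> (b(j := n)) * monom_fun J b y"
  have split: "(\<Sum>b\<in>insert j J \<rightarrow>\<^sub>E {..k}. \<mu> b * monom_fun (insert j J) b y) = (\<Sum>n\<le>k. ?c n y * y j ^ n)" for y
  proof -
    have "(\<Sum>b\<in>insert j J \<rightarrow>\<^sub>E {..k}. \<mu> b * monom_fun (insert j J) b y)
        = (\<Sum>(n, b)\<in>{..k} \<times> (J \<rightarrow>\<^sub>E {..k}). \<mu> (b(j := n)) * monom_fun (insert j J) (b(j := n)) y)"
      unfolding PiE_insert_eq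
      by (subst sum.reindex[OF inj_combinator[OF insert.hyps(2)]]) (auto intro!: sum.cong)
    also have "\<dots> = (\<Sum>n\<le>k. \<Sum>b\<in>J \<rightarrow>\<^sub>E {..k}. \<mu> (b(j := n)) * monom_fun (insert j J) (b(j := n)) y)"
      by (simp add: sum.cartesian_product)
    also have "\<dots> = (\<Sum>n\<le>k. ?c n y * y j ^ n)"
    proof (intro sum.cong refl)
      fix n
      have "monom_fun (insert j J) (b(j := n)) y = y j ^ n * monom_fun J b y" for b
      proof -
        have "(\<Prod>i\<in>J. y i ^ (b(j := n)) i) = (\<Prod>i\<in>J. y i ^ b i)" using insert.hyps by (intro prod.cong) auto
        then show ?thesis using insert.hyps by (simp add: monom_fun_def)
      qed
      then show "(\<Sum>b\<in>J \<rightarrow>\<^sub>E {..k}. \<mu> (b(j := n)) * monom_fun (insert j J) (b(j := n)) y) = ?c n y * y j ^ n"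
        unfolding sum_distrib_right by (intro sum.cong refl) (simp add: ac_simps)
    qed
    finally show ?thesis .
  qed
  have aj: "a j \<le> k" and "(restrict a J)(j := a j) = a" "restrict a J \<in> J \<rightarrow>\<^sub>E {..k}"
    using insert.prems(1) insert.hyps(2) by (auto simp: PiE_iff extensional_def fun_eq_iff restrict_def)
  then have "\<mu> ((restrict a J)(j := a j)) \<noteq> 0" using insert.prems(2) by metis
  from insert.IH[OF \<open>restrict a J \<in> J \<rightarrow>\<^sub>E {..k}\<close>, of "\<lambda>b. \<mu> (b(j := a j))", OF this]
  obtain y where y: "?c (a j) y \<noteq> 0" by blast
  define p where "p = (\<Sum>n\<le>k. Polynomial.monom (?c n y) n)"
  have "Polynomial.coeff p (a j) = ?c (a j) y" unfolding p_def using aj by (simp add: coeff_sum)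
  then have "p \<noteq> 0" using y by auto
  then obtain t where t: "poly p t \<noteq> 0" using poly_all_0_iff_0 by blast
  have "?c n (y(j := t)) = ?c n y" for n
  proof (intro sum.cong refl arg_cong2[where f = "(*)"])
    fix b
    show "monom_fun J b (y(j := t)) = monom_fun J b y"
      using insert.hyps(2) by (auto simp: monom_fun_def intro!: prod.cong)
  qed
  then have "(\<Sum>n\<le>k. ?c n (y(j := t)) * (y(j := t)) j ^ n) = poly p t"
    by (simp add: p_def poly_sum poly_monom)
  then show ?case using t unfolding split by metis
qed

lemma mpoly_vanish:
  assumes "f \<in> mpoly I" "g \<in> mpoly I" "f x \<noteq> 0" "\<And>x. f x * g x = 0" shows "g y = 0"
  using mpoly_nonzero2[OF assms(1,2,3), of y] assms(4) by (metis mult_eq_0_iff)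

text \<open>A counting argument: the monomials of degree at most \<open>k\<close> in each of the \<open>\<beta> j\<close> and \<open>h\<close> are too
  many to be independent, and a power of \<open>h\<close> can be cancelled from the relation.\<close>

lemma vanishing_locus_image:
  assumes I: "finite I" and J: "finite J" and IJ: "card I \<le> card J"
    and \<beta>: "\<And>j. j \<in> J \<Longrightarrow> (\<lambda>x. \<beta> x j) \<in> mpoly I" and h: "h \<in> mpoly I" "h x0 \<noteq> 0"
  obtains q y where "q \<in> mpoly J" "q y \<noteq> 0" "\<And>x. h x = 0 \<Longrightarrow> q (\<beta> x) = 0"
proof -
  have "\<forall>j\<in>J. \<exists>k. deg_le I k (\<lambda>x. \<beta> x j)" using mpoly_deg_le[OF I] \<beta> by blast
  then obtain d where d: "\<And>j. j \<in> J \<Longrightarrow> deg_le I (d j) (\<lambda>x. \<beta> x j)" by metis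
  obtain dh where dh: "deg_le I dh h" using mpoly_deg_le[OF I h(1)] by blast
  define K where "K = dh + (\<Sum>j\<in>J. d j)"
  have hK: "deg_le I K h" by (rule deg_le_mono[OF I dh]) (simp add: K_def)
  have \<beta>K: "deg_le I K (\<lambda>x. \<beta> x j)" if "j \<in> J" for j
    by (rule deg_le_mono[OF I d[OF that]]) (use member_le_sum[OF that, of d] J in \<open>simp add: K_def\<close>)
  \<comment> \<open>\<open>L\<close> bounds the degrees of the products
    \<open>h x ^ n * monom_fun J b (\<beta> x)\<close> with all exponents at most \<open>k\<close>,
    and \<open>L + 1 \<le> C * (k + 1)\<close>. The choice of \<open>k\<close> gives
    \<open>(L + 1) ^ card I \<le> k * (k + 1) ^ card I\<close>, less than the number
    \<open>(k + 1) ^ (card J + 1)\<close> of products because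
    \<open>card I \<le> card J\<close>.\<close>
  define C where "C = (card J + 1) * K + 1"
  define k where "k = C ^ card I"
  define L where "L = (card J + 1) * (k * K)"
  let ?B = "{..k} \<times> (J \<rightarrow>\<^sub>E {..k})"
  let ?G = "\<lambda>(n, b) x. h x ^ n * monom_fun J b (\<beta> x)"
  have fB: "finite ?B" using J by (intro finite_cartesian_product finite_PiE) auto
  have G: "deg_le I L (?G p)" if p: "p \<in> ?B" for p
  proof -
    obtain n b where nb: "p = (n, b)" "n \<le> k" "b \<in> J \<rightarrow>\<^sub>E {..k}" using p by auto
    have "deg_le I (k * K) (\<lambda>x. \<beta> x j ^ b j)" if "j \<in> J" for j
      using nb(3) that by (intro deg_le_mono[OF I deg_le_power[OF I \<beta>K[OF that]]]) (auto intro: mult_le_mono1)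
    then have "deg_le I (card J * (k * K)) (\<lambda>x. \<Prod>j\<in>J. \<beta> x j ^ b j)" by (intro deg_le_prod I J)
    then have "deg_le I (card J * (k * K)) (\<lambda>x. monom_fun J b (\<beta> x))" by (simp add: monom_fun_def)
    from deg_le_mult[OF I deg_le_power[OF I hK, of n] this]
    show ?thesis unfolding nb case_prod_conv
      by (rule deg_le_mono[OF I]) (use nb(2) in \<open>simp add: L_def algebra_simps\<close>)
  qed
  have "L + 1 \<le> C * (k + 1)" unfolding L_def C_def by (simp add: algebra_simps)
  then have "(L + 1) ^ card I \<le> C ^ card I * (k + 1) ^ card I"
    by (metis power_mono power_mult_distrib zero_le)
  also have "\<dots> < (k + 1) * (k + 1) ^ card I" by (simp add: k_def)
  also have "\<dots> \<le> (k + 1) * (k + 1) ^ card J" using IJ by (intro mult_left_mono power_increasing) auto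
  also have "\<dots> = card ?B" using J by (simp add: card_cartesian_product card_PiE)
  finally have card: "(L + 1) ^ card I < card ?B" .
  obtain \<mu> p0 where \<mu>: "p0 \<in> ?B" "\<mu> p0 \<noteq> 0" "\<And>x. (\<Sum>p\<in>?B. \<mu> p * ?G p x) = 0"
  proof (rule deg_le_dependent[OF I fB G card])
    fix \<mu> p assume "p \<in> ?B" "\<mu> p \<noteq> 0" "\<And>x. (\<Sum>p\<in>?B. \<mu> p * ?G p x) = 0"
    then show thesis by (rule that)
  qed
  let ?P = "\<lambda>n y. \<Sum>b\<in>J \<rightarrow>\<^sub>E {..k}. \<mu> (n, b) * monom_fun J b y"
  \<comment> \<open>The lowest power of \<open>h\<close> that occurs. After division by
    \<open>h x ^ n0\<close> only the summand of \<open>n0\<close> survives where \<open>h\<close>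
    vanishes.\<close>
  define n0 where "n0 = (LEAST n. n \<le> k \<and> (\<exists>b\<in>J \<rightarrow>\<^sub>E {..k}. \<mu> (n, b) \<noteq> 0))"
  have ex: "\<exists>n. n \<le> k \<and> (\<exists>b\<in>J \<rightarrow>\<^sub>E {..k}. \<mu> (n, b) \<noteq> 0)" using \<mu>(1,2) by auto
  have n0: "n0 \<le> k" "\<exists>b\<in>J \<rightarrow>\<^sub>E {..k}. \<mu> (n0, b) \<noteq> 0" using LeastI_ex[OF ex] unfolding n0_def by blast+
  have below: "?P n y = 0" if "n < n0" for n y
    using not_less_Least[of n "\<lambda>n. n \<le> k \<and> (\<exists>b\<in>J \<rightarrow>\<^sub>E {..k}. \<mu> (n, b) \<noteq> 0)", folded n0_def] that n0(1)
    by (intro sum.neutral) auto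
  define S where "S x = (\<Sum>n\<in>{n0..k}. h x ^ (n - n0) * ?P n (\<beta> x))" for x
  have Pm: "?P n \<in> mpoly J" for n by (intro mpoly_sum mpoly.mult mpoly.const monom_fun_mpoly)
  have Sm: "S \<in> mpoly I" unfolding S_def
    by (intro mpoly_sum mpoly.mult mpoly_power h(1) mpoly_comp[OF Pm] \<beta>)
  have hS: "h x ^ n0 * S x = 0" for x
  proof -
    have "0 = (\<Sum>n\<le>k. \<Sum>b\<in>J \<rightarrow>\<^sub>E {..k}. \<mu> (n, b) * (h x ^ n * monom_fun J b (\<beta> x)))"
      unfolding sum.cartesian_product \<mu>(3)[of x, symmetric] by (intro sum.cong refl) auto
    also have "\<dots> = (\<Sum>n\<le>k. h x ^ n * ?P n (\<beta> x))"
      unfolding sum_distrib_left by (intro sum.cong refl) (simp only: ac_simps)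
    also have "\<dots> = (\<Sum>n\<in>{n0..k}. h x ^ n * ?P n (\<beta> x))"
    proof (rule sum.mono_neutral_right)
      show "\<forall>n\<in>{..k} - {n0..k}. h x ^ n * ?P n (\<beta> x) = 0"
      proof
        fix n assume "n \<in> {..k} - {n0..k}"
        then have "n < n0" by auto
        from below[OF this] show "h x ^ n * ?P n (\<beta> x) = 0" by (simp only: mult_zero_right)
      qed
    qed auto
    also have "\<dots> = h x ^ n0 * S x" unfolding S_def sum_distrib_left[of "h x ^ n0"]
    proof (intro sum.cong refl)
      fix n assume "n \<in> {n0..k}"
      then have "h x ^ n = h x ^ n0 * h x ^ (n - n0)" by (simp flip: power_add)
      then show "h x ^ n * ?P n (\<beta> x) = h x ^ n0 * (h x ^ (n - n0) * ?P n (\<beta> x))" by (simp only: mult.assoc)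
    qed
    finally show ?thesis by simp
  qed
  have S0: "S x = 0" for x
    by (rule mpoly_vanish[OF mpoly_power[OF h(1), of n0] Sm, of x0]) (use h(2) hS in simp_all)
  obtain b where "b \<in> J \<rightarrow>\<^sub>E {..k}" "\<mu> (n0, b) \<noteq> 0" using n0(2) by blast
  from monom_sum_nonzero[OF J this(1), of "\<lambda>b. \<mu> (n0, b)"] this(2) obtain y where y: "?P n0 y \<noteq> 0" by blast
  have "?P n0 (\<beta> x) = 0" if "h x = 0" for x
  proof -
    have "S x = (\<Sum>n\<in>{n0..k}. if n = n0 then ?P n0 (\<beta> x) else 0)"
      unfolding S_def by (intro sum.cong refl) (use that in auto)
    then show ?thesis using S0[of x] n0(1) by simp
  qed
  then show ?thesis using that[OF Pm[of n0] y] by blast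
qed

section \<open>Injective polynomial maps and dimension\<close>

lemma Euclidean_space_top_of_set: "Euclidean_space n = top_of_set {x. \<forall>i\<ge>n. x i = 0}"
  unfolding Euclidean_space_def by (simp add: euclidean_product_topology)

lemma mpoly_continuous:
  fixes enc :: "(nat \<Rightarrow> real) \<Rightarrow> 'i \<Rightarrow> complex"
  assumes "f \<in> mpoly I" "\<And>i. i \<in> I \<Longrightarrow> continuous_on S (\<lambda>y. enc y i)"
  shows "continuous_on S (\<lambda>y. f (enc y))"
  using assms by (induction rule: mpoly.induct) (auto intro: continuous_intros)

text \<open>An injective polynomial map on a nonempty Zariski-open subset of affine space does not lower the
  dimension, by invariance of domain.\<close>

lemma injective_mpoly_card_le:
  assumes I: "finite I" and J: "finite J"
    and \<beta>: "\<And>j. j \<in> J \<Longrightarrow> (\<lambda>x. \<beta> x j) \<in> mpoly I" and g: "g \<in> mpoly I" "g x0 \<noteq> 0"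
    and inj: "\<And>x y. x \<in> I \<rightarrow>\<^sub>E UNIV \<Longrightarrow> y \<in> I \<rightarrow>\<^sub>E UNIV \<Longrightarrow> g x \<noteq> 0 \<Longrightarrow> g y \<noteq> 0 \<Longrightarrow> (\<And>j. j \<in> J \<Longrightarrow> \<beta> x j = \<beta> y j) \<Longrightarrow> x = y"
  shows "card I \<le> card J"
proof (rule ccontr)
  assume "\<not> card I \<le> card J"
  then have lt: "card J < card I" by simp
  define N where "N = card I"
  define M where "M = card J"
  obtain e where e: "bij_betw e {..<N} I" using ex_bij_betw_nat_finite[OF I] by (auto simp: N_def atLeast0LessThan)
  obtain f where f: "bij_betw f {..<M} J" using ex_bij_betw_nat_finite[OF J] by (auto simp: M_def atLeast0LessThan)
  define e' where "e' = the_inv_into {..<N} e"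
  have e': "e' i < N" "e (e' i) = i" if "i \<in> I" for i
    using the_inv_into_into[of e "{..<N}" i "{..<N}"] f_the_inv_into_f[of e "{..<N}" i] e that
    by (auto simp: e'_def bij_betw_def)
  have e'e: "e' (e n) = n" if "n < N" for n
    using e that by (simp add: e'_def bij_betw_def the_inv_into_f_f)
  define enc where "enc y = (\<lambda>i\<in>I. of_real (y (2 * e' i)) + \<i> * of_real (y (2 * e' i + 1)))" for y :: "nat \<Rightarrow> real"
  \<comment> \<open>The polynomial map in real coordinates, with real parts at even and imaginary
    parts at odd indices. The image is padded by zeros to the \<open>2 * N\<close> real dimensions
    of the source, since invariance of domain compares equal dimensions.\<close>
  define \<Phi> where "\<Phi> y = (\<lambda>n. if n < 2 * M then (if even n then Re else Im) (\<beta> (enc y) (f (n div 2))) else 0)" for y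
  let ?T = "{x :: nat \<Rightarrow> real. \<forall>i\<ge>2 * N. x i = 0}"
  let ?U = "{y \<in> ?T. g (enc y) \<noteq> 0}"
  have enc_c: "continuous_on S (\<lambda>y. enc y i)" if "i \<in> I" for S i
    using that unfolding enc_def by (auto intro!: continuous_intros continuous_on_subset[OF continuous_on_product_coordinates])
  have cont: "continuous_on S (\<lambda>y. p (enc y))" if "p \<in> mpoly I" for p S
    by (rule mpoly_continuous[OF that enc_c])
  have U: "openin (Euclidean_space (2 * N)) ?U"
  proof -
    have "openin (top_of_set ?T) (?T \<inter> (\<lambda>y. g (enc y)) -` (- {0}))"
      by (rule continuous_openin_preimage_gen[OF cont[OF g(1)]]) auto
    moreover have "?T \<inter> (\<lambda>y. g (enc y)) -` (- {0}) = ?U" by auto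
    ultimately show ?thesis unfolding Euclidean_space_top_of_set by simp
  qed
  have \<Phi>T: "\<Phi> y \<in> ?T" for y using lt by (auto simp: \<Phi>_def M_def N_def)
  have \<Phi>c: "continuous_on S \<Phi>" for S
  proof (rule continuous_on_coordinatewise_then_product)
    fix n
    show "continuous_on S (\<lambda>y. \<Phi> y n)"
    proof (cases "n < 2 * M")
      case True
      then have "f (n div 2) \<in> J" using f by (auto simp: bij_betw_def)
      from cont[OF \<beta>[OF this]] show ?thesis using True
        by (cases "even n") (auto simp: \<Phi>_def intro!: continuous_intros)
    next
      case False
      then show ?thesis by (simp add: \<Phi>_def)
    qed
  qed
  have "openin (Euclidean_space (2 * N)) (\<Phi> ` ?U)"
  proof (rule invariance_of_domain_Euclidean_space[OF U])
    show "continuous_map (subtopology (Euclidean_space (2 * N)) ?U) (Euclidean_space (2 * N)) \<Phi>"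
      unfolding Euclidean_space_top_of_set subtopology_subtopology using \<Phi>c \<Phi>T
      by (auto simp: continuous_map_in_subtopology)
    show "inj_on \<Phi> ?U"
    proof (rule inj_onI)
      fix y y' assume y: "y \<in> ?U" "y' \<in> ?U" "\<Phi> y = \<Phi> y'"
      have "\<beta> (enc y) j = \<beta> (enc y') j" if j: "j \<in> J" for j
      proof -
        obtain k where k: "k < M" "f k = j" using f j by (auto simp: bij_betw_def)
        have "\<Phi> y (2 * k) = \<Phi> y' (2 * k)" "\<Phi> y (2 * k + 1) = \<Phi> y' (2 * k + 1)" using y(3) by auto
        then show ?thesis using k by (simp add: \<Phi>_def complex_eq_iff)
      qed
      then have eq: "enc y = enc y'" using inj[of "enc y" "enc y'"] y by (auto simp: enc_def)
      have "y n = y' n" for n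
      proof (cases "n < 2 * N")
        case True
        then have n2: "n div 2 < N" by simp
        then have "e (n div 2) \<in> I" using e by (auto simp: bij_betw_def)
        then have "of_real (y (2 * (n div 2))) + \<i> * of_real (y (2 * (n div 2) + 1))
            = of_real (y' (2 * (n div 2))) + \<i> * of_real (y' (2 * (n div 2) + 1))"
          using fun_cong[OF eq, of "e (n div 2)"] e'e[OF n2] by (simp add: enc_def)
        then have "y (2 * (n div 2)) = y' (2 * (n div 2))" "y (2 * (n div 2) + 1) = y' (2 * (n div 2) + 1)"
          by (simp_all add: complex_eq_iff)
        then show ?thesis by (cases "even n") (auto elim!: evenE oddE)
      next
        case False then show ?thesis using y by simp
      qed
      then show "y = y'" by blast
    qed
  qed
  then obtain A where A: "open A" "\<Phi> ` ?U = ?T \<inter> A" unfolding Euclidean_space_top_of_set openin_open by blast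
  define y0 where "y0 n = (if n < 2 * N then (if even n then Re else Im) (x0 (e (n div 2))) else 0)" for n
  have "enc y0 i = x0 i" if "i \<in> I" for i
    using e'[OF that] that by (simp add: enc_def y0_def complex_eq_iff)
  then have "g (enc y0) = g x0" by (rule mpoly_cong[OF g(1)])
  then have "y0 \<in> ?U" using g(2) by (simp add: y0_def)
  then have b: "\<Phi> y0 \<in> A" using A(2) by blast
  \<comment> \<open>The last real coordinate, which the padding makes \<open>0\<close> on the whole
    image. An open image would contain points that differ from \<open>\<Phi> y0\<close> in
    it.\<close>
  let ?m = "2 * N - 1"
  have m: "2 * M \<le> ?m" "?m < 2 * N" using lt by (auto simp: M_def N_def)
  have "continuous_on UNIV (\<lambda>t::real. (\<Phi> y0)(?m := t))"
  proof (rule continuous_on_coordinatewise_then_product)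
    fix i show "continuous_on UNIV (\<lambda>t::real. ((\<Phi> y0)(?m := t)) i)" by (cases "i = ?m") simp_all
  qed
  then have "open ((\<lambda>t::real. (\<Phi> y0)(?m := t)) -` A)" using A(1) by (simp add: open_vimage)
  moreover have "(\<lambda>t::real. (\<Phi> y0)(?m := t)) -` A = {0}"
  proof -
    have z: "\<Phi> y ?m = 0" for y using m by (simp add: \<Phi>_def)
    have "t = 0" if "(\<Phi> y0)(?m := t) \<in> A" for t
    proof -
      have "(\<Phi> y0)(?m := t) \<in> ?T" using \<Phi>T[of y0] m by auto
      then have "(\<Phi> y0)(?m := t) \<in> \<Phi> ` ?U" using A(2) that by blast
      then obtain y where "(\<Phi> y0)(?m := t) = \<Phi> y" by blast
      then show ?thesis using z[of y] by (metis fun_upd_same)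
    qed
    moreover have "(\<Phi> y0)(?m := 0) = \<Phi> y0" using z[of y0] by (metis fun_upd_triv)
    ultimately show ?thesis using b by auto
  qed
  ultimately show False using not_open_singleton[of "0::real"] by simp
qed

section \<open>Polynomial functions of tuples of vectors\<close>

lemma polyfun_mpoly:
  fixes f :: "('i \<Rightarrow> complex ^ 'm) \<Rightarrow> complex"
  assumes "f \<in> polyfun I" "\<And>i k. i \<in> I \<Longrightarrow> (\<lambda>x. g x i $ k) \<in> mpoly J"
  shows "(\<lambda>x. f (g x)) \<in> mpoly J"
  using assms by (induction rule: polyfun.induct) (simp_all add: mpoly.const mpoly.add mpoly.mult)

lemma mpoly_polyfun:
  assumes "f \<in> mpoly J" "\<And>j. j \<in> J \<Longrightarrow> (\<lambda>x. g x j) \<in> polyfun I"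
  shows "(\<lambda>x. f (g x)) \<in> polyfun I"
  using assms by (induction rule: mpoly.induct) (simp_all add: polyfun.const polyfun.add polyfun.mult)

lemma polyfun_cong: "f \<in> polyfun I \<Longrightarrow> (\<And>i. i \<in> I \<Longrightarrow> x i = y i) \<Longrightarrow> f x = f y"
  by (induction rule: polyfun.induct) auto

lemma polyfun_comp:
  assumes "f \<in> polyfun I" "\<And>i k. i \<in> I \<Longrightarrow> (\<lambda>x. g x i $ k) \<in> polyfun J"
  shows "(\<lambda>x. f (g x)) \<in> polyfun J"
  using assms by (induction rule: polyfun.induct) (simp_all add: polyfun.const polyfun.add polyfun.mult)

lemma polyfun_sum: "(\<And>a. a \<in> A \<Longrightarrow> f a \<in> polyfun I) \<Longrightarrow> (\<lambda>x. \<Sum>a\<in>A. f a x) \<in> polyfun I"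
  by (induction A rule: infinite_finite_induct) (simp_all add: polyfun.const polyfun.add polyfun.mult)

lemma polyfun_prod: "(\<And>a. a \<in> A \<Longrightarrow> f a \<in> polyfun I) \<Longrightarrow> (\<lambda>x. \<Prod>a\<in>A. f a x) \<in> polyfun I"
  by (induction A rule: infinite_finite_induct) (simp_all add: polyfun.const polyfun.add polyfun.mult)

lemma polyfun_nonzero_family:
  fixes F :: "'a \<Rightarrow> ('i \<Rightarrow> complex ^ 'm) \<Rightarrow> complex"
  assumes "finite A" "\<And>a. a \<in> A \<Longrightarrow> F a \<in> polyfun I" "\<And>a. a \<in> A \<Longrightarrow> \<exists>x. F a x \<noteq> 0"
  obtains z where "z \<in> I \<rightarrow>\<^sub>E UNIV" "\<And>a. a \<in> A \<Longrightarrow> F a z \<noteq> 0"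
proof -
  let ?v = "\<lambda>y i. \<chi> k. y (i, k)"
  have "\<exists>y. \<forall>a\<in>A. F a (?v y) \<noteq> 0"
  proof (rule mpoly_nonzero_family[OF assms(1)])
    show "(\<lambda>y. F a (?v y)) \<in> mpoly (I \<times> UNIV)" if "a \<in> A" for a
      by (rule polyfun_mpoly[OF assms(2)[OF that]]) (auto intro: mpoly.intros)
    show "\<exists>y. F a (?v y) \<noteq> 0" if a: "a \<in> A" for a
    proof -
      obtain x where "F a x \<noteq> 0" using assms(3)[OF a] by blast
      moreover have "?v (\<lambda>(i, k). x i $ k) = x" by (simp add: fun_eq_iff vec_eq_iff)
      ultimately show ?thesis by metis
    qed
  qed
  then obtain y where y: "\<forall>a\<in>A. F a (?v y) \<noteq> 0" by blast
  have "F a (restrict (?v y) I) = F a (?v y)" if "a \<in> A" for a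
    by (rule polyfun_cong[OF assms(2)[OF that]]) simp
  then show ?thesis using that[of "restrict (?v y) I"] y by auto
qed

section \<open>Acyclic orientations and solutions of the relations\<close>

locale plabic =
  fixes G :: "('e, 'x) plabic_scheme"
  assumes pg: "plabic_graph G"
begin

lemma fin: "finite (blacks G)" "finite (whites G)" "finite (edges G)" "finite (all_blacks G)"
  using pg by (auto simp: plabic_graph_def all_blacks_def boundary_verts_def)

lemma bvert_circle:
  obtains \<theta> where "\<And>j. j \<in> {1..nbd G} \<Longrightarrow> bvert G j = cis (\<theta> j)"
    "\<And>j k. j \<in> {1..nbd G} \<Longrightarrow> k \<in> {1..nbd G} \<Longrightarrow> j < k \<Longrightarrow> \<theta> k < \<theta> j \<and> \<theta> j < \<theta> k + 2 * pi"
  using pg unfolding plabic_graph_def clockwise_def by auto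

lemma boundary_norm: "b \<in> boundary_verts G \<Longrightarrow> norm b = 1"
  by (rule bvert_circle) (auto simp: boundary_verts_def)

lemma internal_norm: "x \<in> blacks G \<union> whites G \<Longrightarrow> norm x < 1"
  using pg by (auto simp: plabic_graph_def)

lemma black_white: "b \<in> all_blacks G \<Longrightarrow> b \<notin> whites G"
proof
  assume b: "b \<in> all_blacks G" and w: "b \<in> whites G"
  have "blacks G \<inter> whites G = {}" using pg by (simp add: plabic_graph_def)
  then have "b \<in> boundary_verts G" using b w by (auto simp: all_blacks_def)
  then show False using boundary_norm[of b] internal_norm[of b] w by simp
qed

lemma blacks_boundary: "b \<in> blacks G \<Longrightarrow> b \<notin> boundary_verts G"
  using boundary_norm[of b] internal_norm[of b] by auto

lemma edge: "e \<in> edges G \<Longrightarrow> blk G e \<in> all_blacks G" "e \<in> edges G \<Longrightarrow> wht G e \<in> whites G"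
  using pg by (auto simp: plabic_graph_def)

lemma boundary_edge: "b \<in> boundary_verts G \<Longrightarrow> card (incident G b) = 1"
  using pg by (auto simp: plabic_graph_def)

lemma incident_black:
  assumes "b \<in> all_blacks G" shows "incident G b = {e \<in> edges G. blk G e = b}"
proof -
  have "wht G e \<noteq> b" if "e \<in> edges G" for e using black_white[OF assms] edge(2)[OF that] by auto
  then show ?thesis unfolding incident_def by auto
qed

lemma incident_white:
  assumes "w \<in> whites G" shows "incident G w = {e \<in> edges G. wht G e = w}"
proof -
  have "blk G e \<noteq> w" if "e \<in> edges G" for e using black_white[OF edge(1)[OF that]] assms by auto
  then show ?thesis unfolding incident_def by auto
qed

lemma connected: "x \<in> blacks G \<union> whites G \<Longrightarrow> \<exists>y\<in>boundary_verts G. (x, y) \<in> (adj G)\<^sup>*"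
  using pg by (simp add: plabic_graph_def)

lemma leafless: "x \<in> blacks G \<union> whites G \<Longrightarrow> card (incident G x) = 1 \<Longrightarrow> \<exists>y\<in>boundary_verts G. (x, y) \<in> adj G"
  using pg by (simp add: plabic_graph_def)

lemma black_has_edge:
  assumes "b \<in> all_blacks G" shows "\<exists>e\<in>edges G. blk G e = b"
proof (cases "b \<in> boundary_verts G")
  case True
  then have "incident G b \<noteq> {}" using boundary_edge by force
  then show ?thesis using incident_black[OF assms] by auto
next
  case False
  then have "b \<in> blacks G" using assms by (simp add: all_blacks_def)
  then obtain y where y: "y \<in> boundary_verts G" "(b, y) \<in> (adj G)\<^sup>*"
    using connected[of b] by blast
  then have "b \<noteq> y" using False by blast
  then obtain z where "(b, z) \<in> adj G" using y(2) by (metis converse_rtranclE)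
  then obtain e where "e \<in> edges G" "{b, z} = {blk G e, wht G e}" by (auto simp: adj_def)
  then show ?thesis using black_white[OF assms] edge(2)[of e] by (metis doubleton_eq_iff)
qed

lemma adj_boundary:
  assumes "(x, y) \<in> adj G" "y \<in> boundary_verts G"
  obtains e where "e \<in> edges G" "blk G e = y" "wht G e = x"
proof -
  obtain e where e: "e \<in> edges G" "{x, y} = {blk G e, wht G e}" using assms(1) by (auto simp: adj_def)
  have "y \<in> all_blacks G" using assms(2) by (simp add: all_blacks_def)
  then have "y \<noteq> wht G e" using black_white edge(2)[OF e(1)] by blast
  then show ?thesis using that[OF e(1)] e(2) by (metis doubleton_eq_iff)
qed

text \<open>A black leaf would have to be adjacent to a boundary vertex, which is black too.\<close>

lemma internal_black_degree:
  assumes b: "b \<in> blacks G" and f: "f \<in> edges G" "blk G f = b"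
  shows "\<exists>e\<in>edges G. blk G e = b \<and> e \<noteq> f"
proof (rule ccontr)
  assume "\<not> ?thesis"
  then have "\<And>e. e \<in> edges G \<Longrightarrow> blk G e = b \<Longrightarrow> e = f" by blast
  then have "{e \<in> edges G. blk G e = b} = {f}" using f by blast
  moreover have bB: "b \<in> all_blacks G" using b by (simp add: all_blacks_def)
  ultimately have "incident G b = {f}" using incident_black by simp
  then have "card (incident G b) = 1" by simp
  then obtain y where y: "y \<in> boundary_verts G" "(b, y) \<in> adj G" using leafless[of b] b by blast
  obtain e where "e \<in> edges G" "wht G e = b" using adj_boundary[OF y(2,1)] by blast
  then show False using edge(2)[of e] black_white[OF bB] by simp
qed

end

locale rpo_graph = plabic G for G :: "('e, 'x) plabic_scheme" +
  fixes F :: "'e set"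
  assumes rpo: "acyclic_rpo G F"
begin

lemma F_edges: "f \<in> F \<Longrightarrow> f \<in> edges G"
  using rpo by (auto simp: acyclic_rpo_def reverse_perfect_orientation_def)

lemma acyclic: "acyclic (arcs_of G F)"
  using rpo by (simp add: acyclic_rpo_def)

lemma white_out:
  assumes "w \<in> whites G" shows "\<exists>!f. f \<in> F \<and> wht G f = w"
proof -
  have "card {f \<in> F. wht G f = w} = 1"
    using rpo assms by (auto simp: acyclic_rpo_def reverse_perfect_orientation_def)
  then obtain f where "{f \<in> F. wht G f = w} = {f}" by (auto simp: card_1_singleton_iff)
  then show ?thesis by (intro ex1I[of _ f]) auto
qed

lemma F_white_inj: "f \<in> F \<Longrightarrow> f' \<in> F \<Longrightarrow> wht G f = wht G f' \<Longrightarrow> f = f'"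
  using white_out[OF edge(2)[OF F_edges]] by blast

text \<open>The orientation constrains internal vertices only; at the boundary uniqueness comes from
  degree one.\<close>

lemma F_black_inj:
  assumes f: "f \<in> F" "f' \<in> F" "blk G f = blk G f'" shows "f = f'"
proof -
  have "card {e \<in> F. blk G e = blk G f} \<le> 1"
  proof (cases "blk G f \<in> blacks G")
    case True
    then show ?thesis using rpo by (auto simp: acyclic_rpo_def reverse_perfect_orientation_def)
  next
    case False
    then have "blk G f \<in> boundary_verts G" using edge(1)[OF F_edges[OF f(1)]] by (simp add: all_blacks_def)
    then have 1: "card (incident G (blk G f)) = 1" by (rule boundary_edge)
    have "{e \<in> F. blk G e = blk G f} \<subseteq> incident G (blk G f)" using F_edges by (auto simp: incident_def)
    then have "card {e \<in> F. blk G e = blk G f} \<le> card (incident G (blk G f))"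
      by (intro card_mono) (auto simp: incident_def fin)
    then show ?thesis using 1 by simp
  qed
  moreover have "finite {e \<in> F. blk G e = blk G f}" using F_edges fin(3) by (auto intro: finite_subset[of _ "edges G"])
  ultimately show ?thesis using f by (auto simp: card_le_Suc0_iff_eq)
qed

definition is_source :: "complex \<Rightarrow> bool"
  where "is_source b \<longleftrightarrow> (\<forall>f\<in>F. blk G f \<noteq> b)"

definition in_edge :: "complex \<Rightarrow> 'e"
  where "in_edge b = (THE f. f \<in> F \<and> blk G f = b)"

lemma in_edge_eq [simp]: "f \<in> F \<Longrightarrow> in_edge (blk G f) = f"
  unfolding in_edge_def using F_black_inj by blast

lemma in_edge: assumes "\<not> is_source b" shows "in_edge b \<in> F" "blk G (in_edge b) = b"
proof -
  obtain f where "f \<in> F" "blk G f = b" using assms by (auto simp: is_source_def)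
  then show "in_edge b \<in> F" "blk G (in_edge b) = b" by auto
qed

lemma source_boundary: "b \<in> all_blacks G \<Longrightarrow> is_source b \<Longrightarrow> b \<in> boundary_verts G"
proof (rule ccontr)
  assume b: "b \<in> all_blacks G" "is_source b" "b \<notin> boundary_verts G"
  then have "card {e \<in> F. blk G e = b} = 1"
    using rpo by (auto simp: acyclic_rpo_def reverse_perfect_orientation_def all_blacks_def)
  moreover have "{e \<in> F. blk G e = b} = {}" using b(2) by (auto simp: is_source_def)
  ultimately show False by simp
qed

lemma boundary_sources_eq: "boundary_sources G F = {b \<in> boundary_verts G. is_source b}"
proof -
  have "b \<in> Range (arcs_of G F) \<longleftrightarrow> \<not> is_source b" if "b \<in> boundary_verts G" for b
    using that black_white[of b] edge F_edges unfolding arcs_of_def is_source_def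
    by (auto simp: all_blacks_def Range_iff) blast+
  then show ?thesis by (auto simp: boundary_sources_def)
qed

text \<open>By the relation at the white vertex in front of \<open>b\<close>, the vector at
  \<open>b\<close> is determined by the vectors at the black ends of these edges. The set is
  meaningful only when \<open>b\<close> is not a source.\<close>

definition feeds :: "complex \<Rightarrow> 'e set"
  where "feeds b = {e \<in> edges G - F. wht G e = wht G (in_edge b)}"

text \<open>Dependence between black vertices, two arcs of the orientation at a time. Acyclicity
  makes it well-founded in both directions, which supports the recursions and inductions
  below.\<close>

definition prec :: "complex rel"
  where "prec = {(blk G e, b) | e b. \<not> is_source b \<and> e \<in> feeds b}"

lemma finite_feeds: "finite (feeds b)" using fin by (simp add: feeds_def)

lemma arc_out: "f \<in> F \<Longrightarrow> (wht G f, blk G f) \<in> arcs_of G F"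
  using F_edges by (auto simp: arcs_of_def)

lemma arc_in: "e \<in> edges G - F \<Longrightarrow> (blk G e, wht G e) \<in> arcs_of G F"
  by (auto simp: arcs_of_def)

lemma prec_trancl: "prec \<subseteq> (arcs_of G F)\<^sup>+"
proof (rule subrelI)
  fix x y assume "(x, y) \<in> prec"
  then obtain e where e: "x = blk G e" "\<not> is_source y" "e \<in> feeds y" by (auto simp: prec_def)
  have eF: "e \<in> edges G - F" and wh: "wht G e = wht G (in_edge y)" using e(3) by (simp_all add: feeds_def)
  have "(x, wht G e) \<in> arcs_of G F" unfolding e(1) by (rule arc_in[OF eF])
  moreover have "(wht G e, y) \<in> arcs_of G F" using arc_out[OF in_edge(1)[OF e(2)]] in_edge(2)[OF e(2)] unfolding wh by simp
  ultimately show "(x, y) \<in> (arcs_of G F)\<^sup>+" by auto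
qed

lemma acyclic_prec: "acyclic prec"
proof -
  have "acyclic ((arcs_of G F)\<^sup>+)" using acyclic by (simp add: acyclic_def)
  then show ?thesis using prec_trancl acyclic_subset by blast
qed

lemma finite_prec: "finite prec"
proof -
  have "prec \<subseteq> all_blacks G \<times> all_blacks G"
    using edge in_edge F_edges by (fastforce simp: prec_def feeds_def)
  then show ?thesis using fin(4) finite_subset by blast
qed

lemma wf_prec: "wf prec"
  using finite_acyclic_wf[OF finite_prec acyclic_prec] .

lemma wf_prec_converse: "wf (prec\<inverse>)"
  using finite_acyclic_wf_converse[OF finite_prec acyclic_prec] .

lemma feeds_black: "e \<in> feeds b \<Longrightarrow> blk G e \<in> all_blacks G"
  using edge by (auto simp: feeds_def)

lemma feeds_prec: "\<not> is_source b \<Longrightarrow> e \<in> feeds b \<Longrightarrow> (blk G e, b) \<in> prec"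
  by (auto simp: prec_def)

lemma black_induct [consumes 1, case_names source step]:
  assumes b: "b \<in> all_blacks G"
    and source: "\<And>b. b \<in> all_blacks G \<Longrightarrow> is_source b \<Longrightarrow> P b"
    and step: "\<And>b. b \<in> all_blacks G \<Longrightarrow> \<not> is_source b \<Longrightarrow> (\<And>e. e \<in> feeds b \<Longrightarrow> P (blk G e)) \<Longrightarrow> P b"
  shows "P b"
  using b
proof (induction b rule: wf_induct_rule[OF wf_prec])
  case (1 b)
  then show ?case using source step feeds_prec feeds_black by (cases "is_source b") blast+
qed

lemma white_edges:
  assumes "\<not> is_source b"
  shows "{e \<in> edges G. wht G e = wht G (in_edge b)} = insert (in_edge b) (feeds b)" "in_edge b \<notin> feeds b"
  using in_edge[OF assms] F_edges F_white_inj by (auto simp: feeds_def)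

lemma white_below:
  assumes "w \<in> whites G"
  obtains b where "b \<in> all_blacks G" "\<not> is_source b" "wht G (in_edge b) = w"
proof -
  obtain f where "f \<in> F" "wht G f = w" using white_out[OF assms] by blast
  then show ?thesis using that[of "blk G f"] edge F_edges by (auto simp: is_source_def)
qed

text \<open>Otherwise the white vertex in front of \<open>b\<close> would be a leaf whose only
  neighbour is the internal vertex \<open>b\<close>, against leaflessness.\<close>

lemma feeds_nonempty:
  assumes b: "b \<in> blacks G" shows "feeds b \<noteq> {}"
proof
  assume e: "feeds b = {}"
  have ns: "\<not> is_source b" using source_boundary b blacks_boundary by (auto simp: all_blacks_def)
  let ?w = "wht G (in_edge b)"
  have w: "?w \<in> whites G" using in_edge[OF ns] F_edges edge by blast
  have inc: "incident G ?w = {in_edge b}" using incident_white[OF w] white_edges[OF ns] e by simp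
  then have "card (incident G ?w) = 1" by simp
  then obtain y where y: "y \<in> boundary_verts G" "(?w, y) \<in> adj G" using leafless[of ?w] w by blast
  obtain e where "e \<in> edges G" "blk G e = y" "wht G e = ?w" using adj_boundary[OF y(2,1)] by blast
  then have "e \<in> incident G ?w" unfolding incident_white[OF w] by simp
  then have "e = in_edge b" unfolding inc by simp
  then have "y = b" using \<open>blk G e = y\<close> in_edge(2)[OF ns] by simp
  then show False using y(1) blacks_boundary[OF b] by blast
qed

text \<open>A head of \<open>F\<close> that no head follows in \<open>prec\<close> cannot be
  internal, since an internal black vertex has a second edge and this feeds a later head.\<close>

lemma ex_sink:
  assumes "boundary_verts G \<noteq> {}"
  obtains t where "t \<in> boundary_verts G" "\<not> is_source t"
proof -
  obtain b0 where "b0 \<in> boundary_verts G" using assms by blast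
  then obtain e where "e \<in> edges G" using black_has_edge by (auto simp: all_blacks_def)
  then obtain f0 where "f0 \<in> F" using white_out[OF edge(2)] by blast
  then have "blk G f0 \<in> blk G ` F" by blast
  then obtain t where t: "t \<in> blk G ` F" "\<And>y. (y, t) \<in> prec\<inverse> \<Longrightarrow> y \<notin> blk G ` F"
    using wfE_min[OF wf_prec_converse] by metis
  obtain f where f: "f \<in> F" "blk G f = t" using t(1) by blast
  have "t \<in> boundary_verts G"
  proof (rule ccontr)
    assume "t \<notin> boundary_verts G"
    then have "t \<in> blacks G" using f edge(1)[OF F_edges[OF f(1)]] by (simp add: all_blacks_def)
    then obtain e where e: "e \<in> edges G" "blk G e = t" "e \<noteq> f" using internal_black_degree F_edges f by blast
    then have eF: "e \<notin> F" using F_black_inj f by blast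
    obtain b where b: "\<not> is_source b" "wht G (in_edge b) = wht G e" using white_below[OF edge(2)[OF e(1)]] by blast
    then have "e \<in> feeds b" using e eF by (simp add: feeds_def)
    then have "(t, b) \<in> prec" using feeds_prec[OF b(1)] e(2) by blast
    moreover have "b \<in> blk G ` F" using in_edge[OF b(1)] by (metis image_eqI)
    ultimately show False using t(2)[of b] by simp
  qed
  then show ?thesis using that[of t] f by (auto simp: is_source_def)
qed

text \<open>The solution of the relations with coefficient \<open>-1\<close> on the edges of \<open>F\<close> and \<open>q\<close> on the others, and
  with value \<open>s\<close> at the sources.\<close>

definition sol :: "('e \<Rightarrow> complex) \<Rightarrow> (complex \<Rightarrow> complex ^ 'm) \<Rightarrow> complex \<Rightarrow> complex ^ 'm"
  where "sol q s = wfrec prec (\<lambda>v b. if is_source b then s b else \<Sum>e\<in>feeds b. q e *s v (blk G e))"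

lemma sol: "sol q s b = (if is_source b then s b else \<Sum>e\<in>feeds b. q e *s sol q s (blk G e))"
proof -
  have "sol q s b = (if is_source b then s b else \<Sum>e\<in>feeds b. q e *s cut (sol q s) prec b (blk G e))"
    unfolding sol_def by (subst wfrec[OF wf_prec]) simp
  then show ?thesis using feeds_prec by (simp add: cut_apply cong: sum.cong)
qed

definition rel_holds :: "(complex \<Rightarrow> complex ^ 'm) \<Rightarrow> ('e \<Rightarrow> complex) \<Rightarrow> bool"
  where "rel_holds v r \<longleftrightarrow> (\<forall>w\<in>whites G. (\<Sum>e\<in>{e \<in> edges G. wht G e = w}. r e *s v (blk G e)) = 0)"

text \<open>Every white vertex is in front of exactly one non-source, so its relation can be indexed
  by that black vertex.\<close>

lemma rel_holds_iff:
  "rel_holds v r \<longleftrightarrow> (\<forall>b\<in>all_blacks G. \<not> is_source b \<longrightarrow> r (in_edge b) *s v b + (\<Sum>e\<in>feeds b. r e *s v (blk G e)) = 0)"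
proof -
  have *: "(\<Sum>e\<in>{e \<in> edges G. wht G e = wht G (in_edge b)}. r e *s v (blk G e))
      = r (in_edge b) *s v b + (\<Sum>e\<in>feeds b. r e *s v (blk G e))" if "\<not> is_source b" for b
    unfolding white_edges(1)[OF that] using white_edges(2)[OF that] finite_feeds in_edge(2)[OF that] by simp
  show ?thesis
  proof
    assume a: "rel_holds v r"
    show "\<forall>b\<in>all_blacks G. \<not> is_source b \<longrightarrow> r (in_edge b) *s v b + (\<Sum>e\<in>feeds b. r e *s v (blk G e)) = 0"
    proof (intro ballI impI)
      fix b assume b: "\<not> is_source b"
      have "wht G (in_edge b) \<in> whites G" using in_edge(1)[OF b] F_edges edge(2) by blast
      then show "r (in_edge b) *s v b + (\<Sum>e\<in>feeds b. r e *s v (blk G e)) = 0"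
        using a unfolding rel_holds_def *[OF b, symmetric] by blast
    qed
  next
    assume a: "\<forall>b\<in>all_blacks G. \<not> is_source b \<longrightarrow> r (in_edge b) *s v b + (\<Sum>e\<in>feeds b. r e *s v (blk G e)) = 0"
    show "rel_holds v r" unfolding rel_holds_def
    proof
      fix w assume "w \<in> whites G"
      then obtain b where "b \<in> all_blacks G" "\<not> is_source b" "wht G (in_edge b) = w" by (rule white_below)
      then show "(\<Sum>e\<in>{e \<in> edges G. wht G e = w}. r e *s v (blk G e)) = 0" using a * by auto
    qed
  qed
qed

definition weight :: "('e \<Rightarrow> complex) \<Rightarrow> 'e \<Rightarrow> complex"
  where "weight q e = (if e \<in> F then -1 else q e)"

lemma weight_simps: "\<not> is_source b \<Longrightarrow> weight q (in_edge b) = -1" "e \<in> feeds b \<Longrightarrow> weight q e = q e"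
  using in_edge by (auto simp: weight_def feeds_def)

lemma rel_holds_sol: "rel_holds (sol q s) (weight q)"
  unfolding rel_holds_iff
proof (intro ballI impI)
  fix b assume "\<not> is_source b"
  then show "weight q (in_edge b) *s sol q s b + (\<Sum>e\<in>feeds b. weight q e *s sol q s (blk G e)) = 0"
    by (subst sol) (simp add: weight_simps cong: sum.cong)
qed

lemma sol_unique:
  assumes rel: "rel_holds v r" and F: "\<And>f. f \<in> F \<Longrightarrow> r f = -1" and q: "\<And>e. e \<in> edges G - F \<Longrightarrow> q e = r e"
    and s: "\<And>b. b \<in> boundary_verts G \<Longrightarrow> is_source b \<Longrightarrow> s b = v b" and b: "b \<in> all_blacks G"
  shows "sol q s b = v b"
  using b
proof (induction rule: black_induct)
  case (source b)
  then show ?case using s source_boundary by (subst sol) simp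
next
  case (step b)
  have "r (in_edge b) = -1" using F in_edge step(2) by blast
  moreover have "r (in_edge b) *s v b + (\<Sum>e\<in>feeds b. r e *s v (blk G e)) = 0"
    using rel step(1,2) unfolding rel_holds_iff by blast
  ultimately have "v b = (\<Sum>e\<in>feeds b. r e *s v (blk G e))" by simp
  also have "\<dots> = (\<Sum>e\<in>feeds b. q e *s sol q s (blk G e))"
    using step(3) q by (intro sum.cong) (auto simp: feeds_def)
  finally show ?case using step(2) by (subst sol) simp
qed

lemma span_sources:
  assumes rel: "rel_holds v r" and r: "\<And>e. e \<in> edges G \<Longrightarrow> r e \<noteq> 0" and b: "b \<in> all_blacks G"
  shows "v b \<in> vec.span (v ` boundary_sources G F)"
  using b
proof (induction rule: black_induct)
  case (source b)
  then show ?case using source_boundary boundary_sources_eq by (auto intro: vec.span_base)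
next
  case (step b)
  have ne: "r (in_edge b) \<noteq> 0" using r F_edges in_edge step(2) by blast
  have "r (in_edge b) *s v b = - (\<Sum>e\<in>feeds b. r e *s v (blk G e))"
  proof -
    have "r (in_edge b) *s v b + (\<Sum>e\<in>feeds b. r e *s v (blk G e)) = 0"
      using rel step(1,2) unfolding rel_holds_iff by blast
    then show ?thesis unfolding eq_neg_iff_add_eq_0 .
  qed
  also have "\<dots> \<in> vec.span (v ` boundary_sources G F)"
    by (intro vec.span_neg vec.span_sum vec.span_scale step(3))
  finally have "inverse (r (in_edge b)) *s (r (in_edge b) *s v b) \<in> vec.span (v ` boundary_sources G F)"
    by (rule vec.span_scale)
  then show ?case using ne by simp
qed

lemma vrc_rel: "(v, r) \<in> vrcs G \<Longrightarrow> rel_holds v r"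
  by (simp add: vrcs_def rel_holds_def)

text \<open>The source vectors already span, so there are at least \<open>CARD('m)\<close> sources,
  and some boundary vertex is a sink. The strict inequality makes a boundary in general position
  contain a projective frame.\<close>

lemma card_boundary:
  assumes "(v :: complex \<Rightarrow> complex ^ 'm, r) \<in> vrcs G"
  shows "CARD('m) < nbd G"
proof -
  have r: "\<And>e. e \<in> edges G \<Longrightarrow> r e \<noteq> 0" and sp: "vec.span (v ` boundary_verts G) = UNIV"
    using assms by (auto simp: vrcs_def)
  have bf: "finite (boundary_verts G)" by (simp add: boundary_verts_def)
  have sub: "boundary_sources G F \<subseteq> boundary_verts G" by (auto simp: boundary_sources_def)
  have "v ` boundary_verts G \<subseteq> vec.span (v ` boundary_sources G F)"
    using span_sources[OF vrc_rel[OF assms] r] by (auto simp: all_blacks_def)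
  then have "vec.span (v ` boundary_sources G F) = UNIV"
    using sp vec.span_minimal[OF _ vec.subspace_span] by (metis top.extremum_uniqueI)
  then have "vec.dim (UNIV :: (complex ^ 'm) set) \<le> card (v ` boundary_sources G F)"
    using bf sub by (intro vec.dim_le_card) (auto intro: finite_subset)
  also have "\<dots> \<le> card (boundary_sources G F)" using bf sub finite_subset card_image_le by blast
  finally have 1: "CARD('m) \<le> card (boundary_sources G F)" by (simp add: vec.dim_UNIV card_cart_basis)
  then have "card (boundary_sources G F) \<noteq> 0" using zero_less_card_finite[where 'a = 'm] by linarith
  then have "boundary_verts G \<noteq> {}" using sub by auto
  then obtain t where "t \<in> boundary_verts G" "\<not> is_source t" by (rule ex_sink)
  then have "boundary_sources G F \<subset> boundary_verts G" using sub boundary_sources_eq by auto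
  then have "card (boundary_sources G F) < card (boundary_verts G)" using bf by (rule psubset_card_mono[rotated])
  also have "\<dots> \<le> nbd G" unfolding boundary_verts_def using card_image_le[of "{1..nbd G}" "bvert G"] by simp
  finally show ?thesis using 1 by simp
qed

text \<open>Induction against the orientation: at a black vertex \<open>b\<close> all edges but
  \<open>in_edge b\<close> lead to white vertices in front of later black vertices, so one term of
  the sum at \<open>b\<close> remains.\<close>

lemma no_left_kernel:
  assumes r: "\<And>e. e \<in> edges G \<Longrightarrow> r e \<noteq> (0::complex)"
    and 0: "\<And>b. b \<in> all_blacks G \<Longrightarrow> (\<Sum>e\<in>{e \<in> edges G. blk G e = b}. \<nu> (wht G e) * r e) = 0"
    and w: "w \<in> whites G"
  shows "\<nu> w = 0"
proof -
  have *: "b \<in> all_blacks G \<longrightarrow> \<not> is_source b \<longrightarrow> \<nu> (wht G (in_edge b)) = 0" for b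
  proof (induction b rule: wf_induct_rule[OF wf_prec_converse])
    case (1 b)
    show ?case
    proof (intro impI)
      assume b: "b \<in> all_blacks G" "\<not> is_source b"
      let ?S = "{e \<in> edges G. blk G e = b}"
      have inS: "in_edge b \<in> ?S" using in_edge[OF b(2)] F_edges by blast
      have "\<nu> (wht G e) * r e = 0" if e: "e \<in> ?S - {in_edge b}" for e
      proof -
        have eF: "e \<notin> F" using e F_black_inj[of e "in_edge b"] in_edge[OF b(2)] by auto
        have "wht G e \<in> whites G" using e edge(2) by blast
        then obtain c where c: "c \<in> all_blacks G" "\<not> is_source c" "wht G (in_edge c) = wht G e" by (rule white_below)
        then have "e \<in> feeds c" using e eF by (simp add: feeds_def)
        then have "(b, c) \<in> prec" using feeds_prec[OF c(2)] e by blast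
        then show ?thesis using 1[of c] c by simp
      qed
      then have "(\<Sum>e\<in>?S - {in_edge b}. \<nu> (wht G e) * r e) = 0" by (intro sum.neutral ballI)
      moreover have "(\<Sum>e\<in>?S. \<nu> (wht G e) * r e) = \<nu> (wht G (in_edge b)) * r (in_edge b) + (\<Sum>e\<in>?S - {in_edge b}. \<nu> (wht G e) * r e)"
        using inS fin(3) by (intro sum.remove) simp_all
      ultimately have "(\<Sum>e\<in>?S. \<nu> (wht G e) * r e) = \<nu> (wht G (in_edge b)) * r (in_edge b)" by simp
      then show "\<nu> (wht G (in_edge b)) = 0" using 0[OF b(1)] r[OF F_edges[OF in_edge(1)[OF b(2)]]] by simp
    qed
  qed
  obtain b where "b \<in> all_blacks G" "\<not> is_source b" "wht G (in_edge b) = w" using white_below[OF w] by blast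
  then show ?thesis using * by blast
qed

end

section \<open>Matchings and disjoint paths\<close>

lemma acyclic_path_distinct:
  assumes "acyclic r" "successively (\<lambda>x y. (x, y) \<in> r) p" shows "distinct p"
proof -
  have "(x, z) \<in> r\<^sup>+" if "successively (\<lambda>x y. (x, y) \<in> r) (x # p)" "z \<in> set p" for x z p
    using that
  proof (induction p arbitrary: x)
    case (Cons y p)
    then have xy: "(x, y) \<in> r" by simp
    show ?case
    proof (cases "z = y")
      case True then show ?thesis using xy by auto
    next
      case False
      then have "(y, z) \<in> r\<^sup>+" using Cons by simp
      then show ?thesis using xy by (rule trancl_into_trancl2[rotated])
    qed
  qed simp
  note * = this
  show ?thesis using assms(2)
  proof (induction p)
    case (Cons x p)
    have "x \<notin> set p"
    proof
      assume "x \<in> set p"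
      then have "(x, x) \<in> r\<^sup>+" using *[OF Cons.prems] by blast
      then show False using assms(1) by (simp add: acyclic_def)
    qed
    moreover have "successively (\<lambda>x y. (x, y) \<in> r) p" using Cons.prems by (cases p) auto
    ultimately show ?case using Cons.IH by simp
  qed simp
qed

context rpo_graph begin

lemma arc_to_black:
  assumes "(w, b) \<in> arcs_of G F" "b \<in> all_blacks G"
  obtains f where "f \<in> F" "w = wht G f" "b = blk G f"
proof -
  consider f where "f \<in> edges G \<inter> F" "w = wht G f" "b = blk G f" | e where "e \<in> edges G" "b = wht G e"
    using assms(1) by (auto simp: arcs_of_def)
  then show ?thesis
  proof cases
    case 1 then show ?thesis using that by blast
  next
    case 2 then show ?thesis using black_white[OF assms(2)] edge(2)[OF 2(1)] by simp
  qed
qed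

lemma arc_to_white:
  assumes "(x, w) \<in> arcs_of G F" "w \<in> whites G"
  shows "\<exists>e. e \<in> edges G - F \<and> blk G e = x \<and> wht G e = w"
proof -
  consider e where "e \<in> edges G - F" "x = blk G e" "w = wht G e" | e where "e \<in> edges G" "w = blk G e"
    using assms(1) by (auto simp: arcs_of_def)
  then show ?thesis
  proof cases
    case 1 then show ?thesis by blast
  next
    case 2 then show ?thesis using black_white[OF edge(1)[OF 2(1)]] assms(2) by simp
  qed
qed

text \<open>The symmetric difference of \<open>F\<close> with a matching of the white vertices into the black
  vertices off \<open>D\<close> contains disjoint paths from sources to \<open>D\<close>.\<close>

lemma matching_paths:
  assumes D: "D \<subseteq> all_blacks G" and inj: "inj_on \<pi> (whites G)"
    and \<pi>: "\<And>w. w \<in> whites G \<Longrightarrow> \<exists>e\<in>edges G. wht G e = w \<and> blk G e = \<pi> w"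
    and disj: "\<And>w. w \<in> whites G \<Longrightarrow> \<pi> w \<notin> D"
  obtains p where "\<And>b. b \<in> D \<Longrightarrow> boundary_path_to G F b (p b)"
    "\<And>b c. b \<in> D \<Longrightarrow> c \<in> D \<Longrightarrow> b \<noteq> c \<Longrightarrow> set (p b) \<inter> set (p c) = {}"
proof -
  \<comment> \<open>One step back from \<open>b\<close>: through \<open>in_edge b\<close> to its
    white end, then to the black vertex matched with it. Injectivity of the matching makes this
    injective on non-sources.\<close>
  define pr where "pr b = \<pi> (wht G (in_edge b))" for b
  have wI: "wht G (in_edge b) \<in> whites G" if "\<not> is_source b" for b
    using in_edge(1)[OF that] F_edges edge(2) by blast
  have w_inj: "b = c" if "\<not> is_source b" "\<not> is_source c" "wht G (in_edge b) = wht G (in_edge c)" for b c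
  proof -
    have "in_edge b = in_edge c" using F_white_inj[OF in_edge(1)[OF that(1)] in_edge(1)[OF that(2)] that(3)] .
    from arg_cong[OF this, of "blk G"] show ?thesis unfolding in_edge(2)[OF that(1)] in_edge(2)[OF that(2)] .
  qed
  have pr_inj: "b = c" if "\<not> is_source b" "\<not> is_source c" "pr b = pr c" for b c
    using w_inj[OF that(1,2)] inj_onD[OF inj that(3)[unfolded pr_def] wI[OF that(1)] wI[OF that(2)]] by blast
  \<comment> \<open>The vertices met when stepping back from \<open>c\<close> until a source is
    reached; recorded along with each path, they yield disjointness.\<close>
  let ?on = "\<lambda>c x. \<exists>i. (\<forall>j<i. \<not> is_source ((pr ^^ j) c)) \<and>
    (x = (pr ^^ i) c \<and> x \<in> all_blacks G \<or> \<not> is_source ((pr ^^ i) c) \<and> x = wht G (in_edge ((pr ^^ i) c)))"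
  have path: "is_source c \<or> pr c \<noteq> c \<longrightarrow> (\<exists>p. p \<noteq> [] \<and> successively (\<lambda>x y. (x, y) \<in> arcs_of G F) p \<and>
      hd p \<in> boundary_sources G F \<and> last p = c \<and> (\<forall>x\<in>set p. ?on c x))" if "c \<in> all_blacks G" for c
    using that
  proof (induction c rule: black_induct)
    case (source b)
    then have "b \<in> boundary_sources G F" using source_boundary boundary_sources_eq by blast
    then show ?case using source by (intro impI exI[of _ "[b]"]) (auto intro!: exI[of _ 0])
  next
    case (step b)
    show ?case
    proof
      assume "is_source b \<or> pr b \<noteq> b"
      then have ne: "pr b \<noteq> b" using step(2) by blast
      let ?w = "wht G (in_edge b)"
      obtain e where e: "e \<in> edges G" "wht G e = ?w" "blk G e = pr b" using \<pi>[OF wI[OF step(2)]] unfolding pr_def by blast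
      have "e \<notin> F"
      proof
        assume "e \<in> F"
        then have "e = in_edge b" using F_white_inj[OF _ in_edge(1)[OF step(2)] e(2)] by blast
        then show False using e(3) in_edge(2)[OF step(2)] ne by simp
      qed
      then have ef: "e \<in> feeds b" using e by (simp add: feeds_def)
      \<comment> \<open>A fixed point of \<open>pr\<close> is matched with the white vertex in front
        of it, and stepping back gets stuck there. Injectivity prevents reaching one from outside,
        and vertices of \<open>D\<close> are unmatched.\<close>
      have "is_source (pr b) \<or> pr (pr b) \<noteq> pr b" using pr_inj[of "pr b" b] step(2) ne by blast
      with step(3)[OF ef] e(3) obtain p where p: "p \<noteq> []" "successively (\<lambda>x y. (x, y) \<in> arcs_of G F) p"
        "hd p \<in> boundary_sources G F" "last p = pr b" "\<forall>x\<in>set p. ?on (pr b) x" by auto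
      have "(pr b, ?w) \<in> arcs_of G F" using arc_in[of e] e \<open>e \<notin> F\<close> by (metis DiffI)
      moreover have "(?w, b) \<in> arcs_of G F" using arc_out[OF in_edge(1)[OF step(2)]] in_edge(2)[OF step(2)] by simp
      ultimately have "successively (\<lambda>x y. (x, y) \<in> arcs_of G F) (p @ [?w, b])"
        using p by (simp add: successively_append_iff)
      moreover have "?on b x" if x: "x \<in> set (p @ [?w, b])" for x
      proof -
        consider "x \<in> set p" | "x = ?w" | "x = b" using x by auto
        then show ?thesis
        proof cases
          case 1
          then obtain i where i: "\<forall>j<i. \<not> is_source ((pr ^^ j) (pr b))"
            "x = (pr ^^ i) (pr b) \<and> x \<in> all_blacks G \<or> \<not> is_source ((pr ^^ i) (pr b)) \<and> x = wht G (in_edge ((pr ^^ i) (pr b)))"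
            using p(5) by blast
          have s: "(pr ^^ Suc j) b = (pr ^^ j) (pr b)" for j by (simp add: funpow_swap1)
          have "\<forall>j<Suc i. \<not> is_source ((pr ^^ j) b)"
          proof (intro allI impI)
            fix j assume "j < Suc i"
            then show "\<not> is_source ((pr ^^ j) b)" using i(1) step(2) s by (cases j) (auto simp del: funpow.simps(2))
          qed
          then show ?thesis using i(2) s[of i] by (intro exI[of _ "Suc i"]) (simp del: funpow.simps(2))
        next
          case 2 then show ?thesis using step(2) by (intro exI[of _ 0]) simp
        next
          case 3 then show ?thesis using step(1) by (intro exI[of _ 0]) simp
        qed
      qed
      ultimately show "\<exists>p. p \<noteq> [] \<and> successively (\<lambda>x y. (x, y) \<in> arcs_of G F) p \<and>
          hd p \<in> boundary_sources G F \<and> last p = b \<and> (\<forall>x\<in>set p. ?on b x)"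
        using p(1,3) by (intro exI[of _ "p @ [?w, b]"] conjI) simp_all
    qed
  qed
  have prD: "pr b \<notin> D" if "\<not> is_source b" for b using disj[OF wI[OF that]] by (simp add: pr_def)
  \<comment> \<open>Injectivity strips equal numbers of steps from two ways back that meet. Then
    either the starting points agree, or one of them is an image under \<open>pr\<close>, hence
    matched and not in \<open>D\<close>.\<close>
  have cross: "b = c" if "b \<in> D" "c \<in> D" "\<forall>k<i. \<not> is_source ((pr ^^ k) b)" "\<forall>k<j. \<not> is_source ((pr ^^ k) c)"
    "(pr ^^ i) b = (pr ^^ j) c" for b c i j
    using that
  proof (induction i arbitrary: j)
    case 0
    show ?case
    proof (cases j)
      case 0 then show ?thesis using "0.prems"(5) by simp
    next
      case (Suc k)
      then have "b = pr ((pr ^^ k) c)" using "0.prems"(5) by simp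
      then show ?thesis using prD[of "(pr ^^ k) c"] "0.prems"(1,4) Suc by simp
    qed
  next
    case (Suc i)
    show ?case
    proof (cases j)
      case 0
      then have "c = pr ((pr ^^ i) b)" using Suc.prems(5) by simp
      then show ?thesis using prD[of "(pr ^^ i) b"] Suc.prems(2,3) by simp
    next
      case (Suc k)
      have "pr ((pr ^^ i) b) = pr ((pr ^^ k) c)" using Suc.prems(5) Suc by simp
      then have "(pr ^^ i) b = (pr ^^ k) c" using pr_inj Suc.prems(3,4) Suc by auto
      then show ?thesis using Suc.IH[of k] Suc.prems(1-4) Suc by simp
    qed
  qed
  have "\<exists>p. boundary_path_to G F b p \<and> (\<forall>x\<in>set p. ?on b x)" if b: "b \<in> D" for b
  proof -
    have "is_source b \<or> pr b \<noteq> b" using prD b by metis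
    then obtain p where p: "p \<noteq> []" "successively (\<lambda>x y. (x, y) \<in> arcs_of G F) p" "hd p \<in> boundary_sources G F" "last p = b" "\<forall>x\<in>set p. ?on b x"
      using path[of b] b D by blast
    then show ?thesis unfolding boundary_path_to_def using acyclic_path_distinct[OF acyclic] by blast
  qed
  then have "\<forall>b\<in>D. \<exists>p. boundary_path_to G F b p \<and> (\<forall>x\<in>set p. ?on b x)" by blast
  from bchoice[OF this] obtain p where p: "\<And>b. b \<in> D \<Longrightarrow> boundary_path_to G F b (p b)" "\<And>b x. b \<in> D \<Longrightarrow> x \<in> set (p b) \<Longrightarrow> ?on b x"
    by blast
  have "set (p b) \<inter> set (p c) = {}" if bc: "b \<in> D" "c \<in> D" "b \<noteq> c" for b c
  proof (rule ccontr)
    assume "set (p b) \<inter> set (p c) \<noteq> {}"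
    then obtain x where x: "x \<in> set (p b)" "x \<in> set (p c)" by blast
    obtain i where i: "\<forall>j<i. \<not> is_source ((pr ^^ j) b)"
      "x = (pr ^^ i) b \<and> x \<in> all_blacks G \<or> \<not> is_source ((pr ^^ i) b) \<and> x = wht G (in_edge ((pr ^^ i) b))" using p(2)[OF bc(1) x(1)] by blast
    obtain j where j: "\<forall>k<j. \<not> is_source ((pr ^^ k) c)"
      "x = (pr ^^ j) c \<and> x \<in> all_blacks G \<or> \<not> is_source ((pr ^^ j) c) \<and> x = wht G (in_edge ((pr ^^ j) c))" using p(2)[OF bc(2) x(2)] by blast
    have "(pr ^^ i) b = (pr ^^ j) c"
      using i(2) j(2)
    proof (elim disjE conjE)
      assume "x = (pr ^^ i) b" "x = (pr ^^ j) c" then show ?thesis by simp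
    next
      assume "x \<in> all_blacks G" "\<not> is_source ((pr ^^ j) c)" "x = wht G (in_edge ((pr ^^ j) c))"
      then show ?thesis using black_white wI by blast
    next
      assume "x \<in> all_blacks G" "\<not> is_source ((pr ^^ i) b)" "x = wht G (in_edge ((pr ^^ i) b))"
      then show ?thesis using black_white wI by blast
    next
      assume "\<not> is_source ((pr ^^ i) b)" "\<not> is_source ((pr ^^ j) c)"
        "x = wht G (in_edge ((pr ^^ i) b))" "x = wht G (in_edge ((pr ^^ j) c))"
      then show ?thesis using w_inj by simp
    qed
    then show False using cross[OF bc(1,2) i(1) j(1)] bc(3) by blast
  qed
  then show ?thesis using that p(1) by blast
qed

text \<open>With coefficients \<open>1\<close> along the paths and \<open>0\<close> elsewhere, the values at the sources are
  transported along the paths.\<close>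

lemma path_weights:
  assumes p: "\<And>j. j \<in> J \<Longrightarrow> boundary_path_to G F (t j) (p j)"
    and disj: "\<And>j k. j \<in> J \<Longrightarrow> k \<in> J \<Longrightarrow> j \<noteq> k \<Longrightarrow> set (p j) \<inter> set (p k) = {}"
    and tB: "\<And>j. j \<in> J \<Longrightarrow> t j \<in> all_blacks G"
  obtains q where "\<And>(s :: complex \<Rightarrow> complex ^ 'm) j. j \<in> J \<Longrightarrow> sol q s (t j) = s (hd (p j))"
proof -
  let ?st = "\<lambda>x w. \<exists>j\<in>J. \<exists>k. Suc k < length (p j) \<and> p j ! k = x \<and> p j ! Suc k = w"
  \<comment> \<open>Parallel edges are possible, so one edge is selected for each step of a path;
    the weight \<open>1\<close> sits on that edge alone.\<close>
  define ch where "ch x w = (SOME e. e \<in> edges G - F \<and> blk G e = x \<and> wht G e = w)" for x w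
  define q where "q e = (if ?st (blk G e) (wht G e) \<and> e = ch (blk G e) (wht G e) then 1 else 0 :: complex)" for e
  have "sol q s (t j) = s (hd (p j))" if j: "j \<in> J" for s :: "complex \<Rightarrow> complex ^ 'm" and j
  proof -
    have pj: "p j \<noteq> []" "distinct (p j)" "successively (\<lambda>x y. (x, y) \<in> arcs_of G F) (p j)"
      "hd (p j) \<in> boundary_sources G F" "last (p j) = t j" using p[OF j] by (auto simp: boundary_path_to_def)
    have arc: "(p j ! k, p j ! Suc k) \<in> arcs_of G F" if "Suc k < length (p j)" for k
      using pj(3) that by (simp add: successively_conv_nth)
    have "p j ! k \<in> all_blacks G \<longrightarrow> sol q s (p j ! k) = s (hd (p j))" if "k < length (p j)" for k
      using that
    proof (induction k rule: less_induct)
      case (less k)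
      show ?case
      proof (intro impI)
        assume bB: "p j ! k \<in> all_blacks G"
        show "sol q s (p j ! k) = s (hd (p j))"
        proof (cases k)
          case 0
          then have "p j ! k = hd (p j)" using pj(1) by (simp add: hd_conv_nth)
          moreover have "is_source (hd (p j))" using pj(4) boundary_sources_eq by blast
          ultimately show ?thesis by (subst sol) simp
        next
          case (Suc l)
          define b where "b = p j ! k"
          define w where "w = p j ! l"
          have "(w, b) \<in> arcs_of G F" using arc[of l] less.prems Suc by (simp add: b_def w_def)
          then obtain f where f: "f \<in> F" "w = wht G f" "b = blk G f"
            by (rule arc_to_black) (simp add: b_def bB)
          have wW: "w \<in> whites G" using f F_edges edge(2) by blast
          have ns: "\<not> is_source b" and ib: "in_edge b = f" using f by (auto simp: is_source_def)
          have "l \<noteq> 0"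
          proof
            assume "l = 0"
            then have "w = hd (p j)" using pj(1) by (simp add: w_def hd_conv_nth)
            then have "w \<in> all_blacks G" using pj(4) by (auto simp: boundary_sources_def all_blacks_def)
            then show False using wW black_white by blast
          qed
          then obtain m where m: "l = Suc m" by (cases l) auto
          define x where "x = p j ! m"
          have "(x, w) \<in> arcs_of G F" using arc[of m] less.prems Suc m by (simp add: x_def w_def)
          then have ex: "\<exists>e. e \<in> edges G - F \<and> blk G e = x \<and> wht G e = w"
            using wW by (rule arc_to_white)
          define c where "c = ch x w"
          have c: "c \<in> edges G - F" "blk G c = x" "wht G c = w" using someI_ex[OF ex] unfolding c_def ch_def by blast+
          have cf: "c \<in> feeds b" using c f ib by (simp add: feeds_def)
          have st: "?st x w" using j less.prems Suc m by (intro bexI[OF _ j] exI[of _ m]) (simp add: x_def w_def)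
          have qc: "q c = 1" using c st by (simp add: q_def c_def[symmetric])
          \<comment> \<open>A feed of nonzero weight would be a step of some path into
            \<open>w\<close>; disjointness and distinctness leave only the step under
            consideration.\<close>
          have "q e = 0" if e: "e \<in> feeds b" "e \<noteq> c" for e
          proof (rule ccontr)
            assume "q e \<noteq> 0"
            then have e': "?st (blk G e) (wht G e)" "e = ch (blk G e) (wht G e)" by (simp_all add: q_def split: if_splits)
            have we: "wht G e = w" using e(1) f ib by (simp add: feeds_def)
            obtain i k' where i: "i \<in> J" "Suc k' < length (p i)" "p i ! k' = blk G e" "p i ! Suc k' = w" using e'(1) we by blast
            have "w \<in> set (p i)" "w \<in> set (p j)" using i less.prems Suc by (auto simp: w_def intro: nth_mem) (metis i(2,4) nth_mem w_def)
            then have ij: "i = j" using disj[OF i(1) j] by blast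
            have "Suc k' = l" using i ij pj(2) less.prems Suc by (metis Suc_lessD nth_eq_iff_index_eq w_def)
            then have "blk G e = x" using i ij m by (simp add: x_def)
            then show False using e'(2) we e(2) by (simp add: c_def)
          qed
          then have "(\<Sum>e\<in>feeds b. q e *s sol q s (blk G e)) = (\<Sum>e\<in>feeds b. if e = c then sol q s x else 0)"
            using qc c(2) by (intro sum.cong) auto
          also have "\<dots> = sol q s x" using cf finite_feeds by simp
          finally have "sol q s b = sol q s x" using ns by (subst sol) simp
          moreover have "x \<in> all_blacks G" using c edge(1)[of c] by auto
          then have "sol q s x = s (hd (p j))" using less.IH[of m] less.prems Suc m by (simp add: x_def)
          ultimately show ?thesis by (simp add: b_def)
        qed
      qed
    qed
    from this[of "length (p j) - 1"] show ?thesis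
      using pj(1,5) tB[OF j] by (simp add: last_conv_nth)
  qed
  then show ?thesis using that by blast
qed

end

section \<open>The topology of configuration spaces\<close>

lemma span_transform:
  fixes A :: "complex ^ 'm ^ 'm"
  assumes A: "invertible A" and t: "\<And>i. i \<in> J \<Longrightarrow> t i \<noteq> 0" and y: "\<And>i. i \<in> J \<Longrightarrow> y i = t i *s (A *v x i)"
    and x: "vec.span (x ` J) = UNIV"
  shows "vec.span (y ` J) = UNIV"
proof -
  have *: "A *v u \<in> vec.span (y ` J)" for u
  proof -
    have "u \<in> vec.span (x ` J)" using x by simp
    then show ?thesis
    proof (induction rule: vec.span_induct_alt)
      case base
      then show ?case by (simp add: vec.span_zero)
    next
      case (step c v w)
      then obtain i where i: "i \<in> J" "v = x i" by blast
      have "A *v v = inverse (t i) *s y i" using y[OF i(1)] t[OF i(1)] i(2) by simp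
      then have "A *v v \<in> vec.span (y ` J)" using i(1) by (auto intro: vec.span_scale vec.span_base)
      moreover have "A *v (c *s v + w) = c *s (A *v v) + A *v w"
        by (simp add: matrix_vector_right_distrib vector_scalar_commute)
      ultimately show ?case using step by (auto intro: vec.span_add vec.span_scale)
    qed
  qed
  obtain B where "A ** B = mat 1" using A unfolding invertible_def by blast
  then have "w = A *v (B *v w)" for w by (simp add: matrix_vector_mul_assoc)
  then show ?thesis using * by (metis UNIV_eq_I)
qed

lemma span_inverse_transform:
  fixes A :: "complex ^ 'm ^ 'm"
  assumes A: "invertible A" and t: "\<And>i. i \<in> J \<Longrightarrow> t i \<noteq> 0" and y: "\<And>i. i \<in> J \<Longrightarrow> y i = t i *s (A *v x i)"
    and x: "vec.span (y ` J) = UNIV"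
  shows "vec.span (x ` J) = UNIV"
proof -
  obtain B where B: "A ** B = mat 1" "B ** A = mat 1" using A unfolding invertible_def by blast
  then have "invertible B" unfolding invertible_def by blast
  moreover have "x i = inverse (t i) *s (B *v y i)" if "i \<in> J" for i
    using t[OF that] y[OF that] B(2) by (simp add: vector_scalar_commute matrix_vector_mul_assoc)
  ultimately show ?thesis using t x by (intro span_transform[of B J "\<lambda>i. inverse (t i)" x y]) auto
qed

lemma general_position_points: "x \<in> general_position I \<Longrightarrow> x \<in> points I"
  by (simp add: general_position_def)

lemma points_extensional: "x \<in> points I \<Longrightarrow> x \<in> I \<rightarrow>\<^sub>E UNIV"
  by (simp add: points_def)

lemma conf_rel_general_position:
  assumes "(x, y) \<in> conf_rel I" "x \<in> general_position I" shows "y \<in> general_position I"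
proof -
  obtain A t where *: "y \<in> points I" "invertible A" "\<And>i. i \<in> I \<Longrightarrow> t i \<noteq> 0" "\<And>i. i \<in> I \<Longrightarrow> y i = t i *s (A *v x i)"
    using assms(1) unfolding conf_rel_def by blast
  have "vec.span (y ` J) = UNIV" if J: "J \<subseteq> I" "card J = CARD('b)" for J
    by (rule span_transform[OF *(2), of J t y x]) (use J * assms(2) in \<open>auto simp: general_position_def\<close>)
  then show ?thesis using *(1) by (simp add: general_position_def)
qed

lemma conf_of_self: "x \<in> points I \<Longrightarrow> x \<in> conf_of I x"
  using equiv_class_self[OF equiv_conf_rel] by (simp add: conf_of_def)

lemma conf_genE:
  assumes "X \<in> conf_gen I" obtains x where "x \<in> general_position I" "X = conf_of I x"
  using assms by (auto simp: conf_gen_def quotient_def conf_of_def)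

lemma conf_gen_subset:
  assumes "X \<in> conf_gen I" shows "X \<subseteq> general_position I"
proof
  fix y assume y: "y \<in> X"
  obtain x where x: "x \<in> general_position I" "X = conf_of I x" using assms by (rule conf_genE)
  show "y \<in> general_position I"
    by (rule conf_rel_general_position[OF _ x(1)]) (use y x(2) in \<open>simp add: conf_of_def\<close>)
qed

lemma conf_gen_nonempty_class:
  assumes "X \<in> conf_gen I" shows "\<exists>x. x \<in> X"
proof -
  obtain x where "x \<in> general_position I" "X = conf_of I x" using assms by (rule conf_genE)
  then show ?thesis using conf_of_self[OF general_position_points, of x] by (intro exI[of _ x]) simp
qed

lemma conf_of_eq: "(x, y) \<in> conf_rel I \<Longrightarrow> conf_of I x = conf_of I y"
  unfolding conf_of_def by (rule equiv_class_eq[OF equiv_conf_rel])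

lemma conf_class_eq:
  assumes "X \<in> conf_gen I" "x \<in> X" shows "X = conf_of I x"
proof -
  obtain y where y: "X = conf_of I y" using assms(1) by (rule conf_genE)
  then have "(y, x) \<in> conf_rel I" using assms(2) by (simp add: conf_of_def)
  then show ?thesis unfolding y by (rule conf_of_eq)
qed

lemma conf_of_gen: "x \<in> general_position I \<Longrightarrow> conf_of I x \<in> conf_gen I"
  by (auto simp: conf_gen_def conf_of_def quotient_def)

lemma conf_of_genD:
  assumes "conf_of I x \<in> conf_gen I" shows "x \<in> general_position I"
proof -
  obtain y where y: "y \<in> conf_of I x" using conf_gen_nonempty_class[OF assms] by blast
  then have "y \<in> general_position I" using conf_gen_subset[OF assms] by blast
  moreover have "(y, x) \<in> conf_rel I" using y equiv_conf_rel unfolding conf_of_def by (meson Image_singleton_iff equivE symE)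
  ultimately show ?thesis using conf_rel_general_position by blast
qed

lemma Union_conf_gen: "\<Union>(conf_gen I) = general_position I"
proof
  show "\<Union>(conf_gen I) \<subseteq> general_position I" using conf_gen_subset by blast
  show "general_position I \<subseteq> \<Union>(conf_gen I)"
    using conf_of_gen conf_of_self[OF general_position_points] by blast
qed

lemma conf_of_mem:
  assumes "U \<subseteq> conf_gen I" "x \<in> \<Union>U" shows "conf_of I x \<in> U"
proof -
  obtain X where X: "X \<in> U" "x \<in> X" using assms(2) by blast
  then have "X = conf_of I x" using assms(1) by (intro conf_class_eq) auto
  then show ?thesis using X(1) by simp
qed

lemma topspace_zariski: "topspace (zariski I :: ('i \<Rightarrow> complex ^ 'm) topology) = I \<rightarrow>\<^sub>E UNIV"
proof -
  have "(\<lambda>_ :: 'i \<Rightarrow> complex ^ 'm. 1) \<in> polyfun I" by (rule polyfun.const)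
  then have "I \<rightarrow>\<^sub>E UNIV \<in> {{x :: 'i \<Rightarrow> complex ^ 'm. x \<in> I \<rightarrow>\<^sub>E UNIV \<and> f x \<noteq> 0} | f. f \<in> polyfun I}"
    by (intro CollectI exI[of _ "\<lambda>_. 1"]) simp
  then show ?thesis unfolding zariski_def topology_generated_by_topspace by (intro equalityI Sup_least Sup_upper) auto
qed

lemma openin_zariski_basic: "f \<in> polyfun I \<Longrightarrow> openin (zariski I) {x \<in> I \<rightarrow>\<^sub>E UNIV. f x \<noteq> 0}"
  unfolding zariski_def by (intro topology_generated_by_Basis) blast

text \<open>Products make the nonvanishing sets of polynomials closed under finite intersections, so
  they form a base.\<close>

lemma zariski_basic:
  assumes "openin (zariski I) S" "x \<in> S"
  shows "\<exists>f\<in>polyfun I. f x \<noteq> 0 \<and> {y \<in> I \<rightarrow>\<^sub>E UNIV. f y \<noteq> 0} \<subseteq> S"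
proof -
  have "generate_topology_on {{x \<in> I \<rightarrow>\<^sub>E UNIV. f x \<noteq> 0} | f. f \<in> polyfun I} S"
    using assms(1) unfolding zariski_def openin_topology_generated_by_iff .
  then show ?thesis using assms(2)
  proof (induction arbitrary: x)
    case Empty
    then show ?case by simp
  next
    case (Int a b)
    obtain f where f: "f \<in> polyfun I" "f x \<noteq> 0" "{y \<in> I \<rightarrow>\<^sub>E UNIV. f y \<noteq> 0} \<subseteq> a"
      using Int.IH(1)[of x] Int.prems by auto
    obtain g where g: "g \<in> polyfun I" "g x \<noteq> 0" "{y \<in> I \<rightarrow>\<^sub>E UNIV. g y \<noteq> 0} \<subseteq> b"
      using Int.IH(2)[of x] Int.prems by auto
    from f g show ?case by (intro bexI[of _ "\<lambda>x. f x * g x"] polyfun.mult) auto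
  next
    case (UN K)
    then obtain a where a: "a \<in> K" "x \<in> a" by blast
    then obtain f where "f \<in> polyfun I" "f x \<noteq> 0" "{y \<in> I \<rightarrow>\<^sub>E UNIV. f y \<noteq> 0} \<subseteq> a"
      using UN.IH[of a x] by blast
    then show ?case using a(1) by (intro bexI[of _ f] conjI) auto
  next
    case (Basis s)
    then show ?case by auto
  qed
qed

section \<open>Minors and general position\<close>

lemma polyfun_det:
  assumes "\<And>a b. (\<lambda>x. M x $ a $ b) \<in> polyfun I"
  shows "(\<lambda>x. det (M x :: complex ^ 'm ^ 'm)) \<in> polyfun I"
  unfolding det_def by (intro polyfun_sum polyfun.mult polyfun.const polyfun_prod assms)

lemma det_rows_span:
  fixes x :: "'i \<Rightarrow> complex ^ 'm"
  shows "det (\<chi> a. x (g a)) \<noteq> 0 \<longleftrightarrow> vec.span (x ` range g) = UNIV"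
proof -
  have "rows (\<chi> a. x (g a)) = x ` range g"
    unfolding rows_def row_def by (auto simp: vec_lambda_eta)
  then show ?thesis
    using matrix_left_invertible_span_rows_gen[of "\<chi> a. x (g a)"]
    by (simp add: invertible_det_nz[symmetric] invertible_left_inverse)
qed

text \<open>Any enumeration will do: changing it permutes the rows of a minor, and only the
  vanishing of minors matters.\<close>

definition enum_of :: "'i set \<Rightarrow> 'm::finite \<Rightarrow> 'i"
  where "enum_of J = (SOME g. bij_betw g UNIV J)"

lemma enum_of:
  assumes "finite J" "card J = CARD('m::finite)" shows "bij_betw (enum_of J :: 'm \<Rightarrow> 'i) UNIV J"
proof -
  have "\<exists>g :: 'm \<Rightarrow> 'i. bij_betw g UNIV J" using assms by (intro finite_same_card_bij) auto
  then show ?thesis unfolding enum_of_def by (rule someI_ex)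
qed

definition minor_of :: "'i set \<Rightarrow> ('i \<Rightarrow> complex ^ 'm) \<Rightarrow> complex"
  where "minor_of J x = det (\<chi> a. x (enum_of J a))"

lemma minor_of_nonzero:
  fixes x :: "'i \<Rightarrow> complex ^ 'm"
  assumes "finite J" "card J = CARD('m)" shows "minor_of J x \<noteq> 0 \<longleftrightarrow> vec.span (x ` J) = UNIV"
  using enum_of[OF assms] unfolding minor_of_def det_rows_span by (simp add: bij_betw_def)

lemma minor_of_polyfun:
  assumes "finite J" "card J = CARD('m)" "J \<subseteq> I"
  shows "(minor_of J :: ('i \<Rightarrow> complex ^ 'm) \<Rightarrow> complex) \<in> polyfun I"
proof -
  have "enum_of J (a :: 'm) \<in> I" for a using enum_of[OF assms(1,2)] assms(3) by (auto simp: bij_betw_def)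
  then show ?thesis unfolding minor_of_def by (intro polyfun_det) (simp add: polyfun.coord)
qed

lemma ex_minor_of_nonzero:
  assumes "finite J" "card J = CARD('m)" shows "\<exists>x. minor_of J (x :: 'i \<Rightarrow> complex ^ 'm) \<noteq> 0"
proof -
  define g where "g = (enum_of J :: 'm \<Rightarrow> 'i)"
  have g: "inj g" using enum_of[OF assms] by (simp add: bij_betw_def g_def)
  define x where "x i = (axis (inv_into UNIV g i) 1 :: complex ^ 'm)" for i
  have "(\<chi> a. x (g a)) = mat 1" using g by (simp add: x_def mat_def axis_def vec_eq_iff)
  then have "minor_of J x = 1" unfolding minor_of_def g_def[symmetric] by simp
  then show ?thesis by (intro exI[of _ x]) simp
qed

abbreviation bases :: "'m::finite itself \<Rightarrow> 'i set \<Rightarrow> 'i set set"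
  where "bases _ I \<equiv> {J. J \<subseteq> I \<and> card J = CARD('m)}"

lemma bases_finite: "finite I \<Longrightarrow> finite (bases TYPE('m::finite) I)"
  "finite I \<Longrightarrow> J \<in> bases TYPE('m) I \<Longrightarrow> finite J"
  by (auto intro: finite_subset[of _ "Pow I"] finite_subset)

lemma general_position_iff:
  fixes x :: "'i \<Rightarrow> complex ^ 'm"
  assumes "finite I"
  shows "x \<in> general_position I \<longleftrightarrow> x \<in> points I \<and> (\<forall>J\<in>bases TYPE('m) I. minor_of J x \<noteq> 0)"
proof -
  have "minor_of J x \<noteq> 0 \<longleftrightarrow> vec.span (x ` J) = UNIV" if "J \<in> bases TYPE('m) I" for J
    by (rule minor_of_nonzero) (use that bases_finite(2)[OF assms that] in auto)
  then show ?thesis unfolding general_position_def by (simp cong: conj_cong)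
qed

lemma general_position_basic:
  fixes x :: "'i \<Rightarrow> complex ^ 'm"
  assumes I: "finite I" and x: "x \<in> general_position I"
  shows "\<exists>f\<in>polyfun I. f x \<noteq> 0 \<and> (\<forall>y\<in>I \<rightarrow>\<^sub>E UNIV. f y \<noteq> 0 \<longrightarrow> y \<in> general_position I)"
proof -
  have "\<forall>i\<in>I. \<exists>k. x i $ k \<noteq> 0" using x by (auto simp: general_position_def points_def vec_eq_iff)
  then obtain \<kappa> where \<kappa>: "\<And>i. i \<in> I \<Longrightarrow> x i $ \<kappa> i \<noteq> 0" by metis
  let ?f = "\<lambda>y. (\<Prod>i\<in>I. y i $ \<kappa> i) * (\<Prod>J\<in>bases TYPE('m) I. minor_of J y)"
  show ?thesis
  proof (intro bexI[of _ ?f] conjI ballI impI)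
    show "?f \<in> polyfun I"
      using bases_finite(2)[OF I, where 'm = 'm]
      by (intro polyfun.mult polyfun_prod polyfun.coord) (auto intro: minor_of_polyfun)
    show "?f x \<noteq> 0" using I bases_finite(1)[OF I] \<kappa> x by (simp add: general_position_iff)
    fix y assume y: "y \<in> I \<rightarrow>\<^sub>E UNIV" "?f y \<noteq> 0"
    then have "\<forall>i\<in>I. y i $ \<kappa> i \<noteq> 0" "\<forall>J\<in>bases TYPE('m) I. minor_of J y \<noteq> 0"
      using I bases_finite(1)[OF I, where 'm = 'm] by auto
    then show "y \<in> general_position I" using y(1) I by (auto simp: general_position_iff points_def)
  qed
qed

lemma general_position_nonempty:
  assumes I: "finite I" shows "\<exists>x :: 'i \<Rightarrow> complex ^ 'm. x \<in> general_position I"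
proof -
  let ?k = "SOME k :: 'm. True"
  let ?F = "case_sum (\<lambda>i (y :: 'i \<Rightarrow> complex ^ 'm). y i $ ?k) minor_of"
  obtain z :: "'i \<Rightarrow> complex ^ 'm" where z: "z \<in> I \<rightarrow>\<^sub>E UNIV" "\<And>a. a \<in> Inl ` I \<union> Inr ` bases TYPE('m) I \<Longrightarrow> ?F a z \<noteq> 0"
  proof (rule polyfun_nonzero_family)
    show "finite (Inl ` I \<union> Inr ` bases TYPE('m) I)" using I bases_finite(1)[OF I, where 'm = 'm] by simp
    show "?F a \<in> polyfun I" if "a \<in> Inl ` I \<union> Inr ` bases TYPE('m) I" for a
      using that
    proof
      assume "a \<in> Inl ` I"
      then obtain i where "a = Inl i" "i \<in> I" by blast
      then show ?thesis by (simp add: polyfun.coord)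
    next
      assume "a \<in> Inr ` bases TYPE('m) I"
      then obtain J where J: "a = Inr J" "J \<in> bases TYPE('m) I" by blast
      then show ?thesis using minor_of_polyfun[OF bases_finite(2)[OF I J(2)], where 'm = 'm and I = I] by simp
    qed
    show "\<exists>x. ?F a x \<noteq> 0" if "a \<in> Inl ` I \<union> Inr ` bases TYPE('m) I" for a
      using that
    proof
      assume "a \<in> Inl ` I"
      then obtain i where "a = Inl i" by blast
      then show ?thesis by (intro exI[of _ "\<lambda>_. \<chi> k. 1"]) simp
    next
      assume "a \<in> Inr ` bases TYPE('m) I"
      then obtain J where J: "a = Inr J" "J \<in> bases TYPE('m) I" by blast
      then show ?thesis using ex_minor_of_nonzero[OF bases_finite(2)[OF I J(2)], where 'm = 'm] by simp
    qed
  qed (use that in blast)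
  have "z i \<noteq> 0" if "i \<in> I" for i using z(2)[of "Inl i"] that by auto
  moreover have "minor_of J z \<noteq> 0" if "J \<in> bases TYPE('m) I" for J using z(2)[of "Inr J"] that by auto
  ultimately show ?thesis using z(1) by (intro exI[of _ z]) (simp add: general_position_iff[OF I] points_def)
qed

text \<open>Reduces questions about the quotient topology to the nonvanishing of one polynomial; a
  factor for general position makes the condition sufficient for arbitrary tuples.\<close>

lemma conf_open_basic:
  assumes I: "finite I" and U: "conf_open I U" and x: "x \<in> \<Union>U"
  shows "\<exists>f\<in>polyfun I. f x \<noteq> 0 \<and> (\<forall>y\<in>I \<rightarrow>\<^sub>E UNIV. f y \<noteq> 0 \<longrightarrow> y \<in> \<Union>U)"
proof -
  have "openin (subtopology (zariski I) (general_position I)) (\<Union>U)" using U by (simp add: conf_open_def)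
  then obtain S where S: "openin (zariski I) S" "\<Union>U = S \<inter> general_position I" by (auto simp: openin_subtopology)
  obtain f where f: "f \<in> polyfun I" "f x \<noteq> 0" "{y \<in> I \<rightarrow>\<^sub>E UNIV. f y \<noteq> 0} \<subseteq> S" using zariski_basic[OF S(1)] x S(2) by blast
  obtain g where g: "g \<in> polyfun I" "g x \<noteq> 0" "\<forall>y\<in>I \<rightarrow>\<^sub>E UNIV. g y \<noteq> 0 \<longrightarrow> y \<in> general_position I"
    using general_position_basic[OF I, of x] x S(2) by blast
  show ?thesis unfolding S(2)
    by (intro bexI[of _ "\<lambda>y. f y * g y"] polyfun.mult f(1) g(1)) (use f g in auto)
qed

lemma conf_open_conf_gen: "conf_open I (conf_gen I :: ('i \<Rightarrow> complex ^ 'm) set set)"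
proof -
  have "(general_position I :: ('i \<Rightarrow> complex ^ 'm) set) \<subseteq> topspace (zariski I)"
    unfolding topspace_zariski using points_extensional[OF general_position_points] by (rule subsetI)
  then have "openin (subtopology (zariski I) (general_position I)) (general_position I :: ('i \<Rightarrow> complex ^ 'm) set)"
    unfolding openin_subtopology by (intro exI[of _ "topspace (zariski I)"]) auto
  then show ?thesis unfolding conf_open_def Union_conf_gen by simp
qed

lemma topspace_conf_top: "topspace (conf_top I) = conf_gen I"
proof
  show "topspace (conf_top I) \<subseteq> conf_gen I"
    unfolding topspace_def openin_conf_top by (rule Sup_least) (simp add: conf_open_def)
  show "conf_gen I \<subseteq> topspace (conf_top I)"
    unfolding topspace_def openin_conf_top by (rule Sup_upper) (simp add: conf_open_conf_gen)
qed

lemma conf_dense_iff: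
  fixes S :: "('i \<Rightarrow> complex ^ 'm) set set"
  shows "conf_dense I S \<longleftrightarrow> S \<subseteq> conf_gen I \<and> (\<forall>V. conf_open I V \<and> V \<noteq> {} \<longrightarrow> S \<inter> V \<noteq> {})"
proof -
  have "conf_top I closure_of S = conf_gen I \<longleftrightarrow> (\<forall>V. conf_open I V \<and> V \<noteq> {} \<longrightarrow> S \<inter> V \<noteq> {})"
  proof
    assume eq: "conf_top I closure_of S = conf_gen I"
    show "\<forall>V. conf_open I V \<and> V \<noteq> {} \<longrightarrow> S \<inter> V \<noteq> {}"
    proof (intro allI impI)
      fix V :: "('i \<Rightarrow> complex ^ 'm) set set" assume V: "conf_open I V \<and> V \<noteq> {}"
      then obtain X where X: "X \<in> V" by blast
      then have "X \<in> conf_top I closure_of S" using V unfolding eq conf_open_def by blast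
      then show "S \<inter> V \<noteq> {}" using X V unfolding in_closure_of openin_conf_top by blast
    qed
  next
    assume V: "\<forall>V. conf_open I V \<and> V \<noteq> {} \<longrightarrow> S \<inter> V \<noteq> {}"
    show "conf_top I closure_of S = conf_gen I"
    proof (intro equalityI subsetI)
      fix X assume "X \<in> conf_top I closure_of S"
      then show "X \<in> conf_gen I" unfolding in_closure_of topspace_conf_top by simp
    next
      fix X :: "('i \<Rightarrow> complex ^ 'm) set" assume "X \<in> conf_gen I"
      then show "X \<in> conf_top I closure_of S"
        unfolding in_closure_of topspace_conf_top openin_conf_top
      proof (intro conjI allI impI)
        fix W assume W: "X \<in> W \<and> conf_open I W"
        then have "S \<inter> W \<noteq> {}" using V by auto
        then show "\<exists>Y. Y \<in> S \<and> Y \<in> W" by auto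
      qed
    qed
  qed
  then show ?thesis by (simp add: conf_dense_def)
qed

text \<open>Irreducibility again: the polynomials describing the two sets have a common point of
  nonvanishing.\<close>

lemma conf_open_meet:
  fixes U V :: "('i \<Rightarrow> complex ^ 'm) set set"
  assumes I: "finite I" and U: "conf_open I U" "U \<noteq> {}" and V: "conf_open I V" "V \<noteq> {}"
  shows "U \<inter> V \<noteq> {}"
proof -
  have ne: "\<exists>x. x \<in> \<Union>W" if "conf_open I W" "W \<noteq> {}" for W :: "('i \<Rightarrow> complex ^ 'm) set set"
  proof -
    obtain X where X: "X \<in> W" using \<open>W \<noteq> {}\<close> by blast
    then have "X \<in> conf_gen I" using \<open>conf_open I W\<close> unfolding conf_open_def by blast
    then obtain x where "x \<in> X" using conf_gen_nonempty_class by blast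
    then show ?thesis using X by blast
  qed
  obtain x where x: "x \<in> \<Union>U" using ne[OF U] by blast
  obtain y where y: "y \<in> \<Union>V" using ne[OF V] by blast
  obtain f where f: "f \<in> polyfun I" "f x \<noteq> 0" "\<forall>y\<in>I \<rightarrow>\<^sub>E UNIV. f y \<noteq> 0 \<longrightarrow> y \<in> \<Union>U" using conf_open_basic[OF I U(1) x] by blast
  obtain g where g: "g \<in> polyfun I" "g y \<noteq> 0" "\<forall>y\<in>I \<rightarrow>\<^sub>E UNIV. g y \<noteq> 0 \<longrightarrow> y \<in> \<Union>V" using conf_open_basic[OF I V(1) y] by blast
  obtain z where z: "z \<in> I \<rightarrow>\<^sub>E UNIV" "\<And>b. b \<in> {True, False} \<Longrightarrow> (if b then f else g) z \<noteq> 0"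
    by (rule polyfun_nonzero_family[of "{True, False}" "\<lambda>b. if b then f else g" I]) (use f g in auto)
  then have "z \<in> \<Union>U" "z \<in> \<Union>V" using f(3) g(3) z(2)[of True] z(2)[of False] by auto
  then have "conf_of I z \<in> U" "conf_of I z \<in> V" using U(1) V(1) by (auto simp: conf_open_def intro: conf_of_mem)
  then show ?thesis by blast
qed

text \<open>By irreducibility every nonempty open set is dense; conversely a dense set is nonempty
  because tuples in general position exist.\<close>

lemma open_dense_iff:
  assumes "finite I" shows "open_dense I U \<longleftrightarrow> conf_open I U \<and> U \<noteq> {}"
proof
  assume "open_dense I U"
  then have U: "conf_open I U" "conf_dense I U" by (simp_all add: open_dense_def openin_conf_top)
  have "conf_gen I \<noteq> {}" using general_position_nonempty[OF assms] conf_of_gen by blast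
  then have "U \<noteq> {}" using U(2) conf_open_conf_gen unfolding conf_dense_iff by blast
  then show "conf_open I U \<and> U \<noteq> {}" using U(1) by simp
next
  assume U: "conf_open I U \<and> U \<noteq> {}"
  then have "conf_dense I U" unfolding conf_dense_iff using conf_open_meet[OF assms] by (auto simp: conf_open_def)
  then show "open_dense I U" using U by (simp add: open_dense_def openin_conf_top)
qed

text \<open>The polynomial \<open>q\<close> is not invariant under \<open>conf_rel\<close>. The
  classes with a representative off its zeros are swept out by the open sets
  \<open>q (g x) \<noteq> 0\<close>, one for each matrix and rescaling \<open>g\<close>.\<close>

lemma conf_open_nonvanishing:
  fixes U :: "('i \<Rightarrow> complex ^ 'm) set set"
  assumes U: "conf_open I U" and q: "q \<in> polyfun I"
  shows "conf_open I {z \<in> U. \<exists>x\<in>z. q x \<noteq> 0}"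
proof -
  let ?tr = "\<lambda>(A :: complex ^ 'm ^ 'm, t :: 'i \<Rightarrow> complex) x i. t i *s (A *v x i)"
  let ?P = "{(A, t). invertible (A :: complex ^ 'm ^ 'm) \<and> (\<forall>i\<in>I. t i \<noteq> 0)}"
  let ?V = "\<lambda>p. {x \<in> I \<rightarrow>\<^sub>E UNIV. q (?tr p x) \<noteq> 0}"
  have gen: "U \<subseteq> conf_gen I" using U by (simp add: conf_open_def)
  have op: "openin (zariski I) (?V p)" for p
  proof (rule openin_zariski_basic, rule polyfun_comp[OF q])
    obtain A t where p: "p = (A, t)" by (cases p)
    show "(\<lambda>x. ?tr p x i $ k) \<in> polyfun I" if "i \<in> I" for i k
      unfolding p case_prod_conv vector_smult_component matrix_vector_mult_def vec_lambda_beta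
      by (intro polyfun.mult polyfun.const polyfun_sum polyfun.coord that)
  qed
  have "\<Union>{z \<in> U. \<exists>x\<in>z. q x \<noteq> 0} = \<Union>U \<inter> (\<Union>p\<in>?P. ?V p)"
  proof (intro equalityI subsetI)
    fix x assume "x \<in> \<Union>{z \<in> U. \<exists>x\<in>z. q x \<noteq> 0}"
    then obtain z y where z: "z \<in> U" "x \<in> z" "y \<in> z" "q y \<noteq> 0" by blast
    have "z = conf_of I x" using conf_class_eq z gen by blast
    then have "(x, y) \<in> conf_rel I" using z(3) by (simp add: conf_of_def)
    then obtain A t where A: "x \<in> points I" "invertible (A :: complex ^ 'm ^ 'm)" "\<forall>i\<in>I. t i \<noteq> 0 \<and> y i = t i *s (A *v x i)"
      unfolding conf_rel_def by blast
    have "q (?tr (A, t) x) = q y" by (rule polyfun_cong[OF q]) (use A(3) in simp)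
    then have "x \<in> ?V (A, t)" using z(4) A(1) points_extensional by simp
    then show "x \<in> \<Union>U \<inter> (\<Union>p\<in>?P. ?V p)" using z A by blast
  next
    fix x assume "x \<in> \<Union>U \<inter> (\<Union>p\<in>?P. ?V p)"
    then obtain z A t where z: "z \<in> U" "x \<in> z" and A: "invertible (A :: complex ^ 'm ^ 'm)" "\<forall>i\<in>I. t i \<noteq> 0" and qx: "q (?tr (A, t) x) \<noteq> 0" by blast
    define y where "y = restrict (?tr (A, t) x) I"
    have x: "x \<in> points I" using z gen conf_gen_subset general_position_points by blast
    have "A *v x i \<noteq> 0" if "i \<in> I" for i
    proof
      assume "A *v x i = 0"
      moreover obtain B where "B ** A = mat 1" using A(1) unfolding invertible_def by blast
      then have "B *v (A *v x i) = x i" by (simp add: matrix_vector_mul_assoc)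
      ultimately show False using x that by (simp add: points_def)
    qed
    then have "y \<in> points I" using A(2) by (auto simp: y_def points_def)
    then have "(x, y) \<in> conf_rel I" unfolding conf_rel_def using x A by (auto simp: y_def)
    then have "y \<in> conf_of I x" by (simp add: conf_of_def)
    then have "y \<in> z" using conf_class_eq[of z I x] z gen by blast
    moreover have "q y = q (?tr (A, t) x)" by (rule polyfun_cong[OF q]) (simp add: y_def)
    moreover have "q (?tr (A, t) x) \<noteq> 0" using qx by simp
    ultimately have "\<exists>x\<in>z. q x \<noteq> 0" by (intro bexI[of _ y]) simp_all
    then have "z \<in> {z \<in> U. \<exists>x\<in>z. q x \<noteq> 0}" using z(1) by simp
    then show "x \<in> \<Union>{z \<in> U. \<exists>x\<in>z. q x \<noteq> 0}" using z(2) by (rule UnionI)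
  qed
  moreover have "openin (subtopology (zariski I) (general_position I)) (\<Union>U \<inter> (\<Union>p\<in>?P. ?V p))"
  proof -
    have "openin (zariski I) (\<Union>p\<in>?P. ?V p)" by (intro openin_Union) (use op in auto)
    moreover have "openin (subtopology (zariski I) (general_position I)) (\<Union>U)" using U by (simp add: conf_open_def)
    ultimately have "openin (subtopology (zariski I) (general_position I)) (\<Union>U \<inter> (general_position I \<inter> (\<Union>p\<in>?P. ?V p)))"
      by (intro openin_Int openin_subtopology_Int2)
    moreover have "\<Union>U \<subseteq> general_position I" using Union_mono[OF gen] unfolding Union_conf_gen .
    ultimately show ?thesis by (simp add: Int_absorb2 flip: Int_assoc)
  qed
  moreover have "{z \<in> U. \<exists>x\<in>z. q x \<noteq> 0} \<subseteq> conf_gen I" using gen by blast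
  ultimately show ?thesis unfolding conf_open_def by presburger
qed

text \<open>Independence as an indexed family, by counting: a nontrivial relation would let fewer
  than \<open>CARD('m)\<close> vectors span.\<close>

lemma general_position_independent:
  fixes x :: "'i \<Rightarrow> complex ^ 'm"
  assumes x: "x \<in> general_position I" and J: "J \<subseteq> I" "card J = CARD('m)" "finite J"
    and 0: "(\<Sum>l\<in>J. c l *s x l) = 0" and i: "i \<in> J"
  shows "c i = 0"
proof (rule ccontr)
  assume c: "c i \<noteq> 0"
  have "c i *s x i = - (\<Sum>l\<in>J - {i}. c l *s x l)"
    using 0 sum.remove[OF J(3) i, of "\<lambda>l. c l *s x l"] by (simp add: eq_neg_iff_add_eq_0)
  also have "\<dots> \<in> vec.span (x ` (J - {i}))" by (intro vec.span_neg vec.span_sum vec.span_scale vec.span_base) auto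
  finally have "inverse (c i) *s (c i *s x i) \<in> vec.span (x ` (J - {i}))" by (rule vec.span_scale)
  then have "x ` J \<subseteq> vec.span (x ` (J - {i}))" using c by (auto intro: vec.span_base)
  moreover have "vec.span (x ` J) = UNIV" using x J by (auto simp: general_position_def)
  ultimately have "vec.span (x ` (J - {i})) = UNIV"
    using vec.span_minimal[OF _ vec.subspace_span] by (metis top.extremum_uniqueI)
  then have "vec.dim (UNIV :: (complex ^ 'm) set) \<le> card (x ` (J - {i}))"
    using J(3) by (intro vec.dim_le_card) auto
  also have "\<dots> \<le> card (J - {i})" using J(3) by (intro card_image_le) auto
  also have "\<dots> < CARD('m)" using J i by (simp add: card_gt_0_iff)
  finally show False by (simp add: vec.dim_UNIV card_cart_basis)
qed

lemma ex_superset_card: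
  assumes "finite I" "S \<subseteq> I" "card S \<le> k" "k \<le> card I"
  obtains J where "S \<subseteq> J" "J \<subseteq> I" "card J = k" "finite J"
proof -
  have "finite S" using assms finite_subset by blast
  have "k - card S \<le> card (I - S)" using assms \<open>finite S\<close> by (simp add: card_Diff_subset)
  then obtain K where K: "K \<subseteq> I - S" "card K = k - card S" "finite K" using obtain_subset_with_card_n by metis
  then have "card (S \<union> K) = k" using assms \<open>finite S\<close> by (subst card_Un_disjoint) auto
  then show ?thesis using that[of "S \<union> K"] K assms \<open>finite S\<close> by auto
qed

text \<open>Since \<open>CARD('m) \<ge> 2\<close>, two indices fit into one subset of size
  \<open>CARD('m)\<close>, whose vectors are independent.\<close>

lemma general_position_nonparallel:
  fixes x :: "'i \<Rightarrow> complex ^ 'm"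
  assumes x: "x \<in> general_position I" and I: "finite I" "CARD('m) \<le> card I" and m: "2 \<le> CARD('m)"
    and ij: "i \<in> I" "j \<in> I" "i \<noteq> j"
  shows "x i \<noteq> c *s x j"
proof
  assume eq: "x i = c *s x j"
  obtain J where J: "{i, j} \<subseteq> J" "J \<subseteq> I" "card J = CARD('m)" "finite J"
    using ex_superset_card[of I "{i, j}" "CARD('m)"] I m ij by auto
  let ?c = "\<lambda>l. if l = i then 1 else if l = j then - c else 0"
  have "(\<Sum>l\<in>J. ?c l *s x l) = (\<Sum>l\<in>{i, j}. ?c l *s x l)"
    using J(1,4) by (intro sum.mono_neutral_right) auto
  also have "\<dots> = 0" using ij(3) eq by simp
  finally show False using general_position_independent[OF x J(2-4), of ?c i] J(1) by simp
qed

lemma matrix_mult_sum_right: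
  fixes A :: "complex ^ 'm ^ 'm"
  shows "A *v (\<Sum>l\<in>S. y l) = (\<Sum>l\<in>S. A *v y l)"
  by (induction S rule: infinite_finite_induct) (simp_all add: matrix_vector_right_distrib)

text \<open>A linear map that fixes a projective frame is scalar: in \<open>CARD('m) + 1\<close>
  vectors in general position each has only nonzero coordinates in the basis formed by the others,
  so the eigenvalues agree.\<close>

lemma eigenvectors_scalar:
  fixes x :: "'i \<Rightarrow> complex ^ 'm" and A :: "complex ^ 'm ^ 'm"
  assumes x: "x \<in> general_position I" and I: "finite I" "CARD('m) < card I"
    and A: "\<And>i. i \<in> I \<Longrightarrow> A *v x i = t i *s x i"
  obtains \<tau> where "\<And>y. A *v y = \<tau> *s y" "\<And>i. i \<in> I \<Longrightarrow> t i = \<tau>"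
proof -
  have tt: "t i = t j" if ij: "i \<in> I" "j \<in> I" "i \<noteq> j" for i j
  proof -
    have "card {i, j} \<le> Suc CARD('m)" using ij by simp
    then obtain J where J: "{i, j} \<subseteq> J" "J \<subseteq> I" "card J = Suc CARD('m)" "finite J"
      using ex_superset_card[of I "{i, j}" "Suc CARD('m)"] I ij by auto
    let ?J = "J - {i}"
    have Ji: "?J \<subseteq> I" "card ?J = CARD('m)" "finite ?J" using J by auto
    have inj: "inj_on x ?J"
    proof (rule inj_onI)
      fix k l assume kl: "k \<in> ?J" "l \<in> ?J" "x k = x l"
      show "k = l"
      proof (rule ccontr)
        assume "k \<noteq> l"
        let ?c = "\<lambda>p. if p = k then 1 else if p = l then - 1 else 0"
        have "(\<Sum>p\<in>?J. ?c p *s x p) = (\<Sum>p\<in>{k, l}. ?c p *s x p)"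
          using kl Ji by (intro sum.mono_neutral_right) auto
        also have "\<dots> = 0" using \<open>k \<noteq> l\<close> kl(3) by simp
        finally show False using general_position_independent[OF x Ji, of ?c k] kl(1) by simp
      qed
    qed
    have "x i \<in> vec.span (x ` ?J)" using x Ji by (auto simp: general_position_def)
    then obtain d where d: "x i = (\<Sum>v\<in>x ` ?J. d v *s v)" using vec.span_finite[of "x ` ?J"] Ji(3) by auto
    define c where "c l = d (x l)" for l
    have c: "x i = (\<Sum>l\<in>?J. c l *s x l)" unfolding d c_def by (simp add: sum.reindex[OF inj])
    have "A *v x i = (\<Sum>l\<in>?J. c l *s (A *v x l))"
      unfolding c by (simp add: matrix_mult_sum_right vector_scalar_commute)
    then have "t i *s (\<Sum>l\<in>?J. c l *s x l) = (\<Sum>l\<in>?J. c l *s (t l *s x l))"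
    proof -
      have "(\<Sum>l\<in>?J. c l *s (A *v x l)) = (\<Sum>l\<in>?J. c l *s (t l *s x l))" using A Ji(1) by (intro sum.cong) auto
      then show ?thesis using \<open>A *v x i = _\<close> A[OF ij(1)] c by simp
    qed
    then have "(\<Sum>l\<in>?J. (c l * (t i - t l)) *s x l) = 0"
      by (simp add: vec.scale_sum_right right_diff_distrib vec.scale_left_diff_distrib sum_subtractf mult.commute)
    then have "c j * (t i - t j) = 0" using general_position_independent[OF x Ji, of "\<lambda>l. c l * (t i - t l)" j] J(1) ij(3) by auto
    moreover have "c j \<noteq> 0"
    proof
      assume cj: "c j = 0"
      let ?K = "J - {j}"
      have K: "?K \<subseteq> I" "card ?K = CARD('m)" "finite ?K" using J by auto
      let ?c = "\<lambda>l. if l = i then - 1 else c l"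
      have "(\<Sum>l\<in>?K. ?c l *s x l) = - x i + (\<Sum>l\<in>?K - {i}. c l *s x l)"
        using K(3) J(1) ij(3) by (subst sum.remove[of _ i]) (auto intro!: sum.cong)
      also have "(\<Sum>l\<in>?K - {i}. c l *s x l) = (\<Sum>l\<in>?J. c l *s x l)"
        using Ji(3) cj by (intro sum.mono_neutral_left) auto
      finally have "(\<Sum>l\<in>?K. ?c l *s x l) = 0" using c by simp
      then show False using general_position_independent[OF x K, of ?c i] J(1) ij(3) by auto
    qed
    ultimately show ?thesis by simp
  qed
  have "I \<noteq> {}" using I by auto
  then obtain i0 where i0: "i0 \<in> I" by blast
  have t: "t i = t i0" if "i \<in> I" for i using tt[of i i0] i0 that by (cases "i = i0") auto
  obtain J where J: "J \<subseteq> I" "card J = CARD('m)" using ex_superset_card[of I "{}" "CARD('m)"] I by auto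
  have "A *v y = t i0 *s y" for y
  proof -
    have "y \<in> vec.span (x ` J)" using x J by (auto simp: general_position_def)
    then show ?thesis
    proof (induction rule: vec.span_induct_alt)
      case (step c v w)
      then obtain i where i: "i \<in> J" "v = x i" by blast
      then have "A *v v = t i0 *s v" using A[of i] t[of i] J(1) by auto
      then show ?case using step by (simp add: matrix_vector_right_distrib vector_scalar_commute vec.scale_right_distrib mult.commute)
    qed simp
  qed
  then show ?thesis using that t by blast
qed

section \<open>Uniqueness and deformation of configurations\<close>

context plabic begin

lemma gauge_rel_refl:
  assumes "(v, r) \<in> vrcs G" shows "((v, r), (v, r)) \<in> gauge_rel G"
proof -
  have "invertible (mat 1 :: complex ^ 'm ^ 'm)" unfolding invertible_def by (rule exI[of _ "mat 1"]) simp
  then show ?thesis using assms unfolding gauge_rel_def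
    by (auto intro!: exI[of _ "mat 1"] exI[of _ "\<lambda>_. 1"])
qed

lemma solvable_gauge:
  assumes z: "z \<in> solvable_locus G" and v: "(v, r) \<in> vrcs G" "bdry G v \<in> z" and v': "(v', r') \<in> vrcs G" "bdry G v' \<in> z"
  shows "((v, r), (v', r')) \<in> gauge_rel G"
proof -
  let ?X = "gauge_rel G `` {(v, r)}" and ?X' = "gauge_rel G `` {(v', r')}"
  have X: "?X \<in> vrc_classes G" "has_boundary G ?X z"
    using v gauge_rel_refl[OF v(1)] unfolding vrc_classes_def quotient_def has_boundary_def by auto
  have X': "?X' \<in> vrc_classes G" "has_boundary G ?X' z"
    using v' gauge_rel_refl[OF v'(1)] unfolding vrc_classes_def quotient_def has_boundary_def by auto
  have "\<exists>!X. X \<in> vrc_classes G \<and> has_boundary G X z" using z by (simp add: solvable_locus_def)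
  then have "?X = ?X'" using X X' by (auto dest: ex1_implies_ex)
  then show ?thesis using gauge_rel_refl[OF v'(1)] by auto
qed

lemma solvable_vrc:
  assumes z: "z \<in> solvable_locus G"
  shows "the_vrc G z \<in> vrcs G" "bdry G (fst (the_vrc G z)) \<in> z"
proof -
  obtain X where X: "X \<in> vrc_classes G" "has_boundary G X z"
    using z unfolding solvable_locus_def by blast
  have "X \<subseteq> vrcs G" using X(1) by (auto simp: vrc_classes_def quotient_def gauge_rel_def)
  then have "\<exists>vr. vr \<in> vrcs G \<and> bdry G (fst vr) \<in> z" using X(2) unfolding has_boundary_def by fastforce
  then have "the_vrc G z \<in> vrcs G \<and> bdry G (fst (the_vrc G z)) \<in> z" unfolding the_vrc_def by (rule someI_ex)
  then show "the_vrc G z \<in> vrcs G" "bdry G (fst (the_vrc G z)) \<in> z" by simp_all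
qed

text \<open>The gauge equivalence given by uniqueness fixes all boundary points, and there are more
  than \<open>CARD('m)\<close> of them in general position. So its matrix is a scalar
  \<open>\<tau>\<close>, and only rescalings remain.\<close>

lemma solvable_rigid:
  fixes v v' :: "complex \<Rightarrow> complex ^ 'm"
  assumes z: "z \<in> solvable_locus G" and n: "CARD('m) < nbd G"
    and v: "(v, r) \<in> vrcs G" "bdry G v \<in> z" and v': "(v', r') \<in> vrcs G"
    and eq: "\<And>b. b \<in> boundary_verts G \<Longrightarrow> v' b = v b"
  obtains \<tau> t where "\<And>b. b \<in> verts G \<Longrightarrow> t b \<noteq> 0" "\<And>b. b \<in> all_blacks G \<Longrightarrow> v' b = (\<tau> / t b) *s v b"
    "\<And>e. e \<in> edges G \<Longrightarrow> r' e = t (blk G e) * t (wht G e) * r e" "\<And>b. b \<in> boundary_verts G \<Longrightarrow> t b = \<tau>"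
proof -
  have bd: "bdry G v' = bdry G v" using eq unfolding bdry_def boundary_verts_def by (auto intro!: restrict_ext)
  have gen: "bdry G v \<in> general_position {1..nbd G}"
    using z v(2) conf_gen_subset[of z] by (auto simp: solvable_locus_def)
  obtain A t where A: "invertible (A :: complex ^ 'm ^ 'm)" and t: "\<And>x. x \<in> verts G \<Longrightarrow> t x \<noteq> 0"
    and vA: "\<And>b. b \<in> all_blacks G \<Longrightarrow> v' b = inverse (t b) *s (A *v v b)"
    and rt: "\<And>e. e \<in> edges G \<Longrightarrow> r' e = t (blk G e) * t (wht G e) * r e"
  proof -
    have "((v, r), (v', r')) \<in> gauge_rel G" by (rule solvable_gauge[OF z v v']) (simp add: bd v(2))
    then have "\<exists>A t. invertible (A :: complex ^ 'm ^ 'm) \<and> (\<forall>x\<in>verts G. t x \<noteq> 0) \<and>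
        (\<forall>b\<in>all_blacks G. v' b = inverse (t b) *s (A *v v b)) \<and>
        (\<forall>e\<in>edges G. r' e = t (blk G e) * t (wht G e) * r e)"
      unfolding gauge_rel_def by blast
    then show ?thesis using that by blast
  qed
  have "A *v (bdry G v i) = t (bvert G i) *s bdry G v i" if i: "i \<in> {1..nbd G}" for i
  proof -
    have b: "bvert G i \<in> boundary_verts G" using i by (simp add: boundary_verts_def)
    then have "v (bvert G i) = inverse (t (bvert G i)) *s (A *v v (bvert G i))" "t (bvert G i) \<noteq> 0"
      using vA[of "bvert G i"] eq[OF b] t[of "bvert G i"] by (auto simp: all_blacks_def verts_def)
    then have "t (bvert G i) *s v (bvert G i) = A *v v (bvert G i)" by (metis vec.scale_scale right_inverse vec.scale_one)
    then show ?thesis using i by (simp add: bdry_def)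
  qed
  then obtain \<tau> where \<tau>: "\<And>y. A *v y = \<tau> *s y" "\<And>i. i \<in> {1..nbd G} \<Longrightarrow> t (bvert G i) = \<tau>"
    using eigenvectors_scalar[OF gen, of A "\<lambda>i. t (bvert G i)"] n by auto
  show ?thesis
  proof (rule that[OF t _ rt])
    show "v' b = (\<tau> / t b) *s v b" if "b \<in> all_blacks G" for b
      using vA[OF that] \<tau>(1) by (simp add: divide_inverse mult.commute)
    show "t b = \<tau>" if "b \<in> boundary_verts G" for b using that \<tau>(2) by (auto simp: boundary_verts_def)
  qed
qed

text \<open>A potential of the circulation \<open>\<nu>\<^sub>w r\<^sub>e v\<^sub>b\<close> moves the configuration along the
  projective flow \<open>h \<mapsto> h / (1 - t h\<^sub>k)\<close>: the relation at \<open>w\<close> becomes a telescoping sum around \<open>w\<close>.\<close>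

lemma deformation:
  fixes v :: "complex \<Rightarrow> complex ^ 'm" and L R :: "'e \<Rightarrow> complex ^ 'm"
  assumes v: "(v, r) \<in> vrcs G"
    and LR: "\<And>e. e \<in> edges G \<Longrightarrow> L e - R e = (\<nu> (wht G e) * r e) *s v (blk G e)"
    and white: "\<And>w f. w \<in> whites G \<Longrightarrow> (\<Sum>e\<in>{e \<in> edges G. wht G e = w}. f (L e) - f (R e) :: complex ^ 'm) = 0"
    and flat: "\<And>w e e'. w \<in> whites G \<Longrightarrow> \<nu> w = 0 \<Longrightarrow> e \<in> edges G \<Longrightarrow> e' \<in> edges G \<Longrightarrow> wht G e = w \<Longrightarrow> wht G e' = w \<Longrightarrow> L e = L e'"
    and D: "\<And>e. e \<in> edges G \<Longrightarrow> v (blk G e) $ k *s L e - L e $ k *s v (blk G e) = D (blk G e)"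
    and D0: "\<And>b. b \<in> boundary_verts G \<Longrightarrow> D b = 0"
    and t: "\<And>e. e \<in> edges G \<Longrightarrow> t * L e $ k \<noteq> 1 \<and> t * R e $ k \<noteq> 1"
  shows "(\<lambda>b. v b + t *s D b, \<lambda>e. r e / ((1 - t * L e $ k) * (1 - t * R e $ k))) \<in> vrcs G"
proof -
  let ?v = "\<lambda>b. v b + t *s D b"
  let ?a = "\<lambda>e. 1 - t * L e $ k" and ?c = "\<lambda>e. 1 - t * R e $ k"
  have ne: "?a e \<noteq> 0" "?c e \<noteq> 0" if "e \<in> edges G" for e using t[OF that] by auto
  have "(\<Sum>e\<in>{e \<in> edges G. wht G e = w}. (r e / (?a e * ?c e)) *s ?v (blk G e)) = 0" if w: "w \<in> whites G" for w
  proof -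
    let ?S = "{e \<in> edges G. wht G e = w}"
    have rel: "(\<Sum>e\<in>?S. r e *s v (blk G e)) = 0" using v w by (auto simp: vrcs_def)
    show ?thesis
    \<comment> \<open>For \<open>\<nu> w = 0\<close> telescoping says nothing, but the potential has
      one value \<open>y\<close> around \<open>w\<close>, and the new relation is a combination of
      the old one and its \<open>k\<close>-th coordinate.\<close>
    proof (cases "\<nu> w = 0")
      case True
      show ?thesis
      proof (cases "?S = {}")
        case False
        then obtain e0 where e0: "e0 \<in> ?S" by blast
        define y where "y = L e0"
        have y: "L e = y" "R e = y" if "e \<in> ?S" for e
        proof -
          show "L e = y" using flat[OF w True, of e e0] that e0 by (simp add: y_def)
          then show "R e = y" using LR[of e] that True by simp
        qed
        have "(\<Sum>e\<in>?S. (r e / (?a e * ?c e)) *s ?v (blk G e))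
            = (\<Sum>e\<in>?S. (1 / (1 - t * y $ k)) *s (r e *s v (blk G e)) + (t / (1 - t * y $ k)^2 * (r e *s v (blk G e)) $ k) *s y)"
        proof (rule sum.cong[OF refl])
          fix e assume e: "e \<in> ?S"
          have n0: "1 - t * y $ k \<noteq> 0" using ne[of e] y[OF e] e by simp
          have De: "D (blk G e) = v (blk G e) $ k *s y - y $ k *s v (blk G e)" using D[of e] e y[OF e] by simp
          show "(r e / (?a e * ?c e)) *s ?v (blk G e) =
            (1 / (1 - t * y $ k)) *s (r e *s v (blk G e)) + (t / (1 - t * y $ k)^2 * (r e *s v (blk G e)) $ k) *s y"
            unfolding De y[OF e] vec_eq_iff
          proof
            fix i
            define a where "a = 1 - t * y $ k"
            have "r e / (a * a) * (v (blk G e) $ i + t * (v (blk G e) $ k * y $ i - y $ k * v (blk G e) $ i))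
              = 1 / a * (r e * v (blk G e) $ i) + t / a^2 * (r e * v (blk G e) $ k) * y $ i"
            proof -
              have "v (blk G e) $ i + t * (v (blk G e) $ k * y $ i - y $ k * v (blk G e) $ i)
                = a * v (blk G e) $ i + t * v (blk G e) $ k * y $ i"
                unfolding a_def by (simp add: algebra_simps)
              then show ?thesis using n0 unfolding a_def[symmetric] by (simp only:) (simp add: field_simps power2_eq_square)
            qed
            then show "((r e / ((1 - t * y $ k) * (1 - t * y $ k))) *s (v (blk G e) + t *s (v (blk G e) $ k *s y - y $ k *s v (blk G e)))) $ i =
              ((1 / (1 - t * y $ k)) *s (r e *s v (blk G e)) + (t / (1 - t * y $ k)^2 * (r e *s v (blk G e)) $ k) *s y) $ i"
              unfolding a_def by (simp only: vector_smult_component vector_add_component vector_minus_component)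
          qed
        qed
        also have "\<dots> = (1 / (1 - t * y $ k)) *s (\<Sum>e\<in>?S. r e *s v (blk G e))
            + (t / (1 - t * y $ k)^2 * (\<Sum>e\<in>?S. r e *s v (blk G e)) $ k) *s y"
          by (simp add: sum.distrib vec.scale_sum_right vec.scale_sum_left sum_distrib_left)
        finally show ?thesis unfolding rel by simp
      next
        case True
        then show ?thesis by (simp only: sum.empty)
      qed
    next
      case False
      \<comment> \<open>The projective map. As \<open>L e\<close> and \<open>R e\<close> differ by a
        multiple of \<open>v (blk G e)\<close>, their images differ by a multiple of the moved
        vector, and the factor is the new coefficient times \<open>\<nu> w\<close>.\<close>
      let ?f = "\<lambda>y :: complex ^ 'm. (1 / (1 - t * y $ k)) *s y"
      have "\<nu> w *s ((r e / (?a e * ?c e)) *s ?v (blk G e)) = ?f (L e) - ?f (R e)" if e: "e \<in> ?S" for e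
        unfolding vec_eq_iff
      proof
        fix i
        have eE: "e \<in> edges G" and we: "wht G e = w" using e by auto
        define x where "x = v (blk G e)"
        define n where "n = \<nu> w * r e"
        have L: "L e $ j = R e $ j + n * x $ j" for j
          using arg_cong[OF LR[OF eE], of "\<lambda>y. y $ j"] we by (simp add: x_def n_def algebra_simps)
        have Di: "D (blk G e) $ i = x $ k * L e $ i - L e $ k * x $ i" using D[OF eE] by (simp add: x_def flip: D[OF eE])
        define a c where "a = ?a e" and "c = ?c e"
        have ac: "a \<noteq> 0" "c \<noteq> 0" "a = c - t * n * x $ k" "t * R e $ k = 1 - c"
          using ne[OF eE] L[of k] by (simp_all add: a_def c_def algebra_simps)
        have "n * (x $ i + t * (x $ k * L e $ i - L e $ k * x $ i)) = L e $ i * c - R e $ i * a"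
        proof -
          have c: "c = 1 - t * R e $ k" by (simp add: c_def)
          show ?thesis unfolding ac(3) L unfolding c by (simp add: algebra_simps)
        qed
        then have "n * (x $ i + t * D (blk G e) $ i) / (a * c) = L e $ i / a - R e $ i / c"
          using ac(1,2) unfolding Di by (simp add: field_simps)
        then show "(\<nu> w *s ((r e / (?a e * ?c e)) *s ?v (blk G e))) $ i = (?f (L e) - ?f (R e)) $ i"
          by (simp only: vector_smult_component vector_add_component vector_minus_component a_def c_def n_def x_def)
            (simp add: mult.assoc)
      qed
      then have "\<nu> w *s (\<Sum>e\<in>?S. (r e / (?a e * ?c e)) *s ?v (blk G e)) = (\<Sum>e\<in>?S. ?f (L e) - ?f (R e))"
        unfolding vec.scale_sum_right by (intro sum.cong refl)
      also have "\<dots> = 0" by (rule white[OF w])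
      finally show ?thesis using False by simp
    qed
  qed
  moreover have "?v ` boundary_verts G = v ` boundary_verts G" using D0 by (intro image_cong) auto
  ultimately show ?thesis using v ne unfolding vrcs_def by auto
qed

end

section \<open>The plane graph with a white vertex in place of the blob\<close>

lemma clockwise_spokes:
  assumes cw: "clockwise c \<rho> d p" and \<rho>: "0 < \<rho>" and jk: "j \<in> {1..d}" "k \<in> {1..d}" "j \<noteq> k"
  shows "closed_segment c (p j) \<inter> closed_segment c (p k) \<subseteq> {c}"
proof
  fix x assume x: "x \<in> closed_segment c (p j) \<inter> closed_segment c (p k)"
  obtain \<theta> where p: "\<forall>j\<in>{1..d}. p j = c + complex_of_real \<rho> * cis (\<theta> j)"
    and \<theta>: "\<forall>j\<in>{1..d}. \<forall>k\<in>{1..d}. j < k \<longrightarrow> \<theta> k < \<theta> j \<and> \<theta> j < \<theta> k + 2 * pi"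
    using cw unfolding clockwise_def by blast
  have pj: "p j = c + complex_of_real \<rho> * cis (\<theta> j)" and pk: "p k = c + complex_of_real \<rho> * cis (\<theta> k)"
    using p jk by blast+
  have ne: "cis (\<theta> j) \<noteq> cis (\<theta> k)"
  proof
    assume "cis (\<theta> j) = cis (\<theta> k)"
    then obtain n :: int where n: "\<theta> j = \<theta> k + 2 * pi * of_int n" using cis_eq_int by blast
    have "\<theta> k < \<theta> j \<and> \<theta> j < \<theta> k + 2 * pi \<or> \<theta> j < \<theta> k \<and> \<theta> k < \<theta> j + 2 * pi"
      using \<theta> jk by (metis linorder_neqE_nat)
    then have "0 < 2 * pi * of_int n \<and> 2 * pi * of_int n < 2 * pi * 1 \<or> 2 * pi * of_int n < 0 \<and> 2 * pi * (-1) < 2 * pi * of_int n"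
      using n by linarith
    then have "0 < n \<and> n < 1 \<or> n < 0 \<and> -1 < n"
      unfolding mult_less_cancel_left_pos[OF pi_gt_zero[THEN mult_pos_pos[OF zero_less_numeral]]]
      by (auto simp: zero_less_mult_iff mult_less_0_iff)
    then show False by linarith
  qed
  obtain s where s: "0 \<le> s" "x = c + of_real (s * \<rho>) * cis (\<theta> j)"
    using x pj by (auto simp: in_segment algebra_simps scaleR_conv_of_real)
  obtain t where t: "0 \<le> t" "x = c + of_real (t * \<rho>) * cis (\<theta> k)"
    using x pk by (auto simp: in_segment algebra_simps scaleR_conv_of_real)
  have eq: "of_real (s * \<rho>) * cis (\<theta> j) = of_real (t * \<rho>) * cis (\<theta> k)" using s(2) t(2) by (metis add_left_cancel)
  then have "norm (of_real (s * \<rho>) * cis (\<theta> j)) = norm (of_real (t * \<rho>) * cis (\<theta> k))" by (rule arg_cong)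
  then have "s * \<rho> = t * \<rho>" using s(1) t(1) \<rho> by (simp add: norm_mult abs_mult)
  then have "s * \<rho> = 0" using eq ne by (metis mult_cancel_left of_real_eq_0_iff)
  then show "x \<in> {c}" using s(2) by simp
qed

locale tangle_blob =
  fixes T :: "'e tangle" and i :: nat
  assumes tangle: "plabic_tangle T" and i: "i \<in> {1..nblobs T}"
begin

abbreviation "G \<equiv> pgraph T"

sublocale plabic G
  using tangle by unfold_locales (simp add: plabic_tangle_def)

text \<open>The edges of \<open>G\<close> together with the segments of the blob, prolonged to its center.\<close>

definition spoke :: "nat \<Rightarrow> real \<Rightarrow> complex"
  where "spoke j = reversepath (linepath (center T i) (bpos T i j) +++ seg T i j)"

definition aug_curve :: "'e + nat \<Rightarrow> real \<Rightarrow> complex"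
  where "aug_curve = case_sum (curve G) spoke"

definition aug_edges :: "('e + nat) set"
  where "aug_edges = Inl ` edges G \<union> Inr ` {1..bsize T i}"

lemma radius_pos: "0 < radius T i"
  and blob_face: "\<exists>f\<in>faces G. blob T i \<subseteq> f"
  and blob_clockwise: "clockwise (center T i) (radius T i) (bsize T i) (bpos T i)"
  using bspec[OF conjunct1[OF conjunct2[OF tangle[unfolded plabic_tangle_def]]] i] by simp_all

lemma seg:
  assumes "j \<in> {1..bsize T i}"
  shows "arc (seg T i j)" "pathstart (seg T i j) = bpos T i j" "target T i j \<in> all_blacks G"
    "open_arc (seg T i j) \<subseteq> ball 0 1" "open_arc (seg T i j) \<inter> drawing G = {}" "open_arc (seg T i j) \<inter> blob T i = {}"
proof -
  have "arc (seg T i j) \<and> pathstart (seg T i j) = bpos T i j \<and> target T i j \<in> all_blacks G \<and>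
       open_arc (seg T i j) \<subseteq> ball 0 1 - drawing G - (\<Union>k\<in>{1..nblobs T}. blob T k)"
    by (rule bspec[OF bspec[OF conjunct1[OF conjunct2[OF conjunct2[OF conjunct2[OF tangle[unfolded plabic_tangle_def]]]]] i] assms])
  then show "arc (seg T i j)" "pathstart (seg T i j) = bpos T i j" "target T i j \<in> all_blacks G"
    "open_arc (seg T i j) \<subseteq> ball 0 1" "open_arc (seg T i j) \<inter> drawing G = {}" "open_arc (seg T i j) \<inter> blob T i = {}"
    using i by auto
qed

lemma seg_disjoint:
  assumes "j \<in> {1..bsize T i}" "k \<in> {1..bsize T i}" "j \<noteq> k"
  shows "open_arc (seg T i j) \<inter> open_arc (seg T i k) = {}"
  using conjunct2[OF conjunct2[OF conjunct2[OF conjunct2[OF tangle[unfolded plabic_tangle_def]]]]] i assms by simp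

lemma blob_disc: "blob T i \<subseteq> ball 0 1 - drawing G"
  using blob_face in_components_subset unfolding faces_def by blast

lemma bpos_norm: "j \<in> {1..bsize T i} \<Longrightarrow> dist (center T i) (bpos T i j) = radius T i"
  using blob_clockwise radius_pos by (auto simp: clockwise_def dist_norm norm_mult)

lemma spoke_inner: "j \<in> {1..bsize T i} \<Longrightarrow> closed_segment (center T i) (bpos T i j) \<subseteq> blob T i"
  using bpos_norm[of j] radius_pos unfolding blob_def
  by (intro closed_segment_subset) auto

lemma center_blob: "center T i \<in> blob T i"
  using radius_pos by (simp add: blob_def)

lemma center_drawing: "center T i \<notin> drawing G"
  using center_blob blob_disc by blast

lemma verts_drawing: "verts G \<subseteq> drawing G" by (auto simp: drawing_def)

lemma target_drawing: "j \<in> {1..bsize T i} \<Longrightarrow> target T i j \<in> drawing G"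
  using seg(3) verts_drawing by (auto simp: verts_def)

lemma seg_image: 
  assumes "j \<in> {1..bsize T i}"
  shows "path_image (seg T i j) = insert (bpos T i j) (insert (target T i j) (open_arc (seg T i j)))"
  using seg(2)[OF assms] pathstart_in_path_image[of "seg T i j"] pathfinish_in_path_image[of "seg T i j"]
  unfolding open_arc_def target_def by auto

lemma spoke_image:
  assumes "j \<in> {1..bsize T i}"
  shows "path_image (spoke j) = closed_segment (center T i) (bpos T i j) \<union> insert (target T i j) (open_arc (seg T i j))"
  using seg(2)[OF assms] ends_in_segment(2)[of "bpos T i j" "center T i"]
  by (auto simp: spoke_def path_image_join seg_image[OF assms])

lemma spoke_arc:
  assumes j: "j \<in> {1..bsize T i}" shows "arc (spoke j)"
proof -
  have "center T i \<noteq> bpos T i j" using bpos_norm[OF j] radius_pos by auto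
  moreover have "target T i j \<notin> blob T i" using target_drawing[OF j] blob_disc by blast
  then have "closed_segment (center T i) (bpos T i j) \<inter> path_image (seg T i j) \<subseteq> {bpos T i j}"
    using spoke_inner[OF j] seg(6)[OF j] unfolding seg_image[OF j] by blast
  ultimately show ?thesis unfolding spoke_def
    by (intro arc_reversepath arc_join arc_linepath seg(1)[OF j]) (simp_all add: seg(2)[OF j])
qed

lemma spoke_ends: "pathstart (spoke j) = target T i j" "pathfinish (spoke j) = center T i"
  by (simp_all add: spoke_def target_def)

lemma spoke_drawing: "j \<in> {1..bsize T i} \<Longrightarrow> path_image (spoke j) \<inter> drawing G \<subseteq> {target T i j}"
  using spoke_inner[of j] seg(5)[of j] blob_disc unfolding spoke_image by blast

lemma curve_arc: "e \<in> edges G \<Longrightarrow> arc (curve G e)"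
  and open_arc_verts: "e \<in> edges G \<Longrightarrow> open_arc (curve G e) \<subseteq> ball 0 1 - verts G"
  using pg by (simp_all add: plabic_graph_def)

lemma open_arc_disjoint:
  "e \<in> edges G \<Longrightarrow> f \<in> edges G \<Longrightarrow> e \<noteq> f \<Longrightarrow> open_arc (curve G e) \<inter> open_arc (curve G f) = {}"
  using pg by (simp add: plabic_graph_def)

lemma curve_image: "path_image (curve G e) = {blk G e, wht G e} \<union> open_arc (curve G e)"
  using pathstart_in_path_image[of "curve G e"] pathfinish_in_path_image[of "curve G e"]
  by (auto simp: open_arc_def blk_def wht_def)

lemma curve_drawing: "e \<in> edges G \<Longrightarrow> path_image (curve G e) \<subseteq> drawing G"
  by (auto simp: drawing_def)

lemma edge_verts: "e \<in> edges G \<Longrightarrow> {blk G e, wht G e} \<subseteq> verts G"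
  using edge by (auto simp: verts_def)

lemma verts_cball: "verts G \<subseteq> cball 0 1"
  using boundary_norm internal_norm by (force simp: verts_def all_blacks_def)

lemma aug_simps:
  "aug_curve (Inl e) = curve G e" "aug_curve (Inr j) = spoke j"
  "Inl e \<in> aug_edges \<longleftrightarrow> e \<in> edges G" "Inr j \<in> aug_edges \<longleftrightarrow> j \<in> {1..bsize T i}"
  by (auto simp: aug_curve_def aug_edges_def)

lemma aug_cases:
  assumes "a \<in> aug_edges"
  obtains e where "a = Inl e" "e \<in> edges G" | j where "a = Inr j" "j \<in> {1..bsize T i}"
  using assms by (auto simp: aug_edges_def)

text \<open>The segments meet neither the drawing, except at their targets, nor each other away from
  vertices, and the radii inside the blob meet only at the center. So the prolonged segments are
  edges of a plane graph with one more vertex.\<close>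

sublocale aug: plane_graph aug_edges "insert (center T i) (verts G)" aug_curve
proof
  show "finite aug_edges" using fin by (simp add: aug_edges_def)
  show "finite (insert (center T i) (verts G))" using fin by (simp add: verts_def)
next
  fix a assume "a \<in> aug_edges"
  then show "arc (aug_curve a)" by (cases rule: aug_cases) (simp_all add: aug_simps curve_arc spoke_arc)
next
  fix a s assume "a \<in> aug_edges"
  then show "end_pt aug_curve (a, s) \<in> insert (center T i) (verts G)"
  proof (cases rule: aug_cases)
    case (1 e)
    then show ?thesis using edge_verts[of e] by (simp add: end_pt_def aug_simps blk_def wht_def)
  next
    case (2 j)
    then show ?thesis using seg(3)[of j] by (simp add: end_pt_def aug_simps spoke_ends verts_def)
  qed
next
  fix a assume "a \<in> aug_edges"
  then show "path_image (aug_curve a) \<inter> insert (center T i) (verts G) \<subseteq> {pathstart (aug_curve a), pathfinish (aug_curve a)}"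
  proof (cases rule: aug_cases)
    case (1 e)
    have "center T i \<notin> path_image (curve G e)" using curve_drawing[OF 1(2)] center_drawing by blast
    then show ?thesis unfolding 1(1) aug_simps curve_image using open_arc_verts[OF 1(2)]
      unfolding blk_def wht_def by blast
  next
    case (2 j)
    then show ?thesis using spoke_drawing[of j] verts_drawing unfolding 2(1) aug_simps spoke_ends by blast
  qed
next
  fix a assume "a \<in> aug_edges"
  then show "path_image (aug_curve a) \<subseteq> cball 0 1"
  proof (cases rule: aug_cases)
    case (1 e)
    have "ball 0 1 \<subseteq> cball (0::complex) 1" by auto
    then show ?thesis unfolding 1(1) aug_simps curve_image
      using open_arc_verts[OF 1(2)] edge_verts[OF 1(2)] verts_cball by blast
  next
    case (2 j)
    have "ball 0 1 \<subseteq> cball (0::complex) 1" by auto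
    moreover have "target T i j \<in> cball 0 1" using seg(3)[OF 2(2)] verts_cball by (auto simp: verts_def)
    ultimately show ?thesis unfolding 2(1) aug_simps spoke_image[OF 2(2)]
      using spoke_inner[OF 2(2)] blob_disc seg(4)[OF 2(2)] by blast
  qed
next
  have mixed: "path_image (curve G e) \<inter> path_image (spoke j) \<subseteq> verts G" if e: "e \<in> edges G" and j: "j \<in> {1..bsize T i}" for e j
    using curve_drawing[OF e] spoke_drawing[OF j] seg(3)[OF j] by (auto simp: verts_def)
  fix a b assume "a \<in> aug_edges" and b: "b \<in> aug_edges" and ab: "a \<noteq> b"
  then show "path_image (aug_curve a) \<inter> path_image (aug_curve b) \<subseteq> insert (center T i) (verts G)"
  proof (cases rule: aug_cases)
    case a: (1 e)
    from b show ?thesis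
    proof (cases rule: aug_cases)
      case b: (1 f)
      have "e \<noteq> f" using ab a b by simp
      then show ?thesis using open_arc_disjoint[OF a(2) b(2)] edge_verts[OF a(2)] edge_verts[OF b(2)]
        unfolding a(1) b(1) aug_simps curve_image by blast
    next
      case b: (2 j)
      show ?thesis using mixed[OF a(2) b(2)] unfolding a(1) b(1) aug_simps by blast
    qed
  next
    case a: (2 j)
    from b show ?thesis
    proof (cases rule: aug_cases)
      case b: (1 e)
      show ?thesis using mixed[OF b(2) a(2)] unfolding a(1) b(1) aug_simps by blast
    next
      case b: (2 k)
      have jk: "j \<noteq> k" using ab a b by simp
      have t: "target T i j \<in> verts G" "target T i k \<in> verts G" using seg(3) a(2) b(2) by (auto simp: verts_def)
      show ?thesis unfolding a(1) b(1) aug_simps spoke_image[OF a(2)] spoke_image[OF b(2)]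
        using clockwise_spokes[OF blob_clockwise radius_pos a(2) b(2) jk] seg_disjoint[OF a(2) b(2) jk]
          spoke_inner[OF a(2)] spoke_inner[OF b(2)] seg(6)[OF a(2)] seg(6)[OF b(2)] t
        by blast
    qed
  qed
qed

end

context tangle_blob begin

lemma starts_at: "{a \<in> aug_edges. pathstart (aug_curve a) = x} = {e \<in> edges G. blk G e = x} <+> {j \<in> {1..bsize T i}. target T i j = x}"
  by (auto simp: aug_edges_def aug_simps spoke_ends blk_def)

lemma finishes_at: "{a \<in> aug_edges. pathfinish (aug_curve a) = x} = {e \<in> edges G. wht G e = x} <+> {j \<in> {1..bsize T i}. center T i = x}"
  by (auto simp: aug_edges_def aug_simps spoke_ends wht_def)

lemma aug_edge_cases:
  assumes "a \<in> aug_edges"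
  shows "pathstart (aug_curve a) \<in> all_blacks G" "pathfinish (aug_curve a) \<in> insert (center T i) (whites G)"
proof -
  have "pathstart (aug_curve a) \<in> all_blacks G \<and> pathfinish (aug_curve a) \<in> insert (center T i) (whites G)"
    using assms
  proof (cases rule: aug_cases)
    case (1 e)
    then show ?thesis using edge[of e] by (simp add: aug_simps blk_def wht_def)
  next
    case (2 j)
    then show ?thesis using seg(3)[of j] by (simp add: aug_simps spoke_ends)
  qed
  then show "pathstart (aug_curve a) \<in> all_blacks G" "pathfinish (aug_curve a) \<in> insert (center T i) (whites G)"
    by blast+
qed

lemma center_verts: "center T i \<notin> verts G"
  using center_drawing verts_drawing by blast

lemma black_only_start:
  assumes "a \<in> aug_edges" "b \<in> all_blacks G" "pathstart (aug_curve a) = b \<or> pathfinish (aug_curve a) = b"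
  shows "pathstart (aug_curve a) = b"
  using aug_edge_cases[OF assms(1)] assms(2,3) center_verts black_white[OF assms(2)] by (auto simp: verts_def)

lemma white_only_finish:
  assumes "a \<in> aug_edges" "w \<in> whites G" "pathstart (aug_curve a) = w \<or> pathfinish (aug_curve a) = w"
  obtains e where "a = Inl e" "e \<in> edges G" "wht G e = w"
proof -
  have ps: "pathstart (aug_curve a) \<noteq> w" using aug_edge_cases(1)[OF assms(1)] assms(2) black_white by blast
  have cw: "center T i \<noteq> w" using center_verts assms(2) by (auto simp: verts_def)
  from assms(1) show ?thesis
  proof (cases rule: aug_cases)
    case (1 e)
    then show ?thesis using that[of e] assms(3) ps by (simp add: aug_simps wht_def)
  next
    case (2 j)
    then show ?thesis using assms(3) ps cw by (simp add: aug_simps spoke_ends)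
  qed
qed

text \<open>A left kernel vector \<open>\<nu>\<close> of the relations away from the blob gives a circulation once the blob is
  replaced by a white vertex at its center. Its potential vanishes at the blob, since otherwise the
  deformation above contradicts the uniqueness of the configuration.\<close>

lemma potential_in_line:
  fixes v :: "complex \<Rightarrow> complex ^ 'm" and L R :: "'e + nat \<Rightarrow> complex ^ 'm"
  assumes z: "z \<in> solvable_locus G" and n: "CARD('m) < nbd G" and v: "(v, r) \<in> vrcs G" "bdry G v \<in> z"
    and LR: "\<And>a. a \<in> aug_edges \<Longrightarrow> L a - R a = \<kappa> a *s v (pathstart (aug_curve a))"
    and \<kappa>: "\<And>e. e \<in> edges G \<Longrightarrow> \<kappa> (Inl e) = \<nu> (wht G e) * r e"
    and P2: "\<And>x f. x \<in> insert (center T i) (verts G) \<Longrightarrow>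
       (\<Sum>e\<in>{e\<in>aug_edges. pathstart (aug_curve e) = x}. f (L e) - f (R e) :: complex ^ 'm)
       = (\<Sum>e\<in>{e\<in>aug_edges. pathfinish (aug_curve e) = x}. f (L e) - f (R e))"
    and P3: "\<And>x (Q :: complex ^ 'm \<Rightarrow> bool) e e'. x \<in> insert (center T i) (verts G) \<Longrightarrow>
       (\<And>e. e \<in> aug_edges \<Longrightarrow> pathstart (aug_curve e) = x \<or> pathfinish (aug_curve e) = x \<Longrightarrow> Q (L e) = Q (R e))
       \<Longrightarrow> e \<in> aug_edges \<Longrightarrow> pathstart (aug_curve e) = x \<or> pathfinish (aug_curve e) = x
       \<Longrightarrow> e' \<in> aug_edges \<Longrightarrow> pathstart (aug_curve e') = x \<or> pathfinish (aug_curve e') = x \<Longrightarrow> Q (L e) = Q (L e')"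
    and P4: "\<And>x (Q :: complex ^ 'm \<Rightarrow> bool) e. x \<in> insert (center T i) (verts G) \<Longrightarrow> norm x = 1 \<Longrightarrow>
       (\<And>e. e \<in> aug_edges \<Longrightarrow> pathstart (aug_curve e) = x \<or> pathfinish (aug_curve e) = x \<Longrightarrow> Q (L e) = Q (R e))
       \<Longrightarrow> e \<in> aug_edges \<Longrightarrow> pathstart (aug_curve e) = x \<or> pathfinish (aug_curve e) = x \<Longrightarrow> Q (L e) = Q 0"
    and a: "a \<in> aug_edges" and k: "v (pathstart (aug_curve a)) $ k \<noteq> 0"
  shows "\<exists>c. L a = c *s v (pathstart (aug_curve a))" "\<exists>c. R a = c *s v (pathstart (aug_curve a))"
proof -
  \<comment> \<open>\<open>\<Delta> b\<close> kills the multiples of \<open>v b\<close>. The values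
    beside the edges at \<open>b\<close> differ by such multiples, so they have a common image
    \<open>D b\<close>; at the boundary it is \<open>0\<close>, as the potential vanishes
    outside.\<close>
  define \<Delta> where "\<Delta> b y = v b $ k *s y - y $ k *s v b" for b and y :: "complex ^ 'm"
  have \<Delta>LR: "\<Delta> b (L a) = \<Delta> b (R a)" if "a \<in> aug_edges" "pathstart (aug_curve a) = b" for a b
  proof -
    have "L a = R a + \<kappa> a *s v b" using LR[OF that(1)] that(2) by (simp add: algebra_simps)
    then show ?thesis by (simp add: \<Delta>_def vec_eq_iff algebra_simps)
  qed
  have "\<forall>b. \<exists>e. b \<in> all_blacks G \<longrightarrow> e \<in> edges G \<and> blk G e = b" using black_has_edge by blast
  then obtain \<epsilon> where \<epsilon>: "\<And>b. b \<in> all_blacks G \<Longrightarrow> \<epsilon> b \<in> edges G" "\<And>b. b \<in> all_blacks G \<Longrightarrow> blk G (\<epsilon> b) = b" by metis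
  define D where "D b = \<Delta> b (L (Inl (\<epsilon> b)))" for b
  have \<epsilon>a: "Inl (\<epsilon> b) \<in> aug_edges" "pathstart (aug_curve (Inl (\<epsilon> b))) = b" if "b \<in> all_blacks G" for b
    using \<epsilon>[OF that] by (simp_all add: aug_simps blk_def)
  have D: "\<Delta> b (L a) = D b" if b: "b \<in> all_blacks G" and a: "a \<in> aug_edges" "pathstart (aug_curve a) = b" for a b
  proof -
    have "(\<Delta> b (L a) = D b) = (\<Delta> b (L (Inl (\<epsilon> b))) = D b)"
    proof (rule P3[of b "\<lambda>y. \<Delta> b y = D b" a "Inl (\<epsilon> b)"])
      show "b \<in> insert (center T i) (verts G)" using b by (simp add: verts_def)
      show "(\<Delta> b (L e) = D b) = (\<Delta> b (R e) = D b)"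
        if "e \<in> aug_edges" "pathstart (aug_curve e) = b \<or> pathfinish (aug_curve e) = b" for e
        using \<Delta>LR[OF that(1) black_only_start[OF that(1) b that(2)]] by simp
    qed (use a \<epsilon>a[OF b] in auto)
    then show ?thesis by (simp add: D_def)
  qed
  have D0: "D b = 0" if b: "b \<in> boundary_verts G" for b
  proof -
    have bB: "b \<in> all_blacks G" using b by (simp add: all_blacks_def)
    have "(\<Delta> b (L (Inl (\<epsilon> b))) = 0) = (\<Delta> b 0 = 0)"
    proof (rule P4[of b "\<lambda>y. \<Delta> b y = 0" "Inl (\<epsilon> b)"])
      show "b \<in> insert (center T i) (verts G)" using bB by (simp add: verts_def)
      show "norm b = 1" using boundary_norm[OF b] .
      show "(\<Delta> b (L e) = 0) = (\<Delta> b (R e) = 0)"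
        if "e \<in> aug_edges" "pathstart (aug_curve e) = b \<or> pathfinish (aug_curve e) = b" for e
        using \<Delta>LR[OF that(1) black_only_start[OF that(1) bB that(2)]] by simp
    qed (use \<epsilon>a[OF bB] in auto)
    then show ?thesis by (simp add: D_def \<Delta>_def)
  qed
  define l where "l e = L (Inl e)" for e
  define \<rho> where "\<rho> e = R (Inl e)" for e
  have "finite ({0} \<union> (\<lambda>e. 1 / l e $ k) ` edges G \<union> (\<lambda>e. 1 / \<rho> e $ k) ` edges G)" using fin by simp
  from ex_new_if_finite[OF infinite_UNIV_char_0 this]
  \<comment> \<open>A nonzero time off the finitely many poles of the flow.\<close>
  obtain t where t: "t \<notin> {0} \<union> (\<lambda>e. 1 / l e $ k) ` edges G \<union> (\<lambda>e. 1 / \<rho> e $ k) ` edges G" by (rule exE)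
  have tne: "t * c \<noteq> 1" if tc: "t \<noteq> 1 / c" for c
  proof
    assume 1: "t * c = 1"
    then have "c \<noteq> 0" by auto
    then show False using 1 tc by (simp add: eq_divide_eq)
  qed
  have vrc: "(\<lambda>b. v b + t *s D b, \<lambda>e. r e / ((1 - t * l e $ k) * (1 - t * \<rho> e $ k))) \<in> vrcs G"
  proof (rule deformation[OF v(1), of l \<rho> \<nu> k D t])
    fix e assume e: "e \<in> edges G"
    then show "l e - \<rho> e = (\<nu> (wht G e) * r e) *s v (blk G e)"
      using LR[of "Inl e"] \<kappa>[OF e] by (simp add: aug_simps l_def \<rho>_def blk_def)
    show "v (blk G e) $ k *s l e - l e $ k *s v (blk G e) = D (blk G e)"
      using D[of "blk G e" "Inl e"] edge(1)[OF e] e by (simp add: \<Delta>_def l_def aug_simps blk_def)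
    show "t * l e $ k \<noteq> 1 \<and> t * \<rho> e $ k \<noteq> 1" using t e by (intro conjI tne) auto
  next
    fix w and f :: "complex ^ 'm \<Rightarrow> complex ^ 'm" assume w: "w \<in> whites G"
    have wV: "w \<in> insert (center T i) (verts G)" using w by (simp add: verts_def)
    have nc: "center T i \<noteq> w" using center_verts w by (auto simp: verts_def)
    have nb: "b \<noteq> w" if "b \<in> all_blacks G" for b using black_white[OF that] w by auto
    have e1: "{e \<in> edges G. blk G e = w} = {}" using nb[OF edge(1)] by auto
    have e2: "{j \<in> {1..bsize T i}. target T i j = w} = {}" using nb[OF seg(3)] by auto
    have e3: "{j \<in> {1..bsize T i}. center T i = w} = {}" using nc by simp
    have "0 = (\<Sum>a\<in>{a\<in>aug_edges. pathfinish (aug_curve a) = w}. f (L a) - f (R a))"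
      using P2[OF wV, of f] unfolding starts_at e1 e2 by (simp add: Plus_def)
    also have "\<dots> = (\<Sum>e\<in>{e \<in> edges G. wht G e = w}. f (l e) - f (\<rho> e))"
      unfolding finishes_at e3 l_def \<rho>_def using fin by (subst sum.Plus) simp_all
    finally show "(\<Sum>e\<in>{e \<in> edges G. wht G e = w}. f (l e) - f (\<rho> e)) = 0" by simp
  next
    fix w e e' assume w: "w \<in> whites G" "\<nu> w = 0" and e: "e \<in> edges G" "e' \<in> edges G" "wht G e = w" "wht G e' = w"
    have "(L (Inl e) = L (Inl e)) = (L (Inl e') = L (Inl e))"
    proof (rule P3[of w "\<lambda>y. y = L (Inl e)" "Inl e" "Inl e'"])
      show "w \<in> insert (center T i) (verts G)" using w by (simp add: verts_def)
      show "(L a = L (Inl e)) = (R a = L (Inl e))"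
        if aE: "a \<in> aug_edges" and at: "pathstart (aug_curve a) = w \<or> pathfinish (aug_curve a) = w" for a
      proof -
        obtain f where "a = Inl f" "f \<in> edges G" "wht G f = w" using white_only_finish[OF aE w(1) at] .
        then have "L a = R a" using LR[OF aE] \<kappa>[of f] w(2) by simp
        then show ?thesis by simp
      qed
    qed (use e in \<open>auto simp: aug_simps wht_def\<close>)
    then show "l e = l e'" by (simp add: l_def)
  qed (rule D0)
  \<comment> \<open>The boundary is unchanged, so by rigidity the moved vectors are multiples of the
    old ones; as \<open>t \<noteq> 0\<close>, each \<open>D b\<close> lies in the line of
    \<open>v b\<close>.\<close>
  obtain \<tau> s where \<tau>: "\<And>b. b \<in> all_blacks G \<Longrightarrow> v b + t *s D b = (\<tau> / s b) *s v b"
    by (rule solvable_rigid[OF z n v vrc]) (use D0 in auto)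
  define b where "b = pathstart (aug_curve a)"
  have b: "b \<in> all_blacks G" using aug_edge_cases(1)[OF a] by (simp add: b_def)
  have t0: "t \<noteq> 0" using t by simp
  have kb: "v b $ k \<noteq> 0" using k by (simp add: b_def)
  \<comment> \<open>Where \<open>v b $ k \<noteq> 0\<close>, membership of
    \<open>\<Delta> b y\<close> in the line of \<open>v b\<close> puts \<open>y\<close> itself into
    it.\<close>
  have line: "\<exists>c. y = c *s v b" if "\<Delta> b y = D b" for y
  proof -
    have "t *s (v b $ k *s y) = t *s (D b + y $ k *s v b)" unfolding that[symmetric] by (simp add: \<Delta>_def)
    also have "\<dots> = (\<tau> / s b) *s v b - v b + (t * y $ k) *s v b"
      using \<tau>[OF b] by (simp add: vec.scale_right_distrib algebra_simps)
    also have "\<dots> = (\<tau> / s b - 1 + t * y $ k) *s v b" by (simp add: vec.scale_left_distrib vec.scale_left_diff_distrib)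
    finally have eq: "(t * v b $ k) *s y = (\<tau> / s b - 1 + t * y $ k) *s v b" by simp
    define C where "C = t * v b $ k"
    have "C \<noteq> 0" using t0 kb by (simp add: C_def)
    then have "y = inverse C *s (C *s y)" by simp
    also have "\<dots> = (inverse C * (\<tau> / s b - 1 + t * y $ k)) *s v b"
      unfolding eq[folded C_def] vec.scale_scale ..
    finally have "y = (inverse C * (\<tau> / s b - 1 + t * y $ k)) *s v b" .
    then show ?thesis by blast
  qed
  have DL: "\<Delta> b (L a) = D b" using D[OF b a] by (simp add: b_def)
  moreover have "\<Delta> b (R a) = D b" using DL \<Delta>LR[OF a] by (simp add: b_def)
  ultimately show "\<exists>c. L a = c *s v (pathstart (aug_curve a))" "\<exists>c. R a = c *s v (pathstart (aug_curve a))"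
    using line by (simp_all add: b_def)
qed

text \<open>One configuration with blob vectors in general position is enough, and the paths are
  found in whatever acyclic orientation \<open>F\<close> is given.\<close>

lemma generic_paths:
  fixes v :: "complex \<Rightarrow> complex ^ 'm"
  assumes F: "acyclic_rpo G F" and m: "2 \<le> CARD('m)" "CARD('m) \<le> bsize T i"
    and z: "z \<in> solvable_locus G" and v: "(v, r) \<in> vrcs G" "bdry G v \<in> z"
    and gen: "blob_tuple T i v \<in> general_position {1..bsize T i}"
  obtains P where "\<And>j. j \<in> {1..bsize T i} \<Longrightarrow> boundary_path_to G F (target T i j) (P j)"
    "\<And>j k. j \<in> {1..bsize T i} \<Longrightarrow> k \<in> {1..bsize T i} \<Longrightarrow> j \<noteq> k \<Longrightarrow> set (P j) \<inter> set (P k) = {}"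
proof -
  interpret rpo_graph G F using F by unfold_locales
  let ?J = "{1..bsize T i}"
  define x where "x j = v (target T i j)" for j
  define Dt where "Dt = target T i ` ?J"
  have DtB: "Dt \<subseteq> all_blacks G" using seg(3) by (auto simp: Dt_def)
  have r: "\<And>e. e \<in> edges G \<Longrightarrow> r e \<noteq> 0" using v(1) by (auto simp: vrcs_def)
  have x0: "x j \<noteq> 0" if "j \<in> ?J" for j
    using general_position_points[OF gen] that by (auto simp: points_def blob_tuple_def x_def)
  have xne: "x j \<noteq> c *s x k" if "j \<in> ?J" "k \<in> ?J" "j \<noteq> k" for j k c
    using general_position_nonparallel[OF gen _ _ m(1) that, of c] m(2) that by (simp add: blob_tuple_def x_def)
  have inj: "inj_on (target T i) ?J"
  proof (rule inj_onI, rule ccontr)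
    fix j k assume "j \<in> ?J" "k \<in> ?J" "target T i j = target T i k" "j \<noteq> k"
    then show False using xne[of j k 1] by (simp add: x_def)
  qed
  \<comment> \<open>Coefficients of parallel edges are added, so a nonzero entry still witnesses an
    edge.\<close>
  define M where "M w b = (\<Sum>e\<in>{e \<in> {e \<in> edges G. blk G e = b}. wht G e = w}. r e)" for w b
  have kernel: "\<forall>w\<in>whites G. \<nu> w = 0" if ker: "\<forall>b\<in>all_blacks G - Dt. (\<Sum>w\<in>whites G. \<nu> w * M w b) = 0" for \<nu>
  proof -
    define \<kappa> where "\<kappa> b = (\<Sum>e\<in>{e \<in> edges G. blk G e = b}. \<nu> (wht G e) * r e)" for b
    have \<kappa>M: "(\<Sum>w\<in>whites G. \<nu> w * M w b) = \<kappa> b" for b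
    proof -
      have "(\<Sum>w\<in>whites G. \<nu> w * M w b)
          = (\<Sum>w\<in>whites G. \<Sum>e\<in>{e \<in> {e \<in> edges G. blk G e = b}. wht G e = w}. \<nu> (wht G e) * r e)"
        unfolding M_def sum_distrib_left by (intro sum.cong refl) simp
      also have "\<dots> = \<kappa> b" unfolding \<kappa>_def by (rule sum.group) (use fin edge in auto)
      finally show ?thesis .
    qed
    have \<kappa>0: "\<kappa> b = 0" if "b \<notin> Dt" for b
    proof (cases "b \<in> all_blacks G")
      case True
      then show ?thesis using ker that unfolding \<kappa>M by blast
    next
      case False
      then have "{e \<in> edges G. blk G e = b} = {}" using edge(1) by auto
      then show ?thesis unfolding \<kappa>_def by (simp only: sum.empty)
    qed
    \<comment> \<open>The excess \<open>\<kappa>\<close> of \<open>\<nu>\<close> at a target is led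
      off through the spoke, which balances all black vertices.\<close>
    define c where "c = case_sum (\<lambda>e. \<nu> (wht G e) * r e) (\<lambda>j. - \<kappa> (target T i j))"
    define \<omega> where "\<omega> a = c a *s v (pathstart (aug_curve a))" for a
    have \<omega>: "\<omega> (Inl e) = (\<nu> (wht G e) * r e) *s v (blk G e)" "\<omega> (Inr j) = - (\<kappa> (target T i j) *s x j)" for e j
      by (simp_all add: \<omega>_def c_def aug_simps spoke_ends x_def blk_def)
    have out: "(\<Sum>e\<in>{e \<in> edges G. blk G e = b}. \<omega> (Inl e)) = \<kappa> b *s v b" for b
      unfolding \<omega> \<kappa>_def vec.scale_sum_left by (intro sum.cong) auto
    have starts: "(\<Sum>a\<in>{a\<in>aug_edges. pathstart (aug_curve a) = y}. \<omega> a) = 0" for y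
    proof -
      have "(\<Sum>j\<in>{j \<in> ?J. target T i j = y}. \<omega> (Inr j)) = - (\<kappa> y *s v y)"
      proof (cases "y \<in> Dt")
        case True
        then obtain j where j: "j \<in> ?J" "target T i j = y" by (auto simp: Dt_def)
        then have "{j \<in> ?J. target T i j = y} = {j}" using inj by (auto dest: inj_onD)
        then show ?thesis using j by (simp add: \<omega> x_def)
      next
        case False
        then have "{j \<in> ?J. target T i j = y} = {}" by (auto simp: Dt_def)
        then show ?thesis using \<kappa>0[OF False] by (simp only: sum.empty) simp
      qed
      then show ?thesis unfolding starts_at using fin out[of y] by (subst sum.Plus) simp_all
    qed
    have in_white: "(\<Sum>e\<in>{e \<in> edges G. wht G e = w}. \<omega> (Inl e)) = 0" for w
    proof (cases "w \<in> whites G")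
      case True
      have "(\<Sum>e\<in>{e \<in> edges G. wht G e = w}. \<omega> (Inl e)) = \<nu> w *s (\<Sum>e\<in>{e \<in> edges G. wht G e = w}. r e *s v (blk G e))"
        unfolding \<omega> vec.scale_sum_right by (intro sum.cong) auto
      then show ?thesis using v(1) True by (simp add: vrcs_def)
    next
      case False
      then have "{e \<in> edges G. wht G e = w} = {}" using edge(2) by auto
      then show ?thesis by (simp only: sum.empty)
    qed
    \<comment> \<open>Balance at the center: the excess over all black vertices adds up to the sum
      of the white relations weighted by \<open>\<nu>\<close>, which is zero.\<close>
    have total: "(\<Sum>j\<in>?J. \<omega> (Inr j)) = 0"
    proof -
      have "(\<Sum>j\<in>?J. \<kappa> (target T i j) *s x j) = (\<Sum>b\<in>Dt. \<kappa> b *s v b)"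
        unfolding Dt_def x_def by (simp only: sum.reindex[OF inj] o_def)
      also have "\<dots> = (\<Sum>b\<in>all_blacks G. \<kappa> b *s v b)"
        using DtB fin \<kappa>0 by (intro sum.mono_neutral_left) auto
      also have "\<dots> = (\<Sum>b\<in>all_blacks G. \<Sum>e\<in>{e \<in> edges G. blk G e = b}. \<omega> (Inl e))" unfolding out ..
      also have "\<dots> = (\<Sum>e\<in>edges G. \<omega> (Inl e))" by (rule sum.group) (use fin edge in auto)
      also have "\<dots> = (\<Sum>w\<in>whites G. \<Sum>e\<in>{e \<in> edges G. wht G e = w}. \<omega> (Inl e))"
        by (rule sum.group[symmetric]) (use fin edge in auto)
      also have "\<dots> = 0" unfolding in_white by simp
      finally show ?thesis unfolding \<omega> by (simp add: sum_negf)
    qed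
    have finishes: "(\<Sum>a\<in>{a\<in>aug_edges. pathfinish (aug_curve a) = y}. \<omega> a) = 0" for y
    proof -
      have "(\<Sum>j\<in>{j \<in> ?J. center T i = y}. \<omega> (Inr j)) = 0"
      proof (cases "center T i = y")
        case True
        then have "{j \<in> ?J. center T i = y} = ?J" by blast
        then show ?thesis using total by (simp only:)
      next
        case False
        then have "{j \<in> ?J. center T i = y} = {}" by blast
        then show ?thesis by (simp only: sum.empty)
      qed
      then show ?thesis unfolding finishes_at using fin in_white[of y] by (subst sum.Plus) simp_all
    qed
    show ?thesis
    proof (rule aug.ex_potential[of \<omega>])
      show "(\<Sum>a\<in>{a\<in>aug_edges. pathstart (aug_curve a) = y}. \<omega> a) = (\<Sum>a\<in>{a\<in>aug_edges. pathfinish (aug_curve a) = y}. \<omega> a)" for y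
        unfolding starts finishes ..
    next
      fix L R :: "'e + nat \<Rightarrow> complex ^ 'm"
      assume LR: "\<And>a. a \<in> aug_edges \<Longrightarrow> L a - R a = \<omega> a"
        and P2: "\<And>x f. x \<in> insert (center T i) (verts G) \<Longrightarrow>
           (\<Sum>e\<in>{e\<in>aug_edges. pathstart (aug_curve e) = x}. f (L e) - f (R e) :: complex ^ 'm)
           = (\<Sum>e\<in>{e\<in>aug_edges. pathfinish (aug_curve e) = x}. f (L e) - f (R e))"
        and P3: "\<And>x (Q :: complex ^ 'm \<Rightarrow> bool) e e'. x \<in> insert (center T i) (verts G) \<Longrightarrow>
           (\<And>e. e \<in> aug_edges \<Longrightarrow> pathstart (aug_curve e) = x \<or> pathfinish (aug_curve e) = x \<Longrightarrow> Q (L e) = Q (R e))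
           \<Longrightarrow> e \<in> aug_edges \<Longrightarrow> pathstart (aug_curve e) = x \<or> pathfinish (aug_curve e) = x
           \<Longrightarrow> e' \<in> aug_edges \<Longrightarrow> pathstart (aug_curve e') = x \<or> pathfinish (aug_curve e') = x \<Longrightarrow> Q (L e) = Q (L e')"
        and P4: "\<And>x (Q :: complex ^ 'm \<Rightarrow> bool) e. x \<in> insert (center T i) (verts G) \<Longrightarrow> norm x = 1 \<Longrightarrow>
           (\<And>e. e \<in> aug_edges \<Longrightarrow> pathstart (aug_curve e) = x \<or> pathfinish (aug_curve e) = x \<Longrightarrow> Q (L e) = Q (R e))
           \<Longrightarrow> e \<in> aug_edges \<Longrightarrow> pathstart (aug_curve e) = x \<or> pathfinish (aug_curve e) = x \<Longrightarrow> Q (L e) = Q 0"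
      have line: "\<exists>c. L (Inr j) = c *s x j" "\<exists>c. R (Inr j) = c *s x j" if j: "j \<in> ?J" for j
      proof -
        have ps: "pathstart (aug_curve (Inr j)) = target T i j" by (simp add: aug_simps spoke_ends)
        obtain k where k: "v (target T i j) $ k \<noteq> 0" using x0[OF j] by (auto simp: x_def vec_eq_iff)
        note pl = potential_in_line[OF z card_boundary[OF v(1)] v, of L R c \<nu> "Inr j" k, unfolded ps, folded \<omega>_def x_def]
        show "\<exists>c. L (Inr j) = c *s x j"
          by (rule pl(1)) (use LR P2 P3 P4 k j in \<open>simp_all add: c_def aug_simps x_def\<close>)
        show "\<exists>c. R (Inr j) = c *s x j"
          by (rule pl(2)) (use LR P2 P3 P4 k j in \<open>simp_all add: c_def aug_simps x_def\<close>)
      qed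
      have "\<kappa> (target T i j) = 0" if j: "j \<in> ?J" for j
      proof -
        \<comment> \<open>The sum rule at the center holds for nonlinear \<open>f\<close> too. This
          one keeps the line of \<open>x j\<close> and kills the other lines, so that only the spoke
          \<open>j\<close> contributes.\<close>
        define f where "f y = (if \<exists>c. y = c *s x j then y else 0)" for y
        have other: "f (c *s x k) = 0" if k: "k \<in> ?J" "k \<noteq> j" for c k
        proof (cases "\<exists>d. c *s x k = d *s x j")
          case True
          then obtain d where d: "c *s x k = d *s x j" by blast
          have "c = 0"
          proof (rule ccontr)
            assume "c \<noteq> 0"
            then have "x k = (inverse c * d) *s x j" using arg_cong[OF d, of "\<lambda>y. inverse c *s y"] by simp
            then show False using xne[OF k(1) j k(2)] by blast
          qed
          then show ?thesis by (simp add: f_def)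
        qed (simp add: f_def)
        have cV: "center T i \<in> insert (center T i) (verts G)" by simp
        have e1: "{e \<in> edges G. blk G e = center T i} = {}" "{e \<in> edges G. wht G e = center T i} = {}"
          "{j \<in> ?J. target T i j = center T i} = {}"
        proof -
          have cb: "center T i \<notin> all_blacks G" "center T i \<notin> whites G" using center_verts by (simp_all add: verts_def)
          have "blk G e \<noteq> center T i" "wht G e \<noteq> center T i" if "e \<in> edges G" for e using edge[OF that] cb by metis+
          moreover have "target T i j \<noteq> center T i" if "j \<in> ?J" for j using seg(3)[OF that] cb by metis
          ultimately show "{e \<in> edges G. blk G e = center T i} = {}" "{e \<in> edges G. wht G e = center T i} = {}"
            "{j \<in> ?J. target T i j = center T i} = {}" by simp_all
        qed
        have "0 = (\<Sum>a\<in>{a\<in>aug_edges. pathfinish (aug_curve a) = center T i}. f (L a) - f (R a))"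
          using P2[OF cV, of f] unfolding starts_at e1 by (simp add: Plus_def)
        also have "\<dots> = (\<Sum>k\<in>?J. f (L (Inr k)) - f (R (Inr k)))"
        proof -
          have "{j \<in> ?J. center T i = center T i} = ?J" by blast
          then show ?thesis unfolding finishes_at e1 by (simp only:) (subst sum.Plus, simp_all)
        qed
        also have "\<dots> = (\<Sum>k\<in>{j}. f (L (Inr k)) - f (R (Inr k)))"
        proof (rule sum.mono_neutral_right)
          show "\<forall>k\<in>?J - {j}. f (L (Inr k)) - f (R (Inr k)) = 0"
          proof
            fix k assume "k \<in> ?J - {j}"
            then have k: "k \<in> ?J" "k \<noteq> j" by auto
            obtain c d where "L (Inr k) = c *s x k" "R (Inr k) = d *s x k" using line[OF k(1)] by blast
            then show "f (L (Inr k)) - f (R (Inr k)) = 0" using other[OF k] by simp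
          qed
        qed (use j in auto)
        also have "\<dots> = L (Inr j) - R (Inr j)" using line[OF j] by (simp add: f_def)
        also have "\<dots> = - (\<kappa> (target T i j) *s x j)" using LR[of "Inr j"] j by (simp add: aug_simps \<omega>)
        finally show ?thesis using x0[OF j] by simp
      qed
      then have "\<kappa> b = 0" for b using \<kappa>0[of b] by (cases "b \<in> Dt") (auto simp: Dt_def)
      then show ?thesis using no_left_kernel[of r \<nu>] r unfolding \<kappa>_def by blast
    qed
  qed
  obtain \<pi> where \<pi>: "inj_on \<pi> (whites G)" "\<pi> ` whites G \<subseteq> all_blacks G - Dt" "\<And>w. w \<in> whites G \<Longrightarrow> M w (\<pi> w) \<noteq> 0"
    using independent_rows_matching[of "whites G" "all_blacks G - Dt" M] fin kernel by blast
  have \<pi>e: "\<exists>e\<in>edges G. wht G e = w \<and> blk G e = \<pi> w" if w: "w \<in> whites G" for w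
  proof (rule ccontr)
    assume "\<not> ?thesis"
    then have "{e \<in> {e \<in> edges G. blk G e = \<pi> w}. wht G e = w} = {}" by blast
    then have "M w (\<pi> w) = 0" unfolding M_def by (simp only: sum.empty)
    then show False using \<pi>(3)[OF w] by simp
  qed
  have \<pi>D: "\<pi> w \<notin> Dt" if "w \<in> whites G" for w using \<pi>(2) that by blast
  obtain p where p: "\<And>b. b \<in> Dt \<Longrightarrow> boundary_path_to G F b (p b)"
    "\<And>b c. b \<in> Dt \<Longrightarrow> c \<in> Dt \<Longrightarrow> b \<noteq> c \<Longrightarrow> set (p b) \<inter> set (p c) = {}"
    using matching_paths[OF DtB \<pi>(1) \<pi>e \<pi>D] by metis
  show ?thesis
  proof (rule that[of "\<lambda>j. p (target T i j)"])
    show "boundary_path_to G F (target T i j) (p (target T i j))" if "j \<in> ?J" for j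
      using p(1) that by (simp add: Dt_def)
    show "set (p (target T i j)) \<inter> set (p (target T i k)) = {}" if "j \<in> ?J" "k \<in> ?J" "j \<noteq> k" for j k
      using that inj by (intro p(2)) (auto simp: Dt_def dest: inj_onD)
  qed
qed

end

section \<open>The image of a tangle with a brushing\<close>

lemma general_position_span:
  fixes x :: "'i \<Rightarrow> complex ^ 'm"
  assumes x: "x \<in> general_position I" and I: "finite I" "CARD('m) \<le> card I"
  shows "vec.span (x ` I) = UNIV"
proof -
  obtain J where J: "J \<subseteq> I" "card J = CARD('m)" using ex_superset_card[of I "{}" "CARD('m)"] I by auto
  then have "UNIV = vec.span (x ` J)" using x by (simp add: general_position_def)
  also have "\<dots> \<subseteq> vec.span (x ` I)" using J(1) by (intro vec.span_mono image_mono)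
  finally show ?thesis by blast
qed

lemma spanning_minor:
  fixes x :: "'i \<Rightarrow> complex ^ 'm"
  assumes J: "finite J" and x: "minor_of K x \<noteq> 0" "K \<subseteq> J" "card K = CARD('m)"
  shows "vec.span (x ` J) = UNIV"
proof -
  have "vec.span (x ` K) = UNIV" using x J minor_of_nonzero[of K x] finite_subset by blast
  then show ?thesis using vec.span_mono[OF image_mono[OF x(2)], of x] by auto
qed

lemma conf_open_nonvanishing_nonempty:
  fixes U :: "('i \<Rightarrow> complex ^ 'm) set set"
  assumes I: "finite I" and U: "conf_open I U" "U \<noteq> {}" and q: "q \<in> polyfun I" "q y \<noteq> 0"
  shows "{z \<in> U. \<exists>x\<in>z. q x \<noteq> 0} \<noteq> {}"
proof -
  obtain X where X: "X \<in> U" using U(2) by blast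
  then have "X \<in> conf_gen I" using U(1) by (auto simp: conf_open_def)
  then obtain x where "x \<in> X" using conf_gen_nonempty_class by blast
  then have x: "x \<in> \<Union>U" using X by blast
  obtain f where f: "f \<in> polyfun I" "f x \<noteq> 0" "\<forall>y\<in>I \<rightarrow>\<^sub>E UNIV. f y \<noteq> 0 \<longrightarrow> y \<in> \<Union>U" using conf_open_basic[OF I U(1) x] by blast
  obtain z where z: "z \<in> I \<rightarrow>\<^sub>E UNIV" "\<And>b. b \<in> {True, False} \<Longrightarrow> (if b then f else q) z \<noteq> 0"
    by (rule polyfun_nonzero_family[of "{True, False}" "\<lambda>b. if b then f else q" I]) (use f q in auto)
  have zU: "z \<in> \<Union>U" and qz: "q z \<noteq> 0" using f(3) z(1) z(2)[of True] z(2)[of False] by auto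
  have gen: "U \<subseteq> conf_gen I" using U(1) by (simp add: conf_open_def)
  have "z \<in> general_position I" using zU Union_mono[OF gen] unfolding Union_conf_gen by blast
  then have "z \<in> conf_of I z" by (intro conf_of_self general_position_points)
  then show ?thesis using conf_of_mem[OF gen zU] qz by blast
qed

lemma conf_open_nonvanishing_family:
  fixes U :: "('i \<Rightarrow> complex ^ 'm) set set"
  assumes "finite A" and I: "finite I" and U: "conf_open I U" "U \<noteq> {}"
    and q: "\<And>a. a \<in> A \<Longrightarrow> q a \<in> polyfun I" "\<And>a. a \<in> A \<Longrightarrow> \<exists>y. q a y \<noteq> 0"
  shows "conf_open I {z \<in> U. \<forall>a\<in>A. \<exists>x\<in>z. q a x \<noteq> 0} \<and> {z \<in> U. \<forall>a\<in>A. \<exists>x\<in>z. q a x \<noteq> 0} \<noteq> {}"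
  using assms(1) q
proof (induction A rule: finite_induct)
  case empty
  then show ?case using U by simp
next
  case (insert a A)
  let ?V = "{z \<in> U. \<forall>a\<in>A. \<exists>x\<in>z. q a x \<noteq> 0}"
  have "conf_open I ?V \<and> ?V \<noteq> {}" by (rule insert.IH) (use insert.prems in simp_all)
  then have V: "conf_open I ?V" "?V \<noteq> {}" by (rule conjunct1, rule conjunct2)
  obtain y where y: "q a y \<noteq> 0" using insert.prems(2)[of a] by blast
  have qa: "q a \<in> polyfun I" using insert.prems(1) by simp
  have "{z \<in> U. \<forall>a\<in>insert a A. \<exists>x\<in>z. q a x \<noteq> 0} = {z \<in> ?V. \<exists>x\<in>z. q a x \<noteq> 0}" by auto
  then show ?case using conf_open_nonvanishing[OF V(1) qa] conf_open_nonvanishing_nonempty[OF I V qa y] by (simp only:) simp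
qed

context plabic begin

lemma inj_bvert: "inj_on (bvert G) {1..nbd G}"
proof (rule inj_onI, rule ccontr)
  fix j k assume jk: "j \<in> {1..nbd G}" "k \<in> {1..nbd G}" "bvert G j = bvert G k" "j \<noteq> k"
  have "clockwise 0 1 (nbd G) (bvert G)" using pg by (simp add: plabic_graph_def)
  then have "closed_segment 0 (bvert G j) \<inter> closed_segment 0 (bvert G k) \<subseteq> {0}" using jk by (intro clockwise_spokes) auto
  then have "bvert G j = 0" using jk(3) by auto
  then show False using boundary_norm[of "bvert G j"] jk(1) by (simp add: boundary_verts_def)
qed

lemma bdry_image: "bdry G v ` {1..nbd G} = v ` boundary_verts G"
  by (auto simp: bdry_def boundary_verts_def)

lemma bdry_extensional: "bdry G v \<in> {1..nbd G} \<rightarrow>\<^sub>E UNIV"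
  by (simp add: bdry_def)

text \<open>A polynomial condition on a class may hold at another representative than the boundary
  at hand. The configuration is moved to that representative, and its vectors change only by a
  matrix and nonzero scalars.\<close>

lemma transport_boundary:
  fixes v :: "complex \<Rightarrow> complex ^ 'm"
  assumes v: "(v, r) \<in> vrcs G" and x: "(bdry G v, x) \<in> conf_rel {1..nbd G}"
  obtains v' r' A t where "(v', r') \<in> vrcs G" "bdry G v' = x" "invertible (A :: complex ^ 'm ^ 'm)"
    "\<And>b. t b \<noteq> 0" "\<And>b. v' b = t b *s (A *v v b)"
proof -
  obtain A s where A: "invertible (A :: complex ^ 'm ^ 'm)" and x: "x \<in> points {1..nbd G}"
    and s: "\<And>j. j \<in> {1..nbd G} \<Longrightarrow> s j \<noteq> 0" "\<And>j. j \<in> {1..nbd G} \<Longrightarrow> x j = s j *s (A *v bdry G v j)"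
    using x unfolding conf_rel_def by blast
  define t where "t b = (if b \<in> boundary_verts G then s (inv_into {1..nbd G} (bvert G) b) else 1)" for b
  have tb: "t (bvert G j) = s j" if "j \<in> {1..nbd G}" for j
    using inv_into_f_f[OF inj_bvert that] that by (simp add: t_def boundary_verts_def)
  have t0: "t b \<noteq> 0" for b
  proof (cases "b \<in> boundary_verts G")
    case True
    then obtain j where "j \<in> {1..nbd G}" "b = bvert G j" by (auto simp: boundary_verts_def)
    then show ?thesis using tb s(1) by simp
  qed (simp add: t_def)
  define v' where "v' b = t b *s (A *v v b)" for b
  define r' where "r' e = r e / t (blk G e)" for e
  have bd: "bdry G v' = x"
  proof
    fix j
    show "bdry G v' j = x j"
    proof (cases "j \<in> {1..nbd G}")
      case True
      then show ?thesis using s(2)[OF True] tb[OF True] by (simp add: bdry_def v'_def)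
    next
      case False
      then show ?thesis using PiE_arb[OF bdry_extensional False] PiE_arb[OF points_extensional[OF x] False] by simp
    qed
  qed
  have "(v', r') \<in> vrcs G"
  proof -
    have "vec.span (v' ` boundary_verts G) = UNIV"
      by (rule span_transform[OF A, of _ t v' v]) (use t0 v in \<open>auto simp: v'_def vrcs_def\<close>)
    moreover have "(\<Sum>e\<in>{e \<in> edges G. wht G e = w}. r' e *s v' (blk G e)) = 0" if w: "w \<in> whites G" for w
    proof -
      have "(\<Sum>e\<in>{e \<in> edges G. wht G e = w}. r' e *s v' (blk G e)) = (\<Sum>e\<in>{e \<in> edges G. wht G e = w}. A *v (r e *s v (blk G e)))"
        by (intro sum.cong refl) (simp add: r'_def v'_def t0 vector_scalar_commute)
      also have "\<dots> = A *v (\<Sum>e\<in>{e \<in> edges G. wht G e = w}. r e *s v (blk G e))" by (simp add: matrix_mult_sum_right)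
      also have "\<dots> = 0" using v w by (simp add: vrcs_def)
      finally show ?thesis .
    qed
    moreover have "\<forall>e\<in>edges G. r' e \<noteq> 0" using v t0 by (simp add: vrcs_def r'_def)
    ultimately show ?thesis by (simp add: vrcs_def)
  qed
  then show ?thesis by (rule that[OF _ bd A t0 v'_def])
qed

end

section \<open>Normal forms under gauge transformations\<close>

context rpo_graph begin

text \<open>Gauge transformations at the white vertices achieve coefficient \<open>- 1\<close> on
  \<open>F\<close>; by \<open>sol_unique\<close> the vectors are then given by the
  recursion.\<close>

lemma normal_form:
  fixes v :: "complex \<Rightarrow> complex ^ 'm"
  assumes v: "(v, r) \<in> vrcs G"
  obtains q where "\<And>e. e \<in> edges G \<Longrightarrow> q e \<noteq> 0" "\<And>b. b \<in> all_blacks G \<Longrightarrow> sol q v b = v b"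
proof -
  have r: "r e \<noteq> 0" if "e \<in> edges G" for e using v that by (simp add: vrcs_def)
  define \<phi> where "\<phi> w = (THE f. f \<in> F \<and> wht G f = w)" for w
  have \<phi>: "\<phi> w \<in> F" "wht G (\<phi> w) = w" if "w \<in> whites G" for w
    using theI'[OF white_out[OF that]] by (simp_all add: \<phi>_def)
  define r' where "r' e = - r e / r (\<phi> (wht G e))" for e
  have nz: "r' e \<noteq> 0" if "e \<in> edges G" for e
    using r[OF that] r[OF F_edges[OF \<phi>(1)[OF edge(2)[OF that]]]] by (simp add: r'_def)
  have "rel_holds v r'" unfolding rel_holds_def
  proof
    fix w assume w: "w \<in> whites G"
    have "(\<Sum>e\<in>{e \<in> edges G. wht G e = w}. r' e *s v (blk G e))
        = (\<Sum>e\<in>{e \<in> edges G. wht G e = w}. (- 1 / r (\<phi> w)) *s (r e *s v (blk G e)))"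
      by (intro sum.cong) (auto simp: r'_def)
    also have "\<dots> = (- 1 / r (\<phi> w)) *s (\<Sum>e\<in>{e \<in> edges G. wht G e = w}. r e *s v (blk G e))"
      by (simp only: vec.scale_sum_right)
    also have "\<dots> = 0" using vrc_rel[OF v] w by (simp add: rel_holds_def)
    finally show "(\<Sum>e\<in>{e \<in> edges G. wht G e = w}. r' e *s v (blk G e)) = 0" .
  qed
  moreover have "r' f = -1" if f: "f \<in> F" for f
  proof -
    have "\<phi> (wht G f) = f" using F_white_inj f \<phi>[OF edge(2)[OF F_edges[OF f]]] by blast
    then show ?thesis using r[OF F_edges[OF f]] by (simp add: r'_def)
  qed
  ultimately have "sol r' v b = v b" if "b \<in> all_blacks G" for b using that by (intro sol_unique) auto
  then show ?thesis using that[of r'] nz by blast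
qed

lemma vrc_sol:
  fixes s :: "complex \<Rightarrow> complex ^ 'm"
  assumes q: "\<And>e. e \<in> edges G - F \<Longrightarrow> q e \<noteq> 0" and sp: "vec.span (sol q s ` boundary_verts G) = UNIV"
  shows "(sol q s, weight q) \<in> vrcs G"
  using rel_holds_sol[of q s] q sp by (auto simp: vrcs_def rel_holds_def weight_def)

lemma sol_cong:
  assumes q: "\<And>e. e \<in> edges G - F \<Longrightarrow> q e = q' e" and s: "\<And>b. b \<in> boundary_verts G \<Longrightarrow> is_source b \<Longrightarrow> s b = s' b"
    and b: "b \<in> all_blacks G"
  shows "sol q s b = sol q' s' b"
  using b
proof (induction rule: black_induct)
  case (source b)
  then show ?case using s source_boundary by (subst (1 2) sol) simp
next
  case (step b)
  have "(\<Sum>e\<in>feeds b. q e *s sol q s (blk G e)) = (\<Sum>e\<in>feeds b. q' e *s sol q' s' (blk G e))"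
    using step(3) q by (intro sum.cong) (auto simp: feeds_def)
  then show ?case using step(2) by (subst (1 2) sol) simp
qed

text \<open>An arbitrary choice of one coefficient for each internal black vertex, on which the
  gauge freedom at that vertex will be spent.\<close>

definition main_feed :: "complex \<Rightarrow> 'e"
  where "main_feed b = (SOME e. e \<in> feeds b)"

lemma main_feed: "b \<in> blacks G \<Longrightarrow> main_feed b \<in> feeds b"
  using feeds_nonempty by (auto simp: main_feed_def some_in_eq)

lemma internal_not_source: "b \<in> blacks G \<Longrightarrow> \<not> is_source b"
  using source_boundary[of b] blacks_boundary[of b] by (auto simp: all_blacks_def)

text \<open>Rescaling the vectors at internal vertices makes the coefficients of the edges \<open>main_feed b\<close> equal to \<open>1\<close>.\<close>

lemma slice:
  fixes s :: "complex \<Rightarrow> complex ^ 'm"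
  assumes q: "\<And>e. e \<in> edges G - F \<Longrightarrow> q e \<noteq> 0"
  obtains q' c where "\<And>e. e \<in> edges G - F \<Longrightarrow> q' e \<noteq> 0" "\<And>b. b \<in> blacks G \<Longrightarrow> q' (main_feed b) = 1"
    "\<And>b. b \<in> all_blacks G \<Longrightarrow> c b \<noteq> 0" "\<And>b. b \<in> boundary_verts G \<Longrightarrow> c b = 1"
    "\<And>b. b \<in> all_blacks G \<Longrightarrow> sol q' s b = c b *s sol q s b"
proof -
  \<comment> \<open>The factors are forced by \<open>q' (main_feed b) = 1\<close> along
    \<open>prec\<close>, starting from \<open>1\<close> at the boundary, where vectors must not
    change.\<close>
  define c where "c = wfrec prec (\<lambda>c b. if b \<in> blacks G then c (blk G (main_feed b)) / q (main_feed b) else (1::complex))"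
  have c: "c b = (if b \<in> blacks G then c (blk G (main_feed b)) / q (main_feed b) else 1)" for b
  proof -
    have "c b = (if b \<in> blacks G then cut c prec b (blk G (main_feed b)) / q (main_feed b) else 1)"
      unfolding c_def by (subst wfrec[OF wf_prec]) simp
    then show ?thesis using feeds_prec[OF internal_not_source main_feed] by (simp add: cut_apply)
  qed
  have fE: "e \<in> edges G - F" if "e \<in> feeds b" for e b using that by (simp add: feeds_def)
  have cb: "c b = 1" if "b \<in> boundary_verts G" for b using that blacks_boundary c[of b] by auto
  have c0: "c b \<noteq> 0" if "b \<in> all_blacks G" for b using that
  proof (induction rule: black_induct)
    case (source b)
    then show ?case using cb source_boundary by simp
  next
    case (step b)
    show ?case
    proof (cases "b \<in> blacks G")
      case True
      show ?thesis using step(3)[OF main_feed[OF True]] q[OF fE[OF main_feed[OF True]]] True by (subst c) simp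
    qed (subst c, simp)
  qed
  define below where "below e = (THE b. b \<in> all_blacks G \<and> \<not> is_source b \<and> wht G (in_edge b) = wht G e)" for e
  have below: "below e = b" if "b \<in> all_blacks G" "\<not> is_source b" "e \<in> feeds b" for e b
    unfolding below_def
  proof (rule the_equality)
    have eb: "wht G e = wht G (in_edge b)" using that(3) by (simp add: feeds_def)
    then show "b \<in> all_blacks G \<and> \<not> is_source b \<and> wht G (in_edge b) = wht G e" using that by simp
    fix b' assume b': "b' \<in> all_blacks G \<and> \<not> is_source b' \<and> wht G (in_edge b') = wht G e"
    then have "in_edge b' = in_edge b" using in_edge(1) that(2) eb F_white_inj by metis
    then show "b' = b" using in_edge(2) b' that(2) by metis
  qed
  define q' where "q' e = q e * c (below e) / c (blk G e)" for e
  have q'f: "q' e = q e * c b / c (blk G e)" if "b \<in> all_blacks G" "\<not> is_source b" "e \<in> feeds b" for b e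
    using below[OF that] by (simp add: q'_def)
  show ?thesis
  proof (rule that[OF _ _ c0 cb])
    show "q' e \<noteq> 0" if e: "e \<in> edges G - F" for e
    proof -
      obtain b where b: "b \<in> all_blacks G" "\<not> is_source b" "wht G (in_edge b) = wht G e" using white_below[OF edge(2)[of e]] e by blast
      then have "e \<in> feeds b" using e by (simp add: feeds_def)
      then show ?thesis using q'f[OF b(1,2)] q[OF e] c0[OF b(1)] c0[OF edge(1)[of e]] e by simp
    qed
    show "q' (main_feed b) = 1" if b: "b \<in> blacks G" for b
    proof -
      have bB: "b \<in> all_blacks G" using b by (simp add: all_blacks_def)
      have "c (blk G (main_feed b)) \<noteq> 0" using c0 feeds_black[OF main_feed[OF b]] by blast
      moreover have "c b = c (blk G (main_feed b)) / q (main_feed b)" using c[of b] b by simp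
      ultimately show ?thesis using q'f[OF bB internal_not_source[OF b] main_feed[OF b]] q[OF fE[OF main_feed[OF b]]] by simp
    qed
    show "sol q' s b = c b *s sol q s b" if "b \<in> all_blacks G" for b using that
    proof (induction rule: black_induct)
      case (source b)
      then show ?case using cb[OF source_boundary[OF source]] by (subst (1 2) sol) simp
    next
      case (step b)
      have "(\<Sum>e\<in>feeds b. q' e *s sol q' s (blk G e)) = (\<Sum>e\<in>feeds b. c b *s (q e *s sol q s (blk G e)))"
      proof (rule sum.cong[OF refl])
        fix e assume e: "e \<in> feeds b"
        then show "q' e *s sol q' s (blk G e) = c b *s (q e *s sol q s (blk G e))"
          using step(3)[OF e] q'f[OF step(1,2) e] c0[OF feeds_black[OF e]] by (simp add: mult.commute)
      qed
      then show ?case using step(2) by (subst (1 2) sol) (simp add: vec.scale_sum_right)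
    qed
  qed
qed

end

lemma (in plabic) the_vrc_related:
  fixes v :: "complex \<Rightarrow> complex ^ 'm"
  assumes z: "z \<in> solvable_locus G" and v: "(v, r) \<in> vrcs G" "bdry G v \<in> z"
  obtains A t where "invertible (A :: complex ^ 'm ^ 'm)" "\<And>b. b \<in> all_blacks G \<Longrightarrow> t b \<noteq> 0"
    "\<And>b. b \<in> all_blacks G \<Longrightarrow> fst (the_vrc G z) b = t b *s (A *v v b)"
proof -
  have "(fst (the_vrc G z), snd (the_vrc G z)) \<in> vrcs G" using solvable_vrc(1)[OF z] by simp
  then have "((v, r), (fst (the_vrc G z), snd (the_vrc G z))) \<in> gauge_rel G" using solvable_vrc(2)[OF z] by (rule solvable_gauge[OF z v])
  then have "\<exists>A t. invertible (A :: complex ^ 'm ^ 'm) \<and> (\<forall>x\<in>verts G. t x \<noteq> 0) \<and>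
      (\<forall>b\<in>all_blacks G. fst (the_vrc G z) b = inverse (t b) *s (A *v v b))"
    unfolding gauge_rel_def by blast
  then obtain A t where "invertible (A :: complex ^ 'm ^ 'm)" "\<forall>x\<in>verts G. t x \<noteq> 0"
      "\<forall>b\<in>all_blacks G. fst (the_vrc G z) b = inverse (t b) *s (A *v v b)" by blast
  then show ?thesis by (intro that[of A "\<lambda>b. inverse (t b)"]) (auto simp: verts_def)
qed

section \<open>Parameter spaces of solutions\<close>

context rpo_graph begin

definition params :: "('e + complex \<times> 'm::finite) set"
  where "params = Inl ` (edges G - F) \<union> Inr ` ({b \<in> boundary_verts G. is_source b} \<times> UNIV)"

definition solp :: "('e + complex \<times> 'm \<Rightarrow> complex) \<Rightarrow> complex \<Rightarrow> complex ^ 'm"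
  where "solp p = sol (\<lambda>e. p (Inl e)) (\<lambda>b. \<chi> k. p (Inr (b, k)))"

definition encode :: "('e \<Rightarrow> complex) \<Rightarrow> (complex \<Rightarrow> complex ^ 'm) \<Rightarrow> 'e + complex \<times> 'm \<Rightarrow> complex"
  where "encode q s = case_sum q (\<lambda>(b, k). s b $ k)"

lemma solp_encode: "solp (encode q s) = sol q s"
  by (simp add: solp_def encode_def vec_lambda_eta)

lemma finite_params: "finite params"
  using fin by (simp add: params_def boundary_verts_def)

lemma solp_mpoly:
  fixes k :: "'m :: finite"
  assumes "b \<in> all_blacks G" shows "(\<lambda>p. solp p b $ k) \<in> mpoly params"
  using assms
proof (induction arbitrary: k rule: black_induct)
  case (source b)
  have "solp p b $ k = p (Inr (b, k))" for p :: "'e + complex \<times> 'm \<Rightarrow> complex"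
    using source(2) unfolding solp_def by (subst sol) simp
  moreover have "(Inr (b, k) :: 'e + complex \<times> 'm) \<in> params" using source source_boundary by (auto simp: params_def)
  ultimately show ?case by (simp add: mpoly.coord)
next
  case (step b)
  have "solp p b $ k = (\<Sum>e\<in>feeds b. p (Inl e) * solp p (blk G e) $ k)" for p :: "'e + complex \<times> 'm \<Rightarrow> complex"
    using step(2) unfolding solp_def by (subst sol) simp
  moreover have "(\<lambda>p :: 'e + complex \<times> 'm \<Rightarrow> complex. p (Inl e) * solp p (blk G e) $ k) \<in> mpoly params" if "e \<in> feeds b" for e
    using that by (intro mpoly.mult mpoly.coord step(3)) (auto simp: params_def feeds_def)
  ultimately show ?case by (simp add: mpoly_sum)
qed

lemma bdry_coord_mpoly: "i \<in> {1..nbd G} \<Longrightarrow> (\<lambda>p. bdry G (solp p) i $ k) \<in> mpoly params"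
  using solp_mpoly[of "bvert G i" k] by (simp add: bdry_def all_blacks_def boundary_verts_def)

text \<open>The conditions are nonzero polynomials in the parameters, each with a witness of its
  own: the given configuration for \<open>f\<close>, the possibly degenerate \<open>q1\<close> and
  \<open>s1\<close> for \<open>g\<close>, and parameters equal to \<open>1\<close> for the
  coefficients. Generic parameters meet all of them.\<close>

lemma ex_generic_sol:
  fixes v :: "complex \<Rightarrow> complex ^ 'm"
  assumes n: "CARD('m) \<le> nbd G" and v: "(v, r) \<in> vrcs G"
    and f: "f \<in> polyfun {1..nbd G}" "f (bdry G v) \<noteq> 0"
      "\<forall>y\<in>{1..nbd G} \<rightarrow>\<^sub>E UNIV. f y \<noteq> 0 \<longrightarrow> y \<in> general_position {1..nbd G}"
    and g: "(\<lambda>p. g (solp p)) \<in> mpoly params" "g (sol q1 s1) \<noteq> 0"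
  shows "\<exists>q (s :: complex \<Rightarrow> complex ^ 'm). (\<forall>e\<in>edges G - F. q e \<noteq> 0) \<and>
    (sol q s, weight q) \<in> vrcs G \<and> f (bdry G (sol q s)) \<noteq> 0 \<and> g (sol q s) \<noteq> 0"
proof -
  obtain q0 where "\<And>e. e \<in> edges G \<Longrightarrow> q0 e \<noteq> 0" and q0: "\<And>b. b \<in> all_blacks G \<Longrightarrow> sol q0 v b = v b"
    using normal_form[OF v] by metis
  have b0: "bdry G (sol q0 v) = bdry G v"
    unfolding bdry_def by (intro restrict_ext q0) (simp add: all_blacks_def boundary_verts_def)
  define A where "A = insert None (insert (Some None) ((\<lambda>e. Some (Some e)) ` (edges G - F)))"
  define H where "H a p = (case a of None \<Rightarrow> f (bdry G (solp p)) | Some None \<Rightarrow> g (solp p) | Some (Some e) \<Rightarrow> p (Inl e))"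
    for a and p :: "'e + complex \<times> 'm \<Rightarrow> complex"
  have "\<exists>p. \<forall>a\<in>A. H a p \<noteq> 0"
  proof (rule mpoly_nonzero_family)
    show "finite A" using fin by (simp add: A_def)
    fix a assume a: "a \<in> A"
    have acase: thesis if "a \<in> A" "a = None \<Longrightarrow> thesis" "a = Some None \<Longrightarrow> thesis"
        "\<And>e. a = Some (Some e) \<Longrightarrow> e \<in> edges G - F \<Longrightarrow> thesis" for thesis
      using that unfolding A_def by auto
    from a show "H a \<in> mpoly params"
    proof (elim acase)
      assume 1: "a = None"
      have "(\<lambda>p. f (bdry G (solp p))) \<in> mpoly params" by (rule polyfun_mpoly[OF f(1) bdry_coord_mpoly])
      then show ?thesis unfolding 1 H_def by simp
    next
      assume 2: "a = Some None"
      show ?thesis using g(1) unfolding 2 H_def by simp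
    next
      fix e assume 3: "a = Some (Some e)" "e \<in> edges G - F"
      have "(\<lambda>p :: 'e + complex \<times> 'm \<Rightarrow> complex. p (Inl e)) \<in> mpoly params" using 3(2) by (intro mpoly.coord) (auto simp: params_def)
      then show ?thesis unfolding 3(1) H_def by simp
    qed
    from a show "\<exists>p. H a p \<noteq> 0"
    proof (elim acase)
      assume "a = None"
      then show ?thesis using f(2) b0 by (intro exI[of _ "encode q0 v"]) (simp add: H_def solp_encode)
    next
      assume "a = Some None"
      then show ?thesis using g(2) by (intro exI[of _ "encode q1 s1"]) (simp add: H_def solp_encode)
    next
      fix e assume "a = Some (Some e)"
      then show ?thesis by (intro exI[of _ "\<lambda>_. 1"]) (simp add: H_def)
    qed
  qed
  then obtain p where p: "\<And>a. a \<in> A \<Longrightarrow> H a p \<noteq> 0" by blast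
  define q where "q e = p (Inl e)" for e
  define s :: "complex \<Rightarrow> complex ^ 'm" where "s b = (\<chi> k. p (Inr (b, k)))" for b
  have sp: "solp p = sol q s" unfolding solp_def q_def s_def ..
  have q: "q e \<noteq> 0" if "e \<in> edges G - F" for e using p[of "Some (Some e)"] that by (simp add: A_def H_def q_def)
  have fq: "f (bdry G (sol q s)) \<noteq> 0" using p[of None] by (simp add: A_def H_def sp)
  then have "bdry G (sol q s) \<in> general_position {1..nbd G}" using f(3) bdry_extensional[of "sol q s"] by simp
  then have "vec.span (bdry G (sol q s) ` {1..nbd G}) = UNIV" using n by (intro general_position_span) auto
  then have "(sol q s, weight q) \<in> vrcs G" unfolding bdry_image by (intro vrc_sol q)
  moreover have "g (sol q s) \<noteq> 0" using p[of "Some None"] by (simp add: A_def H_def sp)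
  ultimately show ?thesis using q fq by (intro exI[of _ q] exI[of _ s]) simp
qed

definition pad :: "('e + complex \<times> 'm \<Rightarrow> complex) \<Rightarrow> 'e + complex \<times> 'm \<Rightarrow> complex"
  where "pad p a = (if a \<in> Inl ` main_feed ` blacks G then 1 else p a)"

definition slice_params :: "('e + complex \<times> 'm::finite) set"
  where "slice_params = params - Inl ` main_feed ` blacks G"

lemma pad_mpoly: "a \<in> params \<Longrightarrow> (\<lambda>p. pad p a) \<in> mpoly slice_params"
  unfolding pad_def slice_params_def by (cases "a \<in> Inl ` main_feed ` blacks G") (simp_all add: mpoly.const mpoly.coord)

lemma pad_simps: "pad p (Inl e) = (if e \<in> main_feed ` blacks G then 1 else p (Inl e))" "pad p (Inr a) = p (Inr a)"
  by (auto simp: pad_def)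

lemma pad_main_feed: "b \<in> blacks G \<Longrightarrow> pad p (Inl (main_feed b)) = 1"
  by (simp add: pad_def)

text \<open>Rigidity leaves a gauge \<open>t\<close> that is \<open>\<tau>\<close> on the boundary.
  The coefficients \<open>- 1\<close> of \<open>in_edge b\<close> and \<open>1\<close> of
  \<open>main_feed b\<close> at the same white vertex carry \<open>t = \<tau>\<close> on to
  \<open>b\<close>, and then every coefficient is unchanged.\<close>

lemma slice_rigid:
  fixes s s' :: "complex \<Rightarrow> complex ^ 'm"
  assumes z: "z \<in> solvable_locus G" and n: "CARD('m) < nbd G"
    and v: "(sol q s, weight q) \<in> vrcs G" "bdry G (sol q s) \<in> z" and v': "(sol q' s', weight q') \<in> vrcs G"
    and one: "\<And>b. b \<in> blacks G \<Longrightarrow> q (main_feed b) = 1" "\<And>b. b \<in> blacks G \<Longrightarrow> q' (main_feed b) = 1"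
    and eq: "\<And>b. b \<in> boundary_verts G \<Longrightarrow> sol q' s' b = sol q s b"
    and e: "e \<in> edges G - F"
  shows "q' e = q e"
proof -
  obtain \<tau> t where t0: "\<And>b. b \<in> verts G \<Longrightarrow> t b \<noteq> 0"
    and t: "\<And>e. e \<in> edges G \<Longrightarrow> weight q' e = t (blk G e) * t (wht G e) * weight q e" "\<And>b. b \<in> boundary_verts G \<Longrightarrow> t b = \<tau>"
    using solvable_rigid[OF z n v v' eq] by metis
  have in1: "t b * t (wht G (in_edge b)) = 1" if b: "\<not> is_source b" for b
    using t(1)[OF F_edges[OF in_edge(1)[OF b]]] in_edge[OF b] weight_simps(1)[OF b] by simp
  have t\<tau>: "t b = \<tau>" if "b \<in> all_blacks G" for b using that
  proof (induction rule: black_induct)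
    case (source b)
    then show ?case using t(2) source_boundary by blast
  next
    case (step b)
    show ?case
    proof (cases "b \<in> blacks G")
      case True
      note mf = main_feed[OF True]
      have "main_feed b \<in> edges G" "wht G (main_feed b) = wht G (in_edge b)" using mf by (simp_all add: feeds_def)
      then have "1 = \<tau> * t (wht G (in_edge b))"
        using t(1)[of "main_feed b"] weight_simps(2)[OF mf] one[OF True] step(3)[OF mf] by simp
      then have "t b * t (wht G (in_edge b)) = \<tau> * t (wht G (in_edge b))" "t (wht G (in_edge b)) \<noteq> 0"
        using in1[OF step(2)] by auto
      then show ?thesis by simp
    next
      case False
      then show ?thesis using t(2) step(1) by (simp add: all_blacks_def)
    qed
  qed
  have eE: "e \<in> edges G" using e by simp
  obtain b where b: "b \<in> all_blacks G" "\<not> is_source b" "wht G (in_edge b) = wht G e" using white_below[OF edge(2)[OF eE]] by blast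
  then have "\<tau> * t (wht G e) = 1" using in1[OF b(2)] t\<tau>[OF b(1)] by simp
  then show ?thesis using t(1)[OF eE] t\<tau>[OF edge(1)[OF eE]] e by (simp add: weight_def)
qed

end

lemma minor_of_mpoly:
  fixes v :: "('i \<Rightarrow> complex) \<Rightarrow> 'j \<Rightarrow> complex ^ 'm"
  assumes K: "finite K" "card K = CARD('m)" and v: "\<And>j k. j \<in> K \<Longrightarrow> (\<lambda>p. v p j $ k) \<in> mpoly I"
  shows "(\<lambda>p. minor_of K (v p)) \<in> mpoly I"
  by (rule polyfun_mpoly[OF minor_of_polyfun[OF K order_refl] v])

lemma minor_of_scale:
  fixes x :: "'i \<Rightarrow> complex ^ 'm"
  assumes K: "finite K" "card K = CARD('m)" and c: "\<And>j. j \<in> K \<Longrightarrow> c j \<noteq> 0"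
    and y: "\<And>j. j \<in> K \<Longrightarrow> y j = c j *s x j"
  shows "minor_of K y \<noteq> 0 \<longleftrightarrow> minor_of K x \<noteq> 0"
proof -
  have id: "invertible (mat 1 :: complex ^ 'm ^ 'm)" unfolding invertible_def by (rule exI[of _ "mat 1"]) simp
  show ?thesis unfolding minor_of_nonzero[OF K]
    using span_transform[OF id, of K c y x] span_inverse_transform[OF id, of K c y x] c y by auto
qed

context rpo_graph begin

lemma path_minor:
  fixes x :: "'j \<Rightarrow> complex ^ 'm"
  assumes p: "\<And>j. j \<in> J \<Longrightarrow> boundary_path_to G F (t j) (p j)"
    and disj: "\<And>j k. j \<in> J \<Longrightarrow> k \<in> J \<Longrightarrow> j \<noteq> k \<Longrightarrow> set (p j) \<inter> set (p k) = {}"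
    and t: "\<And>j. j \<in> J \<Longrightarrow> t j \<in> all_blacks G"
  shows "\<exists>q s. \<forall>j\<in>J. sol q s (t j) = x j"
proof -
  have "p j \<noteq> []" if "j \<in> J" for j using p[OF that] by (simp add: boundary_path_to_def)
  then have hd: "hd (p j) \<in> set (p j)" if "j \<in> J" for j using that by simp
  have inj: "inj_on (\<lambda>j. hd (p j)) J"
  proof (rule inj_onI, rule ccontr)
    fix j k assume jk: "j \<in> J" "k \<in> J" "hd (p j) = hd (p k)" "j \<noteq> k"
    then have "hd (p j) \<in> set (p j) \<inter> set (p k)" using hd[of j] hd[of k] by simp
    then show False using disj[OF jk(1,2,4)] by simp
  qed
  show ?thesis
  proof (rule path_weights[of J t p])
    fix q assume q: "\<And>(s :: complex \<Rightarrow> complex ^ 'm) j. j \<in> J \<Longrightarrow> sol q s (t j) = s (hd (p j))"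
    have "sol q (\<lambda>b. x (inv_into J (\<lambda>j. hd (p j)) b)) (t j) = x j" if "j \<in> J" for j
      using q[OF that] inv_into_f_f[OF inj that] by simp
    then show ?thesis by blast
  qed (use p disj t in auto)
qed

text \<open>On the slice \<open>main_feed b \<mapsto> 1\<close> the boundary determines the solution, so the slice has dimension at
  most that of the space of boundaries, and a hypersurface in it is not mapped onto a dense set.\<close>

lemma span_discriminant:
  fixes U :: "(nat \<Rightarrow> complex ^ 'm) set set" and t :: "'j \<Rightarrow> complex"
  assumes U: "conf_open {1..nbd G} U" "U \<noteq> {}" "U \<subseteq> solvable_locus G"
    and K: "finite K" "card K = CARD('m)" and t: "\<And>j. j \<in> K \<Longrightarrow> t j \<in> all_blacks G"
    and p: "\<And>j. j \<in> K \<Longrightarrow> boundary_path_to G F (t j) (p j)"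
    and disj: "\<And>j k. j \<in> K \<Longrightarrow> k \<in> K \<Longrightarrow> j \<noteq> k \<Longrightarrow> set (p j) \<inter> set (p k) = {}"
  obtains Q y where "Q \<in> polyfun {1..nbd G}" "Q y \<noteq> 0"
    "\<And>v r. (v :: complex \<Rightarrow> complex ^ 'm, r) \<in> vrcs G \<Longrightarrow> Q (bdry G v) \<noteq> 0 \<Longrightarrow> minor_of K (\<lambda>j. v (t j)) \<noteq> 0"
proof -
  obtain z0 where z0: "z0 \<in> U" using U(2) by blast
  obtain v0 :: "complex \<Rightarrow> complex ^ 'm" and r0 where v0: "(v0, r0) \<in> vrcs G" "bdry G v0 \<in> z0"
    using solvable_vrc[of z0] z0 U(3) by (cases "the_vrc G z0") auto
  have b0: "bdry G v0 \<in> \<Union>U" using v0(2) z0 by blast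
  have n: "CARD('m) < nbd G" by (rule card_boundary[OF v0(1)])
  obtain f where f: "f \<in> polyfun {1..nbd G}" "f (bdry G v0) \<noteq> 0" "\<forall>y\<in>{1..nbd G} \<rightarrow>\<^sub>E UNIV. f y \<noteq> 0 \<longrightarrow> y \<in> \<Union>U"
    using conf_open_basic[OF _ U(1) b0] by auto
  have gen: "U \<subseteq> conf_gen {1..nbd G}" using U(1) by (simp add: conf_open_def)
  define h where "h q = minor_of K (\<lambda>j. solp (pad q) (t j) :: complex ^ 'm)" for q
  define \<beta> where "\<beta> q = (\<lambda>(i, k). bdry G (solp (pad q) :: complex \<Rightarrow> complex ^ 'm) i $ k)" for q
  define E where "E = edges G - F - main_feed ` blacks G"
  \<comment> \<open>Off the zeros of \<open>g\<close> the slice parameters give a configuration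
    whose boundary lies in \<open>U\<close>, so that uniqueness applies to it.\<close>
  define g where "g q = f (bdry G (solp (pad q))) * (\<Prod>e\<in>E. q (Inl e))" for q
  let ?I = "slice_params :: ('e + complex \<times> 'm) set"
  let ?J = "{1..nbd G} \<times> (UNIV :: 'm set)"
  have finI: "finite ?I" unfolding slice_params_def by (intro finite_Diff finite_params)
  have E: "Inl e \<in> ?I" if "e \<in> E" for e using that by (auto simp: E_def slice_params_def params_def)
  have coord: "(\<lambda>q. solp (pad q) b $ k) \<in> mpoly ?I" if "b \<in> all_blacks G" for b and k :: 'm
    by (rule mpoly_comp[OF solp_mpoly[OF that] pad_mpoly])
  have bcoord: "(\<lambda>q. bdry G (solp (pad q)) i $ k) \<in> mpoly ?I" if "i \<in> {1..nbd G}" for i and k :: 'm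
    by (rule mpoly_comp[OF bdry_coord_mpoly[OF that] pad_mpoly])
  have \<beta>: "(\<lambda>q. \<beta> q j) \<in> mpoly ?I" if "j \<in> ?J" for j using that bcoord by (auto simp: \<beta>_def)
  have h: "h \<in> mpoly ?I" unfolding h_def by (intro minor_of_mpoly[OF K] coord t)
  have g: "g \<in> mpoly ?I" unfolding g_def by (intro mpoly.mult polyfun_mpoly[OF f(1) bcoord] mpoly_prod mpoly.coord E)
  have pad_encode: "solp (pad (encode q s)) b = sol q s b"
    if "\<And>b. b \<in> blacks G \<Longrightarrow> q (main_feed b) = 1" "b \<in> all_blacks G" for q and s :: "complex \<Rightarrow> complex ^ 'm" and b
    unfolding solp_def by (rule sol_cong[OF _ _ that(2)]) (use that(1) in \<open>auto simp: pad_def encode_def vec_eq_iff\<close>)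
  have bd_cong: "bdry G v = bdry G v'" if "\<And>b. b \<in> all_blacks G \<Longrightarrow> v b = v' b" for v v' :: "complex \<Rightarrow> complex ^ 'm"
    unfolding bdry_def by (intro restrict_ext that) (simp add: all_blacks_def boundary_verts_def)
  have bd_cong': "bdry G v = bdry G v'" if "\<And>b. b \<in> boundary_verts G \<Longrightarrow> v b = v' b" for v v' :: "complex \<Rightarrow> complex ^ 'm"
    unfolding bdry_def by (intro restrict_ext that) (simp add: boundary_verts_def)
  \<comment> \<open>The paths bring the standard basis to the vertices \<open>t j\<close>, possibly
    with zero coefficients. So the minor is not the zero polynomial; genericity and
    \<open>slice\<close> then give a witness \<open>x0\<close> on the slice.\<close>
  obtain q1 s1 where q1: "\<And>j. j \<in> K \<Longrightarrow> sol q1 s1 (t j) = (axis (inv_into UNIV (enum_of K) j) 1 :: complex ^ 'm)"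
  proof -
    have "\<exists>q1 s1. \<forall>j\<in>K. sol q1 s1 (t j) = (axis (inv_into UNIV (enum_of K) j) 1 :: complex ^ 'm)"
      by (rule path_minor[of K t p]) (use p disj t in auto)
    then show ?thesis using that by blast
  qed
  have m1: "minor_of K (\<lambda>j. sol q1 s1 (t j)) \<noteq> 0"
  proof -
    have bij: "bij_betw (enum_of K :: 'm \<Rightarrow> 'j) UNIV K" by (rule enum_of[OF K])
    have "sol q1 s1 (t (enum_of K a)) = axis a 1" for a :: 'm
      using q1[of "enum_of K a"] bij_betwE[OF bij] inv_into_f_f[OF bij_betw_imp_inj_on[OF bij], of a] by simp
    then have "(\<chi> a. sol q1 s1 (t (enum_of K a))) = (mat 1 :: complex ^ 'm ^ 'm)"
      by (simp add: mat_def axis_def vec_eq_iff)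
    then show ?thesis by (simp add: minor_of_def)
  qed
  have f_gen: "\<forall>y\<in>{1..nbd G} \<rightarrow>\<^sub>E UNIV. f y \<noteq> 0 \<longrightarrow> y \<in> general_position {1..nbd G}"
    using f(3) Union_mono[OF gen] unfolding Union_conf_gen by blast
  have gm: "(\<lambda>p. minor_of K (\<lambda>j. solp p (t j) :: complex ^ 'm)) \<in> mpoly params"
    by (intro minor_of_mpoly[OF K] solp_mpoly t)
  obtain q and s :: "complex \<Rightarrow> complex ^ 'm" where q: "\<And>e. e \<in> edges G - F \<Longrightarrow> q e \<noteq> 0"
    and qs: "(sol q s, weight q) \<in> vrcs G" "f (bdry G (sol q s)) \<noteq> 0" "minor_of K (\<lambda>j. sol q s (t j)) \<noteq> 0"
  proof -
    have "\<exists>q (s :: complex \<Rightarrow> complex ^ 'm). (\<forall>e\<in>edges G - F. q e \<noteq> 0) \<and> (sol q s, weight q) \<in> vrcs G \<and>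
        f (bdry G (sol q s)) \<noteq> 0 \<and> minor_of K (\<lambda>j. sol q s (t j)) \<noteq> 0"
      by (rule ex_generic_sol[where g = "\<lambda>v. minor_of K (\<lambda>j. v (t j))", OF less_imp_le[OF n] v0(1) f(1,2) f_gen gm m1])
    then show ?thesis using that by blast
  qed
  obtain q' c where q': "\<And>e. e \<in> edges G - F \<Longrightarrow> q' e \<noteq> 0" "\<And>b. b \<in> blacks G \<Longrightarrow> q' (main_feed b) = 1"
    "\<And>b. b \<in> all_blacks G \<Longrightarrow> c b \<noteq> 0" "\<And>b. b \<in> boundary_verts G \<Longrightarrow> c b = 1"
    "\<And>b. b \<in> all_blacks G \<Longrightarrow> sol q' s b = c b *s sol q s b"
  proof (rule slice[of q s])
    fix e assume "e \<in> edges G - F"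
    then show "q e \<noteq> 0" by (rule q)
  next
    fix q' c assume a: "\<And>e. e \<in> edges G - F \<Longrightarrow> q' e \<noteq> 0" "\<And>b. b \<in> blacks G \<Longrightarrow> q' (main_feed b) = 1"
      "\<And>b. b \<in> all_blacks G \<Longrightarrow> c b \<noteq> 0" "\<And>b. b \<in> boundary_verts G \<Longrightarrow> c b = 1"
      "\<And>b. b \<in> all_blacks G \<Longrightarrow> sol q' s b = c b *s sol q s b"
    show thesis by (rule that[of q' c]) (fact a)+
  qed
  define x0 where "x0 = encode q' s"
  have x0: "solp (pad x0) b = sol q' s b" if "b \<in> all_blacks G" for b
    unfolding x0_def by (rule pad_encode) (use q'(2) that in simp_all)
  have hx0: "h x0 \<noteq> 0"
  proof -
    have "minor_of K (\<lambda>j. solp (pad x0) (t j)) \<noteq> 0 \<longleftrightarrow> minor_of K (\<lambda>j. sol q s (t j)) \<noteq> 0"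
      by (rule minor_of_scale[OF K, of "\<lambda>j. c (t j)"]) (use x0 q'(3,5) t in auto)
    then show ?thesis using qs(3) by (simp add: h_def)
  qed
  have gx0: "g x0 \<noteq> 0"
  proof -
    have "bdry G (solp (pad x0)) = bdry G (sol q s)"
      by (rule bd_cong') (use x0 q'(4,5) in \<open>auto simp: all_blacks_def\<close>)
    moreover have "x0 (Inl e) \<noteq> 0" if "e \<in> E" for e using q'(1) that by (simp add: E_def x0_def encode_def)
    ultimately show ?thesis using qs(2) fin by (simp add: g_def E_def)
  qed
  have g_vrc: "\<exists>z\<in>U. (solp (pad x), weight (\<lambda>e. pad x (Inl e))) \<in> vrcs G \<and> bdry G (solp (pad x)) \<in> z"
    "\<And>e. e \<in> E \<Longrightarrow> x (Inl e) \<noteq> 0" if x: "g x \<noteq> 0" for x :: "'e + complex \<times> 'm \<Rightarrow> complex"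
  proof -
    have f0: "f (bdry G (solp (pad x))) \<noteq> 0" and x1: "(\<Prod>e\<in>E. x (Inl e)) \<noteq> 0" using x by (simp_all add: g_def)
    have "finite E" using fin by (simp add: E_def)
    then show xe: "\<And>e. e \<in> E \<Longrightarrow> x (Inl e) \<noteq> 0" using x1 by simp
    have pe: "pad x (Inl e) \<noteq> 0" if "e \<in> edges G - F" for e using xe that by (simp add: pad_simps E_def)
    have bU: "bdry G (solp (pad x)) \<in> \<Union>U" using f(3) f0 bdry_extensional[of "solp (pad x)"] by simp
    have "bdry G (solp (pad x)) \<in> general_position {1..nbd G}" using f_gen f0 bdry_extensional[of "solp (pad x)"] by simp
    then have "vec.span (bdry G (solp (pad x)) ` {1..nbd G}) = UNIV" using n by (intro general_position_span) auto
    then have "(solp (pad x), weight (\<lambda>e. pad x (Inl e))) \<in> vrcs G"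
      unfolding bdry_image unfolding solp_def by (intro vrc_sol pe)
    then show "\<exists>z\<in>U. (solp (pad x), weight (\<lambda>e. pad x (Inl e))) \<in> vrcs G \<and> bdry G (solp (pad x)) \<in> z" using bU by blast
  qed
  have inj: "x = y" if xy: "x \<in> ?I \<rightarrow>\<^sub>E UNIV" "y \<in> ?I \<rightarrow>\<^sub>E UNIV" "g x \<noteq> 0" "g y \<noteq> 0"
    and eq: "\<And>j. j \<in> ?J \<Longrightarrow> \<beta> x j = \<beta> y j" for x y
  proof -
    have eqi: "bdry G (solp (pad x)) i = (bdry G (solp (pad y)) i :: complex ^ 'm)" if "i \<in> {1..nbd G}" for i
    proof -
      have "bdry G (solp (pad x)) i $ k = (bdry G (solp (pad y)) i :: complex ^ 'm) $ k" for k
        using eq[of "(i, k)"] that by (simp add: \<beta>_def)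
      then show ?thesis by (simp add: vec_eq_iff)
    qed
    have eqb: "solp (pad y) b = (solp (pad x) b :: complex ^ 'm)" if b: "b \<in> boundary_verts G" for b
    proof -
      obtain i where "i \<in> {1..nbd G}" "b = bvert G i" using b by (auto simp: boundary_verts_def)
      then show ?thesis using eqi[of i] by (simp add: bdry_def)
    qed
    obtain z where z: "z \<in> U" "(solp (pad x) :: complex \<Rightarrow> complex ^ 'm, weight (\<lambda>e. pad x (Inl e))) \<in> vrcs G" "bdry G (solp (pad x)) \<in> z"
      using g_vrc(1)[OF xy(3)] by blast
    have zy: "(solp (pad y) :: complex \<Rightarrow> complex ^ 'm, weight (\<lambda>e. pad y (Inl e))) \<in> vrcs G" using g_vrc(1)[OF xy(4)] by blast
    have zs: "z \<in> solvable_locus G" using z(1) U(3) by blast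
    have e: "pad y (Inl e) = pad x (Inl e)" if "e \<in> edges G - F" for e
      by (rule slice_rigid[OF zs n z(2,3)[unfolded solp_def] zy[unfolded solp_def]])
        (use that eqb[unfolded solp_def] in \<open>simp_all add: pad_main_feed\<close>)
    show "x = y"
    proof (rule PiE_ext[OF xy(1,2)])
      fix a assume a: "a \<in> ?I"
      then consider e where "a = Inl e" "e \<in> edges G - F" | b k where "a = Inr (b, k)" "b \<in> boundary_verts G" "is_source b"
        unfolding slice_params_def params_def by blast
      then show "x a = y a"
      proof cases
        case 1
        have "pad x a = x a" "pad y a = y a" using a by (simp_all add: pad_def slice_params_def)
        then show ?thesis using e[OF 1(2)] 1(1) by simp
      next
        case 2
        have "solp (pad x) b $ k = x a" "solp (pad y) b $ k = y a"
          unfolding solp_def using 2(3) 2(1) by (subst sol, simp add: pad_simps)+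
        then show ?thesis using eqb[OF 2(2)] by simp
      qed
    qed
  qed
  \<comment> \<open>The boundary determines the slice parameters: the coefficients by
    \<open>slice_rigid\<close>, the source vectors because they are part of it.\<close>
  have le: "card ?I \<le> card ?J"
  proof (rule injective_mpoly_card_le[where \<beta> = \<beta> and g = g and ?x0.0 = x0, OF finI])
    show "(\<lambda>q. \<beta> q j) \<in> mpoly ?I" if "j \<in> ?J" for j by (rule \<beta>[OF that])
    show "x = y" if "x \<in> ?I \<rightarrow>\<^sub>E UNIV" "y \<in> ?I \<rightarrow>\<^sub>E UNIV" "g x \<noteq> 0" "g y \<noteq> 0"
      "\<And>j. j \<in> ?J \<Longrightarrow> \<beta> x j = \<beta> y j" for x y by (rule inj) (fact that)+
  qed (simp_all add: g gx0)
  obtain Q y where Q: "Q \<in> mpoly ?J" "Q y \<noteq> 0" "\<And>x. h x = 0 \<Longrightarrow> Q (\<beta> x) = 0"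
  proof (rule vanishing_locus_image[where \<beta> = \<beta> and h = h and ?x0.0 = x0, OF finI _ le])
    show "finite ?J" by simp
    fix j assume "j \<in> ?J"
    then show "(\<lambda>q. \<beta> q j) \<in> mpoly ?I" by (rule \<beta>)
  next
    show "h \<in> mpoly ?I" "h x0 \<noteq> 0" by (fact h, fact hx0)
  next
    fix Q y assume a: "Q \<in> mpoly ?J" "Q y \<noteq> 0" "\<And>x. h x = 0 \<Longrightarrow> Q (\<beta> x) = 0"
    show thesis by (rule that[of Q y]) (fact a)+
  qed
  show ?thesis
  proof (rule that[of "\<lambda>x. Q (\<lambda>(i, k). x i $ k)" "\<lambda>i. \<chi> k. y (i, k)"])
    show "(\<lambda>x. Q (\<lambda>(i, k). x i $ k)) \<in> polyfun {1..nbd G}"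
      by (rule mpoly_polyfun[OF Q(1)]) (auto intro: polyfun.coord)
    show "Q (\<lambda>(i, k). (\<chi> k. y (i, k)) $ k) \<noteq> 0" using Q(2) by simp
  next
    fix v :: "complex \<Rightarrow> complex ^ 'm" and r
    assume v: "(v, r) \<in> vrcs G" and Qv: "Q (\<lambda>(i, k). bdry G v i $ k) \<noteq> 0"
    \<comment> \<open>Every configuration moves to the slice by gauge transformations that fix its
      boundary and only rescale its vectors, so the discriminant found on the slice covers
      it.\<close>
    obtain a where a: "\<And>e. e \<in> edges G \<Longrightarrow> a e \<noteq> 0" "\<And>b. b \<in> all_blacks G \<Longrightarrow> sol a v b = v b"
      using normal_form[OF v] by metis
    obtain a' c where a': "\<And>e. e \<in> edges G - F \<Longrightarrow> a' e \<noteq> 0" "\<And>b. b \<in> blacks G \<Longrightarrow> a' (main_feed b) = 1"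
      "\<And>b. b \<in> all_blacks G \<Longrightarrow> c b \<noteq> 0" "\<And>b. b \<in> boundary_verts G \<Longrightarrow> c b = 1"
      "\<And>b. b \<in> all_blacks G \<Longrightarrow> sol a' v b = c b *s sol a v b"
    proof (rule slice[of a v])
      fix e assume "e \<in> edges G - F"
      then show "a e \<noteq> 0" using a(1) by simp
    next
      fix a' c assume b: "\<And>e. e \<in> edges G - F \<Longrightarrow> a' e \<noteq> 0" "\<And>b. b \<in> blacks G \<Longrightarrow> a' (main_feed b) = 1"
        "\<And>b. b \<in> all_blacks G \<Longrightarrow> c b \<noteq> 0" "\<And>b. b \<in> boundary_verts G \<Longrightarrow> c b = 1"
        "\<And>b. b \<in> all_blacks G \<Longrightarrow> sol a' v b = c b *s sol a v b"
      show thesis by (rule that[of a' c]) (fact b)+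
    qed
    define x where "x = encode a' v"
    have x: "solp (pad x) b = c b *s v b" if "b \<in> all_blacks G" for b
    proof -
      have "solp (pad x) b = sol a' v b" unfolding x_def by (rule pad_encode) (use a'(2) that in simp_all)
      then show ?thesis using a'(5)[OF that] a(2)[OF that] by simp
    qed
    have "bdry G (solp (pad x)) = bdry G v"
      by (rule bd_cong') (use x a'(4) in \<open>auto simp: all_blacks_def\<close>)
    then have \<beta>x: "\<beta> x = (\<lambda>(i, k). bdry G v i $ k)" by (simp add: \<beta>_def)
    have "h x \<noteq> 0"
    proof
      assume "h x = 0"
      then have "Q (\<beta> x) = 0" by (rule Q(3))
      then show False using Qv unfolding \<beta>x by simp
    qed
    moreover have "minor_of K (\<lambda>j. solp (pad x) (t j)) \<noteq> 0 \<longleftrightarrow> minor_of K (\<lambda>j. v (t j)) \<noteq> 0"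
      by (rule minor_of_scale[OF K, of "\<lambda>j. c (t j)"]) (use x a'(3) t in auto)
    ultimately show "minor_of K (\<lambda>j. v (t j)) \<noteq> 0" by (simp add: h_def)
  qed
qed

end

lemma conf_relI:
  fixes x y :: "'i \<Rightarrow> complex ^ 'm"
  assumes x: "x \<in> points I" and y: "y \<in> I \<rightarrow>\<^sub>E UNIV" and A: "invertible (A :: complex ^ 'm ^ 'm)"
    and t: "\<And>i. i \<in> I \<Longrightarrow> t i \<noteq> 0" and eq: "\<And>i. i \<in> I \<Longrightarrow> y i = t i *s (A *v x i)"
  shows "(x, y) \<in> conf_rel I"
proof -
  obtain B where B: "B ** A = mat 1" using A unfolding invertible_def by blast
  have "A *v x i \<noteq> 0" if i: "i \<in> I" for i
  proof
    assume "A *v x i = 0"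
    moreover have "B *v (A *v x i) = x i" by (simp add: matrix_vector_mul_assoc B)
    ultimately show False using x i by (simp add: points_def)
  qed
  then have "y \<in> points I" using y t eq by (simp add: points_def)
  then show ?thesis unfolding conf_rel_def using x A t eq by blast
qed

section \<open>Blob vectors over generic boundaries\<close>

context tangle_blob begin

lemma blob_tuple_image: "blob_tuple T i v ` {1..bsize T i} = (\<lambda>j. v (target T i j)) ` {1..bsize T i}"
  by (intro image_cong) (simp_all add: blob_tuple_def)

lemma blob_tuple_extensional: "blob_tuple T i v \<in> {1..bsize T i} \<rightarrow>\<^sub>E UNIV"
  by (simp add: blob_tuple_def)

text \<open>Uniqueness of the class makes \<open>psi\<close> computable from any configuration over
  \<open>z\<close>, not only from the chosen one.\<close>

lemma psi_eq:
  fixes v :: "complex \<Rightarrow> complex ^ 'm"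
  assumes z: "z \<in> solvable_locus G" and v: "(v, r) \<in> vrcs G" "bdry G v \<in> z"
    and pt: "blob_tuple T i v \<in> points {1..bsize T i}"
  shows "psi T z i = conf_of {1..bsize T i} (blob_tuple T i v)"
proof (rule the_vrc_related[OF z v])
  fix A :: "complex ^ 'm ^ 'm" and t
  assume A: "invertible A" "\<And>b. b \<in> all_blacks G \<Longrightarrow> t b \<noteq> 0"
    "\<And>b. b \<in> all_blacks G \<Longrightarrow> fst (the_vrc G z) b = t b *s (A *v v b)"
  have "(blob_tuple T i v, blob_tuple T i (fst (the_vrc G z))) \<in> conf_rel {1..bsize T i}"
  proof (rule conf_relI[OF pt blob_tuple_extensional A(1)])
    fix j assume j: "j \<in> {1..bsize T i}"
    show "t (target T i j) \<noteq> 0" using A(2) seg(3)[OF j] by simp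
    show "blob_tuple T i (fst (the_vrc G z)) j = t (target T i j) *s (A *v blob_tuple T i v j)"
      using A(3) seg(3)[OF j] j by (simp add: blob_tuple_def)
  qed
  from conf_of_eq[OF this] show ?thesis using i by (simp add: psi_def)
qed

text \<open>An open set of blob configurations contains the nonvanishing set of some
  \<open>g\<close>. Any values can be brought to the blob along the paths, so \<open>g\<close>
  pulled back to the parameters is not zero, and generic parameters land in the open set.\<close>

lemma paths_dense_image:
  fixes U :: "(nat \<Rightarrow> complex ^ 'm) set set"
  assumes F: "acyclic_rpo G F"
    and p: "\<And>j. j \<in> {1..bsize T i} \<Longrightarrow> boundary_path_to G F (target T i j) (p j)"
    and disj: "\<And>j k. j \<in> {1..bsize T i} \<Longrightarrow> k \<in> {1..bsize T i} \<Longrightarrow> j \<noteq> k \<Longrightarrow> set (p j) \<inter> set (p k) = {}"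
    and U: "conf_open {1..nbd G} U" "U \<noteq> {}" "U \<subseteq> solvable_locus G"
  shows "\<exists>S. S \<subseteq> (\<lambda>z. psi T z i) ` U \<and> conf_dense {1..bsize T i} S"
proof -
  interpret rpo_graph G F using F by unfold_locales
  let ?J = "{1..bsize T i}"
  have gen: "U \<subseteq> conf_gen {1..nbd G}" using U(1) by (simp add: conf_open_def)
  obtain z0 where z0: "z0 \<in> U" using U(2) by blast
  define v0 where "v0 = fst (the_vrc G z0)"
  define r0 where "r0 = snd (the_vrc G z0)"
  have z0s: "z0 \<in> solvable_locus G" using z0 U(3) by (rule rev_subsetD)
  have v0: "(v0, r0) \<in> vrcs G" "bdry G v0 \<in> z0"
    unfolding v0_def r0_def using solvable_vrc[OF z0s] by simp_all
  have b0: "bdry G v0 \<in> \<Union>U" using v0(2) z0 by blast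
  have n: "CARD('m) < nbd G" by (rule card_boundary[OF v0(1)])
  obtain f where f: "f \<in> polyfun {1..nbd G}" "f (bdry G v0) \<noteq> 0" "\<forall>y\<in>{1..nbd G} \<rightarrow>\<^sub>E UNIV. f y \<noteq> 0 \<longrightarrow> y \<in> \<Union>U"
    using conf_open_basic[OF _ U(1) b0] by auto
  have f_gen: "\<forall>y\<in>{1..nbd G} \<rightarrow>\<^sub>E UNIV. f y \<noteq> 0 \<longrightarrow> y \<in> general_position {1..nbd G}"
    using f(3) Union_mono[OF gen] unfolding Union_conf_gen by blast
  have meets: "(\<lambda>z. psi T z i) ` U \<inter> conf_gen ?J \<inter> V \<noteq> {}" if V: "conf_open ?J V" "V \<noteq> {}" for V
  proof -
    have Vgen: "V \<subseteq> conf_gen ?J" using V(1) by (simp add: conf_open_def)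
    obtain X where X: "X \<in> V" using V(2) by blast
    then have "X \<in> conf_gen ?J" using Vgen by blast
    then obtain x where "x \<in> X" using conf_gen_nonempty_class by blast
    then have x: "x \<in> \<Union>V" using X by blast
    obtain g where g: "g \<in> polyfun ?J" "g x \<noteq> 0" "\<forall>y\<in>?J \<rightarrow>\<^sub>E UNIV. g y \<noteq> 0 \<longrightarrow> y \<in> \<Union>V"
      using conf_open_basic[OF _ V(1) x] by auto
    have "\<exists>q1 s1. \<forall>j\<in>?J. sol q1 s1 (target T i j) = x j"
      by (rule path_minor[of ?J "target T i" p]) (use p disj seg(3) in auto)
    then obtain q1 s1 where q1: "\<forall>j\<in>?J. sol q1 s1 (target T i j) = x j" by blast
    have "g (blob_tuple T i (sol q1 s1)) = g x" by (rule polyfun_cong[OF g(1)]) (use q1 in \<open>simp add: blob_tuple_def\<close>)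
    then have g1: "g (blob_tuple T i (sol q1 s1)) \<noteq> 0" using g(2) by simp
    have gm: "(\<lambda>p. g (blob_tuple T i (solp p))) \<in> mpoly params"
    proof (rule polyfun_mpoly[OF g(1)])
      show "(\<lambda>p. blob_tuple T i (solp p) j $ k) \<in> mpoly params" if "j \<in> ?J" for j and k :: 'm
        using solp_mpoly[OF seg(3)[OF that], of k] that by (simp add: blob_tuple_def)
    qed
    have "\<exists>q (s :: complex \<Rightarrow> complex ^ 'm). (\<forall>e\<in>edges G - F. q e \<noteq> 0) \<and> (sol q s, weight q) \<in> vrcs G \<and>
        f (bdry G (sol q s)) \<noteq> 0 \<and> g (blob_tuple T i (sol q s)) \<noteq> 0"
      by (rule ex_generic_sol[where g = "\<lambda>v. g (blob_tuple T i v)", OF less_imp_le[OF n] v0(1) f(1,2) f_gen gm g1])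
    then obtain q and s :: "complex \<Rightarrow> complex ^ 'm" where qs: "(sol q s, weight q) \<in> vrcs G"
      "f (bdry G (sol q s)) \<noteq> 0" "g (blob_tuple T i (sol q s)) \<noteq> 0" by blast
    define v where "v = sol q s"
    have "bdry G v \<in> \<Union>U" using f(3) qs(2) bdry_extensional[of v] unfolding v_def by blast
    then obtain z where z: "z \<in> U" "bdry G v \<in> z" by blast
    have bV: "blob_tuple T i v \<in> \<Union>V" using g(3) qs(3) blob_tuple_extensional[of v] unfolding v_def by blast
    then have "blob_tuple T i v \<in> points ?J"
      using Union_mono[OF Vgen] general_position_points unfolding Union_conf_gen by blast
    moreover have "z \<in> solvable_locus G" using z(1) U(3) by blast
    ultimately have "psi T z i = conf_of ?J (blob_tuple T i v)" using psi_eq qs(1) z(2) unfolding v_def by blast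
    also have "\<dots> \<in> V" by (rule conf_of_mem[OF Vgen bV])
    finally have "psi T z i \<in> V" .
    then show ?thesis using z(1) Vgen by blast
  qed
  have "conf_dense ?J ((\<lambda>z. psi T z i) ` U \<inter> conf_gen ?J)" unfolding conf_dense_iff using meets by simp
  then show ?thesis by (intro exI[of _ "(\<lambda>z. psi T z i) ` U \<inter> conf_gen ?J"]) simp
qed

lemma paths_discriminant:
  fixes U :: "(nat \<Rightarrow> complex ^ 'm) set set"
  assumes F: "acyclic_rpo G F"
    and p: "\<And>j. j \<in> {1..bsize T i} \<Longrightarrow> boundary_path_to G F (target T i j) (p j)"
    and disj: "\<And>j k. j \<in> {1..bsize T i} \<Longrightarrow> k \<in> {1..bsize T i} \<Longrightarrow> j \<noteq> k \<Longrightarrow> set (p j) \<inter> set (p k) = {}"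
    and U: "conf_open {1..nbd G} U" "U \<noteq> {}" "U \<subseteq> solvable_locus G" and m: "CARD('m) \<le> bsize T i"
  shows "\<exists>Q\<in>polyfun {1..nbd G}. (\<exists>y. Q y \<noteq> 0) \<and>
    (\<forall>v r. (v :: complex \<Rightarrow> complex ^ 'm, r) \<in> vrcs G \<and> Q (bdry G v) \<noteq> 0 \<longrightarrow>
      vec.span (blob_tuple T i v ` {1..bsize T i}) = UNIV)"
proof -
  interpret rpo_graph G F using F by unfold_locales
  \<comment> \<open>The first \<open>CARD('m)\<close> vertices of the blob already give a
    nonvanishing minor, hence a spanning tuple.\<close>
  let ?K = "{1..CARD('m)}"
  have KJ: "j \<in> {1..bsize T i}" if "j \<in> ?K" for j using that m by simp
  have K: "finite ?K" "card ?K = CARD('m)" by simp_all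
  show ?thesis
  proof (rule span_discriminant[OF U K, of "target T i" p])
    show "target T i j \<in> all_blacks G" if "j \<in> ?K" for j by (rule seg(3)[OF KJ[OF that]])
    show "boundary_path_to G F (target T i j) (p j)" if "j \<in> ?K" for j by (rule p[OF KJ[OF that]])
    show "set (p j) \<inter> set (p k) = {}" if "j \<in> ?K" "k \<in> ?K" "j \<noteq> k" for j k
      by (rule disj[OF KJ[OF that(1)] KJ[OF that(2)] that(3)])
  next
    fix Q y assume Q: "Q \<in> polyfun {1..nbd G}" "Q y \<noteq> 0"
      and Qm: "\<And>v r. (v :: complex \<Rightarrow> complex ^ 'm, r) \<in> vrcs G \<Longrightarrow> Q (bdry G v) \<noteq> 0 \<Longrightarrow> minor_of ?K (\<lambda>j. v (target T i j)) \<noteq> 0"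
    have "vec.span (blob_tuple T i v ` {1..bsize T i}) = UNIV"
      if "(v, r) \<in> vrcs G" "Q (bdry G v) \<noteq> 0" for v :: "complex \<Rightarrow> complex ^ 'm" and r
      unfolding blob_tuple_image
      by (rule spanning_minor[OF _ Qm[OF that] _ K(2)]) (use KJ in auto)
    then show ?thesis using Q by blast
  qed
qed

end

text \<open>Density of the image is used for a single boundary configuration, one whose blob tuple
  is in general position.\<close>

lemma tangle_paths:
  fixes T :: "'e tangle"
  assumes m: "2 \<le> CARD('m::finite)" and T: "plabic_tangle T" "tangle_solvable TYPE('m) T"
    and F: "acyclic_rpo (pgraph T) F" and dom: "dominant TYPE('m) T" and i: "i \<in> {1..nblobs T}"
  shows "\<exists>p. (\<forall>j\<in>{1..bsize T i}. boundary_path_to (pgraph T) F (target T i j) (p j)) \<and>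
    (\<forall>j\<in>{1..bsize T i}. \<forall>k\<in>{1..bsize T i}. j \<noteq> k \<longrightarrow> set (p j) \<inter> set (p k) = {})"
proof -
  interpret tangle_blob T i using T(1) i by unfold_locales
  let ?J = "{1..bsize T i}"
  have size: "CARD('m) \<le> bsize T i" using T(2) i by (simp add: tangle_solvable_def)
  obtain U :: "(nat \<Rightarrow> complex ^ 'm) set set" where U: "open_dense {1..nbd G} U" "U \<subseteq> solvable_locus G"
    using T(2) unfolding tangle_solvable_def generically_solvable_def by blast
  have "\<exists>S. S \<subseteq> (\<lambda>z. psi T z i) ` U \<and> conf_dense ?J S"
    using dom i U unfolding dominant_def by blast
  then obtain S where S: "S \<subseteq> (\<lambda>z. psi T z i) ` U" "conf_dense ?J S" by blast
  have "(conf_gen ?J :: (nat \<Rightarrow> complex ^ 'm) set set) \<noteq> {}"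
    using general_position_nonempty[of ?J, where 'm = 'm] conf_of_gen by blast
  then have "S \<inter> conf_gen ?J \<noteq> {}" using S(2) conf_open_conf_gen unfolding conf_dense_iff by blast
  then obtain z where z: "z \<in> U" "psi T z i \<in> conf_gen ?J" using S(1) by blast
  have zs: "z \<in> solvable_locus G" using z(1) U(2) by blast
  define v where "v = fst (the_vrc G z)"
  have v: "(v, snd (the_vrc G z)) \<in> vrcs G" "bdry G v \<in> z" unfolding v_def using solvable_vrc[OF zs] by simp_all
  have "conf_of ?J (blob_tuple T i v) \<in> conf_gen ?J" using z(2) i by (simp add: psi_def v_def)
  then have "blob_tuple T i v \<in> general_position ?J" by (rule conf_of_genD)
  then show ?thesis
    by (rule generic_paths[OF F m size zs v]) blast
qed

text \<open>The assumed orientation serves all blobs at once, since in a dominant tangle the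
  required paths exist in any acyclic one. For \<open>CARD('m) \<ge> 2\<close> the vectors of a blob
  tuple in general position span distinct lines, as the construction of the paths requires.\<close>

theorem theorem4p13:
  fixes T :: "'e tangle"
  assumes "2 \<le> CARD('m::finite)"
    and "plabic_tangle T"
    and "tangle_solvable TYPE('m) T"
    and "\<exists>F. acyclic_rpo (pgraph T) F"
  shows "dominant TYPE('m) T \<longleftrightarrow> (\<exists>F P. brushing T F P)"
proof
  assume dom: "dominant TYPE('m) T"
  obtain F where F: "acyclic_rpo (pgraph T) F" using assms(4) by blast
  have "\<forall>i. \<exists>p. i \<in> {1..nblobs T} \<longrightarrow> (\<forall>j\<in>{1..bsize T i}. boundary_path_to (pgraph T) F (target T i j) (p j)) \<and>
      (\<forall>j\<in>{1..bsize T i}. \<forall>k\<in>{1..bsize T i}. j \<noteq> k \<longrightarrow> set (p j) \<inter> set (p k) = {})"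
    using tangle_paths[OF assms(1-3) F dom] by blast
  from choice[OF this] obtain P where "\<forall>i. i \<in> {1..nblobs T} \<longrightarrow>
      (\<forall>j\<in>{1..bsize T i}. boundary_path_to (pgraph T) F (target T i j) (P i j)) \<and>
      (\<forall>j\<in>{1..bsize T i}. \<forall>k\<in>{1..bsize T i}. j \<noteq> k \<longrightarrow> set (P i j) \<inter> set (P i k) = {})" by (rule exE)
  then have "brushing T (\<lambda>_. F) P" using F by (simp add: brushing_def)
  then show "\<exists>F P. brushing T F P" by blast
next
  let ?G = "pgraph T"
  let ?I = "{1..nbd ?G}"
  assume "\<exists>F P. brushing T F P"
  then obtain F P where br: "brushing T F P" by blast
  have F: "acyclic_rpo ?G (F i)" if "i \<in> {1..nblobs T}" for i using br that by (simp add: brushing_def)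
  have P: "boundary_path_to ?G (F i) (target T i j) (P i j)" if "i \<in> {1..nblobs T}" "j \<in> {1..bsize T i}" for i j
    using br that by (simp add: brushing_def)
  have disj: "set (P i j) \<inter> set (P i k) = {}"
    if "i \<in> {1..nblobs T}" "j \<in> {1..bsize T i}" "k \<in> {1..bsize T i}" "j \<noteq> k" for i j k
    using br that by (simp add: brushing_def)
  have blob: "tangle_blob T i" if "i \<in> {1..nblobs T}" for i using assms(2) that by unfold_locales
  interpret plabic ?G using assms(2) by unfold_locales (simp add: plabic_tangle_def)
  obtain U :: "(nat \<Rightarrow> complex ^ 'm) set set" where "open_dense ?I U" and Us: "U \<subseteq> solvable_locus ?G"
    using assms(3) unfolding tangle_solvable_def generically_solvable_def by blast
  then have U: "conf_open ?I U" "U \<noteq> {}" using open_dense_iff[of ?I U] by simp_all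
  have Ugen: "U \<subseteq> conf_gen ?I" using U(1) by (simp add: conf_open_def)
  have "\<forall>i. \<exists>Q. i \<in> {1..nblobs T} \<longrightarrow> Q \<in> polyfun ?I \<and> (\<exists>y. Q y \<noteq> 0) \<and>
      (\<forall>v r. (v :: complex \<Rightarrow> complex ^ 'm, r) \<in> vrcs ?G \<and> Q (bdry ?G v) \<noteq> 0 \<longrightarrow>
        vec.span (blob_tuple T i v ` {1..bsize T i}) = UNIV)"
  proof (intro allI)
    fix i
    show "\<exists>Q. i \<in> {1..nblobs T} \<longrightarrow> Q \<in> polyfun ?I \<and> (\<exists>y. Q y \<noteq> 0) \<and>
      (\<forall>v r. (v :: complex \<Rightarrow> complex ^ 'm, r) \<in> vrcs ?G \<and> Q (bdry ?G v) \<noteq> 0 \<longrightarrow>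
        vec.span (blob_tuple T i v ` {1..bsize T i}) = UNIV)"
    proof (cases "i \<in> {1..nblobs T}")
      case True
      have size: "CARD('m) \<le> bsize T i" using assms(3) True by (simp add: tangle_solvable_def)
      have "\<exists>Q\<in>polyfun ?I. (\<exists>y. Q y \<noteq> 0) \<and>
          (\<forall>v r. (v :: complex \<Rightarrow> complex ^ 'm, r) \<in> vrcs ?G \<and> Q (bdry ?G v) \<noteq> 0 \<longrightarrow>
            vec.span (blob_tuple T i v ` {1..bsize T i}) = UNIV)"
        by (rule tangle_blob.paths_discriminant[OF blob[OF True] F[OF True] P[OF True] disj[OF True] U Us size])
      then show ?thesis by blast
    qed blast
  qed
  from choice[OF this] obtain Q where Q0: "\<forall>i. i \<in> {1..nblobs T} \<longrightarrow> Q i \<in> polyfun ?I \<and> (\<exists>y. Q i y \<noteq> 0) \<and>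
      (\<forall>v r. (v :: complex \<Rightarrow> complex ^ 'm, r) \<in> vrcs ?G \<and> Q i (bdry ?G v) \<noteq> 0 \<longrightarrow>
        vec.span (blob_tuple T i v ` {1..bsize T i}) = UNIV)" by (rule exE)
  have Q: "Q i \<in> polyfun ?I" "\<exists>y. Q i y \<noteq> 0" if "i \<in> {1..nblobs T}" for i
    using Q0 that by blast+
  have Qs: "vec.span (blob_tuple T i v ` {1..bsize T i}) = UNIV"
    if "i \<in> {1..nblobs T}" "(v, r) \<in> vrcs ?G" "Q i (bdry ?G v) \<noteq> 0" for i r and v :: "complex \<Rightarrow> complex ^ 'm"
    using Q0 that by blast
  \<comment> \<open>As \<open>Q i\<close> is not invariant, its nonvanishing is asked at some
    representative of the class; \<open>transport_boundary\<close> will move the configuration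
    there.\<close>
  define W where "W = {z \<in> U. \<forall>i\<in>{1..nblobs T}. \<exists>x\<in>z. Q i x \<noteq> 0}"
  have W: "conf_open ?I W \<and> W \<noteq> {}" unfolding W_def
    by (rule conf_open_nonvanishing_family[OF _ _ U]) (use Q in auto)
  have span: "vec.span (blob_tuple T i (fst (the_vrc ?G z)) ` {1..bsize T i}) = UNIV"
    if z: "z \<in> W" and i: "i \<in> {1..nblobs T}" for z i
  proof -
    interpret tangle_blob T i by (rule blob[OF i])
    have zU: "z \<in> U" using z by (simp add: W_def)
    then have zs: "z \<in> solvable_locus ?G" using Us by blast
    define v where "v = fst (the_vrc ?G z)"
    have v: "(v, snd (the_vrc ?G z)) \<in> vrcs ?G" "bdry ?G v \<in> z" unfolding v_def using solvable_vrc[OF zs] by simp_all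
    obtain x where x: "x \<in> z" "Q i x \<noteq> 0" using z i unfolding W_def by blast
    have "z = conf_of ?I (bdry ?G v)" using zU Ugen v(2) by (intro conf_class_eq) auto
    then have "(bdry ?G v, x) \<in> conf_rel ?I" using x(1) by (simp add: conf_of_def)
    then show ?thesis unfolding v_def[symmetric]
    proof (rule transport_boundary[OF v(1)])
      fix v' r' A t
      assume v': "(v', r') \<in> vrcs ?G" "bdry ?G v' = x" "invertible (A :: complex ^ 'm ^ 'm)"
        "\<And>b. t b \<noteq> 0" "\<And>b. v' b = t b *s (A *v v b)"
      show "vec.span (blob_tuple T i v ` {1..bsize T i}) = UNIV"
      proof (rule span_inverse_transform[OF v'(3)])
        show "t (target T i j) \<noteq> 0" for j by (rule v'(4))
        show "blob_tuple T i v' j = t (target T i j) *s (A *v blob_tuple T i v j)" if "j \<in> {1..bsize T i}" for j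
          using that v'(5) by (simp add: blob_tuple_def)
        show "vec.span (blob_tuple T i v' ` {1..bsize T i}) = UNIV" by (rule Qs[OF i v'(1)]) (simp add: v'(2) x(2))
      qed
    qed
  qed
  have "open_dense ?I W" using W open_dense_iff[of ?I W] by simp
  moreover have "W \<subseteq> solvable_locus ?G" using Us by (auto simp: W_def)
  ultimately have "rank_regular TYPE('m) T" unfolding rank_regular_def using span by blast
  moreover have "\<exists>S. S \<subseteq> (\<lambda>z. psi T z i) ` V \<and> conf_dense {1..bsize T i} S"
    if i: "i \<in> {1..nblobs T}" and V: "open_dense ?I V" "V \<subseteq> solvable_locus ?G"
    for i and V :: "(nat \<Rightarrow> complex ^ 'm) set set"
  proof -
    have Vo: "conf_open ?I V" "V \<noteq> {}" using V(1) open_dense_iff[of ?I V] by simp_all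
    show ?thesis by (rule tangle_blob.paths_dense_image[OF blob[OF i] F[OF i] P[OF i] disj[OF i] Vo V(2)])
  qed
  ultimately show "dominant TYPE('m) T" unfolding dominant_def by blast
qed

end
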